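(* Let $d\geqslant1$ and let $U:\mathbb Z^d\to\mathbb R$ satisfy $\sum_{x\in\mathbb Z^d}e^{-U(x)}<+\infty$. Suppose that $U$ admits a strict local minimum and that there exist $R,h>0$ such that for all $i\in\{1,\dots,d\}$, $x\in\mathbb Z^d$ and $v\in\{-1,1\}^d$, $$(U(x+v_ie_i)-U(x))_+\ \geqslant\ h\,\mathbf 1_{\{v_ix_i>R\}}.$$ Set $\mathcal W(x)=\sum_{i=1}^de^{h|x_i|/2}$, and let $f:\mathbb Z^d\to\mathbb R$ be such that $\|f/\mathcal W\|_\infty<\infty$. Let $(X_k,V_k)_{k\in\mathbb N}$ be the Zig-Zag walk on $\mathbb Z^d\times\{-1,1\}^d$ associated to $U$, with some initial condition $(x,v)$. Then, almost surely, $$\frac1n\sum_{k=0}^nf(X_k)\ \underset{n\to\infty}{\longrightarrow}\ \pi(f).$$ If, moreover, $\|f/\sqrt{\mathcal W}\|_\infty<\infty$, then $$\left(\frac1{\sqrt n}\sum_{k=0}^{\lfloor nt\rfloor}\big(f(X_k)-\pi(f)\big)\right)_{t\geqslant0}\ \underset{n\to+\infty}{\longrightarrow}\ (\sigma_fB_t)_{t\geqslant0}$$ in law in the Skorohod topology for some $\sigma_f\geqslant0$, where $(B_t)_{t\geqslant0}$ is a one-dimensional Brownian motion.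
   Context: Let $(r)_+=\max(r,0)$, let $e_i$ be the $i$-th vector of the canonical basis of $\mathbb R^d$, $\pi(x)=e^{-U(x)}/\sum_{y\in\mathbb Z^d}e^{-U(y)}$, and $\pi(f)=\sum_xf(x)\pi(x)$. For $x\in\mathbb Z^d$, $v,w\in\{-1,1\}^d$, set $$q_i(x,v_i)=e^{-(U(x+v_ie_i)-U(x))_+},\qquad p_i(x,v_i;w_i)=q_i(x,v_i)\mathbf 1_{w_i=v_i}+(1-q_i(x,v_i))\mathbf 1_{w_i=-v_i},$$ $$p(x,v;w)=\prod_{i=1}^d p_i\Big(x+\sum_{j=1}^{i-1}\frac{v_j+w_j}2e_j,\ v_i;\ w_i\Big).$$ The Zig-Zag walk on $\mathbb Z^d$ associated to $U$ is the Markov chain on $\mathbb Z^d\times\{-1,1\}^d$ with transitions $V_{n+1}\sim p(X_n,V_n;\cdot)$, $X_{n+1}=X_n+\frac12(V_n+V_{n+1})$. A strict local minimum of $U$ at $x_*\in\mathbb Z^d$ means $U(x_*\pm e_i)>U(x_* )$ for all $i\in\{1,\dots,d\}$. *)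

theory Defs
  imports "HOL-Probability.Probability"
begin

text \<open>
  The coordinates are indexed by a finite type \<open>'d\<close>.  Where their order \<open>1, \<dots>, d\<close> matters,
  \<open>'d\<close> is also linearly ordered.  \<open>CARD('d) \<ge> 1\<close> holds for every such type.
\<close>

type_synonym 'd lattice = "int ^ 'd"

definition gibbs :: "('d::finite lattice \<Rightarrow> real) \<Rightarrow> 'd lattice \<Rightarrow> real" where
  "gibbs U x = exp (- U x) / (\<Sum>\<^sub>\<infinity>y\<in>UNIV. exp (- U y))"

definition gibbs_mean :: "('d::finite lattice \<Rightarrow> real) \<Rightarrow> ('d lattice \<Rightarrow> real) \<Rightarrow> real" where
  "gibbs_mean U f = (\<Sum>\<^sub>\<infinity>x\<in>UNIV. f x * gibbs U x)"

definition velocities :: "'d::finite lattice set" where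
  "velocities = {v. \<forall>i. v $ i \<in> {-1, 1}}"

definition zz_q :: "('d::finite lattice \<Rightarrow> real) \<Rightarrow> 'd \<Rightarrow> 'd lattice \<Rightarrow> int \<Rightarrow> real" where
  "zz_q U i x a = exp (- max (U (x + axis i a) - U x) 0)"

definition zz_p_coord :: "('d::finite lattice \<Rightarrow> real) \<Rightarrow> 'd \<Rightarrow> 'd lattice \<Rightarrow> int \<Rightarrow> int \<Rightarrow> real" where
  "zz_p_coord U i x a b =
     zz_q U i x a * of_bool (b = a) + (1 - zz_q U i x a) * of_bool (b = - a)"

text \<open>
  All the halves below are halves of even integers: \<open>zz_p\<close> vanishes at every \<open>w\<close> outside
  \<open>velocities\<close> if \<open>v \<in> velocities\<close>.
\<close>

definition zz_p ::
  "('d::{finite,linorder} lattice \<Rightarrow> real) \<Rightarrow> 'd lattice \<Rightarrow> 'd lattice \<Rightarrow> 'd lattice \<Rightarrow> real" where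
  "zz_p U x v w =
     (\<Prod>i\<in>UNIV. zz_p_coord U i (x + (\<Sum>j\<in>{..<i}. axis j ((v $ j + w $ j) div 2))) (v $ i) (w $ i))"

definition zz_kernel ::
  "('d::{finite,linorder} lattice \<Rightarrow> real) \<Rightarrow>
   'd lattice \<times> 'd lattice \<Rightarrow> 'd lattice \<times> 'd lattice \<Rightarrow> real" where
  "zz_kernel U = (\<lambda>(x, v) (y, w). zz_p U x v w * of_bool (y = x + (\<chi> i. (v $ i + w $ i) div 2)))"

text \<open>
  The Markov property is stated without division, so that histories of probability zero
  need no separate treatment.
\<close>

definition markov_chain ::
  "'a measure \<Rightarrow> ('s \<Rightarrow> 's \<Rightarrow> real) \<Rightarrow> 's \<Rightarrow> (nat \<Rightarrow> 'a \<Rightarrow> 's) \<Rightarrow> bool" where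
  "markov_chain M K z Z \<longleftrightarrow>
     prob_space M \<and>
     (\<forall>n. Z n \<in> M \<rightarrow>\<^sub>M count_space UNIV) \<and>
     (AE \<omega> in M. Z 0 \<omega> = z) \<and>
     (\<forall>n s t.
        measure M {\<omega> \<in> space M. (\<forall>k\<le>n. Z k \<omega> = s k) \<and> Z (Suc n) \<omega> = t} =
        measure M {\<omega> \<in> space M. \<forall>k\<le>n. Z k \<omega> = s k} * K (s n) t)"

definition zigzag_walk ::
  "'a measure \<Rightarrow> ('d::{finite,linorder} lattice \<Rightarrow> real) \<Rightarrow> 'd lattice \<Rightarrow> 'd lattice \<Rightarrow>
   (nat \<Rightarrow> 'a \<Rightarrow> 'd lattice) \<Rightarrow> (nat \<Rightarrow> 'a \<Rightarrow> 'd lattice) \<Rightarrow> bool" where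
  "zigzag_walk M U x v X V \<longleftrightarrow>
     v \<in> velocities \<and> markov_chain M (zz_kernel U) (x, v) (\<lambda>n \<omega>. (X n \<omega>, V n \<omega>))"

definition strict_local_min :: "('d::finite lattice \<Rightarrow> real) \<Rightarrow> 'd lattice \<Rightarrow> bool" where
  "strict_local_min U x \<longleftrightarrow> (\<forall>i. U (x + axis i 1) > U x \<and> U (x - axis i 1) > U x)"

definition lyap :: "real \<Rightarrow> 'd::finite lattice \<Rightarrow> real" where
  "lyap h x = (\<Sum>i\<in>UNIV. exp (h * \<bar>real_of_int (x $ i)\<bar> / 2))"

text \<open>
  Real-valued right-continuous functions with left limits on \<open>[0, \<infinity>)\<close>, represented by functions
  that are \<open>undefined\<close> at negative times.
\<close>

definition cadlag :: "(real \<Rightarrow> real) set" where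
  "cadlag = {x \<in> extensional {0..}.
     (\<forall>t\<ge>0. (x \<longlongrightarrow> x t) (at_right t)) \<and> (\<forall>t>0. \<exists>l. (x \<longlongrightarrow> l) (at_left t))}"

text \<open>
  Such functions are automatically continuous, so these are the increasing homeomorphisms of
  \<open>[0, \<infinity>)\<close>.
\<close>

definition time_change :: "(real \<Rightarrow> real) \<Rightarrow> bool" where
  "time_change \<tau> \<longleftrightarrow> strict_mono_on {0..} \<tau> \<and> \<tau> ` {0..} = {0..}"

definition skorohod_tendsto :: "(nat \<Rightarrow> real \<Rightarrow> real) \<Rightarrow> (real \<Rightarrow> real) \<Rightarrow> bool" where
  "skorohod_tendsto xs x \<longleftrightarrow>
     (\<exists>\<tau>. (\<forall>n. time_change (\<tau> n)) \<and>
          uniform_limit {0..} \<tau> (\<lambda>t. t) sequentially \<and>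
          (\<forall>T. uniform_limit {0..T} (\<lambda>n t. xs n (\<tau> n t)) x sequentially))"

text \<open>
  The Skorohod (J1) topology is the metrizable topology on \<open>cadlag\<close> whose convergent sequences
  are those of \<open>skorohod_tendsto\<close> (Jacod and Shiryaev, Limit Theorems for Stochastic Processes,
  Theorem VI.1.14).  A metrizable topology is sequential, hence its open sets are
  the sequentially open ones.
\<close>

definition skorohod_open :: "(real \<Rightarrow> real) set \<Rightarrow> bool" where
  "skorohod_open S \<longleftrightarrow> S \<subseteq> cadlag \<and>
     (\<forall>xs x. range xs \<subseteq> cadlag \<and> x \<in> S \<and> skorohod_tendsto xs x \<longrightarrow>
        (\<forall>\<^sub>F n in sequentially. xs n \<in> S))"

definition skorohod_topology :: "(real \<Rightarrow> real) topology" where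
  "skorohod_topology = topology skorohod_open"

lemma openin_skorohod_topology: "openin skorohod_topology = skorohod_open"
proof -
  have "skorohod_open (S \<inter> T)" if "skorohod_open S" "skorohod_open T" for S T
    using that unfolding skorohod_open_def by (simp add: eventually_conj_iff le_infI1) blast
  moreover have "skorohod_open (\<Union>\<K>)" if K: "\<forall>K\<in>\<K>. skorohod_open K" for \<K>
    unfolding skorohod_open_def
  proof (intro conjI allI impI)
    show "\<Union>\<K> \<subseteq> cadlag"
      using K by (auto simp: skorohod_open_def)
  next
    fix xs x
    assume H: "range xs \<subseteq> cadlag \<and> x \<in> \<Union>\<K> \<and> skorohod_tendsto xs x"
    then obtain S where S: "S \<in> \<K>" "x \<in> S"
      by blast
    have "\<forall>\<^sub>F n in sequentially. xs n \<in> S"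
      using K S H unfolding skorohod_open_def by blast
    then show "\<forall>\<^sub>F n in sequentially. xs n \<in> \<Union>\<K>"
      by (rule eventually_mono) (use S in blast)
  qed
  ultimately have "istopology skorohod_open"
    by (simp add: istopology_def)
  then show ?thesis
    by (simp add: skorohod_topology_def)
qed

lemma topspace_skorohod_topology: "topspace skorohod_topology = cadlag"
proof -
  have "skorohod_open cadlag"
    by (auto simp: skorohod_open_def intro!: always_eventually)
  then show ?thesis
    by (auto simp: topspace_def openin_skorohod_topology skorohod_open_def)
qed

definition borel_of :: "'s topology \<Rightarrow> 's measure" where
  "borel_of T = sigma (topspace T) {S. openin T S}"

definition converges_in_law ::
  "'s topology \<Rightarrow> 'a measure \<Rightarrow> (nat \<Rightarrow> 'a \<Rightarrow> 's) \<Rightarrow> 'b measure \<Rightarrow> ('b \<Rightarrow> 's) \<Rightarrow> bool" where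
  "converges_in_law T M Y N Z \<longleftrightarrow>
     (\<forall>n. Y n \<in> M \<rightarrow>\<^sub>M borel_of T) \<and> Z \<in> N \<rightarrow>\<^sub>M borel_of T \<and>
     (\<forall>g. continuous_map T euclideanreal g \<and> bounded (g ` topspace T) \<longrightarrow>
        (\<lambda>n. \<integral>\<omega>. g (Y n \<omega>) \<partial>M) \<longlonglongrightarrow> (\<integral>\<omega>. g (Z \<omega>) \<partial>N))"

definition brownian_motion :: "'b measure \<Rightarrow> (real \<Rightarrow> 'b \<Rightarrow> real) \<Rightarrow> bool" where
  "brownian_motion N B \<longleftrightarrow>
     prob_space N \<and>
     (\<forall>t\<ge>0. B t \<in> borel_measurable N) \<and>
     (\<forall>\<omega>\<in>space N. B 0 \<omega> = 0 \<and> continuous_on {0..} (\<lambda>t. B t \<omega>)) \<and>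
     (\<forall>s t. 0 \<le> s \<and> s < t \<longrightarrow>
        distributed N lborel (\<lambda>\<omega>. B t \<omega> - B s \<omega>) (normal_density 0 (sqrt (t - s)))) \<and>
     (\<forall>r n. 0 \<le> r 0 \<and> incseq r \<longrightarrow>
        prob_space.indep_vars N (\<lambda>_. borel) (\<lambda>k \<omega>. B (r (Suc k)) \<omega> - B (r k) \<omega>) {..<n::nat})"

end

theory Submission
  imports Defs
begin

text \<open>
  In every step of the walk all the products \<open>v\<^sub>i (-1)\<^bsup>x\<^sub>i\<^esup>\<close> change sign, so that the walk is confined
  to a class of states on which these products are prescribed up to a common sign.  The Gibbs measure
  together with uniform velocities, conditioned to this class, is invariant.  The
  functions \<open>\<Sum>\<^sub>i exp (\<theta> \<bar>x\<^sub>i\<bar>)\<close> with \<open>0 < \<theta> < h\<close>, corrected by a factor for inward velocities, satisfy a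
  geometric drift condition, and flipping a velocity outwards of the box of size \<open>R\<close> as well as
  keeping a velocity always have positive probability, so that the state \<open>(0, c)\<close> can be reached from
  everywhere in the class.

  Killing the chain at that state gives a solution \<open>g\<close> of Poisson's equation \<open>g - P g = f - \<pi>(f)\<close>
  which grows no faster than the Lyapunov function.  Hence the sums of \<open>f - \<pi>(f)\<close> are martingales up
  to a boundary term.  Moments of order \<open>3/2\<close> of the martingale and monotonicity along the fourth
  powers give the law of large numbers for \<open>f \<ge> 0\<close>.  For the central limit theorem Poisson's equation
  is solved a second time, for the conditional variance of the martingale increments; this gives the
  characteristic functions of sums over blocks, with an error that is uniform in the past.  Third moments
  of the increments are of order \<open>\<bar>t - s\<bar>\<^sup>3\<^sup>/\<^sup>2\<close>, so chaining over the dyadic times confines the interpolated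
  paths to a compact set of Hoelder functions.  On it the trigonometric polynomials of the dyadic values
  are dense by the Stone-Weierstrass theorem, and convergence of characteristic functions suffices.
  The Brownian motion comes from Levy's construction and is encoded by dyadic values in the same way.
\<close>

section \<open>Poisson's equation for a chain with a reachable atom\<close>

text \<open>The walk has period two and is in general reducible, so the iterates of the kernel
  applied to \<open>f\<close> need not converge and cannot simply be summed. Killing at one atom
  gives geometric decay in spite of the period. The invariant measure of a class depends on the
  initial state, but its position marginal is \<pi> for every class; hence the limit does not depend
  on it.

  The exponents come from the drift condition, which holds for \<theta> < h. Let \<open>w\<close> be
  the sum of the exp (h |x_i| / 4). Both theorems rest on bounded third moments of \<open>w\<close>,
  that is, on the exponent 3h/4. If |f| is at most a multiple of \<open>lyap h\<close>, then
  \<open>g\<close> is of order w^2; a second moment would need w^4 and the excluded exponent h,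
  whence the order 3/2. If |f| is at most a multiple of the square root, then \<open>g\<close> is of
  order w: the increments have third moments, and their conditional variance is of order w^2, for
  which Poisson's equation can be solved with the exponent h/2.

  Since every state has finitely many successors and the start is deterministic, only finitely many
  histories matter at each time. Integrability is then automatic, and the filtration enters only
  through equality of histories.\<close>

definition kernel_op :: "('s \<Rightarrow> 's pmf) \<Rightarrow> ('s \<Rightarrow> real) \<Rightarrow> 's \<Rightarrow> real" where
  "kernel_op K u s = measure_pmf.expectation (K s) u"

text \<open>Tonelli for the positive and the negative part of \<open>g\<close>. The measure
  \<open>p\<close> may have infinite support; the finite supports of the \<open>K s\<close> serve to
  identify the inner Bochner integrals with nonnegative ones.\<close>

lemma integral_bind_finite_pmf:
  fixes g :: "'s \<Rightarrow> real"
  assumes fin: "\<And>s. s \<in> set_pmf p \<Longrightarrow> finite (set_pmf (K s))"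
    and int: "integrable (measure_pmf (bind_pmf p K)) g"
  shows "integrable (measure_pmf p) (kernel_op K g)"
    and "measure_pmf.expectation (bind_pmf p K) g = measure_pmf.expectation p (kernel_op K g)"
proof -
  have nn: "(\<integral>\<^sup>+s. ennreal (kernel_op K u s) \<partial>p) = (\<integral>\<^sup>+t. ennreal (u t) \<partial>bind_pmf p K)"
    if u: "\<And>t. 0 \<le> u t" for u
  proof -
    have "(\<integral>\<^sup>+s. ennreal (kernel_op K u s) \<partial>p) = (\<integral>\<^sup>+s. (\<integral>\<^sup>+t. ennreal (u t) \<partial>K s) \<partial>p)"
    proof (rule nn_integral_cong_AE)
      show "AE s in measure_pmf p. ennreal (kernel_op K u s) = (\<integral>\<^sup>+t. ennreal (u t) \<partial>K s)"
        unfolding kernel_op_def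
        by (rule AE_pmfI) (metis fin integrable_measure_pmf_finite nn_integral_eq_integral u AE_I2)
    qed
    then show ?thesis by simp
  qed
  define gp gm where "gp = (\<lambda>t. max 0 (g t))" and "gm = (\<lambda>t. max 0 (- g t))"
  have ip: "integrable (measure_pmf (bind_pmf p K)) gp" and im: "integrable (measure_pmf (bind_pmf p K)) gm"
    unfolding gp_def gm_def using int by auto
  have g: "g = (\<lambda>t. gp t - gm t)"
    by (auto simp: gp_def gm_def fun_eq_iff)
  have pos: "0 \<le> gp t" "0 \<le> gm t" for t
    by (auto simp: gp_def gm_def)
  have kpos: "0 \<le> kernel_op K u s" if "\<And>t. 0 \<le> u t" for u s
    unfolding kernel_op_def by (rule integral_nonneg_AE) (simp add: that)
  have one: "integrable (measure_pmf p) (kernel_op K u) \<and>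
      measure_pmf.expectation p (kernel_op K u) = measure_pmf.expectation (bind_pmf p K) u"
    if u: "\<And>t. 0 \<le> u t" "integrable (measure_pmf (bind_pmf p K)) u" for u
  proof -
    have eq: "(\<integral>\<^sup>+s. ennreal (kernel_op K u s) \<partial>p) = ennreal (measure_pmf.expectation (bind_pmf p K) u)"
      using nn[OF u(1)] nn_integral_eq_integral[OF u(2)] u(1) by simp
    have i: "integrable (measure_pmf p) (kernel_op K u)"
      by (rule integrableI_nonneg) (use eq kpos[OF u(1)] in auto)
    moreover have "measure_pmf.expectation p (kernel_op K u) = measure_pmf.expectation (bind_pmf p K) u"
      using u(1) kpos[OF u(1)] eq
      by (subst integral_eq_nn_integral) (auto intro!: integral_nonneg_AE)
    ultimately show ?thesis by blast
  qed
  have split: "AE s in measure_pmf p. kernel_op K g s = kernel_op K gp s - kernel_op K gm s"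
    unfolding kernel_op_def g
    by (rule AE_pmfI, rule Bochner_Integration.integral_diff) (auto intro: integrable_measure_pmf_finite fin)
  have idiff: "integrable (measure_pmf p) (\<lambda>s. kernel_op K gp s - kernel_op K gm s)"
    using one[OF pos(1) ip] one[OF pos(2) im] by auto
  show "integrable (measure_pmf p) (kernel_op K g)"
    by (rule integrable_cong_AE_imp[OF idiff]) (use split in auto)
  have "measure_pmf.expectation p (kernel_op K g) = measure_pmf.expectation p (\<lambda>s. kernel_op K gp s - kernel_op K gm s)"
    by (rule integral_cong_AE) (use split in auto)
  also have "\<dots> = measure_pmf.expectation (bind_pmf p K) g"
    using one[OF pos(1) ip] one[OF pos(2) im] ip im unfolding g by simp
  finally show "measure_pmf.expectation (bind_pmf p K) g = measure_pmf.expectation p (kernel_op K g)" by simp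
qed

text \<open>\<open>S\<close> is a closed set of states, and nothing is claimed outside of it. With
  finitely many outcomes per step every function is integrable under one step, however fast it
  grows.\<close>

locale finite_kernel =
  fixes K :: "'s \<Rightarrow> 's pmf" and S :: "'s set"
  assumes finite_kernel: "s \<in> S \<Longrightarrow> finite (set_pmf (K s))"
    and closed_kernel: "s \<in> S \<Longrightarrow> set_pmf (K s) \<subseteq> S"
begin

lemma integrable_kernel [simp]:
  "s \<in> S \<Longrightarrow> integrable (measure_pmf (K s)) (u :: 's \<Rightarrow> 'b :: {banach, second_countable_topology})"
  by (simp add: finite_kernel integrable_measure_pmf_finite)

lemma kernel_op_mono:
  "s \<in> S \<Longrightarrow> (\<And>t. t \<in> S \<Longrightarrow> u t \<le> v t) \<Longrightarrow> kernel_op K u s \<le> kernel_op K v s"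
  unfolding kernel_op_def
  by (intro integral_mono_AE) (auto intro!: AE_pmfI dest: closed_kernel)

lemma kernel_op_cong:
  "s \<in> S \<Longrightarrow> (\<And>t. t \<in> S \<Longrightarrow> u t = v t) \<Longrightarrow> kernel_op K u s = kernel_op K v s"
  unfolding kernel_op_def
  by (intro integral_cong_AE) (auto intro!: AE_pmfI dest: closed_kernel)

lemma kernel_op_linear:
  assumes "s \<in> S"
  shows "kernel_op K (\<lambda>t. u t + v t) s = kernel_op K u s + kernel_op K v s"
    and "kernel_op K (\<lambda>t. u t - v t) s = kernel_op K u s - kernel_op K v s"
    and "kernel_op K (\<lambda>t. c * u t) s = c * kernel_op K u s"
    and "kernel_op K (\<lambda>t. c) s = c"
  using assms by (simp_all add: kernel_op_def)

lemma kernel_op_eq_sum: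
  "s \<in> S \<Longrightarrow> kernel_op K u s = (\<Sum>t\<in>set_pmf (K s). pmf (K s) t * u t)"
  unfolding kernel_op_def by (subst integral_measure_pmf[of "set_pmf (K s)"]) (auto simp: finite_kernel)

lemma kernel_op_abs_le: "s \<in> S \<Longrightarrow> \<bar>kernel_op K u s\<bar> \<le> kernel_op K (\<lambda>t. \<bar>u t\<bar>) s"
  unfolding kernel_op_def by (rule integral_abs_bound)

text \<open>A single successor with \<open>u t < 1\<close> has positive mass and makes the average
  strict. This carries the chance of being killed backwards along an arrow.\<close>

lemma kernel_op_less_one:
  assumes s: "s \<in> S" and le: "\<And>t. t \<in> S \<Longrightarrow> u t \<le> 1" and t: "t \<in> set_pmf (K s)" "u t < 1"
  shows "kernel_op K u s < 1"
proof -
  have "kernel_op K u s = (\<Sum>t\<in>set_pmf (K s). pmf (K s) t * u t)"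
    by (rule kernel_op_eq_sum[OF s])
  also have "\<dots> < (\<Sum>t\<in>set_pmf (K s). pmf (K s) t * 1)"
  proof (rule sum_strict_mono_ex1)
    show "\<forall>t\<in>set_pmf (K s). pmf (K s) t * u t \<le> pmf (K s) t * 1"
      using le closed_kernel[OF s] by (intro ballI mult_left_mono) auto
    show "\<exists>t\<in>set_pmf (K s). pmf (K s) t * u t < pmf (K s) t * 1"
      using t by (intro bexI[of _ t] mult_strict_left_mono) (auto simp: pmf_positive)
  qed (simp add: finite_kernel s)
  also have "\<dots> = 1"
    using sum_pmf_eq_1[OF finite_kernel[OF s], of "K s"] by simp
  finally show ?thesis .
qed

end

text \<open>
  The chain is killed on entering the atom \<open>z\<close>; summing the killed semigroup solves the Poisson
  equation up to a multiple of the one-step probability of hitting \<open>z\<close>, and this multiple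
  vanishes because \<open>mu\<close> is invariant and charges \<open>z\<close>.
\<close>

locale atomic_chain = finite_kernel K S
  for K :: "'s \<Rightarrow> 's pmf" and S :: "'s set" +
  fixes z :: 's and mu :: "'s pmf"
  assumes atom_reachable: "s \<in> S \<Longrightarrow> (s, z) \<in> {(s, t). s \<in> S \<and> t \<in> set_pmf (K s)}\<^sup>+"
    and support_mu: "set_pmf mu \<subseteq> S"
    and invariant_mu: "bind_pmf mu K = mu"
    and atom_mu: "z \<in> set_pmf mu"
begin

text \<open>Killing takes place on arrival, so \<open>z\<close> itself is an admissible start.
  \<open>(killed_op ^^ n) (\<lambda>t. 1) s\<close> is the probability that the chain from
  \<open>s\<close> avoids \<open>z\<close> at the times 1, ..., n.\<close>

definition killed_op :: "('s \<Rightarrow> real) \<Rightarrow> 's \<Rightarrow> real" where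
  "killed_op u = kernel_op K (\<lambda>t. if t = z then 0 else u t)"

lemma killed_op_mono:
  "s \<in> S \<Longrightarrow> (\<And>t. t \<in> S \<Longrightarrow> u t \<le> v t) \<Longrightarrow> killed_op u s \<le> killed_op v s"
  unfolding killed_op_def by (rule kernel_op_mono) auto

lemma killed_op_le_kernel_op:
  "s \<in> S \<Longrightarrow> (\<And>t. t \<in> S \<Longrightarrow> 0 \<le> u t) \<Longrightarrow> killed_op u s \<le> kernel_op K u s"
  unfolding killed_op_def by (rule kernel_op_mono) auto

lemma killed_op_add: "s \<in> S \<Longrightarrow> killed_op (\<lambda>t. u t + v t) s = killed_op u s + killed_op v s"
  unfolding killed_op_def
  by (subst kernel_op_linear(1)[symmetric]) (auto intro!: kernel_op_cong)

lemma killed_op_cmult: "s \<in> S \<Longrightarrow> killed_op (\<lambda>t. c * u t) s = c * killed_op u s"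
  unfolding killed_op_def
  by (subst kernel_op_linear(3)[symmetric]) (auto intro!: kernel_op_cong)

lemma killed_op_abs_le: "s \<in> S \<Longrightarrow> \<bar>killed_op u s\<bar> \<le> killed_op (\<lambda>t. \<bar>u t\<bar>) s"
  unfolding killed_op_def
  by (rule order_trans[OF kernel_op_abs_le]) (auto intro!: kernel_op_mono)

lemma killed_op_cong: "s \<in> S \<Longrightarrow> (\<And>t. t \<in> S \<Longrightarrow> u t = v t) \<Longrightarrow> killed_op u s = killed_op v s"
  unfolding killed_op_def by (rule kernel_op_cong) auto

lemma killed_pow_mono:
  "s \<in> S \<Longrightarrow> (\<And>t. t \<in> S \<Longrightarrow> u t \<le> v t) \<Longrightarrow> (killed_op ^^ n) u s \<le> (killed_op ^^ n) v s"
  by (induction n arbitrary: s) (auto intro: killed_op_mono)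

lemma killed_pow_add:
  "s \<in> S \<Longrightarrow> (killed_op ^^ n) (\<lambda>t. u t + v t) s = (killed_op ^^ n) u s + (killed_op ^^ n) v s"
proof (induction n arbitrary: s)
  case (Suc n)
  have "killed_op ((killed_op ^^ n) (\<lambda>t. u t + v t)) s =
      killed_op (\<lambda>t. (killed_op ^^ n) u t + (killed_op ^^ n) v t) s"
    by (rule killed_op_cong) (use Suc in auto)
  then show ?case
    using killed_op_add[OF Suc.prems] by simp
qed simp

lemma killed_pow_cmult: "s \<in> S \<Longrightarrow> (killed_op ^^ n) (\<lambda>t. c * u t) s = c * (killed_op ^^ n) u s"
proof (induction n arbitrary: s)
  case (Suc n)
  have "killed_op ((killed_op ^^ n) (\<lambda>t. c * u t)) s = killed_op (\<lambda>t. c * (killed_op ^^ n) u t) s"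
    by (rule killed_op_cong) (use Suc in auto)
  then show ?case
    using killed_op_cmult[OF Suc.prems] by simp
qed simp

lemma killed_pow_abs_le: "s \<in> S \<Longrightarrow> \<bar>(killed_op ^^ n) u s\<bar> \<le> (killed_op ^^ n) (\<lambda>t. \<bar>u t\<bar>) s"
proof (induction n arbitrary: s)
  case (Suc n)
  have "\<bar>killed_op ((killed_op ^^ n) u) s\<bar> \<le> killed_op (\<lambda>t. \<bar>(killed_op ^^ n) u t\<bar>) s"
    using killed_op_abs_le Suc.prems by blast
  also have "\<dots> \<le> killed_op ((killed_op ^^ n) (\<lambda>t. \<bar>u t\<bar>)) s"
    using Suc by (intro killed_op_mono) auto
  finally show ?case by simp
qed simp

lemma killed_one_le: "s \<in> S \<Longrightarrow> killed_op (\<lambda>t. 1) s \<le> 1"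
  using killed_op_le_kernel_op[of s "\<lambda>t. 1"] kernel_op_linear(4)[of s 1] by simp

lemma killed_pow_one_antimono:
  assumes "s \<in> S" "m \<le> n"
  shows "(killed_op ^^ n) (\<lambda>t. 1) s \<le> (killed_op ^^ m) (\<lambda>t. 1) s"
  using assms(2)
proof (induction n rule: dec_induct)
  case (step n)
  have "(killed_op ^^ Suc n) (\<lambda>t. 1) s = (killed_op ^^ n) (killed_op (\<lambda>t. 1)) s"
    by (simp add: funpow_swap1)
  also have "\<dots> \<le> (killed_op ^^ n) (\<lambda>t. 1) s"
    using assms(1) killed_one_le by (intro killed_pow_mono) auto
  finally show ?case using step by simp
qed simp

text \<open>Induction backwards along the arrows into \<open>z\<close>: the last arrow kills with
  positive probability, and every earlier one leads with positive probability to a state already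
  treated.\<close>

lemma killed_pow_one_less:
  assumes "s \<in> S"
  shows "\<exists>n. (killed_op ^^ n) (\<lambda>t. 1) s < 1"
  using atom_reachable[OF assms]
proof (induction rule: converse_trancl_induct)
  case (base s)
  then have "kernel_op K (\<lambda>t. if t = z then 0 else 1) s < 1"
    by (intro kernel_op_less_one[of s _ z]) auto
  then show ?case
    by (intro exI[of _ 1]) (simp add: killed_op_def)
next
  case (step s t)
  then obtain n where n: "(killed_op ^^ n) (\<lambda>t. 1) t < 1" by blast
  have "kernel_op K (\<lambda>t. if t = z then 0 else (killed_op ^^ n) (\<lambda>t. 1) t) s < 1"
    using step n killed_pow_one_antimono[of _ 0 n] by (intro kernel_op_less_one[of s _ t]) auto
  then show ?case
    by (intro exI[of _ "Suc n"]) (simp add: killed_op_def[of "(killed_op ^^ n) (\<lambda>t. 1)"])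
qed

context
  fixes W :: "'s \<Rightarrow> real" and \<gamma> b :: real
  assumes W_ge_1: "s \<in> S \<Longrightarrow> 1 \<le> W s"
    and finite_sublevel: "finite {s \<in> S. W s \<le> c}"
    and drift: "s \<in> S \<Longrightarrow> kernel_op K W s \<le> \<gamma> * W s + b"
    and \<gamma>: "0 \<le> \<gamma>" "\<gamma> < 1" and b: "0 \<le> b"
begin

lemma killed_pow_drift:
  "s \<in> S \<Longrightarrow> (killed_op ^^ n) W s \<le> \<gamma> ^ n * W s + b / (1 - \<gamma>)"
proof (induction n)
  case 0
  then show ?case using \<gamma> b by simp
next
  case (Suc n)
  have "(killed_op ^^ Suc n) W s = (killed_op ^^ n) (killed_op W) s"
    by (simp add: funpow_swap1)
  also have "\<dots> \<le> (killed_op ^^ n) (\<lambda>t. \<gamma> * W t + b * 1) s"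
  proof (rule killed_pow_mono[OF Suc.prems])
    fix t assume t: "t \<in> S"
    have "killed_op W t \<le> kernel_op K W t"
      using W_ge_1 by (intro killed_op_le_kernel_op t) force
    then show "killed_op W t \<le> \<gamma> * W t + b * 1" using drift[OF t] by simp
  qed
  also have "\<dots> = \<gamma> * (killed_op ^^ n) W s + b * (killed_op ^^ n) (\<lambda>t. 1) s"
    using Suc.prems by (simp only: killed_pow_add killed_pow_cmult)
  also have "\<dots> \<le> \<gamma> * (\<gamma> ^ n * W s + b / (1 - \<gamma>)) + b * 1"
    using Suc killed_pow_one_antimono[of s 0 n] \<gamma> b by (intro add_mono mult_left_mono) auto
  also have "\<dots> = \<gamma> ^ Suc n * W s + b / (1 - \<gamma>)"
    using \<gamma> by (simp add: field_simps)
  finally show ?case .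
qed

text \<open>Neither ingredient contracts alone. Far out the drift shrinks \<open>W\<close>; on the
  finite set \<open>C\<close>, where it may fail to do so, some mass is killed within
  \<open>m\<close> steps. A small weight \<open>\<beta>\<close> of \<open>W\<close> against the
  constant 1 makes each gain outweigh the possible loss in the other term.\<close>

lemma killed_contraction:
  obtains m \<beta> \<rho> where "0 < m" "0 < \<beta>" "0 < \<rho>" "\<rho> < 1"
    "\<And>s. s \<in> S \<Longrightarrow> (killed_op ^^ m) (\<lambda>t. 1 + \<beta> * W t) s \<le> \<rho> * (1 + \<beta> * W s)"
proof -
  define B where "B = b / (1 - \<gamma>)"
  \<comment> \<open>From this level on \<open>B\<close> is at most half of what the drift gains, so
    that \<open>\<gamma> * W s + B \<le> (1 + \<gamma>) / 2 * W s\<close>.\<close>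
  define L where "L = 2 * B / (1 - \<gamma>)"
  have B0: "0 \<le> B" using \<gamma> b by (simp add: B_def)
  define C where "C = {s \<in> S. W s \<le> L}"
  have finC: "finite C" unfolding C_def by (rule finite_sublevel)
  have "\<forall>s\<in>C. \<exists>n. (killed_op ^^ n) (\<lambda>t. 1) s < 1"
    using killed_pow_one_less by (auto simp: C_def)
  then obtain N where N: "\<And>s. s \<in> C \<Longrightarrow> (killed_op ^^ (N s)) (\<lambda>t. 1) s < 1"
    by metis
  \<comment> \<open>The sum dominates every \<open>N s\<close>; the \<open>Suc\<close> makes
    \<open>m\<close> positive, so that \<open>\<gamma> ^ m \<le> \<gamma>\<close>.\<close>
  define m where "m = Suc (\<Sum>s\<in>C. N s)"
  have m: "(killed_op ^^ m) (\<lambda>t. 1) s < 1" if "s \<in> C" for s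
  proof -
    have "N s \<le> m" unfolding m_def using member_le_sum[OF that _ finC, of N] by simp
    then show ?thesis
      using killed_pow_one_antimono[of s "N s" m] N[OF that] that by (auto simp: C_def)
  qed
  \<comment> \<open>The inserted 1 covers an empty \<open>C\<close> and ensures
    \<open>\<epsilon> \<le> 1\<close>.\<close>
  define \<epsilon> where "\<epsilon> = Min (insert 1 ((\<lambda>s. 1 - (killed_op ^^ m) (\<lambda>t. 1) s) ` C))"
  have \<epsilon>0: "0 < \<epsilon>" unfolding \<epsilon>_def using finC m by (subst Min_gr_iff) auto
  have \<epsilon>1: "\<epsilon> \<le> 1" unfolding \<epsilon>_def using finC by (intro Min_le) auto
  have \<epsilon>: "(killed_op ^^ m) (\<lambda>t. 1) s \<le> 1 - \<epsilon>" if "s \<in> C" for s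
  proof -
    have "\<epsilon> \<le> 1 - (killed_op ^^ m) (\<lambda>t. 1) s"
      unfolding \<epsilon>_def using finC that by (intro Min_le) auto
    then show ?thesis by simp
  qed
  \<comment> \<open>Chosen for \<open>\<beta> * B \<le> \<epsilon> / 2\<close>: on \<open>C\<close>
    the drift constant uses up at most half of the killed mass.\<close>
  define \<beta> where "\<beta> = min 1 (\<epsilon> / (2 * (B + 1)))"
  have \<beta>0: "0 < \<beta>" and \<beta>1: "\<beta> \<le> 1" using \<epsilon>0 B0 by (auto simp: \<beta>_def)
  have \<beta>B: "\<beta> * B \<le> \<epsilon> / 2"
  proof -
    have "\<beta> * B \<le> \<epsilon> / (2 * (B + 1)) * (B + 1)"
      using B0 \<beta>0 \<epsilon>0 by (intro mult_mono) (auto simp: \<beta>_def)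
    also have "\<dots> = \<epsilon> / 2" using B0 by (simp add: field_simps)
    finally show ?thesis .
  qed
  \<comment> \<open>The first bound is what remains of the killed mass on \<open>C\<close>, the
    second is what the drift gains off \<open>C\<close>, where \<open>1 \<le> W s\<close>.\<close>
  define \<delta> where "\<delta> = min (\<epsilon> / 2) (\<beta> * (1 - \<gamma>) / 4)"
  define \<rho> where "\<rho> = 1 - \<delta>"
  have \<delta>0: "0 < \<delta>" using \<epsilon>0 \<beta>0 \<gamma> by (simp add: \<delta>_def)
  have \<delta>1: "\<delta> \<le> 1 / 2" using \<epsilon>1 by (simp add: \<delta>_def)
  have \<delta>\<gamma>: "\<delta> \<le> (1 - \<gamma>) / 4"
  proof -
    have "\<beta> * (1 - \<gamma>) \<le> 1 * (1 - \<gamma>)" using \<beta>1 \<gamma> by (intro mult_right_mono) auto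
    then show ?thesis by (simp add: \<delta>_def)
  qed
  have pow\<gamma>: "\<gamma> ^ m \<le> \<gamma>"
    using \<gamma> power_decreasing[of 1 m \<gamma>] by (simp add: m_def)
  show ?thesis
  proof (rule that[of m \<beta> \<rho>])
    fix s assume s: "s \<in> S"
    have W1: "1 \<le> W s" by (rule W_ge_1[OF s])
    have split: "(killed_op ^^ m) (\<lambda>t. 1 + \<beta> * W t) s =
        (killed_op ^^ m) (\<lambda>t. 1) s + \<beta> * (killed_op ^^ m) W s"
      using s by (simp only: killed_pow_add killed_pow_cmult)
    have "(killed_op ^^ m) W s \<le> \<gamma> ^ m * W s + B"
      unfolding B_def by (rule killed_pow_drift[OF s])
    also have "\<dots> \<le> \<gamma> * W s + B"
      using pow\<gamma> W1 by (simp add: mult_right_mono)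
    finally have Wm: "\<beta> * (killed_op ^^ m) W s \<le> \<beta> * (\<gamma> * W s + B)"
      using \<beta>0 by (intro mult_left_mono) auto
    show "(killed_op ^^ m) (\<lambda>t. 1 + \<beta> * W t) s \<le> \<rho> * (1 + \<beta> * W s)"
    proof (cases "s \<in> C")
      case True
      have "\<beta> * (\<gamma> * W s) \<le> \<beta> * (\<rho> * W s)"
        using \<beta>0 W1 \<delta>\<gamma> \<gamma> by (intro mult_left_mono mult_right_mono) (auto simp: \<rho>_def)
      moreover have "1 - \<epsilon> / 2 \<le> \<rho>" by (simp add: \<rho>_def \<delta>_def)
      ultimately show ?thesis
        unfolding split using \<epsilon>[OF True] Wm \<beta>B by (simp add: algebra_simps)
    next
      case False
      then have WL: "L \<le> W s" using s by (auto simp: C_def)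
      have "B \<le> (1 - \<gamma>) / 2 * W s"
        using WL \<gamma> by (simp add: L_def field_simps)
      define X where "X = \<beta> * ((1 + \<gamma>) / 2 * W s)"
      have "\<gamma> * W s + B \<le> (1 + \<gamma>) / 2 * W s"
        using \<open>B \<le> (1 - \<gamma>) / 2 * W s\<close> by (simp add: field_simps)
      then have le_X: "\<beta> * (\<gamma> * W s + B) \<le> X"
        unfolding X_def using \<beta>0 by (intro mult_left_mono) auto
      have "1 - \<rho> \<le> \<beta> * ((1 - \<gamma>) / 4 * 1)" by (simp add: \<rho>_def \<delta>_def)
      also have "\<dots> \<le> \<beta> * ((\<rho> - (1 + \<gamma>) / 2) * W s)"
        using \<beta>0 W1 \<gamma> \<delta>\<gamma> by (intro mult_left_mono mult_mono) (auto simp: \<rho>_def field_simps)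
      also have "\<dots> = \<rho> * (\<beta> * W s) - X"
        by (simp only: X_def algebra_simps)
      finally have "1 + X \<le> \<rho> * (1 + \<beta> * W s)"
        by (simp add: distrib_left)
      moreover have "(killed_op ^^ m) (\<lambda>t. 1) s \<le> 1"
        using killed_pow_one_antimono[OF s, of 0 m] by simp
      ultimately show ?thesis
        unfolding split using Wm le_X by simp
    qed
  qed (use \<beta>0 \<delta>0 \<delta>1 in \<open>auto simp: m_def \<rho>_def\<close>)
qed

text \<open>\<open>n\<close> steps consist of \<open>n div m\<close> contracting blocks and a
  remainder shorter than \<open>m\<close>, whose growth is bounded by \<open>E\<close>. The rate per
  step is the \<open>m\<close>-th root of the rate per block.\<close>

lemma killed_geometric:
  obtains r C where "0 < r" "r < 1" "0 < C"
    "\<And>s n. s \<in> S \<Longrightarrow> (killed_op ^^ n) W s \<le> C * r ^ n * W s"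
proof -
  obtain m \<beta> \<rho> where m: "0 < m" and \<beta>: "0 < \<beta>" and \<rho>: "0 < \<rho>" "\<rho> < 1"
    and con: "\<And>s. s \<in> S \<Longrightarrow> (killed_op ^^ m) (\<lambda>t. 1 + \<beta> * W t) s \<le> \<rho> * (1 + \<beta> * W s)"
    by (rule killed_contraction) (rule that)
  define \<Lambda> where "\<Lambda> = (\<lambda>t. 1 + \<beta> * W t)"
  define r where "r = root m \<rho>"
  have r: "0 < r" "r < 1" "r ^ m = \<rho>"
    using m \<rho> by (auto simp: r_def real_root_pow_pos2)
  define E where "E = 1 + \<beta> + \<beta> * (b / (1 - \<gamma>))"
  have B0: "0 \<le> b / (1 - \<gamma>)" using b \<gamma> by simp
  have E0: "0 < E" unfolding E_def by (intro add_pos_nonneg mult_nonneg_nonneg B0) (use \<beta> in auto)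
  have \<Lambda>: "\<Lambda> s \<le> (1 + \<beta>) * W s" "\<beta> * W s \<le> \<Lambda> s" "(killed_op ^^ n) \<Lambda> s \<le> E * W s" if s: "s \<in> S" for s n
  proof -
    show 1: "\<Lambda> s \<le> (1 + \<beta>) * W s" and "\<beta> * W s \<le> \<Lambda> s"
      using W_ge_1[OF s] \<beta> by (auto simp: \<Lambda>_def algebra_simps)
    have "(killed_op ^^ n) \<Lambda> s = (killed_op ^^ n) (\<lambda>t. 1) s + \<beta> * (killed_op ^^ n) W s"
      unfolding \<Lambda>_def using s by (simp only: killed_pow_add killed_pow_cmult)
    also have "\<dots> \<le> 1 + \<beta> * (\<gamma> ^ n * W s + b / (1 - \<gamma>))"
      using killed_pow_one_antimono[OF s, of 0 n] killed_pow_drift[OF s, of n] \<beta>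
      by (intro add_mono mult_left_mono) auto
    also have "\<dots> \<le> W s + \<beta> * (1 * W s + b / (1 - \<gamma>) * W s)"
      using W_ge_1[OF s] \<beta> \<gamma> B0 mult_left_mono[OF W_ge_1[OF s] B0]
      by (intro add_mono mult_left_mono mult_right_mono power_le_one) auto
    finally show "(killed_op ^^ n) \<Lambda> s \<le> E * W s" by (simp add: E_def algebra_simps)
  qed
  have blocks: "(killed_op ^^ (m * k + j)) \<Lambda> s \<le> \<rho> ^ k * (killed_op ^^ j) \<Lambda> s" if s: "s \<in> S" for k j s
  proof (induction k)
    case (Suc k)
    have "(killed_op ^^ (m * Suc k + j)) \<Lambda> s = (killed_op ^^ (m * k + j)) ((killed_op ^^ m) \<Lambda>) s"
      by (simp add: funpow_add[symmetric, THEN fun_cong, simplified comp_def] algebra_simps)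
    also have "\<dots> \<le> (killed_op ^^ (m * k + j)) (\<lambda>t. \<rho> * \<Lambda> t) s"
      using con s unfolding \<Lambda>_def by (intro killed_pow_mono) auto
    also have "\<dots> = \<rho> * (killed_op ^^ (m * k + j)) \<Lambda> s" by (rule killed_pow_cmult[OF s])
    also have "\<dots> \<le> \<rho> * (\<rho> ^ k * (killed_op ^^ j) \<Lambda> s)"
      using Suc \<rho> by (intro mult_left_mono) auto
    finally show ?case by simp
  qed simp
  show ?thesis
  proof (rule that[of r "E / (\<beta> * \<rho>)"])
    fix s n assume s: "s \<in> S"
    \<comment> \<open>An incomplete block is counted as a full one, at the price of one factor
      \<open>\<rho>\<close>.\<close>
    have "\<rho> * \<rho> ^ (n div m) = r ^ (m * (n div m) + m)"
      using r by (simp add: power_add power_mult mult.commute)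
    also have "\<dots> \<le> r ^ n"
    proof (rule power_decreasing)
      show "n \<le> m * (n div m) + m"
        using mult_div_mod_eq[of m n] mod_less_divisor[OF m, of n] by linarith
    qed (use r in auto)
    finally have pow: "\<rho> ^ (n div m) \<le> r ^ n / \<rho>"
      using \<rho> by (simp add: field_simps)
    have "\<beta> * (killed_op ^^ n) W s = (killed_op ^^ n) (\<lambda>t. \<beta> * W t) s"
      by (simp add: killed_pow_cmult[OF s])
    also have "\<dots> \<le> (killed_op ^^ n) \<Lambda> s"
      using s \<Lambda>(2) by (intro killed_pow_mono) auto
    also have "\<dots> \<le> \<rho> ^ (n div m) * (killed_op ^^ (n mod m)) \<Lambda> s"
      using blocks[OF s, of "n div m" "n mod m"] by simp
    also have "\<dots> \<le> \<rho> ^ (n div m) * (E * W s)"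
      using \<Lambda>(3)[OF s] \<rho> by (intro mult_left_mono) auto
    also have "\<dots> \<le> (r ^ n / \<rho>) * (E * W s)"
      using pow E0 W_ge_1[OF s] by (intro mult_right_mono) auto
    finally show "(killed_op ^^ n) W s \<le> E / (\<beta> * \<rho>) * r ^ n * W s"
      using \<beta> \<rho> by (simp add: field_simps)
  qed (use r E0 \<beta> \<rho> in auto)
qed

text \<open>Invariance cannot be applied to \<open>W\<close> before its integrability is known. It
  is applied to bounded truncations, where the drift condition gives a bound independent of the
  level; monotone convergence then gives the claim.\<close>

lemma integrable_mu_W: "integrable (measure_pmf mu) W"
proof -
  have pos: "AE s in measure_pmf mu. 0 \<le> W s"
    using support_mu W_ge_1 by (intro AE_pmfI) force
  have trunc: "measure_pmf.expectation mu (\<lambda>s. if W s \<le> N then W s else 0) \<le> b / (1 - \<gamma>)" for N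
  proof -
    define u where "u = (\<lambda>s. max 0 (min (W s) N))"
    have bu: "\<bar>u s\<bar> \<le> \<bar>N\<bar>" for s by (auto simp: u_def)
    have iu: "integrable (measure_pmf p) u" for p
      by (rule measure_pmf.integrable_const_bound[where B="\<bar>N\<bar>"]) (use bu in auto)
    have inv: "measure_pmf.expectation mu u = measure_pmf.expectation mu (kernel_op K u)"
      "integrable (measure_pmf mu) (kernel_op K u)"
      using integral_bind_finite_pmf[of mu K u] iu finite_kernel support_mu invariant_mu by auto
    define t where "t = (\<lambda>s. if W s \<le> N then W s else 0)"
    define o1 where "o1 = (\<lambda>s. if W s \<le> N then 1 else 0 :: real)"
    have it: "integrable (measure_pmf mu) t"
      by (rule measure_pmf.integrable_const_bound[where B="\<bar>N\<bar>"])
         (use pos in \<open>auto simp: t_def elim!: eventually_mono\<close>)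
    have io: "integrable (measure_pmf mu) o1"
      by (rule measure_pmf.integrable_const_bound[where B=1]) (auto simp: o1_def)
    have "measure_pmf.expectation mu (\<lambda>s. (1 - \<gamma>) * t s - b * o1 s) \<le>
        measure_pmf.expectation mu (\<lambda>s. u s - kernel_op K u s)"
    proof (rule integral_mono_AE)
      show "AE s in measure_pmf mu. (1 - \<gamma>) * t s - b * o1 s \<le> u s - kernel_op K u s"
      proof (rule AE_pmfI)
        fix s assume "s \<in> set_pmf mu"
        then have s: "s \<in> S" using support_mu by auto
        have "kernel_op K u s \<le> kernel_op K W s"
          by (rule kernel_op_mono[OF s]) (use W_ge_1 in \<open>force simp: u_def\<close>)
        then have 1: "kernel_op K u s \<le> \<gamma> * W s + b" using drift[OF s] by simp
        have "kernel_op K u s \<le> kernel_op K (\<lambda>t. max 0 N) s"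
          by (rule kernel_op_mono[OF s]) (auto simp: u_def)
        then have 2: "kernel_op K u s \<le> max 0 N" using kernel_op_linear(4)[OF s] by simp
        \<comment> \<open>Where \<open>W s \<le> N\<close> this is the drift condition. Elsewhere
          the left side is zero and \<open>u\<close> attains its maximum at \<open>s\<close>, so the
          right side is nonnegative.\<close>
        show "(1 - \<gamma>) * t s - b * o1 s \<le> u s - kernel_op K u s"
          using 1 2 W_ge_1[OF s] by (auto simp: t_def o1_def u_def algebra_simps split: if_splits)
      qed
    qed (use it io iu inv in auto)
    also have "\<dots> = 0" using inv iu by simp
    finally have "(1 - \<gamma>) * measure_pmf.expectation mu t \<le> b * measure_pmf.expectation mu o1"
      using it io by simp
    also have "measure_pmf.expectation mu o1 \<le> measure_pmf.expectation mu (\<lambda>s. 1)"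
      by (rule integral_mono_AE) (use io in \<open>auto simp: o1_def\<close>)
    then have "b * measure_pmf.expectation mu o1 \<le> b" using b by (simp add: mult_left_le)
    finally show ?thesis
      using \<gamma> unfolding t_def by (simp add: pos_le_divide_eq mult.commute)
  qed
  have "(\<integral>\<^sup>+s. ennreal (W s) \<partial>mu) = (\<integral>\<^sup>+s. (SUP N::nat. ennreal (if W s \<le> real N then W s else 0)) \<partial>mu)"
  proof (rule nn_integral_cong)
    fix s
    obtain N :: nat where N: "W s \<le> real N" using real_arch_simple by blast
    show "ennreal (W s) = (SUP N::nat. ennreal (if W s \<le> real N then W s else 0))"
      by (rule antisym) (auto intro!: SUP_upper2[of N] SUP_least simp: N)
  qed
  also have "\<dots> = (SUP N::nat. \<integral>\<^sup>+s. ennreal (if W s \<le> real N then W s else 0) \<partial>mu)"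
  proof (rule nn_integral_monotone_convergence_SUP_AE)
    show "AE s in measure_pmf mu. ennreal (if W s \<le> real i then W s else 0) \<le> ennreal (if W s \<le> real (Suc i) then W s else 0)" for i
      using pos by (auto elim!: eventually_mono intro!: ennreal_leI)
  qed auto
  also have "\<dots> \<le> ennreal (b / (1 - \<gamma>))"
  proof (rule SUP_least)
    fix N :: nat
    have int: "integrable (measure_pmf mu) (\<lambda>s. if W s \<le> real N then W s else 0)"
      by (rule measure_pmf.integrable_const_bound[where B="real N"])
         (use pos in \<open>auto elim!: eventually_mono\<close>)
    have "(\<integral>\<^sup>+s. ennreal (if W s \<le> real N then W s else 0) \<partial>mu) =
        ennreal (measure_pmf.expectation mu (\<lambda>s. if W s \<le> real N then W s else 0))"
      by (rule nn_integral_eq_integral[OF int]) (use pos in \<open>auto elim!: eventually_mono\<close>)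
    also have "\<dots> \<le> ennreal (b / (1 - \<gamma>))" by (rule ennreal_leI[OF trunc])
    finally show "(\<integral>\<^sup>+s. ennreal (if W s \<le> real N then W s else 0) \<partial>mu) \<le> ennreal (b / (1 - \<gamma>))" .
  qed
  finally show ?thesis
    by (intro integrableI_nonneg) (use pos in \<open>auto simp: le_less_trans\<close>)
qed

lemma integrable_mu:
  assumes "\<And>s. s \<in> S \<Longrightarrow> \<bar>F s\<bar> \<le> C * W s"
  shows "integrable (measure_pmf mu) F"
proof (rule Bochner_Integration.integrable_bound)
  show "integrable (measure_pmf mu) (\<lambda>s. C * W s)" using integrable_mu_W by simp
  show "AE s in measure_pmf mu. norm (F s) \<le> norm (C * W s)"
    using assms support_mu by (intro AE_pmfI) force
qed auto

theorem poisson_equation: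
  assumes F: "\<And>s. s \<in> S \<Longrightarrow> \<bar>F s\<bar> \<le> C * W s"
  obtains g D where "0 \<le> D" "\<And>s. s \<in> S \<Longrightarrow> \<bar>g s\<bar> \<le> D * W s"
    "\<And>s. s \<in> S \<Longrightarrow> g s - kernel_op K g s = F s - measure_pmf.expectation mu F"
proof -
  obtain r E where r: "0 < r" "r < 1" and E: "0 < E"
    and geo: "\<And>s n. s \<in> S \<Longrightarrow> (killed_op ^^ n) W s \<le> E * r ^ n * W s"
    by (rule killed_geometric) (rule that)
  define c where "c = measure_pmf.expectation mu F"
  define F0 where "F0 = (\<lambda>s. F s - c)"
  define A where "A = \<bar>C\<bar> + \<bar>c\<bar>"
  have F0: "\<bar>F0 s\<bar> \<le> A * W s" if s: "s \<in> S" for s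
  proof -
    have "\<bar>F0 s\<bar> \<le> C * W s + \<bar>c\<bar>" using F[OF s] by (auto simp: F0_def)
    also have "\<dots> \<le> \<bar>C\<bar> * W s + \<bar>c\<bar> * W s"
      using W_ge_1[OF s] mult_left_mono[OF W_ge_1[OF s], of "\<bar>c\<bar>"] by (intro add_mono mult_right_mono) auto
    finally show ?thesis by (simp add: A_def algebra_simps)
  qed
  have term_le: "\<bar>(killed_op ^^ n) F0 s\<bar> \<le> A * E * W s * r ^ n" if s: "s \<in> S" for s n
  proof -
    have "\<bar>(killed_op ^^ n) F0 s\<bar> \<le> (killed_op ^^ n) (\<lambda>t. \<bar>F0 t\<bar>) s" by (rule killed_pow_abs_le[OF s])
    also have "\<dots> \<le> (killed_op ^^ n) (\<lambda>t. A * W t) s" using F0 by (intro killed_pow_mono s)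
    also have "\<dots> = A * (killed_op ^^ n) W s" by (rule killed_pow_cmult[OF s])
    also have "\<dots> \<le> A * (E * r ^ n * W s)" using geo[OF s] by (intro mult_left_mono) (auto simp: A_def)
    finally show ?thesis by (simp add: algebra_simps)
  qed
  have sg: "summable (\<lambda>n. A * E * W s * r ^ n)" for s
    using r by (intro summable_mult summable_geometric) auto
  have sm: "summable (\<lambda>n. (killed_op ^^ n) F0 s)" and sma: "summable (\<lambda>n. \<bar>(killed_op ^^ n) F0 s\<bar>)"
    if s: "s \<in> S" for s
    using term_le[OF s] summable_comparison_test[OF _ sg[of s], of "\<lambda>n. (killed_op ^^ n) F0 s"]
      summable_comparison_test[OF _ sg[of s], of "\<lambda>n. \<bar>(killed_op ^^ n) F0 s\<bar>"] by auto
  define g where "g s = (\<Sum>n. (killed_op ^^ n) F0 s)" for s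
  define D where "D = A * E / (1 - r)"
  have g: "\<bar>g s\<bar> \<le> D * W s" if s: "s \<in> S" for s
  proof -
    have "\<bar>g s\<bar> \<le> (\<Sum>n. \<bar>(killed_op ^^ n) F0 s\<bar>)"
      unfolding g_def by (rule summable_rabs[OF sma[OF s]])
    also have "\<dots> \<le> (\<Sum>n. A * E * W s * r ^ n)"
      by (rule suminf_le[OF _ sma[OF s] sg]) (rule term_le[OF s])
    also have "\<dots> = A * E * W s * (1 / (1 - r))"
      using r suminf_mult[of "\<lambda>n. r ^ n" "A * E * W s"] suminf_geometric[of r]
      by (simp add: summable_geometric)
    finally show ?thesis by (simp add: D_def field_simps)
  qed
  have Qg: "killed_op g s = g s - F0 s" if s: "s \<in> S" for s
  proof -
    \<comment> \<open>The supports are finite, so the series can be taken out of the kernel term by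
      term.\<close>
    have "killed_op g s = (\<Sum>t\<in>set_pmf (K s). \<Sum>n. pmf (K s) t * (if t = z then 0 else (killed_op ^^ n) F0 t))"
      unfolding killed_op_def[of g] kernel_op_eq_sum[OF s] g_def
      using closed_kernel[OF s] by (intro sum.cong) (auto simp: suminf_mult[OF sm])
    also have "\<dots> = (\<Sum>n. \<Sum>t\<in>set_pmf (K s). pmf (K s) t * (if t = z then 0 else (killed_op ^^ n) F0 t))"
      using closed_kernel[OF s] by (intro suminf_sum[symmetric] summable_mult, case_tac "t = z") (auto simp: sm)
    also have "\<dots> = (\<Sum>n. (killed_op ^^ Suc n) F0 s)"
      using kernel_op_eq_sum[OF s] by (simp add: killed_op_def[of "(killed_op ^^ _) F0"])
    also have "\<dots> = g s - F0 s"
      unfolding g_def using suminf_minus_initial_segment[OF sm[OF s], of 1] by simp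
    finally show ?thesis .
  qed
  have Pg: "kernel_op K g s = g s - F0 s + pmf (K s) z * g z" if s: "s \<in> S" for s
  proof -
    have "kernel_op K g s = kernel_op K (\<lambda>t. (if t = z then 0 else g t) + g z * indicator {z} t) s"
      by (rule kernel_op_cong[OF s]) auto
    also have "\<dots> = killed_op g s + g z * kernel_op K (indicator {z}) s"
      using s unfolding killed_op_def by (simp only: kernel_op_linear)
    also have "kernel_op K (indicator {z}) s = pmf (K s) z"
      by (simp add: kernel_op_def measure_pmf_single)
    finally show ?thesis using Qg[OF s] by simp
  qed
  have ig: "integrable (measure_pmf mu) g" by (rule integrable_mu) (rule g)
  have iF: "integrable (measure_pmf mu) F" by (rule integrable_mu) (rule F)
  have iz: "integrable (measure_pmf mu) (\<lambda>s. pmf (K s) z)"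
    by (rule measure_pmf.integrable_const_bound[where B=1]) (auto simp: pmf_le_1)
  have fin: "\<And>s. s \<in> set_pmf mu \<Longrightarrow> finite (set_pmf (K s))" using support_mu finite_kernel by blast
  have "measure_pmf.expectation mu g = measure_pmf.expectation mu (kernel_op K g)"
    using integral_bind_finite_pmf(2)[of mu K g, OF fin] ig invariant_mu by simp
  also have "\<dots> = measure_pmf.expectation mu (\<lambda>s. g s - F0 s + pmf (K s) z * g z)"
    by (rule integral_cong_AE) (use Pg support_mu in \<open>auto intro!: AE_pmfI\<close>)
  also have "\<dots> = measure_pmf.expectation mu g - (measure_pmf.expectation mu F - c) +
      measure_pmf.expectation mu (\<lambda>s. pmf (K s) z) * g z"
    unfolding F0_def using ig iF iz by simp
  also have "measure_pmf.expectation mu (\<lambda>s. pmf (K s) z) = pmf mu z"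
    using pmf_bind[of mu K z] invariant_mu by simp
  \<comment> \<open>\<open>g z\<close> is the mean of the sum of \<open>F0\<close> over one
    excursion from \<open>z\<close>, and this is Kac's formula for \<open>mu\<close>. The
    coefficient of \<open>g z\<close> is \<open>pmf mu z\<close>, positive by
    \<open>atom_mu\<close>.\<close>
  finally have "g z = 0"
    using atom_mu by (simp add: c_def set_pmf_iff)
  then show ?thesis
    using that[of D g] g Pg E r by (auto simp: F0_def c_def D_def A_def)
qed

end

end

section \<open>Martingale estimates along a chain\<close>

locale chain_process = finite_kernel K S + prob_space M
  for K :: "'s::countable \<Rightarrow> 's pmf" and S :: "'s set" and M :: "'a measure" +
  fixes Z :: "nat \<Rightarrow> 'a \<Rightarrow> 's" and z0 :: 's
  assumes Z_measurable [measurable]: "Z n \<in> M \<rightarrow>\<^sub>M count_space UNIV"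
    and start: "AE \<omega> in M. Z 0 \<omega> = z0"
    and start_in: "z0 \<in> S"
    and transition: "s n \<in> S \<Longrightarrow>
        measure M {\<omega> \<in> space M. (\<forall>k\<le>n. Z k \<omega> = s k) \<and> Z (Suc n) \<omega> = t} =
        measure M {\<omega> \<in> space M. \<forall>k\<le>n. Z k \<omega> = s k} * pmf (K (s n)) t"
begin

text \<open>Stands for measurability with respect to the natural filtration. As the states are
  countable, dependence on the history alone already implies measurability.\<close>

definition adapted :: "nat \<Rightarrow> ('a \<Rightarrow> 'b) \<Rightarrow> bool" where
  "adapted k Y \<longleftrightarrow> (\<forall>\<omega>\<in>space M. \<forall>\<omega>'\<in>space M. (\<forall>i\<le>k. Z i \<omega> = Z i \<omega>') \<longrightarrow> Y \<omega> = Y \<omega>')"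

lemma adapted_const: "adapted k (\<lambda>\<omega>. c)"
  by (simp add: adapted_def)

lemma adapted_Z: "i \<le> k \<Longrightarrow> adapted k (Z i)"
  by (simp add: adapted_def)

lemma adapted_fun_Z: "i \<le> k \<Longrightarrow> adapted k (\<lambda>\<omega>. f (Z i \<omega>))"
  by (simp add: adapted_def)

lemma adapted_fun_Z2: "i \<le> k \<Longrightarrow> j \<le> k \<Longrightarrow> adapted k (\<lambda>\<omega>. f (Z i \<omega>) (Z j \<omega>))"
  by (simp add: adapted_def)

lemma adapted_mono: "adapted i Y \<Longrightarrow> i \<le> k \<Longrightarrow> adapted k Y"
  unfolding adapted_def by (meson order_trans)

lemma adapted_compose: "adapted k Y \<Longrightarrow> adapted k (\<lambda>\<omega>. f (Y \<omega>))"
  unfolding adapted_def by metis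

lemma adapted_compose2: "adapted k X \<Longrightarrow> adapted k Y \<Longrightarrow> adapted k (\<lambda>\<omega>. f (X \<omega>) (Y \<omega>))"
  unfolding adapted_def by metis

lemma adapted_sum: "(\<And>i. i \<in> I \<Longrightarrow> adapted k (Y i)) \<Longrightarrow> adapted k (\<lambda>\<omega>. \<Sum>i\<in>I. Y i \<omega>)"
  unfolding adapted_def by (intro ballI impI sum.cong refl) blast

definition hist :: "nat \<Rightarrow> 'a \<Rightarrow> 's list" where
  "hist n \<omega> = map (\<lambda>k. Z k \<omega>) [0..<Suc n]"

lemma hist_nth: "k \<le> n \<Longrightarrow> hist n \<omega> ! k = Z k \<omega>"
  unfolding hist_def by (subst nth_map) (auto simp del: upt_Suc)

lemma hist_Suc: "hist (Suc n) \<omega> = hist n \<omega> @ [Z (Suc n) \<omega>]"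
  by (simp add: hist_def)

lemma hist_eq_iff: "hist n \<omega> = l \<longleftrightarrow> length l = Suc n \<and> (\<forall>k\<le>n. Z k \<omega> = l ! k)"
  by (auto simp: hist_def list_eq_iff_nth_eq less_Suc_eq_le simp del: upt_Suc)

lemma hist_measurable [measurable]: "hist n \<in> M \<rightarrow>\<^sub>M count_space UNIV"
proof -
  have "hist n -` {l} \<inter> space M \<in> sets M" for l :: "'s list"
  proof -
    have "hist n -` {l} \<inter> space M = {\<omega> \<in> space M. length l = Suc n \<and> (\<forall>k\<le>n. Z k \<omega> = l ! k)}"
      by (simp add: set_eq_iff hist_eq_iff conj_commute)
    also have "\<dots> \<in> sets M" by measurable
    finally show ?thesis .
  qed
  then show ?thesis
    using measurable_count_space_eq2_countable[of "hist n" M UNIV] by simp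
qed

text \<open>A Doob-Dynkin factorisation: \<open>H\<close> evaluates \<open>Y\<close> at an
  arbitrarily chosen outcome with the given history.\<close>

lemma adapted_hist:
  assumes "adapted n Y"
  obtains H where "\<And>\<omega>. \<omega> \<in> space M \<Longrightarrow> Y \<omega> = H (hist n \<omega>)"
proof (rule that[of "\<lambda>l. Y (SOME \<omega>. \<omega> \<in> space M \<and> hist n \<omega> = l)"])
  fix \<omega> assume \<omega>: "\<omega> \<in> space M"
  define \<omega>' where "\<omega>' = (SOME \<omega>'. \<omega>' \<in> space M \<and> hist n \<omega>' = hist n \<omega>)"
  have \<omega>': "\<omega>' \<in> space M \<and> hist n \<omega>' = hist n \<omega>"
    unfolding \<omega>'_def
    using someI[of "\<lambda>\<omega>'. \<omega>' \<in> space M \<and> hist n \<omega>' = hist n \<omega>" \<omega>] \<omega> by simp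
  have "Z i \<omega> = Z i \<omega>'" if "i \<le> n" for i
    using hist_nth[OF that, of \<omega>] hist_nth[OF that, of \<omega>'] \<omega>' by simp
  then have "Y \<omega> = Y \<omega>'"
    using assms \<omega> \<omega>' unfolding adapted_def by blast
  then show "Y \<omega> = Y (SOME \<omega>'. \<omega>' \<in> space M \<and> hist n \<omega>' = hist n \<omega>)"
    by (simp add: \<omega>'_def)
qed

lemma adapted_borel_measurable: "adapted n Y \<Longrightarrow> Y \<in> borel_measurable M"
proof -
  assume "adapted n Y"
  then obtain H where H: "\<And>\<omega>. \<omega> \<in> space M \<Longrightarrow> Y \<omega> = H (hist n \<omega>)"
    by (rule adapted_hist) (rule that)
  have "(\<lambda>\<omega>. H (hist n \<omega>)) \<in> borel_measurable M" by measurable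
  then show ?thesis using H by (simp cong: measurable_cong)
qed

lemma hist_transition:
  assumes "length l = Suc n" "l ! n \<in> S"
  shows "measure M {\<omega> \<in> space M. hist n \<omega> = l \<and> Z (Suc n) \<omega> = t} =
      measure M {\<omega> \<in> space M. hist n \<omega> = l} * pmf (K (l ! n)) t"
  using transition[of "\<lambda>k. l ! k" n t] assms by (simp add: hist_eq_iff)

text \<open>The start is deterministic and each state has finitely many successors. Consequently
  every adapted variable takes almost surely finitely many values and is integrable.\<close>

lemma finite_histories:
  "\<exists>H. finite H \<and> (\<forall>l\<in>H. length l = Suc n \<and> (\<forall>k\<le>n. l ! k \<in> S)) \<and> (AE \<omega> in M. hist n \<omega> \<in> H)"
proof (induction n)
  case 0
  then show ?case
    using start start_in by (intro exI[of _ "{[z0]}"]) (auto simp: hist_def)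
next
  case (Suc n)
  then obtain H where H: "finite H" "\<And>l. l \<in> H \<Longrightarrow> length l = Suc n"
    "\<And>l k. l \<in> H \<Longrightarrow> k \<le> n \<Longrightarrow> l ! k \<in> S" "AE \<omega> in M. hist n \<omega> \<in> H"
    by blast
  define T where "T l = set_pmf (K (l ! n))" for l
  have T: "finite (T l)" "T l \<subseteq> S" if "l \<in> H" for l
    using H(3)[OF that, of n] finite_kernel closed_kernel by (auto simp: T_def)
  have "AE \<omega> in M. hist n \<omega> = l \<longrightarrow> Z (Suc n) \<omega> \<in> T l" if l: "l \<in> H" for l
  proof -
    let ?C = "{\<omega> \<in> space M. hist n \<omega> = l}"
    let ?D = "\<lambda>t. {\<omega> \<in> space M. hist n \<omega> = l \<and> Z (Suc n) \<omega> = t}"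
    \<comment> \<open>The event that the history is \<open>l\<close> but the next state lies outside
      of \<open>T l\<close> is null, because the transition probabilities sum to 1 over
      \<open>T l\<close>.\<close>
    have "measure M (?C - (\<Union>t\<in>T l. ?D t)) = measure M ?C - measure M (\<Union>t\<in>T l. ?D t)"
      using T[OF l] by (intro finite_measure_Diff sets.finite_UN) auto
    also have "measure M (\<Union>t\<in>T l. ?D t) = (\<Sum>t\<in>T l. measure M (?D t))"
      using T[OF l] by (intro finite_measure_finite_Union) (auto simp: disjoint_family_on_def)
    also have "\<dots> = measure M ?C * (\<Sum>t\<in>T l. pmf (K (l ! n)) t)"
      using H(2,3)[OF l] by (subst sum_distrib_left) (auto intro!: sum.cong hist_transition)
    also have "(\<Sum>t\<in>T l. pmf (K (l ! n)) t) = 1"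
      using T[OF l] by (intro sum_pmf_eq_1) (auto simp: T_def)
    finally have "measure M (?C - (\<Union>t\<in>T l. ?D t)) = 0" by simp
    then have "AE \<omega> in M. \<omega> \<notin> ?C - (\<Union>t\<in>T l. ?D t)"
      using T[OF l] by (subst prob_eq_0[symmetric]) (auto intro!: sets.Diff sets.finite_UN)
    then show ?thesis by (rule AE_mp) (auto intro!: AE_I2)
  qed
  then have step: "AE \<omega> in M. \<forall>l\<in>H. hist n \<omega> = l \<longrightarrow> Z (Suc n) \<omega> \<in> T l"
    using H(1) by (intro AE_finite_allI) auto
  show ?case
  proof (intro exI[of _ "(\<lambda>(l, t). l @ [t]) ` (SIGMA l:H. T l)"] conjI)
    show "finite ((\<lambda>(l, t). l @ [t]) ` (SIGMA l:H. T l))" using H(1) T by auto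
    show "\<forall>l\<in>(\<lambda>(l, t). l @ [t]) ` (SIGMA l:H. T l). length l = Suc (Suc n) \<and> (\<forall>k\<le>Suc n. l ! k \<in> S)"
    proof safe
      fix l t k assume "l \<in> H" "t \<in> T l" "k \<le> Suc n"
      then show "(l @ [t]) ! k \<in> S"
        using H(2,3)[of l] T[of l] by (cases "k \<le> n") (auto simp: nth_append)
    qed (use H(2) in auto)
    show "AE \<omega> in M. hist (Suc n) \<omega> \<in> (\<lambda>(l, t). l @ [t]) ` (SIGMA l:H. T l)"
      using H(4) step by eventually_elim (force simp: hist_Suc)
  qed
qed

lemma integrable_adapted:
  fixes Y :: "'a \<Rightarrow> 'b::{banach, second_countable_topology}"
  assumes "adapted n Y"
  shows "integrable M Y"
proof -
  obtain F where F: "\<And>\<omega>. \<omega> \<in> space M \<Longrightarrow> Y \<omega> = F (hist n \<omega>)"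
    using assms by (rule adapted_hist) (rule that)
  obtain H where H: "finite H" "AE \<omega> in M. hist n \<omega> \<in> H" using finite_histories by blast
  show ?thesis
  proof (rule integrable_const_bound)
    show "AE \<omega> in M. norm (Y \<omega>) \<le> (\<Sum>l\<in>H. norm (F l))"
      using H(2) AE_space by eventually_elim (use F H(1) in \<open>auto intro!: member_le_sum\<close>)
  qed (rule adapted_borel_measurable[OF assms])
qed

lemma AE_in_S: "AE \<omega> in M. Z n \<omega> \<in> S"
proof -
  obtain H where H: "\<forall>l\<in>H. length l = Suc n \<and> (\<forall>k\<le>n. l ! k \<in> S)" "AE \<omega> in M. hist n \<omega> \<in> H"
    using finite_histories by blast
  show ?thesis
    using H(2) by eventually_elim (use H(1) hist_nth[of n n] in force)
qed

lemma markov_property_hist: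
  fixes F :: "'s list \<Rightarrow> 's \<Rightarrow> 'b::{banach, second_countable_topology}"
  shows "expectation (\<lambda>\<omega>. F (hist n \<omega>) (Z (Suc n) \<omega>)) =
    expectation (\<lambda>\<omega>. \<integral>t. F (hist n \<omega>) t \<partial>K (Z n \<omega>))"
proof -
  obtain H where H: "finite H" "\<And>l. l \<in> H \<Longrightarrow> length l = Suc n \<and> l ! n \<in> S" "AE \<omega> in M. hist n \<omega> \<in> H"
    using finite_histories[of n] by blast
  obtain H' where H': "finite H'" "AE \<omega> in M. hist (Suc n) \<omega> \<in> H'" using finite_histories by blast
  \<comment> \<open>Contains the states occurring at time \<open>n + 1\<close> and all the supports,
    so that both sides become sums over one finite index set.\<close>
  define T where "T = last ` H' \<union> (\<Union>l\<in>H. set_pmf (K (l ! n)))"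
  have T: "finite T" unfolding T_def using H H'(1) finite_kernel by auto
  have ZT: "AE \<omega> in M. Z (Suc n) \<omega> \<in> T"
    using H'(2) by eventually_elim (auto simp: T_def hist_Suc intro!: image_eqI[of _ last])
  let ?D = "\<lambda>l t. {\<omega> \<in> space M. hist n \<omega> = l \<and> Z (Suc n) \<omega> = t}"
  let ?C = "\<lambda>l. {\<omega> \<in> space M. hist n \<omega> = l}"
  have "expectation (\<lambda>\<omega>. F (hist n \<omega>) (Z (Suc n) \<omega>)) =
      expectation (\<lambda>\<omega>. \<Sum>l\<in>H. \<Sum>t\<in>T. indicator (?D l t) \<omega> *\<^sub>R F l t)"
  proof (rule integral_cong_AE)
    show "AE \<omega> in M. F (hist n \<omega>) (Z (Suc n) \<omega>) = (\<Sum>l\<in>H. \<Sum>t\<in>T. indicator (?D l t) \<omega> *\<^sub>R F l t)"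
      using H(3) ZT AE_space
    proof eventually_elim
      case (elim \<omega>)
      have "(\<Sum>l\<in>H. \<Sum>t\<in>T. indicator (?D l t) \<omega> *\<^sub>R F l t) =
          (\<Sum>l\<in>H. if l = hist n \<omega> then \<Sum>t\<in>T. if t = Z (Suc n) \<omega> then F l t else 0 else 0)"
        using elim by (intro sum.cong refl) (auto simp: indicator_def intro!: sum.cong sum.neutral)
      also have "\<dots> = F (hist n \<omega>) (Z (Suc n) \<omega>)"
        using elim H(1) T by simp
      finally show ?case by simp
    qed
  qed measurable
  also have "\<dots> = (\<Sum>l\<in>H. \<Sum>t\<in>T. measure M (?D l t) *\<^sub>R F l t)"
    by (subst Bochner_Integration.integral_sum, measurable)
       (auto intro!: sum.cong Bochner_Integration.integral_sum integrable_real_indicator emeasure_finite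
          simp: Int_absorb1 emeasure_eq_measure subset_eq)
  also have "\<dots> = (\<Sum>l\<in>H. measure M (?C l) *\<^sub>R (\<integral>t. F l t \<partial>K (l ! n)))"
  proof (intro sum.cong refl)
    fix l assume l: "l \<in> H"
    have "(\<integral>t. F l t \<partial>K (l ! n)) = (\<Sum>t\<in>T. pmf (K (l ! n)) t *\<^sub>R F l t)"
      using l T by (intro integral_measure_pmf) (auto simp: T_def)
    then show "(\<Sum>t\<in>T. measure M (?D l t) *\<^sub>R F l t) = measure M (?C l) *\<^sub>R (\<integral>t. F l t \<partial>K (l ! n))"
      using H(2)[OF l] by (simp add: hist_transition scaleR_sum_right)
  qed
  also have "\<dots> = expectation (\<lambda>\<omega>. \<Sum>l\<in>H. indicator (?C l) \<omega> *\<^sub>R (\<integral>t. F l t \<partial>K (l ! n)))"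
    by (subst Bochner_Integration.integral_sum)
       (auto intro!: sum.cong integrable_real_indicator simp: Int_absorb1 emeasure_eq_measure subset_eq)
  also have "\<dots> = expectation (\<lambda>\<omega>. \<integral>t. F (hist n \<omega>) t \<partial>K (Z n \<omega>))"
  proof (rule integral_cong_AE)
    show "AE \<omega> in M. (\<Sum>l\<in>H. indicator (?C l) \<omega> *\<^sub>R (\<integral>t. F l t \<partial>K (l ! n))) = (\<integral>t. F (hist n \<omega>) t \<partial>K (Z n \<omega>))"
      using H(3) AE_space
    proof eventually_elim
      case (elim \<omega>)
      have "(\<Sum>l\<in>H. indicator (?C l) \<omega> *\<^sub>R (\<integral>t. F l t \<partial>K (l ! n))) =
          (\<Sum>l\<in>H. if l = hist n \<omega> then \<integral>t. F l t \<partial>K (l ! n) else 0)"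
        using elim by (intro sum.cong refl) (auto simp: indicator_def)
      also have "\<dots> = (\<integral>t. F (hist n \<omega>) t \<partial>K (Z n \<omega>))"
        using elim H(1) by (simp add: hist_nth)
      finally show ?case .
    qed
    have "(\<lambda>\<omega>. (\<lambda>l. \<integral>t. F l t \<partial>K (l ! n)) (hist n \<omega>)) \<in> borel_measurable M" by measurable
    then show "(\<lambda>\<omega>. \<integral>t. F (hist n \<omega>) t \<partial>K (Z n \<omega>)) \<in> borel_measurable M"
      by (simp add: hist_nth)
  qed measurable
  finally show ?thesis .
qed

theorem markov_property:
  fixes Y :: "'a \<Rightarrow> 's \<Rightarrow> 'b::{banach, second_countable_topology}"
  assumes "\<And>t. adapted n (\<lambda>\<omega>. Y \<omega> t)"
  shows "expectation (\<lambda>\<omega>. Y \<omega> (Z (Suc n) \<omega>)) = expectation (\<lambda>\<omega>. \<integral>t. Y \<omega> t \<partial>K (Z n \<omega>))"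
proof -
  have "adapted n Y"
    unfolding adapted_def
  proof (intro ballI impI ext)
    fix \<omega> \<omega>' t assume "\<omega> \<in> space M" "\<omega>' \<in> space M" "\<forall>i\<le>n. Z i \<omega> = Z i \<omega>'"
    then show "Y \<omega> t = Y \<omega>' t" using assms[of t] unfolding adapted_def by blast
  qed
  then obtain F where F: "\<And>\<omega>. \<omega> \<in> space M \<Longrightarrow> Y \<omega> = F (hist n \<omega>)"
    by (rule adapted_hist) (rule that)
  have "expectation (\<lambda>\<omega>. Y \<omega> (Z (Suc n) \<omega>)) = expectation (\<lambda>\<omega>. F (hist n \<omega>) (Z (Suc n) \<omega>))"
    by (rule Bochner_Integration.integral_cong) (simp_all add: F)
  also have "\<dots> = expectation (\<lambda>\<omega>. \<integral>t. F (hist n \<omega>) t \<partial>K (Z n \<omega>))"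
    by (rule markov_property_hist)
  also have "\<dots> = expectation (\<lambda>\<omega>. \<integral>t. Y \<omega> t \<partial>K (Z n \<omega>))"
    by (rule Bochner_Integration.integral_cong) (simp_all add: F)
  finally show ?thesis .
qed

lemma moment_bound:
  assumes drift: "\<And>s. s \<in> S \<Longrightarrow> kernel_op K W s \<le> \<gamma> * W s + b"
    and W: "\<And>s. s \<in> S \<Longrightarrow> 0 \<le> W s" and \<gamma>: "0 \<le> \<gamma>" "\<gamma> < 1" and b: "0 \<le> b"
  shows "expectation (\<lambda>\<omega>. W (Z n \<omega>)) \<le> W z0 + b / (1 - \<gamma>)"
proof -
  have int: "integrable M (\<lambda>\<omega>. W (Z n \<omega>))" "integrable M (\<lambda>\<omega>. kernel_op K W (Z n \<omega>))" for n
    by (rule integrable_adapted[of n], rule adapted_fun_Z, simp)+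
  have "expectation (\<lambda>\<omega>. W (Z n \<omega>)) \<le> \<gamma> ^ n * W z0 + b / (1 - \<gamma>)"
  proof (induction n)
    case 0
    have "expectation (\<lambda>\<omega>. W (Z 0 \<omega>)) = expectation (\<lambda>\<omega>. W z0)"
      using start int[THEN borel_measurable_integrable] by (intro integral_cong_AE) auto
    then show ?case using \<gamma> b by (simp add: prob_space)
  next
    case (Suc n)
    have "expectation (\<lambda>\<omega>. W (Z (Suc n) \<omega>)) = expectation (\<lambda>\<omega>. kernel_op K W (Z n \<omega>))"
      using markov_property[of n "\<lambda>\<omega>. W"] by (simp add: adapted_const kernel_op_def)
    also have "\<dots> \<le> expectation (\<lambda>\<omega>. \<gamma> * W (Z n \<omega>) + b)"
      using AE_in_S[of n] by (intro integral_mono_AE) (auto simp: int elim!: eventually_mono intro: drift)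
    also have "\<dots> = \<gamma> * expectation (\<lambda>\<omega>. W (Z n \<omega>)) + b"
      using int by (simp add: prob_space)
    also have "\<dots> \<le> \<gamma> * (\<gamma> ^ n * W z0 + b / (1 - \<gamma>)) + b"
      using Suc \<gamma> by (intro add_right_mono mult_left_mono) auto
    also have "\<dots> = \<gamma> ^ Suc n * W z0 + b / (1 - \<gamma>)" using \<gamma> by (simp add: field_simps)
    finally show ?case .
  qed
  also have "\<dots> \<le> 1 * W z0 + b / (1 - \<gamma>)"
    using \<gamma> W start_in by (intro add_right_mono mult_right_mono power_le_one) auto
  finally show ?thesis by simp
qed

end

section \<open>Elementary inequalities for moments of order 3/2 and 3\<close>

lemma abs_sqrt_diff_le: "\<bar>sqrt x - sqrt y\<bar> \<le> 2 * sqrt \<bar>x - y\<bar>"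
proof -
  have same: "\<bar>sqrt x - sqrt y\<bar> \<le> sqrt \<bar>x - y\<bar>" if "0 \<le> x" "0 \<le> y" for x y :: real
  proof -
    have *: "sqrt a - sqrt b \<le> sqrt (a - b)" if "0 \<le> b" "b \<le> a" for a b :: real
      using sqrt_add_le_add_sqrt[of "a - b" b] that by simp
    show ?thesis
      using *[of x y] *[of y x] that by (cases "x \<le> y") (auto simp: abs_if)
  qed
  consider "0 \<le> x" "0 \<le> y" | "x \<le> 0" "y \<le> 0" | "0 \<le> x" "y \<le> 0" | "x \<le> 0" "0 \<le> y" by linarith
  then show ?thesis
  proof cases
    case 1
    then show ?thesis using same[of x y] real_sqrt_ge_zero[of "\<bar>x - y\<bar>"] by linarith
  next
    case 2
    then show ?thesis using same[of "-x" "-y"] real_sqrt_ge_zero[of "\<bar>x - y\<bar>"]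
      by (simp add: real_sqrt_minus abs_minus_commute)
  next
    case 3
    then have "sqrt x \<le> sqrt \<bar>x - y\<bar>" "- sqrt y \<le> sqrt \<bar>x - y\<bar>"
      by (auto simp: real_sqrt_minus[symmetric])
    moreover have "0 \<le> sqrt x" "sqrt y \<le> 0" using 3 by auto
    ultimately show ?thesis by linarith
  next
    case 4
    then have "- sqrt x \<le> sqrt \<bar>x - y\<bar>" "sqrt y \<le> sqrt \<bar>x - y\<bar>"
      by (auto simp: real_sqrt_minus[symmetric])
    moreover have "sqrt x \<le> 0" "0 \<le> sqrt y" using 4 by auto
    ultimately show ?thesis by linarith
  qed
qed

text \<open>Since \<open>sqrt\<close> is odd in Isabelle, this is \<open>\<bar>x\<bar>\<^sup>3\<^sup>/\<^sup>2\<close> for negative \<open>x\<close> as well.\<close>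

definition three_halves :: "real \<Rightarrow> real" where
  "three_halves x = x * sqrt x"

lemma three_halves_nonneg [simp]: "0 \<le> three_halves x"
  unfolding three_halves_def by (cases "0 \<le> x") (auto simp: mult_nonpos_nonpos)

lemma three_halves_abs [simp]: "three_halves \<bar>x\<bar> = three_halves x"
  unfolding three_halves_def by (cases "0 \<le> x") (auto simp: real_sqrt_minus)

lemma three_halves_mono: "\<bar>x\<bar> \<le> \<bar>y\<bar> \<Longrightarrow> three_halves x \<le> three_halves y"
  unfolding three_halves_abs[of x, symmetric] three_halves_abs[of y, symmetric]
  unfolding three_halves_def by (intro mult_mono) auto

lemma three_halves_mult: "three_halves (c * x) = three_halves c * three_halves x"
  by (simp add: three_halves_def real_sqrt_mult)

text \<open>The sum is at most twice the larger absolute value, and 2 to the power 3/2 is less than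
  3.\<close>

lemma three_halves_add_le: "three_halves (x + y) \<le> 3 * (three_halves x + three_halves y)"
proof -
  have "sqrt 2 \<le> 3 / 2" by (rule real_le_lsqrt) (simp_all add: power2_eq_square)
  then have 2: "three_halves 2 \<le> 3" by (simp add: three_halves_def)
  have "three_halves (x + y) \<le> three_halves (2 * max \<bar>x\<bar> \<bar>y\<bar>)"
    by (rule three_halves_mono) auto
  also have "\<dots> = three_halves 2 * three_halves (max \<bar>x\<bar> \<bar>y\<bar>)" by (rule three_halves_mult)
  also have "\<dots> \<le> 3 * three_halves (max \<bar>x\<bar> \<bar>y\<bar>)" using 2 by (intro mult_right_mono) auto
  also have "\<dots> \<le> 3 * (three_halves x + three_halves y)"
    by (auto simp: max_def)
  finally show ?thesis .
qed

lemma three_halves_deriv: "(three_halves has_field_derivative 3 / 2 * sqrt x) (at x)"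
proof (cases "x = 0")
  case True
  have "((\<lambda>y. sqrt y) \<longlongrightarrow> sqrt 0) (at 0)"
    by (intro tendsto_intros)
  moreover have "eventually (\<lambda>y. sqrt y = (three_halves y - three_halves 0) / (y - 0)) (at 0)"
    by (auto simp: eventually_at_filter three_halves_def)
  ultimately have "((\<lambda>y. (three_halves y - three_halves 0) / (y - 0)) \<longlongrightarrow> 0) (at 0)"
    by (simp add: Lim_transform_eventually)
  then show ?thesis using True by (simp add: has_field_derivative_iff)
next
  case False
  have "(sqrt has_field_derivative (if x > 0 then inverse (sqrt x) / 2 else - inverse (sqrt x) / 2)) (at x)"
    using False by (intro DERIV_real_sqrt_generic) auto
  then have "((\<lambda>y. y * sqrt y) has_field_derivative
      x * (if x > 0 then inverse (sqrt x) / 2 else - inverse (sqrt x) / 2) + 1 * sqrt x) (at x)"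
    by (intro DERIV_cong[OF DERIV_mult[OF DERIV_ident]]) (auto simp: mult.commute)
  moreover have "x * inverse (sqrt x) = (if x > 0 then sqrt x else - sqrt x)"
    using False real_sqrt_abs2[of "sqrt x"] by (auto simp: field_simps abs_if mult_less_0_iff)
  ultimately show ?thesis
    using False unfolding three_halves_def by (simp split: if_splits)
qed

text \<open>The derivative is 3/2 times a square root, hence Hoelder continuous of order 1/2, and
  the mean value theorem gives a remainder of order 3/2 in \<open>d\<close>. The linear term has
  mean zero when \<open>d\<close> is a martingale increment.\<close>

lemma three_halves_expansion:
  "three_halves (x + d) \<le> three_halves x + 3 / 2 * sqrt x * d + 3 * three_halves d"
proof -
  have "\<exists>\<xi>. \<bar>\<xi> - x\<bar> \<le> \<bar>d\<bar> \<and> three_halves (x + d) - three_halves x = d * (3 / 2 * sqrt \<xi>)"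
  proof -
    consider "d = 0" | "0 < d" | "d < 0" by linarith
    then show ?thesis
    proof cases
      case 2
      then obtain \<xi> where "x < \<xi>" "\<xi> < x + d" "three_halves (x + d) - three_halves x = (x + d - x) * (3 / 2 * sqrt \<xi>)"
        using MVT2[of x "x + d" three_halves "\<lambda>x. 3 / 2 * sqrt x"] three_halves_deriv by auto
      then show ?thesis by (intro exI[of _ \<xi>]) auto
    next
      case 3
      then obtain \<xi> where "x + d < \<xi>" "\<xi> < x" "three_halves x - three_halves (x + d) = (x - (x + d)) * (3 / 2 * sqrt \<xi>)"
        using MVT2[of "x + d" x three_halves "\<lambda>x. 3 / 2 * sqrt x"] three_halves_deriv by auto
      then show ?thesis by (intro exI[of _ \<xi>]) auto
    qed auto
  qed
  then obtain \<xi> where \<xi>: "\<bar>\<xi> - x\<bar> \<le> \<bar>d\<bar>" "three_halves (x + d) - three_halves x = d * (3 / 2 * sqrt \<xi>)"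
    by blast
  have "d * (sqrt \<xi> - sqrt x) \<le> \<bar>d\<bar> * \<bar>sqrt \<xi> - sqrt x\<bar>"
    by (simp add: abs_mult[symmetric])
  also have "\<dots> \<le> \<bar>d\<bar> * (2 * sqrt \<bar>d\<bar>)"
  proof (rule mult_left_mono)
    show "\<bar>sqrt \<xi> - sqrt x\<bar> \<le> 2 * sqrt \<bar>d\<bar>"
      using abs_sqrt_diff_le[of \<xi> x] real_sqrt_le_mono[OF \<xi>(1)] by linarith
  qed simp
  also have "\<dots> = 2 * three_halves d"
    using three_halves_abs[of d] by (simp add: three_halves_def)
  finally show ?thesis using \<xi>(2) by (simp add: algebra_simps)
qed

lemma abs_cube_expansion:
  "\<bar>x + d\<bar> ^ 3 \<le> \<bar>x\<bar> ^ 3 + 3 * (x * \<bar>x\<bar> * d) + 3 * (\<bar>x\<bar> * d\<^sup>2) + \<bar>d\<bar> ^ 3" for x d :: real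
proof -
  have pos: "\<bar>x + d\<bar> ^ 3 \<le> x ^ 3 + 3 * (x * x * d) + 3 * (x * d\<^sup>2) + \<bar>d\<bar> ^ 3" if "0 \<le> x" for x d :: real
  proof (cases "0 \<le> x + d")
    case True
    have "d ^ 3 \<le> \<bar>d\<bar> ^ 3" by (simp add: power_abs[symmetric])
    then show ?thesis using True by (simp add: power3_eq_cube power2_eq_square algebra_simps)
  next
    case False
    then have "d < 0" using that by simp
    \<comment> \<open>For \<open>x + d < 0\<close> the right side exceeds the left one by
      \<open>2 * x * (x\<^sup>2 + 3 * x * d + 3 * d\<^sup>2)\<close>; here the square is
      completed.\<close>
    have "0 \<le> 2 * x * ((x + 3 / 2 * d)\<^sup>2 + 3 / 4 * d\<^sup>2)" using that by (intro mult_nonneg_nonneg add_nonneg_nonneg) auto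
    then show ?thesis
      using False \<open>d < 0\<close> by (simp add: power3_eq_cube power2_eq_square algebra_simps)
  qed
  show ?thesis
  proof (cases "0 \<le> x")
    case True
    then show ?thesis using pos[of x d] by simp
  next
    case False
    then have "\<bar>x\<bar> = - x" "\<bar>- x + - d\<bar> = \<bar>x + d\<bar>" by linarith+
    then show ?thesis using False pos[of "-x" "-d"] by simp
  qed
qed

text \<open>The mixed term of the cubic expansion is split where |x| equals \<open>sqrt N\<close>
  times |d|. The relative cost \<open>1 / N\<close> stays bounded when it is compounded over
  \<open>N\<close> steps, and the factor \<open>sqrt N\<close> is what a bound of order N^(3/2)
  after \<open>N\<close> steps permits.\<close>

lemma abs_times_square_le:
  fixes x d N :: real
  assumes "0 < N"
  shows "\<bar>x\<bar> * d\<^sup>2 \<le> \<bar>x\<bar> ^ 3 / N + sqrt N * \<bar>d\<bar> ^ 3"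
proof (cases "\<bar>x\<bar> \<le> sqrt N * \<bar>d\<bar>")
  case True
  have "\<bar>x\<bar> * d\<^sup>2 \<le> (sqrt N * \<bar>d\<bar>) * \<bar>d\<bar>\<^sup>2" using True by (intro mult_mono) auto
  also have "\<dots> = sqrt N * \<bar>d\<bar> ^ 3" by (simp add: power3_eq_cube power2_eq_square)
  moreover have "0 \<le> \<bar>x\<bar> ^ 3 / N" using assms by simp
  ultimately show ?thesis by linarith
next
  case False
  then have "(sqrt N * \<bar>d\<bar>)\<^sup>2 \<le> \<bar>x\<bar>\<^sup>2" using assms by (intro power_mono) auto
  then have "d\<^sup>2 \<le> \<bar>x\<bar>\<^sup>2 / N" using assms by (simp add: power_mult_distrib field_simps)
  then have "\<bar>x\<bar> * d\<^sup>2 \<le> \<bar>x\<bar> * (\<bar>x\<bar>\<^sup>2 / N)" by (intro mult_left_mono) auto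
  also have "\<dots> = \<bar>x\<bar> ^ 3 / N" by (simp add: power3_eq_cube power2_eq_square)
  moreover have "0 \<le> sqrt N * \<bar>d\<bar> ^ 3" using assms by simp
  ultimately show ?thesis by linarith
qed

section \<open>Moments of martingales along the chain\<close>

context chain_process
begin

lemma markov_scaleR:
  fixes Y :: "'a \<Rightarrow> 'b::{banach, second_countable_topology}"
  assumes Y: "adapted n Y"
  shows "expectation (\<lambda>\<omega>. D (Z n \<omega>) (Z (Suc n) \<omega>) *\<^sub>R Y \<omega>) =
    expectation (\<lambda>\<omega>. kernel_op K (D (Z n \<omega>)) (Z n \<omega>) *\<^sub>R Y \<omega>)"
proof -
  have ad: "adapted n (\<lambda>\<omega>. D (Z n \<omega>) t *\<^sub>R Y \<omega>)" for t
    by (rule adapted_compose2[OF adapted_fun_Z[of n n "\<lambda>s. D s t"] Y]) simp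
  have "expectation (\<lambda>\<omega>. D (Z n \<omega>) (Z (Suc n) \<omega>) *\<^sub>R Y \<omega>) =
      expectation (\<lambda>\<omega>. \<integral>t. D (Z n \<omega>) t *\<^sub>R Y \<omega> \<partial>K (Z n \<omega>))"
    using markov_property[of n "\<lambda>\<omega> t. D (Z n \<omega>) t *\<^sub>R Y \<omega>", OF ad] by simp
  also have "\<dots> = expectation (\<lambda>\<omega>. kernel_op K (D (Z n \<omega>)) (Z n \<omega>) *\<^sub>R Y \<omega>)"
  proof (rule integral_cong_AE)
    have "adapted n (\<lambda>\<omega>. \<integral>t. D (Z n \<omega>) t *\<^sub>R Y \<omega> \<partial>K (Z n \<omega>))"
      by (rule adapted_compose2[OF adapted_Z[of n n] Y, of "\<lambda>s y. \<integral>t. D s t *\<^sub>R y \<partial>K s"]) simp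
    then show "(\<lambda>\<omega>. \<integral>t. D (Z n \<omega>) t *\<^sub>R Y \<omega> \<partial>K (Z n \<omega>)) \<in> borel_measurable M"
      by (rule adapted_borel_measurable)
    have "adapted n (\<lambda>\<omega>. kernel_op K (D (Z n \<omega>)) (Z n \<omega>) *\<^sub>R Y \<omega>)"
      by (rule adapted_compose2[OF adapted_Z[of n n] Y, of "\<lambda>s y. kernel_op K (D s) s *\<^sub>R y"]) simp
    then show "(\<lambda>\<omega>. kernel_op K (D (Z n \<omega>)) (Z n \<omega>) *\<^sub>R Y \<omega>) \<in> borel_measurable M"
      by (rule adapted_borel_measurable)
    show "AE \<omega> in M. (\<integral>t. D (Z n \<omega>) t *\<^sub>R Y \<omega> \<partial>K (Z n \<omega>)) = kernel_op K (D (Z n \<omega>)) (Z n \<omega>) *\<^sub>R Y \<omega>"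
      using AE_in_S[of n] by eventually_elim (simp add: kernel_op_def)
  qed
  finally show ?thesis .
qed

lemma martingale_orthogonal:
  fixes Y :: "'a \<Rightarrow> 'b::{banach, second_countable_topology}"
  assumes Y: "adapted n Y" and D: "\<And>s. s \<in> S \<Longrightarrow> kernel_op K (D s) s = 0"
  shows "expectation (\<lambda>\<omega>. D (Z n \<omega>) (Z (Suc n) \<omega>) *\<^sub>R Y \<omega>) = 0"
proof -
  have "expectation (\<lambda>\<omega>. D (Z n \<omega>) (Z (Suc n) \<omega>) *\<^sub>R Y \<omega>) =
      expectation (\<lambda>\<omega>. kernel_op K (D (Z n \<omega>)) (Z n \<omega>) *\<^sub>R Y \<omega>)"
    by (rule markov_scaleR[OF Y])
  also have "\<dots> = 0"
    using AE_in_S[of n] by (intro integral_eq_zero_AE) (auto elim!: eventually_mono simp: D)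
  finally show ?thesis .
qed

definition path_sum :: "('s \<Rightarrow> 's \<Rightarrow> real) \<Rightarrow> nat \<Rightarrow> nat \<Rightarrow> 'a \<Rightarrow> real" where
  "path_sum D k m \<omega> = (\<Sum>j<m. D (Z (k + j) \<omega>) (Z (Suc (k + j)) \<omega>))"

lemma path_sum_0 [simp]: "path_sum D k 0 \<omega> = 0"
  by (simp add: path_sum_def)

lemma path_sum_Suc:
  "path_sum D k (Suc m) \<omega> = path_sum D k m \<omega> + D (Z (k + m) \<omega>) (Z (Suc (k + m)) \<omega>)"
  by (simp add: path_sum_def)

lemma adapted_path_sum: "k + m \<le> n \<Longrightarrow> adapted n (path_sum D k m)"
  unfolding path_sum_def[abs_def] by (intro adapted_sum adapted_fun_Z2) auto

lemma integrable_path: "integrable M (\<lambda>\<omega>. (f (Z n \<omega>) (Z (Suc n) \<omega>) :: real))"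
  by (rule integrable_adapted[of "Suc n"], rule adapted_fun_Z2) auto

lemma integrable_path_sum: "integrable M (\<lambda>\<omega>. (f (path_sum D k m \<omega>) :: real))"
  by (rule integrable_adapted[of "k + m"], rule adapted_compose, rule adapted_path_sum) simp

lemma integrable_path_sum2:
  "integrable M (\<lambda>\<omega>. (f (path_sum D k m \<omega>) (D (Z (k + m) \<omega>) (Z (Suc (k + m)) \<omega>)) :: real))"
  by (rule integrable_adapted[of "Suc (k + m)"], rule adapted_compose2, rule adapted_path_sum, simp,
      rule adapted_fun_Z2) auto

text \<open>In the expansion around the previous value the linear term is an increment times an
  adapted variable and has mean zero, so each step adds at most \<open>3 * c\<close>.\<close>

lemma martingale_three_halves:
  assumes D: "\<And>s. s \<in> S \<Longrightarrow> kernel_op K (D s) s = 0"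
    and c: "\<And>i. expectation (\<lambda>\<omega>. three_halves (D (Z i \<omega>) (Z (Suc i) \<omega>))) \<le> c"
  shows "expectation (\<lambda>\<omega>. three_halves (path_sum D k m \<omega>)) \<le> 3 * real m * c"
proof (induction m)
  case (Suc m)
  let ?x = "path_sum D k m" and ?d = "\<lambda>\<omega>. D (Z (k + m) \<omega>) (Z (Suc (k + m)) \<omega>)"
  have "expectation (\<lambda>\<omega>. three_halves (path_sum D k (Suc m) \<omega>)) \<le>
      expectation (\<lambda>\<omega>. three_halves (?x \<omega>) + 3 / 2 * (?d \<omega> *\<^sub>R sqrt (?x \<omega>)) + 3 * three_halves (?d \<omega>))"
  proof (rule integral_mono)
    show "integrable M (\<lambda>\<omega>. three_halves (?x \<omega>) + 3 / 2 * (?d \<omega> *\<^sub>R sqrt (?x \<omega>)) + 3 * three_halves (?d \<omega>))"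
      by (rule integrable_path_sum2[of "\<lambda>x d. three_halves x + 3 / 2 * (d *\<^sub>R sqrt x) + 3 * three_halves d"])
    show "three_halves (path_sum D k (Suc m) \<omega>) \<le>
        three_halves (?x \<omega>) + 3 / 2 * (?d \<omega> *\<^sub>R sqrt (?x \<omega>)) + 3 * three_halves (?d \<omega>)" for \<omega>
      unfolding path_sum_Suc using three_halves_expansion[of "?x \<omega>" "?d \<omega>"] by (simp add: mult_ac)
  qed (rule integrable_path_sum)
  also have "\<dots> = expectation (\<lambda>\<omega>. three_halves (?x \<omega>)) + 3 / 2 * expectation (\<lambda>\<omega>. ?d \<omega> *\<^sub>R sqrt (?x \<omega>)) +
      3 * expectation (\<lambda>\<omega>. three_halves (?d \<omega>))"
    using integrable_path_sum[of three_halves D k m] integrable_path[of "\<lambda>s t. three_halves (D s t)" "k + m"]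
      integrable_path_sum2[of "\<lambda>x d. d *\<^sub>R sqrt x" D k m] by simp
  also have "expectation (\<lambda>\<omega>. ?d \<omega> *\<^sub>R sqrt (?x \<omega>)) = 0"
    by (intro martingale_orthogonal D adapted_compose[OF adapted_path_sum]) auto
  finally show ?case using Suc c[of "k + m"] by (simp add: algebra_simps)
qed (simp add: three_halves_def)

text \<open>A discrete Gronwall argument replaces the square function: each step multiplies the
  third moment by \<open>1 + 3 / N\<close> and adds \<open>e\<close>, which is of order
  \<open>sqrt N\<close>.\<close>

lemma martingale_cube:
  assumes D: "\<And>s. s \<in> S \<Longrightarrow> kernel_op K (D s) s = 0"
    and c: "\<And>i. expectation (\<lambda>\<omega>. \<bar>D (Z i \<omega>) (Z (Suc i) \<omega>)\<bar> ^ 3) \<le> c"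
  shows "expectation (\<lambda>\<omega>. \<bar>path_sum D k m \<omega>\<bar> ^ 3) \<le> 4 * exp 3 * c * real m * sqrt (real m)"
proof (cases "m = 0")
  case False
  define N where "N = real m"
  have N: "1 \<le> N" using False by (simp add: N_def)
  then have sN: "1 \<le> sqrt N" by simp
  have c0: "0 \<le> c"
    by (rule order_trans[OF integral_nonneg_AE c[of 0]]) simp
  define e where "e = (3 * sqrt N + 1) * c"
  have e0: "0 \<le> e" using c0 sN by (simp add: e_def)
  \<comment> \<open>\<open>N\<close> remains the full length \<open>m\<close> while \<open>j\<close>
    runs; otherwise the factors would not compound to at most \<open>exp 3\<close>.\<close>
  have "expectation (\<lambda>\<omega>. \<bar>path_sum D k j \<omega>\<bar> ^ 3) \<le> (1 + 3 / N) ^ j * (real j * e)" for j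
  proof (induction j)
    case (Suc j)
    let ?x = "path_sum D k j" and ?d = "\<lambda>\<omega>. D (Z (k + j) \<omega>) (Z (Suc (k + j)) \<omega>)"
    have "expectation (\<lambda>\<omega>. \<bar>path_sum D k (Suc j) \<omega>\<bar> ^ 3) \<le>
        expectation (\<lambda>\<omega>. (1 + 3 / N) * \<bar>?x \<omega>\<bar> ^ 3 + 3 * (?d \<omega> *\<^sub>R (?x \<omega> * \<bar>?x \<omega>\<bar>)) + (3 * sqrt N + 1) * \<bar>?d \<omega>\<bar> ^ 3)"
    proof (rule integral_mono)
      show "integrable M (\<lambda>\<omega>. (1 + 3 / N) * \<bar>?x \<omega>\<bar> ^ 3 + 3 * (?d \<omega> *\<^sub>R (?x \<omega> * \<bar>?x \<omega>\<bar>)) + (3 * sqrt N + 1) * \<bar>?d \<omega>\<bar> ^ 3)"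
        by (rule integrable_path_sum2[of "\<lambda>x d. (1 + 3 / N) * \<bar>x\<bar> ^ 3 + 3 * (d *\<^sub>R (x * \<bar>x\<bar>)) + (3 * sqrt N + 1) * \<bar>d\<bar> ^ 3"])
      show "\<bar>path_sum D k (Suc j) \<omega>\<bar> ^ 3 \<le>
          (1 + 3 / N) * \<bar>?x \<omega>\<bar> ^ 3 + 3 * (?d \<omega> *\<^sub>R (?x \<omega> * \<bar>?x \<omega>\<bar>)) + (3 * sqrt N + 1) * \<bar>?d \<omega>\<bar> ^ 3" for \<omega>
        using abs_cube_expansion[of "?x \<omega>" "?d \<omega>"] abs_times_square_le[of N "?x \<omega>" "?d \<omega>"] N
        unfolding path_sum_Suc by (simp add: algebra_simps)
    qed (rule integrable_path_sum)
    also have "\<dots> = (1 + 3 / N) * expectation (\<lambda>\<omega>. \<bar>?x \<omega>\<bar> ^ 3) + 3 * expectation (\<lambda>\<omega>. ?d \<omega> *\<^sub>R (?x \<omega> * \<bar>?x \<omega>\<bar>)) +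
        (3 * sqrt N + 1) * expectation (\<lambda>\<omega>. \<bar>?d \<omega>\<bar> ^ 3)"
      using integrable_path_sum[of "\<lambda>x. \<bar>x\<bar> ^ 3" D k j] integrable_path[of "\<lambda>s t. \<bar>D s t\<bar> ^ 3" "k + j"]
        integrable_path_sum2[of "\<lambda>x d. d *\<^sub>R (x * \<bar>x\<bar>)" D k j] by simp
    also have "expectation (\<lambda>\<omega>. ?d \<omega> *\<^sub>R (?x \<omega> * \<bar>?x \<omega>\<bar>)) = 0"
      by (intro martingale_orthogonal D adapted_compose[OF adapted_path_sum, of _ _ _ "\<lambda>x. x * \<bar>x\<bar>"]) auto
    also have "(1 + 3 / N) * expectation (\<lambda>\<omega>. \<bar>?x \<omega>\<bar> ^ 3) + 3 * 0 + (3 * sqrt N + 1) * expectation (\<lambda>\<omega>. \<bar>?d \<omega>\<bar> ^ 3) \<le>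
        (1 + 3 / N) * ((1 + 3 / N) ^ j * (real j * e)) + 3 * 0 + e"
      unfolding e_def using Suc c[of "k + j"] N sN
      by (intro add_mono mult_left_mono) (auto simp: e_def)
    also have "\<dots> \<le> (1 + 3 / N) ^ Suc j * (real j * e) + (1 + 3 / N) ^ Suc j * e"
      using N e0 mult_right_mono[OF one_le_power[of "1 + 3 / N" "Suc j"], of e] by (simp add: mult_ac)
    also have "\<dots> = (1 + 3 / N) ^ Suc j * (real (Suc j) * e)"
      by (simp only: of_nat_Suc distrib_right distrib_left mult_1 add.commute)
    finally show ?case .
  qed (use e0 in simp)
  then have "expectation (\<lambda>\<omega>. \<bar>path_sum D k m \<omega>\<bar> ^ 3) \<le> (1 + 3 / N) ^ m * (N * e)"
    unfolding N_def .
  also have "\<dots> \<le> exp 3 * (N * (4 * sqrt N * c))"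
  proof (intro mult_mono)
    have "(1 + 3 / N) ^ m \<le> exp (3 / N) ^ m"
      using N by (intro power_mono exp_ge_add_one_self) auto
    also have "\<dots> = exp 3" using False by (simp add: exp_of_nat_mult[symmetric] N_def)
    finally show "(1 + 3 / N) ^ m \<le> exp 3" .
    show "e \<le> 4 * sqrt N * c" unfolding e_def using sN c0 by (intro mult_right_mono) auto
  qed (use N e0 in auto)
  finally show ?thesis by (simp add: N_def mult_ac)
qed simp

end

section \<open>The law of large numbers\<close>

text \<open>The ratio of consecutive fourth powers tends to 1, so a monotone sequence is squeezed
  between its values at the fourth powers around \<open>n\<close>.\<close>

lemma average_of_fourth_powers:
  fixes T :: "nat \<Rightarrow> real"
  assumes mono: "incseq T" and pos: "\<And>n. 0 \<le> T n"
    and sub: "(\<lambda>k. T (k ^ 4) / real (k ^ 4)) \<longlonglongrightarrow> c"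
  shows "(\<lambda>n. T n / real n) \<longlonglongrightarrow> c"
proof -
  have "\<exists>k. k ^ 4 \<le> n \<and> n < Suc k ^ 4" for n :: nat
  proof -
    define k where "k = (LEAST k. n < Suc k ^ 4)"
    have "n < Suc n ^ 4" using self_le_power[of "Suc n" 4] by simp
    then have k: "n < Suc k ^ 4" unfolding k_def by (rule LeastI)
    moreover have "k ^ 4 \<le> n"
    proof (cases k)
      case (Suc m)
      then have "\<not> n < Suc m ^ 4" using not_less_Least[of m "\<lambda>k. n < Suc k ^ 4"] by (simp add: k_def)
      then show ?thesis using Suc by simp
    qed simp
    ultimately show ?thesis by blast
  qed
  then obtain k :: "nat \<Rightarrow> nat" where k: "\<And>n. k n ^ 4 \<le> n" "\<And>n. n < Suc (k n) ^ 4" by metis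
  have lim: "filterlim k at_top sequentially"
  proof (subst filterlim_at_top, intro allI)
    fix N
    show "\<forall>\<^sub>F n in sequentially. N \<le> k n"
    proof (rule eventually_sequentiallyI)
      fix n assume "N ^ 4 \<le> n"
      then have "N ^ 4 < Suc (k n) ^ 4" using k(2)[of n] by linarith
      then show "N \<le> k n" using power_less_imp_less_base[of N 4 "Suc (k n)"] by simp
    qed
  qed
  define lo where "lo j = T (j ^ 4) / real (j ^ 4) * (real j / real (Suc j)) ^ 4" for j
  define up where "up j = T (Suc j ^ 4) / real (Suc j ^ 4) * (real (Suc j) / real j) ^ 4" for j
  have "lo \<longlonglongrightarrow> c * 1 ^ 4"
    unfolding lo_def by (intro tendsto_intros sub LIMSEQ_n_over_Suc_n)
  then have lo: "(\<lambda>n. lo (k n)) \<longlonglongrightarrow> c" using lim by (simp add: filterlim_compose)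
  have "up \<longlonglongrightarrow> c * 1 ^ 4"
    unfolding up_def by (intro tendsto_intros LIMSEQ_Suc[OF sub] LIMSEQ_Suc_n_over_n)
  then have up: "(\<lambda>n. up (k n)) \<longlonglongrightarrow> c" using lim by (simp add: filterlim_compose)
  have ev: "\<forall>\<^sub>F n in sequentially. 1 \<le> k n" using lim by (auto simp: filterlim_at_top)
  show ?thesis
  proof (rule tendsto_sandwich[OF _ _ lo up])
    show "\<forall>\<^sub>F n in sequentially. lo (k n) \<le> T n / real n"
      using ev
    proof eventually_elim
      case (elim n)
      then have n: "0 < real (k n ^ 4)" "0 < real n" using k(1)[of n] by (auto intro: Suc_leI order_less_le_trans[of 0 "k n ^ 4" n])
      have "lo (k n) = T (k n ^ 4) / real (Suc (k n) ^ 4)"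
        using elim by (simp add: lo_def power_divide)
      also have "\<dots> \<le> T n / real n"
        using k[of n] n pos incseqD[OF mono k(1)[of n]] by (intro frac_le) (auto simp del: of_nat_power of_nat_Suc)
      finally show ?case .
    qed
    show "\<forall>\<^sub>F n in sequentially. T n / real n \<le> up (k n)"
      using ev
    proof eventually_elim
      case (elim n)
      then have n: "0 < real (k n ^ 4)" by auto
      have "T n / real n \<le> T (Suc (k n) ^ 4) / real (k n ^ 4)"
        using k[of n] n pos incseqD[OF mono, of n "Suc (k n) ^ 4"] by (intro frac_le) (auto simp del: of_nat_power of_nat_Suc)
      also have "\<dots> = up (k n)"
        by (simp add: up_def power_divide del: of_nat_Suc)
      finally show ?case .
    qed
  qed
qed

context chain_process
begin

lemma AE_all_in_S: "AE \<omega> in M. \<forall>n. Z n \<omega> \<in> S"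
  using AE_in_S by (simp add: AE_all_countable)

text \<open>The moment of order 3/2 of the centred sum grows linearly, so that of the average is of
  order n^(-1/2), which is summable along n = k^4 but not along all n. Between the fourth powers
  monotonicity takes over, and this is why \<open>F\<close> is nonnegative.\<close>

lemma law_of_large_numbers_nonneg:
  fixes w :: "'s \<Rightarrow> real"
  assumes poisson: "\<And>s. s \<in> S \<Longrightarrow> g s - kernel_op K g s = F s - c"
    and F: "\<And>s. s \<in> S \<Longrightarrow> 0 \<le> F s"
    and g: "\<And>s. s \<in> S \<Longrightarrow> \<bar>g s\<bar> \<le> C * w s ^ 2" "\<And>s. s \<in> S \<Longrightarrow> \<bar>kernel_op K g s\<bar> \<le> C * w s ^ 2"
    and w: "\<And>s. s \<in> S \<Longrightarrow> 0 \<le> w s" and B: "\<And>n. expectation (\<lambda>\<omega>. w (Z n \<omega>) ^ 3) \<le> B"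
  shows "AE \<omega> in M. (\<lambda>n. (\<Sum>k<n. F (Z k \<omega>)) / real n) \<longlonglongrightarrow> c"
proof -
  define E where "E = three_halves C * B"
  have bound: "three_halves y \<le> three_halves C * w s ^ 3" if "s \<in> S" "\<bar>y\<bar> \<le> C * w s ^ 2" for y s
  proof -
    have "three_halves y \<le> three_halves (C * w s ^ 2)" using that(2) by (intro three_halves_mono) auto
    also have "\<dots> = three_halves C * w s ^ 3"
      using w[OF that(1)] by (simp add: three_halves_mult) (simp add: three_halves_def power2_eq_square power3_eq_cube)
    finally show ?thesis .
  qed
  have E: "expectation (\<lambda>\<omega>. three_halves (u (Z n \<omega>))) \<le> E"
    if "\<And>s. s \<in> S \<Longrightarrow> \<bar>u s\<bar> \<le> C * w s ^ 2" for u n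
  proof -
    have "expectation (\<lambda>\<omega>. three_halves (u (Z n \<omega>))) \<le> expectation (\<lambda>\<omega>. three_halves C * w (Z n \<omega>) ^ 3)"
      using AE_in_S[of n]
      by (intro integral_mono_AE integrable_path[of "\<lambda>s t. three_halves (u s)"] integrable_path[of "\<lambda>s t. three_halves C * w s ^ 3"])
         (auto elim!: eventually_mono intro: bound that)
    also have "\<dots> \<le> E" unfolding E_def using B[of n] by (simp add: mult_left_mono)
    finally show ?thesis .
  qed
  have E0: "0 \<le> E" by (rule order_trans[OF integral_nonneg_AE E[of "\<lambda>s. 0" 0]]) (auto intro!: order_trans[OF abs_ge_zero g(1)])
  define D where "D s t = g t - kernel_op K g s" for s t
  have D0: "kernel_op K (D s) s = 0" if "s \<in> S" for s
    unfolding D_def using that kernel_op_linear(2)[OF that, of g "\<lambda>t. kernel_op K g s"] kernel_op_linear(4)[OF that] by simp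
  have DE: "expectation (\<lambda>\<omega>. three_halves (D (Z i \<omega>) (Z (Suc i) \<omega>))) \<le> 6 * E" for i
  proof -
    have "expectation (\<lambda>\<omega>. three_halves (D (Z i \<omega>) (Z (Suc i) \<omega>))) \<le>
        expectation (\<lambda>\<omega>. 3 * (three_halves (g (Z (Suc i) \<omega>)) + three_halves (kernel_op K g (Z i \<omega>))))"
      using three_halves_add_le[of "g (Z (Suc i) _)" "- kernel_op K g (Z i _)"] three_halves_abs[of "- kernel_op K g (Z i _)"]
      by (intro integral_mono integrable_path[of "\<lambda>s t. three_halves (D s t)"]
          integrable_path[of "\<lambda>s t. 3 * (three_halves (g t) + three_halves (kernel_op K g s))"]) (simp add: D_def)
    also have "\<dots> = 3 * (expectation (\<lambda>\<omega>. three_halves (g (Z (Suc i) \<omega>))) + expectation (\<lambda>\<omega>. three_halves (kernel_op K g (Z i \<omega>))))"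
      using integrable_path[of "\<lambda>s t. three_halves (g s)" "Suc i"] integrable_path[of "\<lambda>s t. three_halves (kernel_op K g s)" i] by simp
    also have "\<dots> \<le> 3 * (E + E)" by (intro mult_left_mono add_mono E g) auto
    finally show ?thesis by simp
  qed
  define T where "T n \<omega> = (\<Sum>k<n. F (Z k \<omega>))" for n \<omega>
  define X where "X n \<omega> = T n \<omega> - real n * c" for n \<omega>
  have X: "AE \<omega> in M. X n \<omega> = path_sum D 0 n \<omega> + (g (Z 0 \<omega>) - g (Z n \<omega>))" for n
    using AE_all_in_S
  proof eventually_elim
    case (elim \<omega>)
    have "X n \<omega> = (\<Sum>k<n. F (Z k \<omega>) - c)" by (simp add: X_def T_def sum_subtractf)
    also have "\<dots> = (\<Sum>k<n. D (Z k \<omega>) (Z (Suc k) \<omega>) - (g (Z (Suc k) \<omega>) - g (Z k \<omega>)))"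
      using poisson elim by (intro sum.cong) (auto simp: D_def algebra_simps)
    also have "\<dots> = path_sum D 0 n \<omega> - (g (Z n \<omega>) - g (Z 0 \<omega>))"
      by (subst sum_subtractf) (simp add: path_sum_def sum_lessThan_telescope[of "\<lambda>k. g (Z k \<omega>)"])
    finally show ?case by simp
  qed
  have X_int: "integrable M (\<lambda>\<omega>. f (X n \<omega>))" for f :: "real \<Rightarrow> real" and n
  proof (rule integrable_adapted[of n])
    have "adapted n (\<lambda>\<omega>. \<Sum>k<n. F (Z k \<omega>))" by (intro adapted_sum adapted_fun_Z) auto
    then show "adapted n (\<lambda>\<omega>. f (X n \<omega>))"
      unfolding X_def T_def by (rule adapted_compose)
  qed
  have XE: "expectation (\<lambda>\<omega>. three_halves (X n \<omega>)) \<le> 72 * E * real n" if "1 \<le> n" for n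
  proof -
    have "expectation (\<lambda>\<omega>. three_halves (X n \<omega>)) \<le> expectation (\<lambda>\<omega>. 3 * three_halves (path_sum D 0 n \<omega>) +
        (9 * three_halves (g (Z 0 \<omega>)) + 9 * three_halves (g (Z n \<omega>))))"
    proof (rule integral_mono_AE)
      show "AE \<omega> in M. three_halves (X n \<omega>) \<le> 3 * three_halves (path_sum D 0 n \<omega>) +
          (9 * three_halves (g (Z 0 \<omega>)) + 9 * three_halves (g (Z n \<omega>)))"
        using X[of n]
      proof eventually_elim
        case (elim \<omega>)
        show ?case unfolding elim
          using three_halves_add_le[of "path_sum D 0 n \<omega>" "g (Z 0 \<omega>) - g (Z n \<omega>)"]
            three_halves_add_le[of "g (Z 0 \<omega>)" "- g (Z n \<omega>)"] three_halves_abs[of "- g (Z n \<omega>)"] by simp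
      qed
      show "integrable M (\<lambda>\<omega>. 3 * three_halves (path_sum D 0 n \<omega>) +
          (9 * three_halves (g (Z 0 \<omega>)) + 9 * three_halves (g (Z n \<omega>))))"
        using integrable_path[of "\<lambda>s t. three_halves (g s)" 0] integrable_path[of "\<lambda>s t. three_halves (g s)" n]
          integrable_path_sum[of three_halves D 0 n] by simp
    qed (rule X_int)
    also have "\<dots> = 3 * expectation (\<lambda>\<omega>. three_halves (path_sum D 0 n \<omega>)) +
        (9 * expectation (\<lambda>\<omega>. three_halves (g (Z 0 \<omega>))) + 9 * expectation (\<lambda>\<omega>. three_halves (g (Z n \<omega>))))"
      using integrable_path[of "\<lambda>s t. three_halves (g s)" 0] integrable_path[of "\<lambda>s t. three_halves (g s)" n]
          integrable_path_sum[of three_halves D 0 n] by simp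
    also have "\<dots> \<le> 3 * (3 * real n * (6 * E)) + (9 * E + 9 * E)"
      by (intro add_mono mult_left_mono E g martingale_three_halves D0 DE) auto
    \<comment> \<open>54 comes from the martingale and 18 from the two boundary terms, which are
      absorbed by \<open>1 \<le> n\<close>.\<close>
    also have "\<dots> \<le> 72 * E * real n"
      using that E0 mult_left_mono[of 1 "real n" E] by (simp add: algebra_simps)
    finally show ?thesis .
  qed
  define Y where "Y k \<omega> = three_halves (X (Suc k ^ 4) \<omega> / real (Suc k ^ 4))" for k \<omega>
  have Y_meas [measurable]: "Y k \<in> borel_measurable M" for k
    unfolding Y_def using X_int[of "\<lambda>x. three_halves (x / real (Suc k ^ 4))" "Suc k ^ 4"] by (rule borel_measurable_integrable)
  have YE: "(\<integral>\<^sup>+\<omega>. ennreal (Y k \<omega>) \<partial>M) \<le> ennreal (72 * E * inverse (real (Suc k) ^ 2))" for k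
  proof -
    let ?m = "Suc k ^ 4"
    have th: "three_halves (1 / real ?m) = inverse (real (Suc k) ^ 6)"
    proof -
      have "sqrt (real (Suc k) ^ 4) = real (Suc k) ^ 2"
        by (rule real_sqrt_unique) (auto simp flip: power_mult simp del: of_nat_Suc)
      then show ?thesis
        by (simp add: three_halves_def real_sqrt_divide field_simps flip: power_add del: of_nat_Suc)
    qed
    have "(\<integral>\<^sup>+\<omega>. ennreal (Y k \<omega>) \<partial>M) = ennreal (expectation (Y k))"
      unfolding Y_def using X_int[of "\<lambda>x. three_halves (x / real ?m)" ?m] by (intro nn_integral_eq_integral) auto
    also have "expectation (Y k) = three_halves (1 / real ?m) * expectation (\<lambda>\<omega>. three_halves (X ?m \<omega>))"
      unfolding Y_def using three_halves_mult[of "1 / real ?m" "X ?m _"] by simp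
    also have "\<dots> \<le> three_halves (1 / real ?m) * (72 * E * real ?m)"
      by (intro mult_left_mono XE) auto
    also have "\<dots> = 72 * E * inverse (real (Suc k) ^ 2)"
      unfolding th by (simp add: field_simps flip: power_add del: of_nat_Suc)
    finally show ?thesis by (simp add: ennreal_leI)
  qed
  have sum2: "summable (\<lambda>k. 72 * E * inverse (real (Suc k) ^ 2))"
    using inverse_power_summable[of 2, where ?'a = real] summable_Suc_iff[of "\<lambda>k. inverse (real k ^ 2)"]
    by (intro summable_mult) auto
  have "(\<integral>\<^sup>+\<omega>. (\<Sum>k. ennreal (Y k \<omega>)) \<partial>M) = (\<Sum>k. \<integral>\<^sup>+\<omega>. ennreal (Y k \<omega>) \<partial>M)"
    by (rule nn_integral_suminf) measurable
  also have "\<dots> \<le> (\<Sum>k. ennreal (72 * E * inverse (real (Suc k) ^ 2)))"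
    by (intro suminf_le YE) auto
  also have "\<dots> = ennreal (\<Sum>k. 72 * E * inverse (real (Suc k) ^ 2))"
    using E0 sum2 by (intro suminf_ennreal2) auto
  finally have "(\<integral>\<^sup>+\<omega>. (\<Sum>k. ennreal (Y k \<omega>)) \<partial>M) \<noteq> \<infinity>" by (auto simp: top_unique)
  then have "AE \<omega> in M. (\<Sum>k. ennreal (Y k \<omega>)) \<noteq> \<infinity>"
    by (intro nn_integral_PInf_AE) auto
  then show ?thesis using AE_all_in_S
  proof eventually_elim
    case (elim \<omega>)
    have "summable (\<lambda>k. Y k \<omega>)"
      using elim(1) by (intro summable_suminf_not_top) (auto simp: Y_def)
    then have "(\<lambda>k. Y k \<omega>) \<longlonglongrightarrow> 0" by (rule summable_LIMSEQ_zero)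
    \<comment> \<open>The square of \<open>three_halves x\<close> is the cube of |x|; this recovers
      the absolute value of the average.\<close>
    then have "(\<lambda>k. root 3 ((Y k \<omega>)\<^sup>2)) \<longlonglongrightarrow> root 3 (0\<^sup>2)" by (intro tendsto_intros)
    moreover have "root 3 ((Y k \<omega>)\<^sup>2) = \<bar>X (Suc k ^ 4) \<omega> / real (Suc k ^ 4)\<bar>" for k
    proof -
      have "(three_halves x)\<^sup>2 = \<bar>x\<bar> ^ 3" for x
      proof -
        have "(three_halves x)\<^sup>2 = (three_halves \<bar>x\<bar>)\<^sup>2" by simp
        also have "\<dots> = \<bar>x\<bar> ^ 3" unfolding three_halves_def power_mult_distrib by (simp add: power3_eq_cube power2_eq_square)
        finally show ?thesis .
      qed
      then show ?thesis unfolding Y_def by (simp add: real_root_power_cancel)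
    qed
    ultimately have "(\<lambda>k. \<bar>X (Suc k ^ 4) \<omega> / real (Suc k ^ 4)\<bar>) \<longlonglongrightarrow> 0"
      by (simp del: of_nat_power of_nat_Suc)
    then have "(\<lambda>k. X (Suc k ^ 4) \<omega> / real (Suc k ^ 4)) \<longlonglongrightarrow> 0"
      by (rule tendsto_rabs_zero_cancel)
    then have "(\<lambda>k. X (Suc k ^ 4) \<omega> / real (Suc k ^ 4) + c) \<longlonglongrightarrow> 0 + c" by (intro tendsto_intros)
    then have "(\<lambda>k. T (Suc k ^ 4) \<omega> / real (Suc k ^ 4)) \<longlonglongrightarrow> c"
      by (simp add: X_def diff_divide_distrib del: of_nat_Suc)
    then have "(\<lambda>k. T (k ^ 4) \<omega> / real (k ^ 4)) \<longlonglongrightarrow> c" by (rule LIMSEQ_imp_Suc)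
    then show ?case unfolding T_def
      using F elim(2) by (intro average_of_fourth_powers) (auto intro!: incseq_SucI sum_nonneg)
  qed
qed

end

section \<open>Characteristic functions of additive functionals\<close>

lemma exp_minus_bounds:
  fixes x :: real
  assumes "0 \<le> x"
  shows "1 - exp (- x) \<le> x" "\<bar>1 - x - exp (- x)\<bar> \<le> x\<^sup>2 / 2"
proof -
  show 1: "1 - exp (- x) \<le> x" using exp_ge_add_one_self[of "- x"] by simp
  have "1 - 0 + 0\<^sup>2 / 2 - exp (- 0) \<le> 1 - x + x\<^sup>2 / 2 - exp (- x)"
  proof (rule DERIV_nonneg_imp_nondecreasing[OF assms])
    fix y :: real
    have "((\<lambda>x. 1 - x + x\<^sup>2 / 2 - exp (- x)) has_real_derivative - 1 + y + exp (- y)) (at y)"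
      by (auto intro!: derivative_eq_intros simp: power2_eq_square)
    moreover have "0 \<le> - 1 + y + exp (- y)" using exp_ge_add_one_self[of "- y"] by simp
    ultimately show "\<exists>d. ((\<lambda>x. 1 - x + x\<^sup>2 / 2 - exp (- x)) has_real_derivative d) (at y) \<and> 0 \<le> d" by blast
  qed
  then show "\<bar>1 - x - exp (- x)\<bar> \<le> x\<^sup>2 / 2" using 1 by simp
qed

lemma norm_iexp_diff_le: "cmod (iexp x - iexp y) \<le> \<bar>x - y\<bar>"
proof -
  have "iexp x - iexp y = iexp y * (iexp (x - y) - 1)"
    by (simp add: exp_diff ring_distribs right_diff_distrib)
  then have "cmod (iexp x - iexp y) = cmod (iexp (x - y) - 1)"
    by (simp add: norm_mult)
  also have "\<dots> \<le> \<bar>x - y\<bar>" using iexp_approx1[of "x - y" 0] by simp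
  finally show ?thesis .
qed

lemma norm_iexp_second_order:
  "cmod (iexp x - (1 + \<i> * complex_of_real x - complex_of_real (x\<^sup>2 / 2))) \<le> \<bar>x\<bar> ^ 3 / 6"
proof -
  have "(\<Sum>k\<le>2. (\<i> * complex_of_real x) ^ k / fact k) = 1 + \<i> * complex_of_real x - complex_of_real (x\<^sup>2 / 2)"
    by (simp add: numeral_2_eq_2 power_mult_distrib)
  then show ?thesis using iexp_approx1[of x 2] by (simp add: numeral_3_eq_3 fact_numeral)
qed

lemma abs_add_cube_le: "\<bar>x + y\<bar> ^ 3 \<le> 4 * (\<bar>x\<bar> ^ 3 + \<bar>y\<bar> ^ 3)" for x y :: real
proof -
  have "(a + b) ^ 3 \<le> 4 * (a ^ 3 + b ^ 3)" if "0 \<le> a" "0 \<le> b" for a b :: real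
  proof -
    have "0 \<le> 3 * (a + b) * (a - b)\<^sup>2" using that by simp
    then show ?thesis by (simp add: power3_eq_cube power2_eq_square algebra_simps)
  qed
  then have "(\<bar>x\<bar> + \<bar>y\<bar>) ^ 3 \<le> 4 * (\<bar>x\<bar> ^ 3 + \<bar>y\<bar> ^ 3)" by simp
  moreover have "\<bar>x + y\<bar> ^ 3 \<le> (\<bar>x\<bar> + \<bar>y\<bar>) ^ 3" by (intro power_mono) auto
  ultimately show ?thesis by linarith
qed

lemma norm_integral_le:
  fixes Y :: "'a \<Rightarrow> 'b::{banach, second_countable_topology}"
  assumes "integrable M u" "AE \<omega> in M. norm (Y \<omega>) \<le> u \<omega>"
  shows "norm (integral\<^sup>L M Y) \<le> integral\<^sup>L M u"
proof -
  have "norm (integral\<^sup>L M Y) \<le> (\<integral>\<omega>. norm (Y \<omega>) \<partial>M)" by (rule integral_norm_bound)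
  also have "\<dots> \<le> integral\<^sup>L M u"
    using assms by (intro integral_mono_AE') (auto elim!: eventually_mono intro: order_trans[OF norm_ge_zero])
  finally show ?thesis .
qed

context chain_process
begin

lemma adapted_char:
  "adapted k G \<Longrightarrow> k + j \<le> n \<Longrightarrow> adapted n (\<lambda>\<omega>. G \<omega> * iexp (\<theta> * path_sum D k j \<omega>))"
  by (rule adapted_compose2[of n G "path_sum D k j" "\<lambda>g x. g * iexp (\<theta> * x)"])
     (auto intro: adapted_mono adapted_path_sum)

lemma integrable_scaleR_adapted:
  fixes Y :: "'a \<Rightarrow> complex"
  assumes "adapted n Y"
  shows "integrable M (\<lambda>\<omega>. f (Z n \<omega>) (Z (Suc n) \<omega>) *\<^sub>R Y \<omega>)"
  by (rule integrable_adapted[of "Suc n"], rule adapted_compose2, rule adapted_fun_Z2, simp, simp,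
      rule adapted_mono[OF assms]) simp

text \<open>
  The increments of the martingale have a non-constant conditional variance; subtracting the term
  with the corrector \<open>q\<close>, the solution of the Poisson equation of the variance, makes the
  characteristic functions geometric up to an error of order \<open>\<bar>\<theta>\<bar>\<^sup>3\<close> per step.
\<close>

lemma martingale_char:
  fixes G :: "'a \<Rightarrow> complex"
  assumes G: "adapted k G" "\<And>\<omega>. cmod (G \<omega>) \<le> 1"
    and D: "\<And>s. s \<in> S \<Longrightarrow> kernel_op K (D s) s = 0"
    and q: "\<And>s. s \<in> S \<Longrightarrow> q s - kernel_op K q s = kernel_op K (\<lambda>t. (D s t)\<^sup>2) s - \<sigma>2"
    and \<sigma>2: "0 \<le> \<sigma>2" "\<sigma>2 \<le> c"
    and cube: "\<And>i. expectation (\<lambda>\<omega>. \<bar>D (Z i \<omega>) (Z (Suc i) \<omega>)\<bar> ^ 3) \<le> c"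
    and qc: "\<And>i. expectation (\<lambda>\<omega>. \<bar>q (Z i \<omega>)\<bar>) \<le> c"
    and Dq: "\<And>i. expectation (\<lambda>\<omega>. \<bar>D (Z i \<omega>) (Z (Suc i) \<omega>)\<bar> * \<bar>q (Z (Suc i) \<omega>)\<bar>) \<le> c"
    and \<theta>: "\<bar>\<theta>\<bar> \<le> 1"
  shows "cmod (expectation (\<lambda>\<omega>. G \<omega> * iexp (\<theta> * path_sum D k m \<omega>)) -
      of_real (exp (- (\<sigma>2 * \<theta>\<^sup>2 / 2)) ^ m) * expectation G) \<le> c * \<theta>\<^sup>2 + real m * \<bar>\<theta>\<bar> ^ 3 * (c + c\<^sup>2)"
proof -
  define E where "E j \<omega> = G \<omega> * iexp (\<theta> * path_sum D k j \<omega>)" for j \<omega>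
  have adE: "adapted n (E j)" if "k + j \<le> n" for n j
    unfolding E_def[abs_def] using G(1) that by (rule adapted_char)
  have intE: "integrable M (E j)" for j by (rule integrable_adapted[OF adE[OF order_refl]])
  have normE: "cmod (E j \<omega>) \<le> 1" for j \<omega> using G(2)[of \<omega>] by (simp add: E_def norm_mult)
  define A where "A j = expectation (E j)" for j
  define B where "B j = expectation (\<lambda>\<omega>. q (Z (k + j) \<omega>) *\<^sub>R E j \<omega>)" for j
  define d where "d j \<omega> = D (Z (k + j) \<omega>) (Z (Suc (k + j)) \<omega>)" for j \<omega>
  have c0: "0 \<le> c" using \<sigma>2 by simp
  have intd: "integrable M (\<lambda>\<omega>. f (d j \<omega>) *\<^sub>R E j \<omega>)" for f :: "real \<Rightarrow> real" and j
    unfolding d_def by (rule integrable_scaleR_adapted[of "k + j" _ "\<lambda>s t. f (D s t)"]) (rule adE, simp)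
  have intq: "integrable M (\<lambda>\<omega>. q (Z (k + j) \<omega>) *\<^sub>R E j \<omega>)"
    "integrable M (\<lambda>\<omega>. q (Z (Suc (k + j)) \<omega>) *\<^sub>R E j \<omega>)" for j
    using integrable_scaleR_adapted[OF adE, of j "k + j" "\<lambda>s t. q s"]
      integrable_scaleR_adapted[OF adE, of j "k + j" "\<lambda>s t. q t"] by simp_all
  have A1: "cmod (A j) \<le> 1" for j
    unfolding A_def using norm_integral_le[of M "\<lambda>_. 1" "E j"] normE by (simp add: prob_space)
  have Bc: "cmod (B j) \<le> c" for j
  proof -
    have "cmod (B j) \<le> expectation (\<lambda>\<omega>. \<bar>q (Z (k + j) \<omega>)\<bar>)"
      unfolding B_def using normE mult_left_mono[OF normE, of "\<bar>q (Z (k + j) _)\<bar>"]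
      by (intro norm_integral_le integrable_path[of "\<lambda>s t. \<bar>q s\<bar>"]) simp
    also have "\<dots> \<le> c" by (rule qc)
    finally show ?thesis .
  qed
  have E_Suc: "E (Suc j) \<omega> = E j \<omega> * iexp (\<theta> * d j \<omega>)" for j \<omega>
    by (simp add: E_def path_sum_Suc d_def distrib_left exp_add)
  define V where "V j = expectation (\<lambda>\<omega>. (d j \<omega>)\<^sup>2 *\<^sub>R E j \<omega>)" for j
  define Q where "Q j = expectation (\<lambda>\<omega>. q (Z (Suc (k + j)) \<omega>) *\<^sub>R E j \<omega>)" for j
  \<comment> \<open>The remainder of the second-order expansion of \<open>iexp\<close>; the linear
    term is missing because it has mean zero.\<close>
  define r1 where "r1 j = A (Suc j) - A j + of_real (\<theta>\<^sup>2 / 2) * V j" for j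
  \<comment> \<open>Compares the corrector at time \<open>j + 1\<close> under the weights
    \<open>E (Suc j)\<close> and \<open>E j\<close>. One factor \<theta> is gained, so that the
    corrector terms telescope up to order |\<theta>|^3.\<close>
  define r2 where "r2 j = B (Suc j) - Q j" for j
  have r1: "cmod (r1 j) \<le> \<bar>\<theta>\<bar> ^ 3 * c / 6" for j
  proof -
    have "r1 j = expectation (\<lambda>\<omega>. E (Suc j) \<omega> - E j \<omega> - (\<i> * of_real \<theta>) * (d j \<omega> *\<^sub>R E j \<omega>) + of_real (\<theta>\<^sup>2 / 2) * ((d j \<omega>)\<^sup>2 *\<^sub>R E j \<omega>))"
    proof -
      have lin: "expectation (\<lambda>\<omega>. E (Suc j) \<omega> - E j \<omega> - a * u \<omega> + b * v \<omega>) = A (Suc j) - A j - a * expectation u + b * expectation v"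
        if "integrable M u" "integrable M v" for u v :: "'a \<Rightarrow> complex" and a b
        using that intE[of j] intE[of "Suc j"] by (simp add: A_def)
      have "expectation (\<lambda>\<omega>. d j \<omega> *\<^sub>R E j \<omega>) = 0"
        unfolding d_def by (rule martingale_orthogonal[OF adE D]) auto
      then show ?thesis
        unfolding lin[OF intd[of "\<lambda>x. x" j] intd[of "\<lambda>x. x\<^sup>2" j]] by (simp add: r1_def V_def)
    qed
    also have "cmod \<dots> \<le> expectation (\<lambda>\<omega>. \<bar>\<theta>\<bar> ^ 3 / 6 * \<bar>d j \<omega>\<bar> ^ 3)"
    proof (rule norm_integral_le)
      show "integrable M (\<lambda>\<omega>. \<bar>\<theta>\<bar> ^ 3 / 6 * \<bar>d j \<omega>\<bar> ^ 3)"
        unfolding d_def by (rule integrable_path[of "\<lambda>s t. \<bar>\<theta>\<bar> ^ 3 / 6 * \<bar>D s t\<bar> ^ 3"])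
      have "cmod (E (Suc j) \<omega> - E j \<omega> - (\<i> * of_real \<theta>) * (d j \<omega> *\<^sub>R E j \<omega>) + of_real (\<theta>\<^sup>2 / 2) * ((d j \<omega>)\<^sup>2 *\<^sub>R E j \<omega>))
          \<le> \<bar>\<theta>\<bar> ^ 3 / 6 * \<bar>d j \<omega>\<bar> ^ 3" for \<omega>
      proof -
        let ?x = "\<theta> * d j \<omega>"
        have "E (Suc j) \<omega> - E j \<omega> - (\<i> * of_real \<theta>) * (d j \<omega> *\<^sub>R E j \<omega>) + of_real (\<theta>\<^sup>2 / 2) * ((d j \<omega>)\<^sup>2 *\<^sub>R E j \<omega>)
            = E j \<omega> * (iexp ?x - (1 + \<i> * complex_of_real ?x - complex_of_real (?x\<^sup>2 / 2)))"
          unfolding E_Suc by (simp add: scaleR_conv_of_real power_mult_distrib algebra_simps)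
        also have "cmod \<dots> \<le> 1 * (\<bar>?x\<bar> ^ 3 / 6)"
          unfolding norm_mult by (intro mult_mono normE norm_iexp_second_order) auto
        finally show ?thesis by (simp add: abs_mult power_mult_distrib)
      qed
      then show "AE \<omega> in M. cmod (E (Suc j) \<omega> - E j \<omega> - (\<i> * of_real \<theta>) * (d j \<omega> *\<^sub>R E j \<omega>) + of_real (\<theta>\<^sup>2 / 2) * ((d j \<omega>)\<^sup>2 *\<^sub>R E j \<omega>))
          \<le> \<bar>\<theta>\<bar> ^ 3 / 6 * \<bar>d j \<omega>\<bar> ^ 3" by simp
    qed
    also have "\<dots> = \<bar>\<theta>\<bar> ^ 3 / 6 * expectation (\<lambda>\<omega>. \<bar>d j \<omega>\<bar> ^ 3)" by simp
    also have "\<dots> \<le> \<bar>\<theta>\<bar> ^ 3 / 6 * c" unfolding d_def using cube[of "k + j"] by (intro mult_left_mono) auto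
    finally show ?thesis by simp
  qed
  have r2: "cmod (r2 j) \<le> \<bar>\<theta>\<bar> * c" for j
  proof -
    have "r2 j = expectation (\<lambda>\<omega>. q (Z (Suc (k + j)) \<omega>) *\<^sub>R (E (Suc j) \<omega> - E j \<omega>))"
      using intq(1)[of "Suc j"] intq(2)[of j] by (simp add: r2_def B_def Q_def scaleR_diff_right)
    also have "cmod \<dots> \<le> expectation (\<lambda>\<omega>. \<bar>\<theta>\<bar> * (\<bar>D (Z (k + j) \<omega>) (Z (Suc (k + j)) \<omega>)\<bar> * \<bar>q (Z (Suc (k + j)) \<omega>)\<bar>))"
    proof (rule norm_integral_le)
      have diff: "cmod (E (Suc j) \<omega> - E j \<omega>) \<le> \<bar>\<theta>\<bar> * \<bar>d j \<omega>\<bar>" for \<omega>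
      proof -
        have "E (Suc j) \<omega> - E j \<omega> = E j \<omega> * (iexp (\<theta> * d j \<omega>) - iexp 0)" by (simp add: E_Suc algebra_simps)
        also have "cmod \<dots> \<le> 1 * \<bar>\<theta> * d j \<omega>\<bar>"
          unfolding norm_mult
          by (intro mult_mono normE norm_iexp_diff_le[of "\<theta> * d j \<omega>" 0, unfolded diff_zero]) auto
        finally show ?thesis by (simp add: abs_mult)
      qed
      show "AE \<omega> in M. cmod (q (Z (Suc (k + j)) \<omega>) *\<^sub>R (E (Suc j) \<omega> - E j \<omega>)) \<le>
          \<bar>\<theta>\<bar> * (\<bar>D (Z (k + j) \<omega>) (Z (Suc (k + j)) \<omega>)\<bar> * \<bar>q (Z (Suc (k + j)) \<omega>)\<bar>)"
      proof (rule AE_I2)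
        fix \<omega>
        show "cmod (q (Z (Suc (k + j)) \<omega>) *\<^sub>R (E (Suc j) \<omega> - E j \<omega>)) \<le>
            \<bar>\<theta>\<bar> * (\<bar>D (Z (k + j) \<omega>) (Z (Suc (k + j)) \<omega>)\<bar> * \<bar>q (Z (Suc (k + j)) \<omega>)\<bar>)"
          using mult_left_mono[OF diff[of \<omega>], of "\<bar>q (Z (Suc (k + j)) \<omega>)\<bar>"] by (simp add: d_def mult_ac)
      qed
    qed (rule integrable_path[of "\<lambda>s t. \<bar>\<theta>\<bar> * (\<bar>D s t\<bar> * \<bar>q t\<bar>)"])
    also have "\<dots> \<le> \<bar>\<theta>\<bar> * c" using Dq[of "k + j"] by (simp add: mult_left_mono)
    finally show ?thesis .
  qed
  have V: "V j = of_real \<sigma>2 * A j + B j - Q j" for j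
  proof -
    have "V j = expectation (\<lambda>\<omega>. kernel_op K (\<lambda>t. (D (Z (k + j) \<omega>) t)\<^sup>2) (Z (k + j) \<omega>) *\<^sub>R E j \<omega>)"
      unfolding V_def d_def by (rule markov_scaleR[of "k + j" "E j" "\<lambda>s t. (D s t)\<^sup>2"]) (rule adE, simp)
    also have "\<dots> = expectation (\<lambda>\<omega>. \<sigma>2 *\<^sub>R E j \<omega> + q (Z (k + j) \<omega>) *\<^sub>R E j \<omega> - kernel_op K q (Z (k + j) \<omega>) *\<^sub>R E j \<omega>)"
    proof (rule integral_cong_AE)
      show "AE \<omega> in M. kernel_op K (\<lambda>t. (D (Z (k + j) \<omega>) t)\<^sup>2) (Z (k + j) \<omega>) *\<^sub>R E j \<omega> =
          \<sigma>2 *\<^sub>R E j \<omega> + q (Z (k + j) \<omega>) *\<^sub>R E j \<omega> - kernel_op K q (Z (k + j) \<omega>) *\<^sub>R E j \<omega>"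
        using AE_in_S[of "k + j"]
      proof eventually_elim
        case (elim \<omega>)
        have "kernel_op K (\<lambda>t. (D (Z (k + j) \<omega>) t)\<^sup>2) (Z (k + j) \<omega>) = \<sigma>2 + q (Z (k + j) \<omega>) - kernel_op K q (Z (k + j) \<omega>)"
          using q[OF elim] by simp
        then show ?case by (simp add: scaleR_left_distrib scaleR_left_diff_distrib)
      qed
      show "(\<lambda>\<omega>. kernel_op K (\<lambda>t. (D (Z (k + j) \<omega>) t)\<^sup>2) (Z (k + j) \<omega>) *\<^sub>R E j \<omega>) \<in> borel_measurable M"
        using integrable_scaleR_adapted[OF adE, of j "k + j" "\<lambda>s _. kernel_op K (\<lambda>t. (D s t)\<^sup>2) s"] by simp
      show "(\<lambda>\<omega>. \<sigma>2 *\<^sub>R E j \<omega> + q (Z (k + j) \<omega>) *\<^sub>R E j \<omega> - kernel_op K q (Z (k + j) \<omega>) *\<^sub>R E j \<omega>) \<in> borel_measurable M"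
        using integrable_scaleR_adapted[OF adE, of j "k + j" "\<lambda>s _. kernel_op K q s"] intq(1)[of j] intE[of j] by simp
    qed
    also have "\<dots> = of_real \<sigma>2 * A j + B j - expectation (\<lambda>\<omega>. kernel_op K q (Z (k + j) \<omega>) *\<^sub>R E j \<omega>)"
      using integrable_scaleR_adapted[OF adE, of j "k + j" "\<lambda>s _. kernel_op K q s"] intq(1)[of j] intE[of j]
      by (simp add: A_def B_def scaleR_conv_of_real)
    also have "expectation (\<lambda>\<omega>. kernel_op K q (Z (k + j) \<omega>) *\<^sub>R E j \<omega>) = Q j"
      unfolding Q_def by (rule markov_scaleR[of "k + j" "E j" "\<lambda>s t. q t", symmetric]) (rule adE, simp)
    finally show ?thesis .
  qed
  define x where "x = \<sigma>2 * \<theta>\<^sup>2 / 2"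
  define \<rho> where "\<rho> = exp (- x)"
  have x0: "0 \<le> x" and xc: "x \<le> c * \<theta>\<^sup>2 / 2" using \<sigma>2 by (auto simp: x_def mult_right_mono)
  have \<rho>: "0 \<le> \<rho>" "\<rho> \<le> 1" using x0 by (auto simp: \<rho>_def)
  have t4: "\<theta> ^ 4 \<le> \<bar>\<theta>\<bar> ^ 3"
    using power_decreasing[of 3 4 "\<bar>\<theta>\<bar>"] \<theta> by (simp add: power_even_abs)
  \<comment> \<open>Poisson's equation turns the conditional variance into \<open>\<sigma>2\<close>
    plus a difference of correctors. Moving that difference to the left side leaves a recursion with
    the constant ratio \<open>\<rho>\<close>.\<close>
  define A' where "A' j = A j - of_real (\<theta>\<^sup>2 / 2) * B j" for j
  have step: "cmod (A' (Suc j) - of_real \<rho> * A' j) \<le> \<bar>\<theta>\<bar> ^ 3 * (c + c\<^sup>2)" for j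
  proof -
    let ?h = "complex_of_real (\<theta>\<^sup>2 / 2)"
    have algebra: "(a - h * (s * a + b - e) + r) - h * b' - p * (a - h * b) =
        (1 - y - p) * a - (h * (1 - p)) * b + (r - h * (b' - e))"
      if "h * s = y" for a b e r h s b' p y :: complex
      unfolding that[symmetric] by (simp add: algebra_simps)
    have ASuc: "A (Suc j) = A j - ?h * V j + r1 j" by (simp add: r1_def)
    have "?h * of_real \<sigma>2 = complex_of_real x" by (simp add: x_def)
    then have "A' (Suc j) - of_real \<rho> * A' j =
        of_real (1 - x - \<rho>) * A j - (?h * of_real (1 - \<rho>)) * B j + (r1 j - ?h * r2 j)"
      unfolding A'_def ASuc V r2_def of_real_diff of_real_1 by (rule algebra)
    also have "cmod \<dots> \<le> cmod (of_real (1 - x - \<rho>) * A j) + cmod ((?h * of_real (1 - \<rho>)) * B j) + (cmod (r1 j) + cmod (?h * r2 j))"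
      by (intro norm_triangle_le add_mono norm_triangle_le_diff norm_triangle_ineq4 order_refl)
    also have "\<dots> \<le> \<bar>\<theta>\<bar> ^ 3 * c\<^sup>2 / 8 + \<bar>\<theta>\<bar> ^ 3 * c\<^sup>2 / 4 + (\<bar>\<theta>\<bar> ^ 3 * c / 6 + \<bar>\<theta>\<bar> ^ 3 * c / 2)"
    proof (intro add_mono)
      have "cmod (of_real (1 - x - \<rho>) * A j) \<le> x\<^sup>2 / 2 * 1"
        unfolding norm_mult norm_of_real \<rho>_def using exp_minus_bounds(2)[OF x0] A1 by (intro mult_mono) auto
      also have "\<dots> \<le> (c * \<theta>\<^sup>2 / 2)\<^sup>2 / 2 * 1" using x0 xc by (intro mult_right_mono divide_right_mono power_mono) auto
      also have "\<dots> = \<theta> ^ 4 * c\<^sup>2 / 8" by (simp add: power2_eq_square power4_eq_xxxx)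
      also have "\<dots> \<le> \<bar>\<theta>\<bar> ^ 3 * c\<^sup>2 / 8" using t4 by (intro divide_right_mono mult_right_mono) auto
      finally show "cmod (of_real (1 - x - \<rho>) * A j) \<le> \<bar>\<theta>\<bar> ^ 3 * c\<^sup>2 / 8" .
      have "cmod ((?h * of_real (1 - \<rho>)) * B j) = (\<theta>\<^sup>2 / 2 * (1 - \<rho>)) * cmod (B j)"
        unfolding norm_mult norm_of_real using \<rho> by simp
      also have "\<dots> \<le> (\<theta>\<^sup>2 / 2 * (c * \<theta>\<^sup>2 / 2)) * c"
        using order_trans[OF exp_minus_bounds(1)[OF x0] xc] Bc \<rho> c0 by (intro mult_mono) (auto simp: \<rho>_def)
      also have "\<dots> = \<theta> ^ 4 * c\<^sup>2 / 4" by (simp add: power2_eq_square power4_eq_xxxx)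
      also have "\<dots> \<le> \<bar>\<theta>\<bar> ^ 3 * c\<^sup>2 / 4" using t4 by (intro divide_right_mono mult_right_mono) auto
      finally show "cmod ((?h * of_real (1 - \<rho>)) * B j) \<le> \<bar>\<theta>\<bar> ^ 3 * c\<^sup>2 / 4" .
      show "cmod (r1 j) \<le> \<bar>\<theta>\<bar> ^ 3 * c / 6" by (rule r1)
      have "cmod (?h * r2 j) \<le> \<theta>\<^sup>2 / 2 * (\<bar>\<theta>\<bar> * c)"
        unfolding norm_mult norm_of_real using r2[of j] by (intro mult_mono) auto
      also have "\<dots> = \<bar>\<theta>\<bar> ^ 3 * c / 2"
        by (simp add: power3_eq_cube power2_eq_square)
      finally show "cmod (?h * r2 j) \<le> \<bar>\<theta>\<bar> ^ 3 * c / 2" .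
    qed
    also have "\<dots> = \<bar>\<theta>\<bar> ^ 3 * (2 / 3 * c + 3 / 8 * c\<^sup>2)" by (simp add: algebra_simps)
    also have "\<dots> \<le> \<bar>\<theta>\<bar> ^ 3 * (c + c\<^sup>2)" using c0 by (intro mult_left_mono add_mono) auto
    finally show ?thesis .
  qed
  have iter: "cmod (A' m - of_real (\<rho> ^ m) * A' 0) \<le> real m * (\<bar>\<theta>\<bar> ^ 3 * (c + c\<^sup>2))" for m
  proof (induction m)
    case (Suc m)
    have "A' (Suc m) - of_real (\<rho> ^ Suc m) * A' 0 =
        (A' (Suc m) - of_real \<rho> * A' m) + of_real \<rho> * (A' m - of_real (\<rho> ^ m) * A' 0)"
      by (simp add: algebra_simps)
    also have "cmod \<dots> \<le> \<bar>\<theta>\<bar> ^ 3 * (c + c\<^sup>2) + 1 * (real m * (\<bar>\<theta>\<bar> ^ 3 * (c + c\<^sup>2)))"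
    proof (intro norm_triangle_mono step)
      show "cmod (of_real \<rho> * (A' m - of_real (\<rho> ^ m) * A' 0)) \<le> 1 * (real m * (\<bar>\<theta>\<bar> ^ 3 * (c + c\<^sup>2)))"
        unfolding norm_mult[of "of_real \<rho>"] norm_of_real using \<rho> Suc.IH by (intro mult_mono) auto
    qed
    finally show ?case by (simp add: algebra_simps)
  qed simp
  \<comment> \<open>Undoing the correction at both ends costs \<open>\<theta>\<^sup>2 / 2\<close>
    times at most \<open>2 * c\<close>, independently of \<open>m\<close>.\<close>
  have "A m - of_real (\<rho> ^ m) * A 0 =
      (A' m - of_real (\<rho> ^ m) * A' 0) + of_real (\<theta>\<^sup>2 / 2) * (B m - of_real (\<rho> ^ m) * B 0)"
  proof -
    have "a - r * a0 = ((a - h * b) - r * (a0 - h * b0)) + h * (b - r * b0)" for a a0 b b0 h r :: complex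
      by (simp add: algebra_simps)
    then show ?thesis unfolding A'_def .
  qed
  also have "cmod \<dots> \<le> real m * (\<bar>\<theta>\<bar> ^ 3 * (c + c\<^sup>2)) + \<theta>\<^sup>2 / 2 * (c + 1 * c)"
  proof (intro norm_triangle_mono iter)
    have "cmod (B m - of_real (\<rho> ^ m) * B 0) \<le> c + 1 * c"
      by (rule order_trans[OF norm_triangle_ineq4], unfold norm_mult norm_of_real, intro add_mono mult_mono Bc)
         (use \<rho> in \<open>auto simp: power_le_one\<close>)
    then show "cmod (of_real (\<theta>\<^sup>2 / 2) * (B m - of_real (\<rho> ^ m) * B 0)) \<le> \<theta>\<^sup>2 / 2 * (c + 1 * c)"
      unfolding norm_mult norm_of_real by (intro mult_mono) auto
  qed
  also have "\<dots> = c * \<theta>\<^sup>2 + real m * \<bar>\<theta>\<bar> ^ 3 * (c + c\<^sup>2)" by (simp add: algebra_simps)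
  finally show ?thesis
    by (simp add: A_def E_def[abs_def] \<rho>_def x_def)
qed

text \<open>
  Both estimates come from \<open>\<Sum>j<m. F (Z (k + j)) = path_sum D k m + g (Z k) - g (Z (k + m))\<close> with
  the martingale increments \<open>D s t = g t - kernel_op K g s\<close>.
\<close>

lemma clt_estimates:
  fixes w :: "'s \<Rightarrow> real"
  assumes poisson: "\<And>s. s \<in> S \<Longrightarrow> g s - kernel_op K g s = F s"
    and g: "\<And>s. s \<in> S \<Longrightarrow> \<bar>g s\<bar> \<le> C * w s" "\<And>s. s \<in> S \<Longrightarrow> \<bar>kernel_op K g s\<bar> \<le> C * w s"
    and q: "\<And>s. s \<in> S \<Longrightarrow> q s - kernel_op K q s = kernel_op K (\<lambda>t. (g t - kernel_op K g s)\<^sup>2) s - \<sigma>2"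
    and qC: "\<And>s. s \<in> S \<Longrightarrow> \<bar>q s\<bar> \<le> C * w s ^ 2"
    and w: "\<And>s. s \<in> S \<Longrightarrow> 1 \<le> w s" and B: "\<And>n. expectation (\<lambda>\<omega>. w (Z n \<omega>) ^ 3) \<le> B"
    and \<sigma>2: "0 \<le> \<sigma>2"
  obtains L where "0 \<le> L"
    "\<And>k m. expectation (\<lambda>\<omega>. \<bar>\<Sum>j<m. F (Z (k + j) \<omega>)\<bar> ^ 3) \<le> L * real m * sqrt (real m)"
    "\<And>k m \<theta> G. adapted k G \<Longrightarrow> (\<And>\<omega>. cmod (G \<omega>) \<le> 1) \<Longrightarrow> \<bar>\<theta>\<bar> \<le> 1 \<Longrightarrow>
      cmod (expectation (\<lambda>\<omega>. G \<omega> * iexp (\<theta> * (\<Sum>j<m. F (Z (k + j) \<omega>)))) -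
        of_real (exp (- (\<sigma>2 * \<theta>\<^sup>2 / 2)) ^ m) * expectation G) \<le> L * (\<bar>\<theta>\<bar> + real m * \<bar>\<theta>\<bar> ^ 3)"
proof -
  have C0: "0 \<le> C"
    using g(1)[OF start_in] w[OF start_in] abs_ge_zero[of "g z0"] by (smt (verit) mult_neg_pos)
  have w3: "w s ^ 2 \<le> w s ^ 3" "w s \<le> w s ^ 3" "0 \<le> w s" if "s \<in> S" for s
    using w[OF that] power_increasing[of 2 3 "w s"] power_increasing[of 1 3 "w s"] by auto
  \<comment> \<open>The increments involve two consecutive states; this separates them, so that
    third moments of \<open>w\<close> at single times suffice.\<close>
  have mix: "w s * (w t)\<^sup>2 \<le> w s ^ 3 + w t ^ 3" if "s \<in> S" "t \<in> S" for s t
  proof (cases "w s \<le> w t")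
    case True
    have "w s * (w t)\<^sup>2 \<le> w t * (w t)\<^sup>2" using True by (intro mult_right_mono) auto
    then show ?thesis using w3[OF that(1)] by (simp add: power3_eq_cube power2_eq_square)
  next
    case False
    have "w s * (w t)\<^sup>2 \<le> w s * (w s)\<^sup>2" using False w3[OF that(1)] w3[OF that(2)] by (intro mult_left_mono power_mono) auto
    then show ?thesis using w3[OF that(2)] by (simp add: power3_eq_cube power2_eq_square)
  qed
  have bound1: "expectation (\<lambda>\<omega>. u (Z n \<omega>)) \<le> a * B" if "\<And>s. s \<in> S \<Longrightarrow> u s \<le> a * w s ^ 3" "0 \<le> a" for u a n
  proof -
    have "expectation (\<lambda>\<omega>. u (Z n \<omega>)) \<le> expectation (\<lambda>\<omega>. a * w (Z n \<omega>) ^ 3)"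
      using AE_in_S[of n]
      by (intro integral_mono_AE integrable_path[of "\<lambda>s t. u s"] integrable_path[of "\<lambda>s t. a * w s ^ 3"])
         (auto elim!: eventually_mono intro: that)
    also have "\<dots> \<le> a * B" using B[of n] that(2) by (simp add: mult_left_mono)
    finally show ?thesis .
  qed
  have bound2: "expectation (\<lambda>\<omega>. u (Z n \<omega>) (Z (Suc n) \<omega>)) \<le> 2 * a * B"
    if u: "\<And>s t. s \<in> S \<Longrightarrow> t \<in> S \<Longrightarrow> u s t \<le> a * (w s ^ 3 + w t ^ 3)" and a: "0 \<le> a" for u a n
  proof -
    have "expectation (\<lambda>\<omega>. u (Z n \<omega>) (Z (Suc n) \<omega>)) \<le> expectation (\<lambda>\<omega>. a * w (Z n \<omega>) ^ 3 + a * w (Z (Suc n) \<omega>) ^ 3)"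
    proof (intro integral_mono_AE integrable_path[of u] integrable_path[of "\<lambda>s t. a * w s ^ 3 + a * w t ^ 3"])
      show "AE \<omega> in M. u (Z n \<omega>) (Z (Suc n) \<omega>) \<le> a * w (Z n \<omega>) ^ 3 + a * w (Z (Suc n) \<omega>) ^ 3"
        using AE_in_S[of n] AE_in_S[of "Suc n"]
      proof eventually_elim
        case (elim \<omega>)
        then show ?case using u by (simp add: distrib_left)
      qed
    qed
    also have "\<dots> = expectation (\<lambda>\<omega>. a * w (Z n \<omega>) ^ 3) + expectation (\<lambda>\<omega>. a * w (Z (Suc n) \<omega>) ^ 3)"
      by (intro Bochner_Integration.integral_add integrable_path[of "\<lambda>s t. a * w s ^ 3"] integrable_path[of "\<lambda>s t. a * w t ^ 3"])
    also have "\<dots> \<le> a * B + a * B"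
      by (intro add_mono bound1 a) auto
    finally show ?thesis by (simp add: mult_ac)
  qed
  have B0: "0 \<le> B"
    using bound1[of "\<lambda>_. 0" 1 0] w3(3) by (auto intro!: zero_le_power)
  define D where "D s t = g t - kernel_op K g s" for s t
  have D0: "kernel_op K (D s) s = 0" if "s \<in> S" for s
    unfolding D_def using that kernel_op_linear(2)[OF that, of g "\<lambda>t. kernel_op K g s"] kernel_op_linear(4)[OF that] by simp
  have DC: "\<bar>D s t\<bar> \<le> C * (w s + w t)" if "s \<in> S" "t \<in> S" for s t
    unfolding D_def using g(1)[OF that(2)] g(2)[OF that(1)] by (simp add: distrib_left)
  \<comment> \<open>One constant for \<open>martingale_char\<close>: the summands bound in turn the
    cubes of the increments, the corrector, the product of increment and corrector, and the
    variance.\<close>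
  define c where "c = 8 * C ^ 3 * B + C * B + 4 * C\<^sup>2 * B + \<sigma>2"
  have c_parts: "8 * C ^ 3 * B \<le> c" "C * B \<le> c" "4 * C\<^sup>2 * B \<le> c" "\<sigma>2 \<le> c" and c0: "0 \<le> c"
    using C0 B0 \<sigma>2 unfolding c_def by auto
  have cube: "expectation (\<lambda>\<omega>. \<bar>D (Z i \<omega>) (Z (Suc i) \<omega>)\<bar> ^ 3) \<le> c" for i
  proof -
    have "expectation (\<lambda>\<omega>. \<bar>D (Z i \<omega>) (Z (Suc i) \<omega>)\<bar> ^ 3) \<le> 2 * (4 * C ^ 3) * B"
    proof (rule bound2)
      fix s t assume st: "s \<in> S" "t \<in> S"
      have "\<bar>D s t\<bar> ^ 3 \<le> (C * (w s + w t)) ^ 3" by (intro power_mono DC st) auto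
      also have "\<dots> \<le> C ^ 3 * (4 * (w s ^ 3 + w t ^ 3))"
        unfolding power_mult_distrib using abs_add_cube_le[of "w s" "w t"] w3(3)[OF st(1)] w3(3)[OF st(2)] C0
        by (intro mult_left_mono) auto
      finally show "\<bar>D s t\<bar> ^ 3 \<le> 4 * C ^ 3 * (w s ^ 3 + w t ^ 3)" by (simp add: algebra_simps)
    qed (use C0 in auto)
    then show ?thesis using c_parts(1) by simp
  qed
  have qc: "expectation (\<lambda>\<omega>. \<bar>q (Z i \<omega>)\<bar>) \<le> c" for i
  proof (rule order_trans[OF bound1 c_parts(2)])
    show "\<bar>q s\<bar> \<le> C * w s ^ 3" if "s \<in> S" for s
      using order_trans[OF qC[OF that] mult_left_mono[OF w3(1)[OF that] C0]] .
  qed (rule C0)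
  have Dq: "expectation (\<lambda>\<omega>. \<bar>D (Z i \<omega>) (Z (Suc i) \<omega>)\<bar> * \<bar>q (Z (Suc i) \<omega>)\<bar>) \<le> c" for i
  proof -
    have "expectation (\<lambda>\<omega>. \<bar>D (Z i \<omega>) (Z (Suc i) \<omega>)\<bar> * \<bar>q (Z (Suc i) \<omega>)\<bar>) \<le> 2 * (2 * C\<^sup>2) * B"
    proof (rule bound2[of "\<lambda>s t. \<bar>D s t\<bar> * \<bar>q t\<bar>"])
      fix s t assume st: "s \<in> S" "t \<in> S"
      have "\<bar>D s t\<bar> * \<bar>q t\<bar> \<le> (C * (w s + w t)) * (C * (w t)\<^sup>2)"
        using st C0 w3(3)[of s] w3(3)[of t] by (intro mult_mono DC qC) auto
      also have "\<dots> = C\<^sup>2 * (w s * (w t)\<^sup>2 + w t ^ 3)" by (simp add: power2_eq_square power3_eq_cube algebra_simps)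
      also have "\<dots> \<le> C\<^sup>2 * (2 * (w s ^ 3 + w t ^ 3))"
      proof (rule mult_left_mono)
        have "0 \<le> w s ^ 3" using w3(3)[OF st(1)] by simp
        then show "w s * (w t)\<^sup>2 + w t ^ 3 \<le> 2 * (w s ^ 3 + w t ^ 3)"
          unfolding distrib_left using mix[OF st] by linarith
      qed simp
      finally show "\<bar>D s t\<bar> * \<bar>q t\<bar> \<le> 2 * C\<^sup>2 * (w s ^ 3 + w t ^ 3)" by (simp add: algebra_simps)
    qed (use C0 in auto)
    then show ?thesis using c_parts(3) by simp
  qed
  have sum_eq: "AE \<omega> in M. (\<Sum>j<m. F (Z (k + j) \<omega>)) = path_sum D k m \<omega> + (g (Z k \<omega>) - g (Z (k + m) \<omega>))" for k m
    using AE_all_in_S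
  proof eventually_elim
    case (elim \<omega>)
    have "(\<Sum>j<m. F (Z (k + j) \<omega>)) = (\<Sum>j<m. D (Z (k + j) \<omega>) (Z (Suc (k + j)) \<omega>) - (g (Z (k + Suc j) \<omega>) - g (Z (k + j) \<omega>)))"
      using poisson elim by (intro sum.cong) (auto simp: D_def algebra_simps)
    also have "\<dots> = path_sum D k m \<omega> - (g (Z (k + m) \<omega>) - g (Z k \<omega>))"
      by (subst sum_subtractf) (simp add: path_sum_def sum_lessThan_telescope[of "\<lambda>j. g (Z (k + j) \<omega>)"] del: add_Suc_right)
    finally show ?case by simp
  qed
  have ad: "adapted (k + m) (\<lambda>\<omega>. \<Sum>j<m. F (Z (k + j) \<omega>))" for k m
    by (intro adapted_sum adapted_fun_Z) auto
  have g3: "expectation (\<lambda>\<omega>. \<bar>g (Z i \<omega>)\<bar> ^ 3) \<le> C ^ 3 * B" for i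
  proof (rule bound1)
    show "\<bar>g s\<bar> ^ 3 \<le> C ^ 3 * w s ^ 3" if "s \<in> S" for s
      unfolding power_mult_distrib[symmetric] by (intro power_mono g that) auto
  qed (use C0 in auto)
  have g1: "expectation (\<lambda>\<omega>. \<bar>g (Z i \<omega>)\<bar>) \<le> C * B" for i
    by (rule bound1) (use order_trans[OF g(1) mult_left_mono[OF w3(2) C0]] C0 in auto)
  \<comment> \<open>The first two summands bound the third moments, the others serve the
    characteristic functions.\<close>
  define L where "L = 64 * exp 3 * c + 32 * C ^ 3 * B + 2 * C * B + c + c\<^sup>2"
  have L0: "0 \<le> L" unfolding L_def using c0 C0 B0 by (intro add_nonneg_nonneg) auto
  show ?thesis
  proof (rule that[OF L0])
    fix k m
    show "expectation (\<lambda>\<omega>. \<bar>\<Sum>j<m. F (Z (k + j) \<omega>)\<bar> ^ 3) \<le> L * real m * sqrt (real m)"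
    proof (cases "m = 0")
      case False
      have "expectation (\<lambda>\<omega>. \<bar>\<Sum>j<m. F (Z (k + j) \<omega>)\<bar> ^ 3) \<le>
          expectation (\<lambda>\<omega>. 16 * \<bar>path_sum D k m \<omega>\<bar> ^ 3 + (16 * \<bar>g (Z k \<omega>)\<bar> ^ 3 + 16 * \<bar>g (Z (k + m) \<omega>)\<bar> ^ 3))"
      proof (rule integral_mono_AE)
        show "integrable M (\<lambda>\<omega>. \<bar>\<Sum>j<m. F (Z (k + j) \<omega>)\<bar> ^ 3)"
          by (rule integrable_adapted[OF adapted_compose[OF ad]])
        show "integrable M (\<lambda>\<omega>. 16 * \<bar>path_sum D k m \<omega>\<bar> ^ 3 + (16 * \<bar>g (Z k \<omega>)\<bar> ^ 3 + 16 * \<bar>g (Z (k + m) \<omega>)\<bar> ^ 3))"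
          by (intro Bochner_Integration.integrable_add integrable_path_sum[of "\<lambda>x. 16 * \<bar>x\<bar> ^ 3"] integrable_path[of "\<lambda>s t. 16 * \<bar>g s\<bar> ^ 3"])
        show "AE \<omega> in M. \<bar>\<Sum>j<m. F (Z (k + j) \<omega>)\<bar> ^ 3 \<le>
            16 * \<bar>path_sum D k m \<omega>\<bar> ^ 3 + (16 * \<bar>g (Z k \<omega>)\<bar> ^ 3 + 16 * \<bar>g (Z (k + m) \<omega>)\<bar> ^ 3)"
          using sum_eq[of k m]
        proof eventually_elim
          case (elim \<omega>)
          have "\<bar>path_sum D k m \<omega> + (g (Z k \<omega>) - g (Z (k + m) \<omega>))\<bar> ^ 3 \<le>
              4 * \<bar>path_sum D k m \<omega>\<bar> ^ 3 + 16 * \<bar>g (Z k \<omega>)\<bar> ^ 3 + 16 * \<bar>g (Z (k + m) \<omega>)\<bar> ^ 3"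
            using abs_add_cube_le[of "path_sum D k m \<omega>" "g (Z k \<omega>) - g (Z (k + m) \<omega>)"]
              abs_add_cube_le[of "g (Z k \<omega>)" "- g (Z (k + m) \<omega>)"] by simp
          moreover have "0 \<le> \<bar>path_sum D k m \<omega>\<bar> ^ 3" by simp
          ultimately show ?case unfolding elim by linarith
        qed
      qed
      also have "\<dots> = 16 * expectation (\<lambda>\<omega>. \<bar>path_sum D k m \<omega>\<bar> ^ 3) +
          (16 * expectation (\<lambda>\<omega>. \<bar>g (Z k \<omega>)\<bar> ^ 3) + 16 * expectation (\<lambda>\<omega>. \<bar>g (Z (k + m) \<omega>)\<bar> ^ 3))"
        using integrable_path_sum[of "\<lambda>x. \<bar>x\<bar> ^ 3" D k m] integrable_path[of "\<lambda>s t. \<bar>g s\<bar> ^ 3"] by simp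
      also have "\<dots> \<le> 16 * (4 * exp 3 * c * real m * sqrt (real m)) + (16 * (C ^ 3 * B) + 16 * (C ^ 3 * B))"
        using martingale_cube[OF D0 cube, of k m] g3 by (intro add_mono mult_left_mono) auto
      also have "\<dots> = 64 * exp 3 * c * (real m * sqrt (real m)) + 32 * C ^ 3 * B * 1" by (simp add: algebra_simps)
      also have "\<dots> \<le> 64 * exp 3 * c * (real m * sqrt (real m)) + 32 * C ^ 3 * B * (real m * sqrt (real m))"
        using False c0 C0 B0 mult_mono[of 1 "real m" 1 "sqrt (real m)"] by (intro add_mono mult_left_mono) auto
      also have "\<dots> = (64 * exp 3 * c + 32 * C ^ 3 * B) * (real m * sqrt (real m))" by (simp add: distrib_right)
      also have "\<dots> \<le> L * (real m * sqrt (real m))"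
        unfolding L_def using c0 C0 B0 by (intro mult_right_mono) auto
      finally show ?thesis by (simp add: mult_ac)
    qed simp
  next
    fix k m and \<theta> :: real and G :: "'a \<Rightarrow> complex"
    assume G: "adapted k G" "\<And>\<omega>. cmod (G \<omega>) \<le> 1" and \<theta>: "\<bar>\<theta>\<bar> \<le> 1"
    let ?R = "of_real (exp (- (\<sigma>2 * \<theta>\<^sup>2 / 2)) ^ m) * expectation G"
    have q': "q s - kernel_op K q s = kernel_op K (\<lambda>t. (D s t)\<^sup>2) s - \<sigma>2" if "s \<in> S" for s
      unfolding D_def by (rule q[OF that])
    have int1: "integrable M (\<lambda>\<omega>. G \<omega> * iexp (\<theta> * (\<Sum>j<m. F (Z (k + j) \<omega>))))"
      by (rule integrable_adapted[OF adapted_compose2[OF adapted_mono[OF G(1)] ad, of _ _ "\<lambda>g x. g * iexp (\<theta> * x)"]]) simp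
    have int2: "integrable M (\<lambda>\<omega>. G \<omega> * iexp (\<theta> * path_sum D k m \<omega>))"
      by (rule integrable_adapted[OF adapted_char[OF G(1) order_refl]])
    have "cmod (expectation (\<lambda>\<omega>. G \<omega> * iexp (\<theta> * (\<Sum>j<m. F (Z (k + j) \<omega>)))) -
        expectation (\<lambda>\<omega>. G \<omega> * iexp (\<theta> * path_sum D k m \<omega>))) =
        cmod (expectation (\<lambda>\<omega>. G \<omega> * iexp (\<theta> * (\<Sum>j<m. F (Z (k + j) \<omega>))) - G \<omega> * iexp (\<theta> * path_sum D k m \<omega>)))"
      by (subst Bochner_Integration.integral_diff[OF int1 int2]) simp
    also have "\<dots> \<le> expectation (\<lambda>\<omega>. \<bar>\<theta>\<bar> * \<bar>g (Z k \<omega>)\<bar> + \<bar>\<theta>\<bar> * \<bar>g (Z (k + m) \<omega>)\<bar>)"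
    proof (rule norm_integral_le)
      show "integrable M (\<lambda>\<omega>. \<bar>\<theta>\<bar> * \<bar>g (Z k \<omega>)\<bar> + \<bar>\<theta>\<bar> * \<bar>g (Z (k + m) \<omega>)\<bar>)"
        by (intro Bochner_Integration.integrable_add integrable_path[of "\<lambda>s t. \<bar>\<theta>\<bar> * \<bar>g s\<bar>"])
      show "AE \<omega> in M. cmod (G \<omega> * iexp (\<theta> * (\<Sum>j<m. F (Z (k + j) \<omega>))) - G \<omega> * iexp (\<theta> * path_sum D k m \<omega>)) \<le>
          \<bar>\<theta>\<bar> * \<bar>g (Z k \<omega>)\<bar> + \<bar>\<theta>\<bar> * \<bar>g (Z (k + m) \<omega>)\<bar>"
        using sum_eq[of k m]
      proof eventually_elim
        case (elim \<omega>)
        let ?x = "path_sum D k m \<omega>" and ?y = "g (Z k \<omega>) - g (Z (k + m) \<omega>)"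
        have "cmod (G \<omega> * iexp (\<theta> * (?x + ?y)) - G \<omega> * iexp (\<theta> * ?x)) =
            cmod (G \<omega>) * cmod (iexp (\<theta> * (?x + ?y)) - iexp (\<theta> * ?x))"
          unfolding norm_mult[symmetric] by (simp add: right_diff_distrib)
        also have "\<dots> \<le> 1 * \<bar>\<theta> * (?x + ?y) - \<theta> * ?x\<bar>"
          by (intro mult_mono G norm_iexp_diff_le) auto
        also have "\<dots> = \<bar>\<theta>\<bar> * \<bar>?y\<bar>" by (simp add: abs_mult[symmetric] algebra_simps)
        also have "\<dots> \<le> \<bar>\<theta>\<bar> * (\<bar>g (Z k \<omega>)\<bar> + \<bar>g (Z (k + m) \<omega>)\<bar>)" by (intro mult_left_mono) auto
        finally show ?case unfolding elim by (simp add: distrib_left)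
      qed
    qed
    also have "\<dots> = \<bar>\<theta>\<bar> * expectation (\<lambda>\<omega>. \<bar>g (Z k \<omega>)\<bar>) + \<bar>\<theta>\<bar> * expectation (\<lambda>\<omega>. \<bar>g (Z (k + m) \<omega>)\<bar>)"
      using integrable_path[of "\<lambda>s t. \<bar>g s\<bar>"] by simp
    also have "\<dots> \<le> \<bar>\<theta>\<bar> * (C * B) + \<bar>\<theta>\<bar> * (C * B)"
      by (intro add_mono mult_left_mono g1) auto
    also have "\<dots> = \<bar>\<theta>\<bar> * (2 * C * B)" by simp
    finally have first: "cmod (expectation (\<lambda>\<omega>. G \<omega> * iexp (\<theta> * (\<Sum>j<m. F (Z (k + j) \<omega>)))) -
        expectation (\<lambda>\<omega>. G \<omega> * iexp (\<theta> * path_sum D k m \<omega>))) \<le> \<bar>\<theta>\<bar> * (2 * C * B)" .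
    have "cmod (expectation (\<lambda>\<omega>. G \<omega> * iexp (\<theta> * (\<Sum>j<m. F (Z (k + j) \<omega>)))) - ?R) \<le>
        \<bar>\<theta>\<bar> * (2 * C * B) + (c * \<theta>\<^sup>2 + real m * \<bar>\<theta>\<bar> ^ 3 * (c + c\<^sup>2))"
      by (rule norm_diff_triangle_le[OF first martingale_char[OF G D0 q' \<sigma>2 c_parts(4) cube qc Dq \<theta>]])
    also have "\<dots> \<le> \<bar>\<theta>\<bar> * (2 * C * B) + (c * \<bar>\<theta>\<bar> + real m * \<bar>\<theta>\<bar> ^ 3 * (c + c\<^sup>2))"
    proof -
      have "\<theta>\<^sup>2 \<le> \<bar>\<theta>\<bar>" using power_decreasing[of 1 2 "\<bar>\<theta>\<bar>"] \<theta> by simp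
      then show ?thesis using c0 by (simp add: mult_left_mono)
    qed
    also have "\<dots> = (2 * C * B + c) * \<bar>\<theta>\<bar> + (c + c\<^sup>2) * (real m * \<bar>\<theta>\<bar> ^ 3)" by (simp add: algebra_simps)
    also have "\<dots> \<le> L * \<bar>\<theta>\<bar> + L * (real m * \<bar>\<theta>\<bar> ^ 3)"
    proof -
      have "0 \<le> 64 * exp 3 * c" "0 \<le> 32 * C ^ 3 * B" "0 \<le> 2 * C * B" "0 \<le> c\<^sup>2" using c0 C0 B0 by auto
      then have "2 * C * B + c \<le> L" "c + c\<^sup>2 \<le> L" unfolding L_def using c0 by linarith+
      then show ?thesis by (intro add_mono[OF mult_right_mono mult_right_mono]) auto
    qed
    finally show "cmod (expectation (\<lambda>\<omega>. G \<omega> * iexp (\<theta> * (\<Sum>j<m. F (Z (k + j) \<omega>)))) - ?R) \<le>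
        L * (\<bar>\<theta>\<bar> + real m * \<bar>\<theta>\<bar> ^ 3)" by (simp add: distrib_left)
  qed
qed

end

section \<open>Interpolated partial sums\<close>

lemma abs_diff_nat_floor_le: "0 \<le> x \<Longrightarrow> \<bar>x - real (nat \<lfloor>x\<rfloor>)\<bar> \<le> 1"
proof -
  assume "0 \<le> x"
  then have "real (nat \<lfloor>x\<rfloor>) = of_int \<lfloor>x\<rfloor>" by simp
  then show ?thesis using of_int_floor_le[of x] real_of_int_floor_add_one_gt[of x] by linarith
qed

lemma tendsto_floor_ratio:
  assumes "0 \<le> t"
  shows "(\<lambda>n. real (nat \<lfloor>real n * t\<rfloor>) / real n) \<longlonglongrightarrow> t"
proof -
  have "(\<lambda>n. real (nat \<lfloor>real n * t\<rfloor>) / real n - t) \<longlonglongrightarrow> 0"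
  proof (rule Lim_null_comparison[OF _ lim_inverse_n])
    show "\<forall>\<^sub>F n in sequentially. norm (real (nat \<lfloor>real n * t\<rfloor>) / real n - t) \<le> inverse (real n)"
      using eventually_gt_at_top[of 0]
    proof eventually_elim
      case (elim n)
      have "\<bar>real (nat \<lfloor>real n * t\<rfloor>) - real n * t\<bar> \<le> 1"
        using abs_diff_nat_floor_le[of "real n * t"] assms by (simp add: abs_minus_commute)
      moreover have "real (nat \<lfloor>real n * t\<rfloor>) / real n - t = (real (nat \<lfloor>real n * t\<rfloor>) - real n * t) / real n"
        using elim by (simp add: field_simps)
      ultimately show ?case by (simp add: abs_divide divide_right_mono inverse_eq_divide)
    qed
  qed
  then show ?thesis by (simp add: LIM_zero_iff)
qed

lemma tendsto_const_over_sqrt: "(\<lambda>n. c / sqrt (real n)) \<longlonglongrightarrow> 0"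
  by (rule real_tendsto_divide_at_top[OF tendsto_const])
     (rule filterlim_compose[OF sqrt_at_top filterlim_real_sequentially])

context chain_process
begin

text \<open>The last block is split off and the character of the earlier blocks is put in the place
  of the weight \<open>G\<close>, over which \<open>est\<close> is uniform. With \<theta> of order
  n^(-1/2) and blocks of length of order n, the error is of order n^(-1/2).\<close>

lemma char_blocks_limit:
  assumes \<sigma>2: "0 \<le> \<sigma>2" and L0: "0 \<le> L"
    and est: "\<And>k m \<theta> G. adapted k G \<Longrightarrow> (\<And>\<omega>. cmod (G \<omega>) \<le> 1) \<Longrightarrow> \<bar>\<theta>\<bar> \<le> 1 \<Longrightarrow>
      cmod (expectation (\<lambda>\<omega>. G \<omega> * iexp (\<theta> * (\<Sum>j<m. F (Z (k + j) \<omega>)))) -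
        of_real (exp (- (\<sigma>2 * \<theta>\<^sup>2 / 2)) ^ m) * expectation G) \<le> L * (\<bar>\<theta>\<bar> + real m * \<bar>\<theta>\<bar> ^ 3)"
    and t: "0 \<le> t 0" "incseq t"
  defines "m \<equiv> \<lambda>n k. nat \<lfloor>real n * t k\<rfloor>"
  shows "(\<lambda>n. expectation (\<lambda>\<omega>. iexp (\<Sum>k<N. v k * ((\<Sum>i\<in>{m n k..<m n (Suc k)}. F (Z i \<omega>)) / sqrt (real n)))))
    \<longlonglongrightarrow> of_real (exp (- (\<sigma>2 / 2 * (\<Sum>k<N. (v k)\<^sup>2 * (t (Suc k) - t k)))))"
proof (induction N)
  case 0
  then show ?case by (simp add: prob_space)
next
  case (Suc N)
  have t0: "0 \<le> t k" for k using t incseqD[OF t(2), of 0 k] by simp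
  have m_mono: "m n k \<le> m n l" if "k \<le> l" for n k l
    unfolding m_def using incseqD[OF t(2) that] by (intro nat_mono floor_mono mult_left_mono) auto
  define G where "G n \<omega> = iexp (\<Sum>k<N. v k * ((\<Sum>i\<in>{m n k..<m n (Suc k)}. F (Z i \<omega>)) / sqrt (real n)))" for n \<omega>
  define d where "d n = m n (Suc N) - m n N" for n
  define \<theta> where "\<theta> n = v N / sqrt (real n)" for n
  define \<rho> where "\<rho> n = exp (- (\<sigma>2 * (\<theta> n)\<^sup>2 / 2)) ^ d n" for n
  have adG: "adapted (m n N) (G n)" for n
    unfolding adapted_def
  proof (intro ballI impI)
    fix \<omega> \<omega>' assume eq: "\<forall>i\<le>m n N. Z i \<omega> = Z i \<omega>'"
    have "(\<Sum>i\<in>{m n k..<m n (Suc k)}. F (Z i \<omega>)) = (\<Sum>i\<in>{m n k..<m n (Suc k)}. F (Z i \<omega>'))" if "k < N" for k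
      using eq m_mono[of "Suc k" N n] that by (intro sum.cong) auto
    then show "G n \<omega> = G n \<omega>'" unfolding G_def by simp
  qed
  have normG: "cmod (G n \<omega>) \<le> 1" for n \<omega> by (simp add: G_def)
  have split: "iexp (\<Sum>k<Suc N. v k * ((\<Sum>i\<in>{m n k..<m n (Suc k)}. F (Z i \<omega>)) / sqrt (real n))) =
      G n \<omega> * iexp (\<theta> n * (\<Sum>j<d n. F (Z (m n N + j) \<omega>)))" for n \<omega>
  proof -
    have "(\<Sum>i\<in>{m n N..<m n (Suc N)}. F (Z i \<omega>)) = (\<Sum>j<d n. F (Z (m n N + j) \<omega>))"
      unfolding d_def using m_mono[of N "Suc N" n]
      by (intro sum.reindex_bij_witness[of _ "\<lambda>j. m n N + j" "\<lambda>i. i - m n N"]) auto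
    then show ?thesis by (simp add: G_def \<theta>_def distrib_left exp_add mult_ac)
  qed
  let ?E = "\<lambda>n. expectation (\<lambda>\<omega>. G n \<omega> * iexp (\<theta> n * (\<Sum>j<d n. F (Z (m n N + j) \<omega>))))"
  have "(\<lambda>n. ?E n - of_real (\<rho> n) * expectation (G n)) \<longlonglongrightarrow> 0"
  proof (rule Lim_null_comparison)
    show "(\<lambda>n. L * (\<bar>v N\<bar> + t (Suc N) * \<bar>v N\<bar> ^ 3) / sqrt (real n)) \<longlonglongrightarrow> 0" by (rule tendsto_const_over_sqrt)
    have "\<forall>\<^sub>F n in sequentially. \<bar>\<bar>v N\<bar> / sqrt (real n)\<bar> < 1"
      using tendsto_const_over_sqrt[of "\<bar>v N\<bar>"] by (auto simp: tendsto_iff dist_real_def)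
    then show "\<forall>\<^sub>F n in sequentially. norm (?E n - of_real (\<rho> n) * expectation (G n)) \<le>
        L * (\<bar>v N\<bar> + t (Suc N) * \<bar>v N\<bar> ^ 3) / sqrt (real n)"
      using eventually_gt_at_top[of 0]
    proof eventually_elim
      case (elim n)
      have \<theta>: "\<bar>\<theta> n\<bar> = \<bar>v N\<bar> / sqrt (real n)" by (simp add: \<theta>_def abs_divide)
      then have "norm (?E n - of_real (\<rho> n) * expectation (G n)) \<le> L * (\<bar>\<theta> n\<bar> + real (d n) * \<bar>\<theta> n\<bar> ^ 3)"
        unfolding \<rho>_def using elim by (intro est adG normG) auto
      also have "\<dots> \<le> L * (\<bar>\<theta> n\<bar> + (real n * t (Suc N)) * \<bar>\<theta> n\<bar> ^ 3)"
      proof -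
        have "real (d n) \<le> real (m n (Suc N))" by (simp add: d_def)
        also have "\<dots> \<le> real n * t (Suc N)" unfolding m_def using t0[of "Suc N"] by simp
        finally show ?thesis using L0 by (intro mult_left_mono add_left_mono mult_right_mono) auto
      qed
      also have "\<dots> = L * (\<bar>v N\<bar> + t (Suc N) * \<bar>v N\<bar> ^ 3) / sqrt (real n)"
        using elim unfolding \<theta> by (simp add: power_divide power3_eq_cube field_simps)
      finally show ?case .
    qed
  qed
  moreover have "(\<lambda>n. of_real (\<rho> n) * expectation (G n)) \<longlonglongrightarrow>
      of_real (exp (- (\<sigma>2 / 2 * ((v N)\<^sup>2 * (t (Suc N) - t N))))) *
      of_real (exp (- (\<sigma>2 / 2 * (\<Sum>k<N. (v k)\<^sup>2 * (t (Suc k) - t k)))))"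
  proof (intro tendsto_mult tendsto_of_real)
    have "(\<lambda>n. exp (- (\<sigma>2 / 2 * ((v N)\<^sup>2 * (real (m n (Suc N)) / real n - real (m n N) / real n)))))
        \<longlonglongrightarrow> exp (- (\<sigma>2 / 2 * ((v N)\<^sup>2 * (t (Suc N) - t N))))"
      unfolding m_def by (intro tendsto_intros tendsto_floor_ratio t0)
    then show "\<rho> \<longlonglongrightarrow> exp (- (\<sigma>2 / 2 * ((v N)\<^sup>2 * (t (Suc N) - t N))))"
    proof (rule Lim_transform_eventually)
      show "\<forall>\<^sub>F n in sequentially. exp (- (\<sigma>2 / 2 * ((v N)\<^sup>2 * (real (m n (Suc N)) / real n - real (m n N) / real n)))) = \<rho> n"
        using eventually_gt_at_top[of 0]
      proof eventually_elim
        case (elim n)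
        have "real (d n) = real (m n (Suc N)) - real (m n N)" using m_mono[of N "Suc N" n] by (simp add: d_def)
        then show ?case
          using elim unfolding \<rho>_def \<theta>_def exp_of_nat_mult[symmetric]
          by (simp add: power_divide diff_divide_distrib right_diff_distrib left_diff_distrib mult_ac)
      qed
    qed
    show "(\<lambda>n. expectation (G n)) \<longlonglongrightarrow> of_real (exp (- (\<sigma>2 / 2 * (\<Sum>k<N. (v k)\<^sup>2 * (t (Suc k) - t k)))))"
      unfolding G_def using Suc.IH .
  qed
  ultimately have "(\<lambda>n. (?E n - of_real (\<rho> n) * expectation (G n)) + of_real (\<rho> n) * expectation (G n)) \<longlonglongrightarrow>
      0 + of_real (exp (- (\<sigma>2 / 2 * ((v N)\<^sup>2 * (t (Suc N) - t N))))) *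
      of_real (exp (- (\<sigma>2 / 2 * (\<Sum>k<N. (v k)\<^sup>2 * (t (Suc k) - t k)))))"
    by (rule tendsto_add)
  then show ?case
    unfolding split by (simp add: exp_add[symmetric] of_real_mult[symmetric] distrib_left add.commute del: of_real_mult)
qed

end

section \<open>Polygonal interpolation of the partial sums\<close>

definition lerp :: "(nat \<Rightarrow> real) \<Rightarrow> real \<Rightarrow> real" where
  "lerp a u = (\<Sum>k<nat \<lfloor>u\<rfloor>. a k) + (u - real (nat \<lfloor>u\<rfloor>)) * a (nat \<lfloor>u\<rfloor>)"

lemma lerp_0 [simp]: "lerp a 0 = 0"
  by (simp add: lerp_def)

text \<open>On a bounded interval the polygonal line is a finite combination of clamped ramps, each
  of which is visibly continuous in \<open>u\<close>.\<close>

lemma lerp_eq_sum: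
  assumes "0 \<le> u" "u < real N"
  shows "lerp a u = (\<Sum>k<N. a k * max 0 (min 1 (u - real k)))"
proof -
  define p where "p = nat \<lfloor>u\<rfloor>"
  have p: "real p \<le> u" "u < real p + 1" "p < N"
    using assms floor_correct[of u] by (auto simp: p_def nat_less_iff floor_less_iff)
  have "(\<Sum>k<N. a k * max 0 (min 1 (u - real k))) = (\<Sum>k<Suc p. a k * max 0 (min 1 (u - real k)))"
    using p by (intro sum.mono_neutral_right) auto
  also have "\<dots> = (\<Sum>k<p. a k * max 0 (min 1 (u - real k))) + a p * (u - real p)"
    using p by simp
  also have "(\<Sum>k<p. a k * max 0 (min 1 (u - real k))) = (\<Sum>k<p. a k)"
  proof (intro sum.cong refl)
    fix k assume "k \<in> {..<p}"
    then have "real k + 1 \<le> real p" by simp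
    then show "a k * max 0 (min 1 (u - real k)) = a k" using p by (simp add: max_def min_def)
  qed
  finally show ?thesis by (simp add: lerp_def p_def mult.commute)
qed

lemma continuous_on_lerp: "continuous_on {0..} (lerp a)"
proof -
  have "continuous_on {0..<real N} (lerp a)" for N
    by (rule continuous_on_eq[of _ "\<lambda>u. \<Sum>k<N. a k * max 0 (min 1 (u - real k))"])
       (auto intro!: continuous_intros simp: lerp_eq_sum)
  then have "isCont_lerp": "continuous (at u within {0..}) (lerp a)" if "0 \<le> u" for u
  proof -
    obtain N :: nat where N: "u < real N" using reals_Archimedean2 by blast
    have "continuous (at u within {0..<real N}) (lerp a)"
      using \<open>\<And>N. continuous_on {0..<real N} (lerp a)\<close>[of N] N that by (auto simp: continuous_on_eq_continuous_within)
    moreover have "at u within {0..<real N} = at u within {0..}"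
      by (rule at_within_nhd[of _ "{..<real N}"]) (use N in auto)
    ultimately show ?thesis by simp
  qed
  then show ?thesis by (simp add: continuous_on_eq_continuous_within)
qed

text \<open>What the functional limit theorem needs from the chain: third moments of blocks of order
  m^(3/2), and the limits of the joint characteristic functions of disjoint blocks.\<close>

locale partial_sums = prob_space M for M :: "'a measure" +
  fixes F :: "nat \<Rightarrow> 'a \<Rightarrow> real" and L \<sigma>2 :: real
  assumes F_measurable [measurable]: "F k \<in> borel_measurable M"
    and cube_integrable: "integrable M (\<lambda>\<omega>. \<bar>\<Sum>j<m. F (k + j) \<omega>\<bar> ^ 3)"
    and cube_bound: "expectation (\<lambda>\<omega>. \<bar>\<Sum>j<m. F (k + j) \<omega>\<bar> ^ 3) \<le> L * real m * sqrt (real m)"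
    and sums_char_limit: "0 \<le> t 0 \<Longrightarrow> incseq t \<Longrightarrow>
      (\<lambda>n. expectation (\<lambda>\<omega>. iexp (\<Sum>k<N. v k *
          ((\<Sum>i\<in>{nat \<lfloor>real n * t k\<rfloor>..<nat \<lfloor>real n * t (Suc k)\<rfloor>}. F i \<omega>) / sqrt (real n)))))
      \<longlonglongrightarrow> of_real (exp (- (\<sigma>2 / 2 * (\<Sum>k<N. (v k)\<^sup>2 * (t (Suc k) - t k)))))"
begin

definition W :: "nat \<Rightarrow> real \<Rightarrow> 'a \<Rightarrow> real" where
  "W n t \<omega> = lerp (\<lambda>k. F k \<omega>) (real n * t) / sqrt (real n)"

lemma F_cube: "integrable M (\<lambda>\<omega>. \<bar>F k \<omega>\<bar> ^ 3)" "expectation (\<lambda>\<omega>. \<bar>F k \<omega>\<bar> ^ 3) \<le> L"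
  using cube_integrable[where m=1 and k=k] cube_bound[where m=1 and k=k] by auto

lemma L_nonneg: "0 \<le> L"
  by (rule order_trans[OF integral_nonneg_AE F_cube(2)[of 0]]) simp

lemma W_measurable [measurable]: "W n t \<in> borel_measurable M"
  unfolding W_def lerp_def by measurable

text \<open>The increment consists of fractions of the end terms and a block of \<open>m\<close>
  whole terms. Third moments of blocks are no help for a short interval, but there the fractions
  \<open>b\<close> and \<open>c\<close> are at most \<open>t - s\<close>. The factor 48 is three
  times the 16 from splitting a cube of three summands.\<close>

lemma lerp_cube:
  assumes "0 \<le> s" "s \<le> t"
  shows "integrable M (\<lambda>\<omega>. \<bar>lerp (\<lambda>k. F k \<omega>) t - lerp (\<lambda>k. F k \<omega>) s\<bar> ^ 3) \<and>
    expectation (\<lambda>\<omega>. \<bar>lerp (\<lambda>k. F k \<omega>) t - lerp (\<lambda>k. F k \<omega>) s\<bar> ^ 3) \<le> 48 * L * three_halves (t - s)"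
proof -
  define p r where "p = nat \<lfloor>s\<rfloor>" and "r = nat \<lfloor>t\<rfloor>"
  have p: "real p \<le> s" "s < real p + 1" and r: "real r \<le> t" "t < real r + 1" and pr: "p \<le> r"
    using assms floor_correct[of s] floor_correct[of t] by (auto simp: p_def r_def intro!: nat_mono floor_mono)
  obtain b c m where lerp_diff: "\<And>\<omega>. lerp (\<lambda>k. F k \<omega>) t - lerp (\<lambda>k. F k \<omega>) s = b * F p \<omega> + c * F r \<omega> + (\<Sum>j<m. F (Suc p + j) \<omega>)"
    and bc: "0 \<le> b" "b \<le> 1" "b \<le> t - s" "0 \<le> c" "c \<le> 1" "c \<le> t - s" and m: "real m \<le> t - s"
  proof (cases "p = r")
    case True
    show ?thesis
    proof (rule that[of "t - s" 0 0])
      show "lerp (\<lambda>k. F k \<omega>) t - lerp (\<lambda>k. F k \<omega>) s = (t - s) * F p \<omega> + 0 * F r \<omega> + (\<Sum>j<0. F (Suc p + j) \<omega>)" for \<omega>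
        using True unfolding lerp_def p_def r_def by (simp add: algebra_simps)
    qed (use assms p r True in auto)
  next
    case False
    then have pr': "Suc p \<le> r" using pr by simp
    show ?thesis
    proof (rule that[of "real p + 1 - s" "t - real r" "r - Suc p"])
      fix \<omega>
      have "(\<Sum>k<r. F k \<omega>) = (\<Sum>k<Suc p. F k \<omega>) + (\<Sum>k\<in>{Suc p..<r}. F k \<omega>)"
        using pr' by (simp only: lessThan_atLeast0 sum.atLeastLessThan_concat[of 0 "Suc p" r])
      also have "(\<Sum>k\<in>{Suc p..<r}. F k \<omega>) = (\<Sum>j<r - Suc p. F (Suc p + j) \<omega>)"
        using pr' by (intro sum.reindex_bij_witness[of _ "\<lambda>j. Suc p + j" "\<lambda>i. i - Suc p"]) auto
      finally show "lerp (\<lambda>k. F k \<omega>) t - lerp (\<lambda>k. F k \<omega>) s =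
          (real p + 1 - s) * F p \<omega> + (t - real r) * F r \<omega> + (\<Sum>j<r - Suc p. F (Suc p + j) \<omega>)"
        unfolding lerp_def p_def[symmetric] r_def[symmetric] by (simp add: algebra_simps)
      show "real (r - Suc p) \<le> t - s" using pr' p r by (simp add: of_nat_diff)
      have "real p + 1 \<le> real r" using pr' by simp
      then show "real p + 1 - s \<le> t - s" "t - real r \<le> t - s" using p r by auto
    qed (use p r in auto)
  qed
  \<comment> \<open>For \<open>x \<le> 1\<close> the cube is at most x^(3/2).\<close>
  have small: "x ^ 3 \<le> three_halves (t - s)" if "0 \<le> x" "x \<le> 1" "x \<le> t - s" for x :: real
  proof -
    have "x * x \<le> 1 * sqrt x" using that real_sqrt_ge_one sqrt_le_D[of x 1]
      by (intro mult_mono) (auto intro: real_le_rsqrt simp: power2_eq_square mult_left_le)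
    then have "x * (x * x) \<le> x * sqrt x" using that(1) by (intro mult_left_mono) auto
    then have "x ^ 3 \<le> three_halves x" by (simp add: three_halves_def power3_eq_cube)
    also have "\<dots> \<le> three_halves (t - s)" using that by (intro three_halves_mono) auto
    finally show ?thesis .
  qed
  define u where "u \<omega> = 16 * (b ^ 3 * \<bar>F p \<omega>\<bar> ^ 3) + 16 * (c ^ 3 * \<bar>F r \<omega>\<bar> ^ 3) + 16 * \<bar>\<Sum>j<m. F (Suc p + j) \<omega>\<bar> ^ 3" for \<omega>
  have iu: "integrable M u" unfolding u_def using F_cube cube_integrable[where k="Suc p"] by auto
  have le: "\<bar>lerp (\<lambda>k. F k \<omega>) t - lerp (\<lambda>k. F k \<omega>) s\<bar> ^ 3 \<le> u \<omega>" for \<omega>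
  proof -
    let ?y = "\<Sum>j<m. F (Suc p + j) \<omega>"
    have "\<bar>b * F p \<omega> + c * F r \<omega> + ?y\<bar> ^ 3 \<le> 4 * (4 * (\<bar>b * F p \<omega>\<bar> ^ 3 + \<bar>c * F r \<omega>\<bar> ^ 3) + \<bar>?y\<bar> ^ 3)"
      using abs_add_cube_le[of "b * F p \<omega> + c * F r \<omega>" ?y] abs_add_cube_le[of "b * F p \<omega>" "c * F r \<omega>"] by simp
    also have "\<dots> \<le> u \<omega>"
      using bc unfolding u_def by (simp add: abs_mult power_mult_distrib)
    finally show ?thesis unfolding lerp_diff .
  qed
  have int: "integrable M (\<lambda>\<omega>. \<bar>lerp (\<lambda>k. F k \<omega>) t - lerp (\<lambda>k. F k \<omega>) s\<bar> ^ 3)"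
    by (rule Bochner_Integration.integrable_bound[OF iu], unfold lerp_def, measurable)
       (use le in \<open>auto simp: lerp_def intro!: AE_I2 order_trans[OF _ abs_ge_self]\<close>)
  have "expectation (\<lambda>\<omega>. \<bar>lerp (\<lambda>k. F k \<omega>) t - lerp (\<lambda>k. F k \<omega>) s\<bar> ^ 3) \<le> expectation u"
    by (intro integral_mono int iu le)
  also have "expectation u = 16 * (b ^ 3 * expectation (\<lambda>\<omega>. \<bar>F p \<omega>\<bar> ^ 3)) + 16 * (c ^ 3 * expectation (\<lambda>\<omega>. \<bar>F r \<omega>\<bar> ^ 3)) +
      16 * expectation (\<lambda>\<omega>. \<bar>\<Sum>j<m. F (Suc p + j) \<omega>\<bar> ^ 3)"
    unfolding u_def using F_cube cube_integrable[where k="Suc p"] by simp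
  also have "\<dots> \<le> 16 * (three_halves (t - s) * L) + 16 * (three_halves (t - s) * L) + 16 * (L * three_halves (t - s))"
  proof (intro add_mono mult_left_mono mult_mono small bc F_cube)
    have "expectation (\<lambda>\<omega>. \<bar>\<Sum>j<m. F (Suc p + j) \<omega>\<bar> ^ 3) \<le> L * three_halves (real m)"
      using cube_bound[where m=m and k="Suc p"] by (simp add: three_halves_def mult_ac)
    also have "\<dots> \<le> L * three_halves (t - s)" using m L_nonneg by (intro mult_left_mono three_halves_mono) auto
    finally show "expectation (\<lambda>\<omega>. \<bar>\<Sum>j<m. F (Suc p + j) \<omega>\<bar> ^ 3) \<le> L * three_halves (t - s)" .
  qed auto
  finally show ?thesis using int by (simp add: mult_ac)
qed

lemma W_cube:
  assumes "0 \<le> s" "s \<le> t"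
  shows "integrable M (\<lambda>\<omega>. \<bar>W n t \<omega> - W n s \<omega>\<bar> ^ 3)"
    "expectation (\<lambda>\<omega>. \<bar>W n t \<omega> - W n s \<omega>\<bar> ^ 3) \<le> 48 * L * three_halves (t - s)"
proof -
  have eq: "\<bar>W n t \<omega> - W n s \<omega>\<bar> ^ 3 =
      1 / sqrt (real n) ^ 3 * \<bar>lerp (\<lambda>k. F k \<omega>) (real n * t) - lerp (\<lambda>k. F k \<omega>) (real n * s)\<bar> ^ 3" for \<omega>
    by (simp add: W_def diff_divide_distrib[symmetric] abs_divide power_divide)
  have *: "integrable M (\<lambda>\<omega>. \<bar>lerp (\<lambda>k. F k \<omega>) (real n * t) - lerp (\<lambda>k. F k \<omega>) (real n * s)\<bar> ^ 3)"
    "expectation (\<lambda>\<omega>. \<bar>lerp (\<lambda>k. F k \<omega>) (real n * t) - lerp (\<lambda>k. F k \<omega>) (real n * s)\<bar> ^ 3) \<le>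
      48 * L * (three_halves (real n) * three_halves (t - s))"
    using lerp_cube[of "real n * s" "real n * t"] assms
    by (auto simp: mult_left_mono three_halves_mult[symmetric] right_diff_distrib)
  show "integrable M (\<lambda>\<omega>. \<bar>W n t \<omega> - W n s \<omega>\<bar> ^ 3)" unfolding eq using *(1) by simp
  have "expectation (\<lambda>\<omega>. \<bar>W n t \<omega> - W n s \<omega>\<bar> ^ 3) \<le>
      1 / sqrt (real n) ^ 3 * (48 * L * (three_halves (real n) * three_halves (t - s)))"
    unfolding eq Bochner_Integration.integral_mult_right_zero using *(2) by (intro mult_left_mono) auto
  \<comment> \<open>The factor n^(3/2) of the moment cancels the scaling. For \<open>n = 0\<close>
    the division by zero makes the left side zero.\<close>
  also have "\<dots> \<le> 48 * L * three_halves (t - s)"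
    using L_nonneg by (cases "n = 0") (simp_all add: three_halves_def[of "real n"] power3_eq_cube)
  finally show "expectation (\<lambda>\<omega>. \<bar>W n t \<omega> - W n s \<omega>\<bar> ^ 3) \<le> 48 * L * three_halves (t - s)" .
qed

lemma F_abs: "integrable M (\<lambda>\<omega>. \<bar>F k \<omega>\<bar>)" "expectation (\<lambda>\<omega>. \<bar>F k \<omega>\<bar>) \<le> 1 + L"
proof -
  have le: "\<bar>x\<bar> \<le> 1 + \<bar>x\<bar> ^ 3" for x :: real
  proof (cases "\<bar>x\<bar> \<le> 1")
    case False
    then show ?thesis using power_increasing[of 1 3 "\<bar>x\<bar>"] by simp
  qed (simp add: add_increasing2)
  have i: "integrable M (\<lambda>\<omega>. 1 + \<bar>F k \<omega>\<bar> ^ 3)" using F_cube by simp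
  show 1: "integrable M (\<lambda>\<omega>. \<bar>F k \<omega>\<bar>)"
    by (rule Bochner_Integration.integrable_bound[OF i]) (auto intro!: AE_I2 simp: le)
  have "expectation (\<lambda>\<omega>. \<bar>F k \<omega>\<bar>) \<le> expectation (\<lambda>\<omega>. 1 + \<bar>F k \<omega>\<bar> ^ 3)" by (intro integral_mono 1 i le)
  also have "\<dots> \<le> 1 + L" using F_cube[of k] by (simp add: prob_space)
  finally show "expectation (\<lambda>\<omega>. \<bar>F k \<omega>\<bar>) \<le> 1 + L" .
qed

text \<open>The interpolation differs from the block sums only by fractions of the terms at the
  block ends, whose means are bounded; after division by \<open>sqrt n\<close> they
  disappear.\<close>

lemma W_char_limit:
  assumes t: "0 \<le> t 0" "incseq t"
  shows "(\<lambda>n. expectation (\<lambda>\<omega>. iexp (\<Sum>k<N. v k * (W n (t (Suc k)) \<omega> - W n (t k) \<omega>))))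
      \<longlonglongrightarrow> of_real (exp (- (\<sigma>2 / 2 * (\<Sum>k<N. (v k)\<^sup>2 * (t (Suc k) - t k)))))"
proof -
  have t0: "0 \<le> t k" for k using t incseqD[OF t(2), of 0 k] by simp
  define m where "m n k = nat \<lfloor>real n * t k\<rfloor>" for n k
  have m_mono: "m n k \<le> m n (Suc k)" for n k
    unfolding m_def using incseqD[OF t(2), of k "Suc k"] by (intro nat_mono floor_mono mult_left_mono) auto
  define A where "A n \<omega> = (\<Sum>k<N. v k * (W n (t (Suc k)) \<omega> - W n (t k) \<omega>))" for n \<omega>
  define B where "B n \<omega> = (\<Sum>k<N. v k * ((\<Sum>i\<in>{m n k..<m n (Suc k)}. F i \<omega>) / sqrt (real n)))" for n \<omega>
  have A_meas [measurable]: "A n \<in> borel_measurable M" and B_meas [measurable]: "B n \<in> borel_measurable M" for n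
    unfolding A_def B_def by measurable
  have ints: "integrable M (\<lambda>\<omega>. iexp (A n \<omega>))" "integrable M (\<lambda>\<omega>. iexp (B n \<omega>))" for n
    by (auto intro!: integrable_const_bound[where B=1])
  have AB: "\<bar>A n \<omega> - B n \<omega>\<bar> \<le> (\<Sum>k<N. \<bar>v k\<bar> * (\<bar>F (m n (Suc k)) \<omega>\<bar> + \<bar>F (m n k) \<omega>\<bar>)) / sqrt (real n)" for n \<omega>
  proof -
    have one: "W n (t (Suc k)) \<omega> - W n (t k) \<omega> - (\<Sum>i\<in>{m n k..<m n (Suc k)}. F i \<omega>) / sqrt (real n) =
        ((real n * t (Suc k) - real (m n (Suc k))) * F (m n (Suc k)) \<omega> - (real n * t k - real (m n k)) * F (m n k) \<omega>) / sqrt (real n)" for k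
    proof -
      have "(\<Sum>i<m n (Suc k). F i \<omega>) = (\<Sum>i<m n k. F i \<omega>) + (\<Sum>i\<in>{m n k..<m n (Suc k)}. F i \<omega>)"
        using m_mono[of n k] by (simp only: lessThan_atLeast0 sum.atLeastLessThan_concat[of 0 "m n k" "m n (Suc k)"])
      then show ?thesis unfolding W_def lerp_def m_def[symmetric] by (simp add: diff_divide_distrib add_divide_distrib)
    qed
    have frac: "\<bar>(real n * t k - real (m n k)) * x\<bar> \<le> \<bar>x\<bar>" for k x
    proof -
      have "0 \<le> real n * t k" using t0 by simp
      then have "\<bar>real n * t k - real (m n k)\<bar> \<le> 1"
        using abs_diff_nat_floor_le by (simp add: m_def)
      then show ?thesis unfolding abs_mult using mult_right_mono[of "\<bar>real n * t k - real (m n k)\<bar>" 1 "\<bar>x\<bar>"] by simp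
    qed
    have abs_sqrt: "\<bar>y / sqrt (real n)\<bar> = \<bar>y\<bar> / sqrt (real n)" for y by (simp add: abs_divide)
    have "\<bar>A n \<omega> - B n \<omega>\<bar> = \<bar>\<Sum>k<N. v k * (((real n * t (Suc k) - real (m n (Suc k))) * F (m n (Suc k)) \<omega> -
        (real n * t k - real (m n k)) * F (m n k) \<omega>) / sqrt (real n))\<bar>"
      unfolding A_def B_def sum_subtractf[symmetric] one[symmetric] by (simp add: algebra_simps)
    also have "\<dots> \<le> (\<Sum>k<N. \<bar>v k * (((real n * t (Suc k) - real (m n (Suc k))) * F (m n (Suc k)) \<omega> -
        (real n * t k - real (m n k)) * F (m n k) \<omega>) / sqrt (real n))\<bar>)" by (rule sum_abs)
    also have "\<dots> \<le> (\<Sum>k<N. \<bar>v k\<bar> * ((\<bar>F (m n (Suc k)) \<omega>\<bar> + \<bar>F (m n k) \<omega>\<bar>) / sqrt (real n)))"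
      unfolding abs_mult[of "v _"] abs_sqrt
      by (intro sum_mono mult_left_mono divide_right_mono order_trans[OF abs_triangle_ineq4] add_mono frac) auto
    also have "\<dots> = (\<Sum>k<N. \<bar>v k\<bar> * (\<bar>F (m n (Suc k)) \<omega>\<bar> + \<bar>F (m n k) \<omega>\<bar>)) / sqrt (real n)"
      by (simp add: sum_divide_distrib)
    finally show ?thesis .
  qed
  have "(\<lambda>n. expectation (\<lambda>\<omega>. iexp (A n \<omega>)) - expectation (\<lambda>\<omega>. iexp (B n \<omega>))) \<longlonglongrightarrow> 0"
  proof (rule Lim_null_comparison[OF always_eventually tendsto_const_over_sqrt], rule allI)
    fix n
    have "norm (expectation (\<lambda>\<omega>. iexp (A n \<omega>)) - expectation (\<lambda>\<omega>. iexp (B n \<omega>))) =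
        norm (expectation (\<lambda>\<omega>. iexp (A n \<omega>) - iexp (B n \<omega>)))"
      by (subst Bochner_Integration.integral_diff[OF ints]) simp
    also have "\<dots> \<le> expectation (\<lambda>\<omega>. (\<Sum>k<N. \<bar>v k\<bar> * (\<bar>F (m n (Suc k)) \<omega>\<bar> + \<bar>F (m n k) \<omega>\<bar>)) / sqrt (real n))"
      using F_abs(1) by (intro norm_integral_le) (auto intro!: order_trans[OF norm_iexp_diff_le AB])
    also have "\<dots> = (\<Sum>k<N. \<bar>v k\<bar> * (expectation (\<lambda>\<omega>. \<bar>F (m n (Suc k)) \<omega>\<bar>) + expectation (\<lambda>\<omega>. \<bar>F (m n k) \<omega>\<bar>))) / sqrt (real n)"
      using F_abs(1) by simp
    also have "\<dots> \<le> (\<Sum>k<N. \<bar>v k\<bar> * ((1 + L) + (1 + L))) / sqrt (real n)"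
      by (intro divide_right_mono sum_mono mult_left_mono add_mono F_abs) auto
    finally show "norm (expectation (\<lambda>\<omega>. iexp (A n \<omega>)) - expectation (\<lambda>\<omega>. iexp (B n \<omega>))) \<le>
        (\<Sum>k<N. \<bar>v k\<bar> * ((1 + L) + (1 + L))) / sqrt (real n)" .
  qed
  from tendsto_add[OF this sums_char_limit[OF t, where N=N and v=v, folded m_def, folded B_def]]
  show ?thesis by (simp add: A_def)
qed

text \<open>A union bound over order n terms, each with probability of order n^(-3/2) by Markov's
  inequality for the third moment.\<close>

lemma remainder_limit:
  assumes T: "0 \<le> T" and \<delta>: "0 < \<delta>"
  shows "(\<lambda>n. prob {\<omega> \<in> space M. \<exists>k\<le>nat \<lfloor>real n * T\<rfloor>. \<delta> * sqrt (real n) \<le> \<bar>F k \<omega>\<bar>}) \<longlonglongrightarrow> 0"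
proof (rule Lim_null_comparison[OF _ tendsto_const_over_sqrt])
  show "\<forall>\<^sub>F n in sequentially. norm (prob {\<omega> \<in> space M. \<exists>k\<le>nat \<lfloor>real n * T\<rfloor>. \<delta> * sqrt (real n) \<le> \<bar>F k \<omega>\<bar>}) \<le>
      ((T + 1) * L / \<delta> ^ 3) / sqrt (real n)"
    using eventually_gt_at_top[of 0]
  proof eventually_elim
    case (elim n)
    let ?N = "nat \<lfloor>real n * T\<rfloor>"
    have one: "prob {\<omega> \<in> space M. \<delta> * sqrt (real n) \<le> \<bar>F k \<omega>\<bar>} \<le> L / (\<delta> * sqrt (real n)) ^ 3" for k
    proof -
      have "prob {\<omega> \<in> space M. \<delta> * sqrt (real n) \<le> \<bar>F k \<omega>\<bar>} \<le> prob {\<omega> \<in> space M. (\<delta> * sqrt (real n)) ^ 3 \<le> \<bar>F k \<omega>\<bar> ^ 3}"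
        using \<delta> by (intro finite_measure_mono) (auto intro!: power_mono)
      also have "\<dots> \<le> expectation (\<lambda>\<omega>. \<bar>F k \<omega>\<bar> ^ 3) / (\<delta> * sqrt (real n)) ^ 3"
        using elim \<delta> F_cube by (intro integral_Markov_inequality_measure[where A="{}"]) auto
      also have "\<dots> \<le> L / (\<delta> * sqrt (real n)) ^ 3" using F_cube[of k] \<delta> by (intro divide_right_mono) auto
      finally show ?thesis .
    qed
    have "{\<omega> \<in> space M. \<exists>k\<le>?N. \<delta> * sqrt (real n) \<le> \<bar>F k \<omega>\<bar>} = (\<Union>k\<le>?N. {\<omega> \<in> space M. \<delta> * sqrt (real n) \<le> \<bar>F k \<omega>\<bar>})" by auto
    also have "prob \<dots> \<le> (\<Sum>k\<le>?N. prob {\<omega> \<in> space M. \<delta> * sqrt (real n) \<le> \<bar>F k \<omega>\<bar>})"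
      by (rule finite_measure_subadditive_finite) auto
    also have "\<dots> \<le> (\<Sum>k\<le>?N. L / (\<delta> * sqrt (real n)) ^ 3)" by (intro sum_mono one)
    also have "\<dots> = (real ?N + 1) * (L / (\<delta> * sqrt (real n)) ^ 3)" by simp
    also have "\<dots> \<le> (real n * (T + 1)) * (L / (\<delta> * sqrt (real n)) ^ 3)"
    proof (rule mult_right_mono)
      have "real ?N \<le> real n * T" using T by simp
      then show "real ?N + 1 \<le> real n * (T + 1)" using elim by (simp add: distrib_left)
    qed (use L_nonneg \<delta> in auto)
    also have "\<dots> = ((T + 1) * L / \<delta> ^ 3) / sqrt (real n)"
      using elim \<delta> by (simp add: power3_eq_cube field_simps)
    finally show ?case by simp
  qed
qed

end

section \<open>The Zig-Zag kernel and its invariant measure\<close>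

definition flip :: "'d \<Rightarrow> 'd::finite lattice \<Rightarrow> 'd lattice" where
  "flip i v = (\<chi> j. if j = i then - (v $ j) else v $ j)"

lemma flip_nth: "flip i v $ j = (if j = i then - (v $ j) else v $ j)"
  by (simp add: flip_def)

lemma flip_flip [simp]: "flip i (flip i v) = v"
  by (simp add: vec_eq_iff flip_nth)

lemma flip_eq_iff: "flip i v = w \<longleftrightarrow> v = flip i w"
  by auto

lemma velocitiesD: "v \<in> velocities \<Longrightarrow> v $ i = 1 \<or> v $ i = - 1"
  by (auto simp: velocities_def)

lemma flip_velocities [simp]: "flip i v \<in> velocities \<longleftrightarrow> v \<in> velocities"
proof -
  have "(if j = i then - a else a) \<in> {-1, 1} \<longleftrightarrow> a \<in> {-1, 1}" for a :: int and j by auto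
  then show ?thesis by (simp only: velocities_def mem_Collect_eq flip_nth)
qed

lemma axis_0 [simp]: "axis i (0 :: int) = 0"
  by (rule axis_eq_0_iff[THEN iffD2]) simp

lemma finite_lattice_box:
  assumes "finite A"
  shows "finite {x :: 'd::finite lattice. \<forall>i. x $ i \<in> A}"
proof (rule finite_subset)
  show "{x :: 'd lattice. \<forall>i. x $ i \<in> A} \<subseteq> (\<lambda>f. \<chi> i. f i) ` (PiE UNIV (\<lambda>_. A))"
    by (auto intro!: image_eqI[of _ _ "\<lambda>i. _ $ i"])
  show "finite ((\<lambda>f. \<chi> i. f i) ` (PiE (UNIV :: 'd set) (\<lambda>_. A)))"
    using assms by (intro finite_imageI finite_PiE) auto
qed

lemma finite_velocities: "finite velocities"
  unfolding velocities_def by (rule finite_lattice_box) simp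

lemma one_in_velocities: "(\<chi> i. 1) \<in> velocities"
  by (simp add: velocities_def)

section \<open>Moves of one coordinate and their composition\<close>

lemma zz_q_bounds: "0 < zz_q U i x a" "zz_q U i x a \<le> 1"
  by (auto simp: zz_q_def)

text \<open>The kernel is the composition of these moves in the order of the coordinates: the factor
  for \<open>i\<close> sees the displacements of all smaller coordinates. Invariance and drift can
  therefore be checked for one coordinate at a time.\<close>

definition coord_step ::
  "('d::finite lattice \<Rightarrow> real) \<Rightarrow> 'd \<Rightarrow> 'd lattice \<times> 'd lattice \<Rightarrow> ('d lattice \<times> 'd lattice) pmf" where
  "coord_step U i = (\<lambda>(x, v). map_pmf (\<lambda>b. if b then (x + axis i (v $ i), v) else (x, flip i v))
     (bernoulli_pmf (zz_q U i x (v $ i))))"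

lemma finite_coord_step: "finite (set_pmf (coord_step U i s))"
  by (auto simp: coord_step_def split: prod.splits)

lemma expectation_coord_step:
  "measure_pmf.expectation (coord_step U i (x, v)) f =
    zz_q U i x (v $ i) * f (x + axis i (v $ i), v) + (1 - zz_q U i x (v $ i)) * f (x, flip i v)"
  for f :: "_ \<Rightarrow> real"
proof -
  have "measure_pmf.expectation (bernoulli_pmf p) g = p * g True + (1 - p) * g False"
    if "0 \<le> p" "p \<le> 1" for p and g :: "bool \<Rightarrow> real"
    using that by (subst integral_measure_pmf[of UNIV]) (auto simp: UNIV_bool)
  then show ?thesis
    using zz_q_bounds[of U i x "v $ i"] by (simp add: coord_step_def less_imp_le)
qed

lemma pmf_coord_step:
  "pmf (coord_step U i (x, v)) (y, w) =
    zz_q U i x (v $ i) * of_bool ((x, v) = (y - axis i (w $ i), w)) +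
    (1 - zz_q U i x (v $ i)) * of_bool ((x, v) = (y, flip i w))"
proof -
  have "pmf (coord_step U i (x, v)) (y, w) = measure_pmf.expectation (coord_step U i (x, v)) (indicator {(y, w)})"
    by (simp add: measure_pmf_single)
  also have "\<dots> = zz_q U i x (v $ i) * of_bool ((x, v) = (y - axis i (w $ i), w)) +
    (1 - zz_q U i x (v $ i)) * of_bool ((x, v) = (y, flip i w))"
    unfolding expectation_coord_step by (auto simp: indicator_def flip_eq_iff)
  finally show ?thesis .
qed

text \<open>The state \<open>(y, w)\<close> has two predecessors, one that advanced and one that
  flipped; the latter had velocity \<open>- (w $ i)\<close> in this coordinate.\<close>

lemma pmf_bind_coord_step:
  "pmf (bind_pmf p (coord_step U i)) (y, w) =
    pmf p (y - axis i (w $ i), w) * zz_q U i (y - axis i (w $ i)) (w $ i) +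
    pmf p (y, flip i w) * (1 - zz_q U i y (- (w $ i)))"
proof -
  let ?a = "(y - axis i (w $ i), w)" and ?b = "(y, flip i w)"
  have "pmf (bind_pmf p (coord_step U i)) (y, w) = measure_pmf.expectation p (\<lambda>s. pmf (coord_step U i s) (y, w))"
    by (rule pmf_bind)
  also have "(\<lambda>s. pmf (coord_step U i s) (y, w)) =
      (\<lambda>s. zz_q U i (y - axis i (w $ i)) (w $ i) * indicator {?a} s + (1 - zz_q U i y (- (w $ i))) * indicator {?b} s)"
    by (auto simp: fun_eq_iff pmf_coord_step indicator_def flip_nth axis_eq_0_iff[THEN iffD2])
  also have "measure_pmf.expectation p \<dots> =
      zz_q U i (y - axis i (w $ i)) (w $ i) * pmf p ?a + (1 - zz_q U i y (- (w $ i))) * pmf p ?b"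
    by (simp add: measure_pmf_single integrable_measure_pmf_finite
        Bochner_Integration.integral_add measure_pmf.integrable_const_bound[where B=1])
  finally show ?thesis by (simp add: mult.commute)
qed

definition coord_steps ::
  "('d::finite lattice \<Rightarrow> real) \<Rightarrow> 'd list \<Rightarrow> 'd lattice \<times> 'd lattice \<Rightarrow> ('d lattice \<times> 'd lattice) pmf" where
  "coord_steps U is s = foldl (\<lambda>p i. bind_pmf p (coord_step U i)) (return_pmf s) is"

lemma coord_steps_Nil [simp]: "coord_steps U [] s = return_pmf s"
  by (simp add: coord_steps_def)

lemma coord_steps_snoc [simp]: "coord_steps U (is @ [i]) s = bind_pmf (coord_steps U is s) (coord_step U i)"
  by (simp add: coord_steps_def)

lemma finite_coord_steps: "finite (set_pmf (coord_steps U is s))"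
  by (induction "is" rule: rev_induct) (auto simp: finite_coord_step)

lemma coord_steps_velocities:
  "snd s \<in> velocities \<Longrightarrow> t \<in> set_pmf (coord_steps U is s) \<Longrightarrow> snd t \<in> velocities"
  by (induction "is" arbitrary: t rule: rev_induct) (auto simp: coord_step_def split: prod.splits if_splits)

text \<open>Induction on the largest coordinate \<open>b\<close>, which moves last. All others are
  smaller, so it sees their total displacement, and flipping the target velocity at \<open>b\<close>
  leaves the earlier factors unchanged.\<close>

lemma pmf_coord_steps:
  fixes U :: "'d::{finite,linorder} lattice \<Rightarrow> real"
  assumes v: "v \<in> velocities"
  shows "sorted_wrt (<) is \<Longrightarrow> pmf (coord_steps U is (x, v)) (y, w) =
    (\<Prod>i\<in>set is. zz_p_coord U i (x + (\<Sum>j\<in>{j \<in> set is. j < i}. axis j ((v $ j + w $ j) div 2))) (v $ i) (w $ i)) *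
    of_bool (y = x + (\<Sum>j\<in>set is. axis j ((v $ j + w $ j) div 2)) \<and> (\<forall>j. j \<notin> set is \<longrightarrow> w $ j = v $ j))"
proof (induction "is" arbitrary: y w rule: rev_induct)
  case Nil
  then show ?case by (auto simp: vec_eq_iff indicator_def)
next
  case (snoc b "is")
  define A where "A = set is"
  have A: "\<And>i. i \<in> A \<Longrightarrow> i < b" and sorted: "sorted_wrt (<) is"
    using snoc.prems by (auto simp: A_def sorted_wrt_append)
  have bA: "b \<notin> A" using A by blast
  define pos where "pos w i = x + (\<Sum>j\<in>{j \<in> A. j < i}. axis j ((v $ j + w $ j) div 2))" for w i
  define tot where "tot w = x + (\<Sum>j\<in>A. axis j ((v $ j + w $ j) div 2))" for w
  define P where "P w = (\<Prod>i\<in>A. zz_p_coord U i (pos w i) (v $ i) (w $ i))" for w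
  have IH: "pmf (coord_steps U is (x, v)) (y, w) = P w * of_bool (y = tot w \<and> (\<forall>j. j \<notin> A \<longrightarrow> w $ j = v $ j))" for y w
    using snoc.IH[OF sorted] by (simp add: P_def pos_def tot_def A_def)
  have pos_flip: "pos (flip b w) i = pos w i" and tot_flip: "tot (flip b w) = tot w" for w i
    unfolding pos_def tot_def using bA
    by (intro arg_cong2[where f="(+)"] sum.cong refl, auto simp: flip_nth)+
  have P_flip: "P (flip b w) = P w" for w
    unfolding P_def pos_flip using bA by (intro prod.cong refl) (auto simp: flip_nth)
  have set: "set (is @ [b]) = insert b A" by (simp add: A_def)
  have finA: "finite A" by (simp add: A_def)
  have prod: "(\<Prod>i\<in>insert b A. zz_p_coord U i (x + (\<Sum>j\<in>{j \<in> insert b A. j < i}. axis j ((v $ j + w $ j) div 2))) (v $ i) (w $ i)) =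
      zz_p_coord U b (tot w) (v $ b) (w $ b) * P w"
  proof -
    have "{j \<in> insert b A. j < i} = {j \<in> A. j < i}" if "i \<in> A" for i using A[OF that] by auto
    moreover have "{j \<in> insert b A. j < b} = A" using A by auto
    ultimately show ?thesis
      using finA bA unfolding P_def pos_def tot_def by (simp cong: prod.cong)
  qed
  have sum: "x + (\<Sum>j\<in>insert b A. axis j ((v $ j + w $ j) div 2)) = tot w + axis b ((v $ b + w $ b) div 2)"
    using finA bA by (simp add: tot_def add_ac)
  have fl: "(\<forall>j. j \<notin> A \<longrightarrow> flip b w $ j = v $ j) \<longleftrightarrow> w $ b = - (v $ b) \<and> (\<forall>j. j \<notin> insert b A \<longrightarrow> w $ j = v $ j)"
    using bA by (auto simp: flip_nth)
  have st: "(\<forall>j. j \<notin> A \<longrightarrow> w $ j = v $ j) \<longleftrightarrow> w $ b = v $ b \<and> (\<forall>j. j \<notin> insert b A \<longrightarrow> w $ j = v $ j)"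
    using bA by auto
  have "pmf (coord_steps U (is @ [b]) (x, v)) (y, w) =
      P w * of_bool (y - axis b (w $ b) = tot w \<and> w $ b = v $ b \<and> (\<forall>j. j \<notin> insert b A \<longrightarrow> w $ j = v $ j)) *
        zz_q U b (y - axis b (w $ b)) (w $ b) +
      P w * of_bool (y = tot w \<and> w $ b = - (v $ b) \<and> (\<forall>j. j \<notin> insert b A \<longrightarrow> w $ j = v $ j)) *
        (1 - zz_q U b y (- (w $ b)))"
    unfolding coord_steps_snoc pmf_bind_coord_step IH tot_flip P_flip fl st ..
  also have "\<dots> = zz_p_coord U b (tot w) (v $ b) (w $ b) * P w *
      of_bool (y = tot w + axis b ((v $ b + w $ b) div 2) \<and> (\<forall>j. j \<notin> insert b A \<longrightarrow> w $ j = v $ j))"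
  proof -
    \<comment> \<open>The velocity is not zero, so keeping and flipping exclude each other; in the
      third case both sides vanish.\<close>
    consider "w $ b = v $ b" "w $ b \<noteq> - (v $ b)" | "w $ b = - (v $ b)" "w $ b \<noteq> v $ b" | "w $ b \<noteq> - (v $ b)" "w $ b \<noteq> v $ b"
      using velocitiesD[OF v, of b] by force
    then show ?thesis
    proof cases
      case 1
      have "y - axis b (v $ b) = tot w \<longleftrightarrow> y = tot w + axis b (v $ b)" by (auto simp: algebra_simps)
      then show ?thesis using 1 by (auto simp: zz_p_coord_def)
    next
      case 2
      then show ?thesis by (auto simp: zz_p_coord_def)
    next
      case 3
      then show ?thesis by (auto simp: zz_p_coord_def)
    qed
  qed
  finally show ?case unfolding set prod sum .
qed

definition zz_pmf ::
  "('d::{finite,linorder} lattice \<Rightarrow> real) \<Rightarrow> 'd lattice \<times> 'd lattice \<Rightarrow> ('d lattice \<times> 'd lattice) pmf" where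
  "zz_pmf U = coord_steps U (sorted_list_of_set UNIV)"

lemma pmf_zz_pmf:
  fixes U :: "'d::{finite,linorder} lattice \<Rightarrow> real"
  assumes "snd s \<in> velocities"
  shows "pmf (zz_pmf U s) t = zz_kernel U s t"
proof -
  obtain x v y w where st: "s = (x, v)" "t = (y, w)" by (cases s, cases t) auto
  have "(\<Sum>j\<in>UNIV. axis j (f j)) = (\<chi> i. f i)" for f :: "'d \<Rightarrow> int"
    by (simp add: vec_eq_iff axis_def)
  then show ?thesis
    using pmf_coord_steps[of v "sorted_list_of_set UNIV" U x y w] assms
    by (simp add: st zz_pmf_def zz_kernel_def zz_p_def lessThan_def strict_sorted_list_of_set)
qed

lemma finite_zz_pmf: "finite (set_pmf (zz_pmf U s))"
  unfolding zz_pmf_def by (rule finite_coord_steps)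

lemma zz_pmf_support:
  assumes v: "v \<in> velocities" and t: "(y, w) \<in> set_pmf (zz_pmf U (x, v))"
  shows "w \<in> velocities"
    and "w $ i = v $ i \<and> y $ i = x $ i + v $ i \<or> w $ i = - (v $ i) \<and> y $ i = x $ i"
proof -
  show "w \<in> velocities"
    using coord_steps_velocities[of "(x, v)" "(y, w)"] v t by (simp add: zz_pmf_def)
  have "zz_kernel U (x, v) (y, w) \<noteq> 0"
    using t v by (simp add: set_pmf_iff pmf_zz_pmf)
  then have y: "y = x + (\<chi> i. (v $ i + w $ i) div 2)" and "zz_p U x v w \<noteq> 0"
    by (auto simp: zz_kernel_def split: if_splits)
  then have "zz_p_coord U i (x + (\<Sum>j\<in>{..<i}. axis j ((v $ j + w $ j) div 2))) (v $ i) (w $ i) \<noteq> 0"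
    by (simp add: zz_p_def)
  then have "w $ i = v $ i \<or> w $ i = - (v $ i)"
    by (rule contrapos_np) (simp add: zz_p_coord_def)
  then show "w $ i = v $ i \<and> y $ i = x $ i + v $ i \<or> w $ i = - (v $ i) \<and> y $ i = x $ i"
    using y by auto
qed

text \<open>When coordinate \<open>i\<close> moves, the smaller coordinates have already changed
  while \<open>x $ i\<close> has not. A flip is therefore asked to be possible at every point with
  this \<open>i\<close>-th coordinate.\<close>

lemma zz_pmf_supportI:
  assumes v: "v \<in> velocities"
    and step: "\<And>i. w $ i = v $ i \<and> y $ i = x $ i + v $ i \<or>
      w $ i = - (v $ i) \<and> y $ i = x $ i \<and> (\<forall>x'. x' $ i = x $ i \<longrightarrow> zz_q U i x' (v $ i) < 1)"
  shows "(y, w) \<in> set_pmf (zz_pmf U (x, v))"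
proof -
  have "y = x + (\<chi> i. (v $ i + w $ i) div 2)"
    unfolding vec_eq_iff
  proof
    fix i show "y $ i = (x + (\<chi> i. (v $ i + w $ i) div 2)) $ i" using step[of i] by auto
  qed
  moreover have "0 < zz_p U x v w"
    unfolding zz_p_def
  proof (rule prod_pos)
    fix i
    let ?x = "x + (\<Sum>j\<in>{..<i}. axis j ((v $ j + w $ j) div 2))"
    have "(\<Sum>j\<in>{..<i}. axis j ((v $ j + w $ j) div 2)) $ i = 0"
      unfolding sum_component by (rule sum.neutral) (auto simp: axis_def)
    then have "?x $ i = x $ i" by simp
    then show "0 < zz_p_coord U i ?x (v $ i) (w $ i)"
      using step[of i] zz_q_bounds(1)[of U i ?x "v $ i"] velocitiesD[OF v, of i] unfolding zz_p_coord_def by force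
  qed
  ultimately have "zz_kernel U (x, v) (y, w) \<noteq> 0" by (simp add: zz_kernel_def)
  then show ?thesis using v by (simp add: set_pmf_iff pmf_zz_pmf)
qed

section \<open>Invariance of the Gibbs measure with uniform velocities\<close>

context
  fixes U :: "'d::{finite,linorder} lattice \<Rightarrow> real"
  assumes summable_U: "(\<lambda>y. exp (- U y)) summable_on UNIV"
begin

lemma partition_pos: "0 < (\<Sum>\<^sub>\<infinity>y. exp (- U y))"
proof -
  have "exp (- U 0) \<le> (\<Sum>\<^sub>\<infinity>y. exp (- U y))"
    using finite_sum_le_infsum[OF summable_U, of "{0}"] by simp
  then show ?thesis using exp_gt_zero[of "- U 0"] by linarith
qed

lemma gibbs_pos: "0 < gibbs U x"
  unfolding gibbs_def using partition_pos by simp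

definition gibbs_pmf :: "'d lattice pmf" where
  "gibbs_pmf = embed_pmf (gibbs U)"

lemma pmf_gibbs_pmf [simp]: "pmf gibbs_pmf x = gibbs U x"
  unfolding gibbs_pmf_def
proof (rule pmf_embed_pmf)
  have "(gibbs U has_sum 1) UNIV"
    using has_sum_divide_const[OF has_sum_infsum[OF summable_U], of "\<Sum>\<^sub>\<infinity>y. exp (- U y)"] partition_pos
    unfolding gibbs_def[abs_def] by simp
  then have s: "gibbs U summable_on UNIV" "infsum (gibbs U) UNIV = 1"
    by (auto simp: has_sum_imp_summable infsumI)
  then have a: "Infinite_Set_Sum.abs_summable_on (gibbs U) UNIV"
    using gibbs_pos by (simp add: abs_summable_equivalent[symmetric] less_imp_le)
  show "(\<integral>\<^sup>+x. ennreal (gibbs U x) \<partial>count_space UNIV) = 1"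
    using nn_integral_conv_infsetsum[OF a] infsetsum_infsum[OF a] s gibbs_pos by (simp add: less_imp_le)
qed (simp add: gibbs_pos less_imp_le)

lemma expectation_gibbs_pmf:
  assumes "integrable (measure_pmf gibbs_pmf) f"
  shows "measure_pmf.expectation gibbs_pmf f = gibbs_mean U f"
proof -
  have "Infinite_Set_Sum.abs_summable_on (\<lambda>x. f x * gibbs U x) UNIV"
    using assms unfolding Infinite_Set_Sum.abs_summable_on_def
    by (subst (asm) measure_pmf_eq_density, subst (asm) integrable_density)
       (auto simp: gibbs_pos less_imp_le mult.commute)
  then show ?thesis
    using pmf_expectation_eq_infsetsum[of gibbs_pmf f] by (simp add: gibbs_mean_def infsetsum_infsum mult.commute)
qed

definition joint_pmf :: "('d lattice \<times> 'd lattice) pmf" where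
  "joint_pmf = pair_pmf gibbs_pmf (pmf_of_set velocities)"

lemma pmf_joint_pmf: "pmf joint_pmf (x, v) = gibbs U x * (of_bool (v \<in> velocities) / card (velocities :: 'd lattice set))"
proof -
  have "(velocities :: 'd lattice set) \<noteq> {}" using one_in_velocities by blast
  then have "pmf (pmf_of_set velocities) v = indicator velocities v / card (velocities :: 'd lattice set)"
    by (rule pmf_of_set[OF _ finite_velocities])
  then show ?thesis
    by (simp add: joint_pmf_def pmf_pair indicator_def)
qed

lemma set_joint_pmf: "(x, v) \<in> set_pmf joint_pmf \<Longrightarrow> v \<in> velocities"
  by (auto simp: set_pmf_iff pmf_joint_pmf split: if_splits)

text \<open>Both sides are \<open>exp (- max (U x) (U (x + axis i a)))\<close> divided by the
  partition sum, which is symmetric in the two end points.\<close>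

lemma gibbs_balance: "gibbs U x * zz_q U i x a = gibbs U (x + axis i a) * zz_q U i (x + axis i a) (- a)"
proof -
  have "axis i a + axis i (- a) = 0" for a :: int by (simp add: vec_eq_iff axis_def)
  then have eq: "x + axis i a + axis i (- a) = x" by (metis add.assoc add.right_neutral)
  show ?thesis
    unfolding gibbs_def zz_q_def eq by (simp add: exp_add[symmetric] max_def)
qed

text \<open>Detailed balance holds up to reversal of the velocity: the mass advancing into
  \<open>(y, w)\<close> equals the mass that would advance out of \<open>y\<close> with the opposite
  velocity, and this is what the mass flipping at \<open>y\<close> lacks.\<close>

lemma invariant_coord_step: "bind_pmf joint_pmf (coord_step U i) = joint_pmf"
proof (rule pmf_eqI)
  fix t :: "'d lattice \<times> 'd lattice"
  obtain y w where t: "t = (y, w)" by (cases t)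
  have "gibbs U (y - axis i (w $ i)) * zz_q U i (y - axis i (w $ i)) (w $ i) = gibbs U y * zz_q U i y (- (w $ i))"
    using gibbs_balance[of "y - axis i (w $ i)" i "w $ i"] by simp
  then have "gibbs U (y - axis i (w $ i)) * c * zz_q U i (y - axis i (w $ i)) (w $ i) +
      gibbs U y * c * (1 - zz_q U i y (- (w $ i))) = gibbs U y * c" for c
    by (simp add: algebra_simps)
  then show "pmf (bind_pmf joint_pmf (coord_step U i)) t = pmf joint_pmf t"
    unfolding t pmf_bind_coord_step pmf_joint_pmf flip_velocities .
qed

lemma invariant_zz_pmf: "bind_pmf joint_pmf (zz_pmf U) = joint_pmf"
proof -
  have "bind_pmf joint_pmf (coord_steps U is) = joint_pmf" for "is"
  proof (induction "is" rule: rev_induct)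
    case (snoc i "is")
    then show ?case
      using bind_assoc_pmf[of joint_pmf "coord_steps U is" "coord_step U i"] by (simp add: invariant_coord_step)
  qed (simp add: bind_return_pmf')
  then show ?thesis by (simp add: zz_pmf_def)
qed

end

section \<open>Drift and accessibility of the Zig-Zag walk\<close>

text \<open>
  The Lyapunov function weighs inward velocities by the factor \<open>damping h \<theta>\<close>.  An outward velocity is
  kept with probability at most \<open>exp (- h)\<close>, so its weight is multiplied in the mean by at most
  \<open>exp (\<theta> - h) + damping h \<theta> = (1 + exp (\<theta> - h)) / 2 < 1\<close>.
\<close>

definition damping :: "real \<Rightarrow> real \<Rightarrow> real" where
  "damping h \<theta> = (1 - exp (\<theta> - h)) / 2"

lemma damping_bounds:
  assumes "\<theta> < h"
  shows "0 < damping h \<theta>" "damping h \<theta> \<le> 1"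
proof -
  show "0 < damping h \<theta>" using assms by (simp add: damping_def)
  have "- 1 \<le> exp (\<theta> - h)" by (rule order_trans[of _ 0]) simp_all
  then show "damping h \<theta> \<le> 1" by (simp add: damping_def)
qed

definition coord_lyap :: "real \<Rightarrow> real \<Rightarrow> int \<Rightarrow> int \<Rightarrow> real" where
  "coord_lyap h \<theta> a s = exp (\<theta> * \<bar>real_of_int a\<bar>) * (if 0 < s * a then 1 else damping h \<theta>)"

text \<open>Moves of a position and velocity that have positive probability whatever the other
  coordinates do: keep the velocity, or flip it beyond \<open>R\<close> when it points
  outwards.\<close>

definition coord_allowed :: "real \<Rightarrow> int \<times> int \<Rightarrow> int \<times> int \<Rightarrow> bool" where
  "coord_allowed R = (\<lambda>(a, s) (b, r). r = s \<and> b = a + s \<or> r = - s \<and> b = a \<and> R < real_of_int (s * a))"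

lemma coord_allowed_moves:
  "(coord_allowed R ^^ k) (a, s) (a + int k * s, s)"
proof (induction k)
  case (Suc k)
  have "coord_allowed R (a + int k * s, s) (a + int (Suc k) * s, s)"
    by (simp add: coord_allowed_def algebra_simps)
  then show ?case by (rule relpowp_Suc_I[OF Suc])
qed simp

text \<open>The path takes \<open>m\<close> steps in its direction, flips, and returns. The turning
  point is at distance \<open>s * a + m\<close> from 0, whence the duration
  \<open>m + 1 + (s * a + m)\<close>.\<close>

lemma coord_allowed_excursion:
  assumes s: "s = 1 \<or> s = - 1" and m: "R < real_of_int (s * a + int m)" "0 \<le> s * a + int m"
  shows "(coord_allowed R ^^ nat (2 * int m + 1 + s * a)) (a, s) (0, - s)"
proof -
  define k where "k = nat (s * a + int m)"
  have pos: "a + int m * s = s * int k"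
    using s m(2) by (auto simp: k_def)
  have "s * (a + int m * s) = s * a + int m" using s by (auto simp: algebra_simps)
  then have "R < real_of_int (s * (a + int m * s))" using m(1) by (simp only:)
  then have "coord_allowed R (a + int m * s, s) (s * int k, - s)"
    unfolding coord_allowed_def prod.case using pos by metis
  then have "(coord_allowed R ^^ Suc m) (a, s) (s * int k, - s)"
    by (rule relpowp_Suc_I[OF coord_allowed_moves])
  moreover have "(coord_allowed R ^^ k) (s * int k, - s) (0, - s)"
    using coord_allowed_moves[of k R "s * int k" "- s"] by (simp add: algebra_simps)
  ultimately have "(coord_allowed R ^^ (Suc m + k)) (a, s) (0, - s)"
    unfolding relpowp_add by blast
  moreover have "Suc m + k = nat (2 * int m + 1 + s * a)" using m(2) by (simp add: k_def)
  ultimately show ?thesis by (simp only:)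
qed

text \<open>Two excursions have the other parity than one, so that every large time is attained.\<close>

lemma coord_allowed_reach:
  assumes s: "s = 1 \<or> s = - 1"
  shows "\<exists>n0. \<forall>n\<ge>n0. \<exists>r. (coord_allowed R ^^ n) (a, s) (0, r)"
proof -
  \<comment> \<open>Far enough to get beyond \<open>R\<close> both from \<open>a\<close> and from 0,
    with either velocity.\<close>
  define m where "m = nat (\<lceil>\<bar>R\<bar>\<rceil> + 1 + \<bar>a\<bar>)"
  have m: "R < real_of_int (s * a + int (m + j))" "0 \<le> s * a + int (m + j)" "R < real_of_int (r * 0 + int (m + j))" for j r
  proof -
    have 1: "\<bar>R\<bar> < real_of_int (\<lceil>\<bar>R\<bar>\<rceil> + 1)" by linarith
    have 2: "\<lceil>\<bar>R\<bar>\<rceil> + 1 \<le> s * a + int (m + j)" "\<lceil>\<bar>R\<bar>\<rceil> + 1 \<le> int (m + j)"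
      using s by (auto simp: m_def)
    have 3: "0 \<le> \<lceil>\<bar>R\<bar>\<rceil> + 1" using 1 by linarith
    show "0 \<le> s * a + int (m + j)" using 2 3 by linarith
    show "R < real_of_int (s * a + int (m + j))" "R < real_of_int (r * 0 + int (m + j))"
      using 1 2 by linarith+
  qed
  define B where "B = nat (2 * int m + 1 + s * a)"
  have B: "int B = 2 * int m + 1 + s * a" using m(2)[of 0] by (simp add: B_def)
  \<comment> \<open>Turning \<open>j\<close> units later lengthens the excursion by
    \<open>2 * j\<close>; one excursion thus attains all large times of one parity.\<close>
  have one: "(coord_allowed R ^^ (B + 2 * j)) (a, s) (0, - s)" for j
  proof -
    have "2 * int (m + j) + 1 + s * a = int (B + 2 * j)" using B by simp
    then have "nat (2 * int (m + j) + 1 + s * a) = B + 2 * j" by (simp only: nat_int)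
    then show ?thesis using coord_allowed_excursion[OF s m(1,2)[of j]] by simp
  qed
  have two: "(coord_allowed R ^^ (B + (2 * m + 1 + 2 * j))) (a, s) (0, s)" for j
  proof -
    have "(coord_allowed R ^^ (2 * m + 1 + 2 * j)) (0, - s) (0, s)"
    proof -
      have "2 * int (m + j) + 1 + (- s) * 0 = int (2 * m + 1 + 2 * j)" by simp
      then have "nat (2 * int (m + j) + 1 + (- s) * 0) = 2 * m + 1 + 2 * j" by (simp only: nat_int)
      moreover have "(coord_allowed R ^^ nat (2 * int (m + j) + 1 + (- s) * 0)) (0, - s) (0, - (- s))"
        using s m(3)[of "- s" j] by (intro coord_allowed_excursion) auto
      ultimately show ?thesis by (simp only: minus_minus)
    qed
    then show ?thesis using one[of 0] unfolding relpowp_add[of B] by auto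
  qed
  show ?thesis
  proof (intro exI[of _ "B + 2 * m + 1"] allI impI)
    fix n assume n: "B + 2 * m + 1 \<le> n"
    show "\<exists>r. (coord_allowed R ^^ n) (a, s) (0, r)"
    proof (cases "even (n - B)")
      case True
      then obtain j where "n = B + 2 * j" using n by (elim evenE) (metis add_diff_inverse_nat add_leD1 not_less)
      then show ?thesis using one by blast
    next
      case False
      then have "even (n - (B + 2 * m + 1))" using n by (simp add: even_diff_nat)
      then obtain j where "n - (B + 2 * m + 1) = 2 * j" by (elim evenE)
      then have "n = B + (2 * m + 1 + 2 * j)" using n by linarith
      then show ?thesis using two by blast
    qed
  qed
qed

section \<open>Parity classes\<close>

definition sgn_parity :: "int \<Rightarrow> int" where
  "sgn_parity a = (if even a then 1 else - 1)"

text \<open>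
  The walk alternates between the half classes for \<open>e = 1\<close> and \<open>e = - 1\<close>: every coordinate of
  \<open>v\<close> times the parity of \<open>x\<close> changes its sign at each step.
\<close>

definition half_class :: "'d::finite lattice \<Rightarrow> int \<Rightarrow> ('d lattice \<times> 'd lattice) set" where
  "half_class c e = {(x, v). v \<in> velocities \<and> (\<forall>i. v $ i * sgn_parity (x $ i) = e * c $ i)}"

definition parity_class :: "'d::finite lattice \<Rightarrow> ('d lattice \<times> 'd lattice) set" where
  "parity_class c = half_class c 1 \<union> half_class c (- 1)"

lemma half_class_step:
  fixes U :: "'d::{finite,linorder} lattice \<Rightarrow> real"
  assumes v: "snd s \<in> velocities" and t: "t \<in> set_pmf (zz_pmf U s)"
  shows "t \<in> half_class c (- e) \<longleftrightarrow> s \<in> half_class c e"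
proof -
  obtain x v y w where st: "s = (x, v)" "t = (y, w)" by (cases s, cases t) auto
  have v': "v \<in> velocities" and t': "(y, w) \<in> set_pmf (zz_pmf U (x, v))" using v t st by auto
  have "w $ i * sgn_parity (y $ i) = - (v $ i * sgn_parity (x $ i))" for i
    using zz_pmf_support(2)[OF v' t', of i] velocitiesD[OF v', of i] by (auto simp: sgn_parity_def)
  then show ?thesis
    using v' zz_pmf_support(1)[OF v' t'] by (simp add: st half_class_def)
qed

lemma parity_class_step:
  fixes U :: "'d::{finite,linorder} lattice \<Rightarrow> real"
  assumes "snd s \<in> velocities" "t \<in> set_pmf (zz_pmf U s)"
  shows "t \<in> parity_class c \<longleftrightarrow> s \<in> parity_class c"
  using half_class_step[OF assms, of c 1] half_class_step[OF assms, of c "- 1"]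
  by (auto simp: parity_class_def)

lemma parity_class_velocities: "s \<in> parity_class c \<Longrightarrow> snd s \<in> velocities"
  by (auto simp: parity_class_def half_class_def)

section \<open>The drift condition\<close>

locale zigzag =
  fixes U :: "'d::{finite,linorder} lattice \<Rightarrow> real" and R h :: real and c :: "'d lattice"
  assumes summable_U: "(\<lambda>y. exp (- U y)) summable_on UNIV"
    and h: "0 < h"
    and growth: "\<And>i y w. w \<in> velocities \<Longrightarrow>
           max (U (y + axis i (w $ i)) - U y) 0 \<ge> h * of_bool (real_of_int (w $ i * y $ i) > R)"
    and c: "c \<in> velocities"
begin

lemma zz_q_outward:
  assumes "w \<in> velocities" "R < real_of_int (w $ i * y $ i)"
  shows "zz_q U i y (w $ i) \<le> exp (- h)"
  using growth[OF assms(1), of i y] assms(2) by (simp add: zz_q_def)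

text \<open>The reversed move is an outward one, starting at a point that is still beyond
  \<open>R\<close> thanks to the extra 1. It climbs by at least \<open>h\<close>, so the inward move
  goes downhill and is certain.\<close>

lemma zz_q_inward:
  assumes w: "w \<in> velocities" and R: "R + 1 < - real_of_int (w $ i * y $ i)"
  shows "zz_q U i y (w $ i) = 1"
proof -
  let ?y = "y + axis i (w $ i)"
  have "axis i (w $ i) + axis i (- (w $ i)) = 0" by (simp add: vec_eq_iff axis_def)
  then have eq: "?y + axis i (flip i w $ i) = y" by (simp add: flip_nth add.assoc)
  have "flip i w $ i * ?y $ i = - (w $ i * y $ i) - 1"
    using velocitiesD[OF w, of i] by (auto simp: flip_nth)
  then have "R < real_of_int (flip i w $ i * ?y $ i)" using R by simp
  then have "h \<le> max (U y - U ?y) 0"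
    using growth[of "flip i w" i ?y] w unfolding eq by simp
  then show ?thesis using h by (simp add: zz_q_def max_def split: if_splits)
qed

text \<open>Near the box both outcomes are bounded by the additive constant. Far out, an outward
  velocity gives the factor computed for \<open>damping\<close>, and an inward one advances with
  certainty and gains \<open>exp (- \<theta>)\<close>.\<close>

lemma coord_drift:
  assumes \<theta>: "0 < \<theta>" "\<theta> < h" and w: "w \<in> velocities"
  shows "zz_q U i y (w $ i) * coord_lyap h \<theta> (y $ i + w $ i) (w $ i) +
      (1 - zz_q U i y (w $ i)) * coord_lyap h \<theta> (y $ i) (- (w $ i)) \<le>
    max ((1 + exp (\<theta> - h)) / 2) (exp (- \<theta>)) * coord_lyap h \<theta> (y $ i) (w $ i) + exp (\<theta> * (\<bar>R\<bar> + 2))"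
proof -
  define a s q \<alpha> \<gamma> where "a = y $ i" and "s = w $ i" and "q = zz_q U i y (w $ i)" and "\<alpha> = damping h \<theta>"
    and "\<gamma> = max ((1 + exp (\<theta> - h)) / 2) (exp (- \<theta>))"
  note defs = a_def s_def q_def \<alpha>_def
  have s: "s = 1 \<or> s = - 1" using velocitiesD[OF w] by (simp add: s_def)
  have q: "0 \<le> q" "q \<le> 1" using zz_q_bounds[of U i y "w $ i"] by (auto simp: q_def)
  have \<alpha>: "0 < \<alpha>" "\<alpha> \<le> 1" using damping_bounds[OF \<theta>(2)] by (auto simp: \<alpha>_def)
  have lyap: "coord_lyap h \<theta> b r = exp (\<theta> * \<bar>real_of_int b\<bar>) * (if 0 < r * b then 1 else \<alpha>)" for b r
    by (simp add: coord_lyap_def \<alpha>_def)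
  have lyap_le: "coord_lyap h \<theta> b r \<le> exp (\<theta> * \<bar>real_of_int b\<bar>)" and lyap_ge: "0 \<le> coord_lyap h \<theta> b r" for b r
    using \<alpha> by (auto simp: lyap)
  have \<gamma>0: "0 \<le> \<gamma>" by (simp add: \<gamma>_def le_max_iff_disj)
  have "q * coord_lyap h \<theta> (a + s) s + (1 - q) * coord_lyap h \<theta> a (- s) \<le> \<gamma> * coord_lyap h \<theta> a s + exp (\<theta> * (\<bar>R\<bar> + 2))"
  \<comment> \<open>One unit more than the box, as \<open>zz_q_inward\<close> requires; the unit
    that a step can add leads to \<open>\<bar>R\<bar> + 2\<close> in the constant.\<close>
  proof (cases "\<bar>real_of_int a\<bar> \<le> \<bar>R\<bar> + 1")
    case True
    have "coord_lyap h \<theta> (a + s) s \<le> exp (\<theta> * (\<bar>R\<bar> + 2))"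
      using True s \<theta> by (intro order_trans[OF lyap_le]) auto
    moreover have "coord_lyap h \<theta> a (- s) \<le> exp (\<theta> * (\<bar>R\<bar> + 2))"
      using True s \<theta> by (intro order_trans[OF lyap_le]) auto
    ultimately have "q * coord_lyap h \<theta> (a + s) s + (1 - q) * coord_lyap h \<theta> a (- s) \<le> q * exp (\<theta> * (\<bar>R\<bar> + 2)) + (1 - q) * exp (\<theta> * (\<bar>R\<bar> + 2))"
      using q by (intro add_mono mult_left_mono) auto
    then show ?thesis using mult_nonneg_nonneg[OF \<gamma>0 lyap_ge[of a s]] by (simp add: algebra_simps)
  next
    case False
    have pos: "0 < exp (\<theta> * (\<bar>R\<bar> + 2))" by simp
    have a: "\<bar>R\<bar> + 1 < \<bar>real_of_int a\<bar>" using False by simp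
    have absa: "real_of_int (s * a) = (if 0 < s * a then \<bar>real_of_int a\<bar> else - \<bar>real_of_int a\<bar>)"
      using s by (auto simp: abs_if)
    show ?thesis
    proof (cases "0 < s * a")
      case True
      have outward: "R < real_of_int (s * a)" unfolding absa using True a by simp
      have q': "q \<le> exp (- h)" using zz_q_outward[OF w, of i y] outward by (simp add: defs)
      have "\<bar>real_of_int (a + s)\<bar> = \<bar>real_of_int a\<bar> + 1" "0 < s * (a + s)"
        using True s by (auto simp: algebra_simps)
      then have l1: "coord_lyap h \<theta> (a + s) s = exp (\<theta> * \<bar>real_of_int a\<bar>) * exp \<theta>"
        unfolding lyap by (simp add: exp_add[symmetric] algebra_simps)
      have l2: "coord_lyap h \<theta> a (- s) = exp (\<theta> * \<bar>real_of_int a\<bar>) * \<alpha>"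
        using True unfolding lyap by simp
      have l3: "coord_lyap h \<theta> a s = exp (\<theta> * \<bar>real_of_int a\<bar>)" using True unfolding lyap by simp
      have e\<alpha>: "0 \<le> exp \<theta> - \<alpha>" using \<alpha> \<theta> one_le_exp_iff[of \<theta>] by linarith
      have "q * exp \<theta> + (1 - q) * \<alpha> = \<alpha> + q * (exp \<theta> - \<alpha>)" by (simp add: algebra_simps)
      also have "\<dots> \<le> \<alpha> + exp (- h) * (exp \<theta> - \<alpha>)" using q' e\<alpha> by (intro add_left_mono mult_right_mono)
      also have "\<dots> \<le> \<alpha> + exp (\<theta> - h)" using \<alpha> by (simp add: right_diff_distrib exp_add[symmetric])
      also have "\<dots> = (1 + exp (\<theta> - h)) / 2" by (simp add: \<alpha>_def damping_def field_simps)
      also have "\<dots> \<le> \<gamma>" by (simp add: \<gamma>_def)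
      finally have "exp (\<theta> * \<bar>real_of_int a\<bar>) * (q * exp \<theta> + (1 - q) * \<alpha>) \<le> exp (\<theta> * \<bar>real_of_int a\<bar>) * \<gamma>"
        by (intro mult_left_mono) auto
      then have "exp (\<theta> * \<bar>real_of_int a\<bar>) * (q * exp \<theta> + (1 - q) * \<alpha>) \<le>
          exp (\<theta> * \<bar>real_of_int a\<bar>) * \<gamma> + exp (\<theta> * (\<bar>R\<bar> + 2))"
        using pos by linarith
      moreover have "q * (e * z) + (1 - q) * (e * \<alpha>) = e * (q * z + (1 - q) * \<alpha>)" for e z
        by (simp add: algebra_simps)
      ultimately show ?thesis unfolding l1 l2 l3 mult.commute[of \<gamma>] by (simp only:)
    next
      case False
      have "R + 1 < - real_of_int (s * a)" unfolding absa using False a by simp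
      then have q1: "q = 1" using zz_q_inward[OF w, of i y] by (simp add: defs)
      have inward: "\<bar>real_of_int (a + s)\<bar> = \<bar>real_of_int a\<bar> - 1" "\<not> 0 < s * (a + s)"
        using False s a by (auto simp: algebra_simps)
      have "coord_lyap h \<theta> (a + s) s = exp (- \<theta>) * coord_lyap h \<theta> a s"
        unfolding lyap inward(1) if_not_P[OF inward(2)] if_not_P[OF False]
        by (simp add: exp_add[symmetric] right_diff_distrib)
      also have "\<dots> \<le> \<gamma> * coord_lyap h \<theta> a s" using lyap_ge by (intro mult_right_mono) (auto simp: \<gamma>_def)
      finally show ?thesis using q1 by (simp add: add_increasing2)
    qed
  qed
  then show ?thesis by (simp add: a_def s_def q_def \<gamma>_def)
qed

text \<open>Only the move of coordinate \<open>i\<close> changes \<open>coord_lyap\<close> at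
  \<open>i\<close>, and in a distinct list it occurs at most once.\<close>

lemma coord_steps_drift:
  assumes \<theta>: "0 < \<theta>" "\<theta> < h" and v: "v \<in> velocities" and d: "distinct is"
  defines "\<gamma> \<equiv> max ((1 + exp (\<theta> - h)) / 2) (exp (- \<theta>))"
  shows "measure_pmf.expectation (coord_steps U is (x, v)) (\<lambda>(y, w). coord_lyap h \<theta> (y $ i) (w $ i)) \<le>
    (if i \<in> set is then \<gamma> * coord_lyap h \<theta> (x $ i) (v $ i) + exp (\<theta> * (\<bar>R\<bar> + 2)) else coord_lyap h \<theta> (x $ i) (v $ i))"
  using d
proof (induction "is" rule: rev_induct)
  case (snoc j "is")
  let ?f = "\<lambda>(y, w). coord_lyap h \<theta> (y $ i) (w $ i)" and ?b = "exp (\<theta> * (\<bar>R\<bar> + 2))"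
  let ?p = "coord_steps U is (x, v)"
  have int: "integrable (measure_pmf ?p) g" for g :: "_ \<Rightarrow> real"
    by (rule integrable_measure_pmf_finite) (rule finite_coord_steps)
  have "measure_pmf.expectation (coord_steps U (is @ [j]) (x, v)) ?f =
      measure_pmf.expectation ?p (kernel_op (coord_step U j) ?f)"
    unfolding coord_steps_snoc
    by (intro integral_bind_finite_pmf finite_coord_step integrable_measure_pmf_finite)
       (auto simp: finite_coord_step finite_coord_steps)
  also have "\<dots> \<le> measure_pmf.expectation ?p (\<lambda>s. if j = i then \<gamma> * ?f s + ?b else ?f s)"
  proof (intro integral_mono_AE int AE_pmfI)
    fix s assume s: "s \<in> set_pmf ?p"
    obtain y w where yw: "s = (y, w)" by (cases s)
    have w: "w \<in> velocities" using coord_steps_velocities[of "(x, v)" s U "is"] s v yw by simp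
    have "kernel_op (coord_step U j) ?f s = zz_q U j y (w $ j) * coord_lyap h \<theta> ((y + axis j (w $ j)) $ i) (w $ i) +
        (1 - zz_q U j y (w $ j)) * coord_lyap h \<theta> (y $ i) (flip j w $ i)"
      by (simp add: kernel_op_def yw expectation_coord_step)
    also have "\<dots> \<le> (if j = i then \<gamma> * ?f s + ?b else ?f s)"
      using coord_drift[OF \<theta> w, of i y] by (auto simp: yw flip_nth axis_def \<gamma>_def algebra_simps)
    finally show "kernel_op (coord_step U j) ?f s \<le> (if j = i then \<gamma> * ?f s + ?b else ?f s)" .
  qed
  also have "\<dots> \<le> (if i \<in> set (is @ [j]) then \<gamma> * coord_lyap h \<theta> (x $ i) (v $ i) + ?b else coord_lyap h \<theta> (x $ i) (v $ i))"
  proof -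
    have \<gamma>0: "0 \<le> \<gamma>" by (simp add: \<gamma>_def le_max_iff_disj)
    have "measure_pmf.expectation ?p (\<lambda>s. \<gamma> * ?f s + ?b) = \<gamma> * measure_pmf.expectation ?p ?f + ?b"
      using int[of ?f] by simp
    then show ?thesis
    proof (cases "j = i")
      case True
      have "\<gamma> * measure_pmf.expectation ?p ?f \<le> \<gamma> * coord_lyap h \<theta> (x $ i) (v $ i)"
        using snoc True by (intro mult_left_mono \<gamma>0) (auto split: if_splits)
      then show ?thesis using True \<open>measure_pmf.expectation ?p (\<lambda>s. \<gamma> * ?f s + ?b) = _\<close> by simp
    next
      case False
      then show ?thesis using snoc by simp
    qed
  qed
  finally show ?case .
qed simp

definition exp_sum :: "real \<Rightarrow> 'd lattice \<times> 'd lattice \<Rightarrow> real" where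
  "exp_sum \<theta> s = (\<Sum>i\<in>UNIV. exp (\<theta> * \<bar>real_of_int (fst s $ i)\<bar>))"

text \<open>The division by \<open>damping h \<theta>\<close> makes it at least
  \<open>exp_sum \<theta>\<close>, in particular at least 1, in spite of the damped inward
  velocities.\<close>

definition zz_lyap :: "real \<Rightarrow> 'd lattice \<times> 'd lattice \<Rightarrow> real" where
  "zz_lyap \<theta> s = (\<Sum>i\<in>UNIV. coord_lyap h \<theta> (fst s $ i) (snd s $ i)) / damping h \<theta>"

lemma zz_lyap_bounds:
  assumes "0 < \<theta>" "\<theta> < h"
  shows "exp_sum \<theta> s \<le> zz_lyap \<theta> s" "zz_lyap \<theta> s \<le> exp_sum \<theta> s / damping h \<theta>"
proof -
  have \<alpha>: "0 < damping h \<theta>" "damping h \<theta> \<le> 1" using damping_bounds[OF assms(2)] by auto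
  have "damping h \<theta> * exp_sum \<theta> s \<le> (\<Sum>i\<in>UNIV. coord_lyap h \<theta> (fst s $ i) (snd s $ i))"
    unfolding exp_sum_def sum_distrib_left using \<alpha> by (intro sum_mono) (auto simp: coord_lyap_def)
  then show "exp_sum \<theta> s \<le> zz_lyap \<theta> s" using \<alpha> by (simp add: zz_lyap_def pos_le_divide_eq mult.commute)
  show "zz_lyap \<theta> s \<le> exp_sum \<theta> s / damping h \<theta>"
    unfolding exp_sum_def zz_lyap_def using \<alpha> by (intro divide_right_mono sum_mono) (auto simp: coord_lyap_def)
qed

lemma exp_sum_ge: "0 < \<theta> \<Longrightarrow> exp (\<theta> * \<bar>real_of_int (fst s $ i)\<bar>) \<le> exp_sum \<theta> s"
  unfolding exp_sum_def by (rule member_le_sum) auto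

lemma exp_sum_ge_1: "0 < \<theta> \<Longrightarrow> 1 \<le> exp_sum \<theta> s"
  by (rule order_trans[OF _ exp_sum_ge]) auto

lemma zz_lyap_drift:
  assumes \<theta>: "0 < \<theta>" "\<theta> < h" and s: "snd s \<in> velocities"
  shows "kernel_op (zz_pmf U) (zz_lyap \<theta>) s \<le>
    max ((1 + exp (\<theta> - h)) / 2) (exp (- \<theta>)) * zz_lyap \<theta> s + CARD('d) * exp (\<theta> * (\<bar>R\<bar> + 2)) / damping h \<theta>"
proof -
  have \<alpha>: "0 < damping h \<theta>" using damping_bounds[OF \<theta>(2)] by auto
  obtain x v where xv: "s = (x, v)" by (cases s)
  have "kernel_op (zz_pmf U) (zz_lyap \<theta>) s =
      (\<Sum>i\<in>UNIV. measure_pmf.expectation (zz_pmf U s) (\<lambda>t. coord_lyap h \<theta> (fst t $ i) (snd t $ i))) / damping h \<theta>"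
    unfolding kernel_op_def zz_lyap_def
    by (simp add: Bochner_Integration.integral_sum integrable_measure_pmf_finite finite_zz_pmf)
  also have "\<dots> \<le> (\<Sum>i\<in>UNIV. max ((1 + exp (\<theta> - h)) / 2) (exp (- \<theta>)) * coord_lyap h \<theta> (fst s $ i) (snd s $ i) +
      exp (\<theta> * (\<bar>R\<bar> + 2))) / damping h \<theta>"
  proof (intro divide_right_mono sum_mono)
    fix i
    show "measure_pmf.expectation (zz_pmf U s) (\<lambda>t. coord_lyap h \<theta> (fst t $ i) (snd t $ i)) \<le>
        max ((1 + exp (\<theta> - h)) / 2) (exp (- \<theta>)) * coord_lyap h \<theta> (fst s $ i) (snd s $ i) + exp (\<theta> * (\<bar>R\<bar> + 2))"
      using coord_steps_drift[OF \<theta>, of v "sorted_list_of_set UNIV" x i] s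
      by (simp add: xv zz_pmf_def case_prod_unfold)
  qed (use \<alpha> in simp)
  also have "\<dots> = max ((1 + exp (\<theta> - h)) / 2) (exp (- \<theta>)) * zz_lyap \<theta> s + CARD('d) * exp (\<theta> * (\<bar>R\<bar> + 2)) / damping h \<theta>"
    by (simp add: zz_lyap_def sum.distrib sum_distrib_left[symmetric] add_divide_distrib)
  finally show ?thesis .
qed

lemma finite_zz_lyap_sublevel:
  assumes "0 < \<theta>" "\<theta> < h"
  shows "finite {s \<in> parity_class c. zz_lyap \<theta> s \<le> C}"
proof (rule finite_subset)
  define N where "N = \<lceil>ln (max 1 C) / \<theta>\<rceil>"
  show "finite ({x :: 'd lattice. \<forall>i. x $ i \<in> {-N..N}} \<times> (velocities :: 'd lattice set))"
    by (intro finite_cartesian_product finite_lattice_box finite_velocities) simp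
  show "{s \<in> parity_class c. zz_lyap \<theta> s \<le> C} \<subseteq> {x. \<forall>i. x $ i \<in> {-N..N}} \<times> velocities"
  proof safe
    fix x v i assume xv: "(x, v) \<in> parity_class c" "zz_lyap \<theta> (x, v) \<le> C"
    have "exp (\<theta> * \<bar>real_of_int (x $ i)\<bar>) \<le> C"
      using exp_sum_ge[of \<theta> "(x, v)" i] zz_lyap_bounds(1)[OF assms, of "(x, v)"] xv(2) assms by simp
    then have "\<theta> * \<bar>real_of_int (x $ i)\<bar> \<le> ln (max 1 C)"
      by (subst ln_ge_iff) auto
    then have "\<bar>real_of_int (x $ i)\<bar> \<le> ln (max 1 C) / \<theta>" using assms by (simp add: pos_le_divide_eq mult.commute)
    also have "\<dots> \<le> real_of_int N" by (simp add: N_def)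
    finally show "x $ i \<in> {-N..N}" by auto
    show "v \<in> velocities" using parity_class_velocities[OF xv(1)] by simp
  qed
qed

section \<open>The atom and the invariant measure of a class\<close>

sublocale finite_kernel "zz_pmf U" "parity_class c"
  by unfold_locales
     (auto simp: finite_zz_pmf parity_class_step[OF parity_class_velocities])

abbreviation "zz_arrows \<equiv> {(s, t). s \<in> parity_class c \<and> t \<in> set_pmf (zz_pmf U s)}"

text \<open>The moves in \<open>coord_allowed\<close> do not refer to other coordinates, so moves
  chosen separately combine to one step of positive probability, provided that all coordinates use
  the same number of steps.\<close>

lemma zz_reach_from_coords:
  assumes "s \<in> parity_class c" "\<And>i. (coord_allowed R ^^ n) (fst s $ i, snd s $ i) (fst t $ i, snd t $ i)"
  shows "(s, t) \<in> zz_arrows ^^ n"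
  using assms
proof (induction n arbitrary: s)
  case 0
  then show ?case by (simp add: vec_eq_iff prod_eq_iff)
next
  case (Suc n)
  have "\<exists>u. coord_allowed R (fst s $ i, snd s $ i) u \<and> (coord_allowed R ^^ n) u (fst t $ i, snd t $ i)" for i
    using Suc.prems(2)[of i] by (blast dest: relpowp_Suc_D2)
  then obtain u where u: "\<And>i. coord_allowed R (fst s $ i, snd s $ i) (u i)"
    "\<And>i. (coord_allowed R ^^ n) (u i) (fst t $ i, snd t $ i)" by metis
  define r where "r = (\<chi> i. fst (u i), \<chi> i. snd (u i))"
  obtain x v where xv: "s = (x, v)" by (cases s)
  have v: "v \<in> velocities" using parity_class_velocities[OF Suc.prems(1)] xv by simp
  have "(fst r, snd r) \<in> set_pmf (zz_pmf U (x, v))"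
  proof (rule zz_pmf_supportI[OF v])
    fix i
    show "snd r $ i = v $ i \<and> fst r $ i = x $ i + v $ i \<or>
      snd r $ i = - (v $ i) \<and> fst r $ i = x $ i \<and> (\<forall>x'. x' $ i = x $ i \<longrightarrow> zz_q U i x' (v $ i) < 1)"
      using u(1)[of i] zz_q_outward[OF v, of i] h
      by (auto simp: r_def xv coord_allowed_def split: prod.splits intro: order.strict_trans1[of _ "exp (- h)"])
  qed
  then have r: "r \<in> set_pmf (zz_pmf U s)" by (simp add: xv)
  then have "r \<in> parity_class c" using closed_kernel[OF Suc.prems(1)] by blast
  then have "(r, t) \<in> zz_arrows ^^ n" using u(2) by (intro Suc.IH) (auto simp: r_def)
  then show ?case using r Suc.prems(1) by (intro relpow_Suc_I2[of s r]) auto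
qed

lemma half_class_arrows:
  "(s, t) \<in> zz_arrows ^^ n \<Longrightarrow> s \<in> half_class c e \<Longrightarrow> t \<in> half_class c (e * (- 1) ^ n)"
proof (induction n arbitrary: t)
  case (Suc n)
  then obtain r where r: "(s, r) \<in> zz_arrows ^^ n" "r \<in> parity_class c" "t \<in> set_pmf (zz_pmf U r)" by auto
  then have "r \<in> half_class c (e * (- 1) ^ n)" using Suc by blast
  then show ?case
    using half_class_step[OF parity_class_velocities[OF r(2)] r(3), of c "e * (- 1) ^ n"] by simp
qed simp

text \<open>Every coordinate can be at 0 at any sufficiently large time. The parity of the common
  time decides the half class of the end point, and in the half class with sign 1 the only state at
  the origin is \<open>(0, c)\<close>.\<close>

lemma atom_reachable:
  assumes s: "s \<in> parity_class c"
  shows "(s, (0, c)) \<in> zz_arrows\<^sup>+"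
proof -
  obtain e :: int where e: "e = 1 \<or> e = - 1" "s \<in> half_class c e"
    using s by (auto simp: parity_class_def)
  have "\<exists>n0. \<forall>n\<ge>n0. \<exists>r. (coord_allowed R ^^ n) (fst s $ i, snd s $ i) (0, r)" for i
    using velocitiesD[OF parity_class_velocities[OF s]] by (intro coord_allowed_reach) auto
  then obtain n0 where n0: "\<And>i n. n0 i \<le> n \<Longrightarrow> \<exists>r. (coord_allowed R ^^ n) (fst s $ i, snd s $ i) (0, r)"
    by metis
  define m where "m = (\<Sum>i\<in>UNIV. n0 i)"
  \<comment> \<open>Dominates all the \<open>n0 i\<close>, has the parity that turns
    \<open>e\<close> into 1, and is positive, as the transitive closure requires.\<close>
  define n where "n = (if e = 1 then 2 * m + 2 else 2 * m + 1)"
  have e1: "e * (- 1) ^ n = 1" using e(1) by (auto simp: n_def)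
  have "n0 i \<le> n" for i
    using member_le_sum[of i UNIV n0] by (auto simp: n_def m_def)
  then have "\<forall>i. \<exists>r. (coord_allowed R ^^ n) (fst s $ i, snd s $ i) (0, r)"
    using n0 by blast
  then obtain w where w: "\<And>i. (coord_allowed R ^^ n) (fst s $ i, snd s $ i) (0, w i)"
    by metis
  define t :: "'d lattice \<times> 'd lattice" where "t = (0, \<chi> i. w i)"
  have arrows: "(s, t) \<in> zz_arrows ^^ n"
    using w by (intro zz_reach_from_coords s) (simp add: t_def)
  then have "t \<in> half_class c 1" using half_class_arrows[OF arrows e(2)] e1 by simp
  then have "t = (0, c)" by (simp add: t_def half_class_def sgn_parity_def vec_eq_iff)
  then show ?thesis using arrows unfolding trancl_power by (intro exI[of _ n]) (auto simp: n_def)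
qed

text \<open>Given the position, a fair coin chooses between the two velocities in the class; the
  construction leaves the Gibbs marginal intact for every \<open>c\<close>.\<close>

definition class_pmf :: "('d lattice \<times> 'd lattice) pmf" where
  "class_pmf = map_pmf (\<lambda>(x, b). (x, \<chi> i. (if b then c $ i else - (c $ i)) * sgn_parity (x $ i)))
     (pair_pmf (gibbs_pmf U) (bernoulli_pmf (1 / 2)))"

lemma map_fst_class_pmf: "map_pmf fst class_pmf = gibbs_pmf U"
proof -
  have "map_pmf fst class_pmf = map_pmf fst (pair_pmf (gibbs_pmf U) (bernoulli_pmf (1 / 2)))"
    unfolding class_pmf_def map_pmf_comp by (rule map_pmf_cong) (auto split: prod.splits)
  then show ?thesis by (simp add: map_fst_pair_pmf)
qed

lemma pmf_class_pmf: "pmf class_pmf (x, v) = gibbs U x / 2 * of_bool ((x, v) \<in> parity_class c)"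
proof -
  define F where "F = (\<lambda>(x :: 'd lattice, b). (x, \<chi> i. (if b then c $ i else - (c $ i)) * sgn_parity (x $ i)))"
  have c0: "c $ i \<noteq> 0" "sgn_parity a \<noteq> 0" "sgn_parity a * sgn_parity a = 1" for i a
    using velocitiesD[OF c, of i] by (auto simp: sgn_parity_def)
  have inj: "inj F"
    using c0 by (auto simp: inj_def F_def vec_eq_iff split: if_splits)
  have class_iff: "(x, v) \<in> parity_class c \<longleftrightarrow> (\<exists>b. (x, v) = F (x, b))"
  proof -
    have vel: "(\<chi> i. (if b then c $ i else - (c $ i)) * sgn_parity (x $ i)) \<in> velocities" for b
      using velocitiesD[OF c] by (auto simp: velocities_def sgn_parity_def)
    have eq: "v $ i * sgn_parity a = r \<longleftrightarrow> v $ i = r * sgn_parity a" for i a r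
      by (auto simp: sgn_parity_def)
    have "(x, v) \<in> half_class c 1 \<longleftrightarrow> (x, v) = F (x, True)" "(x, v) \<in> half_class c (- 1) \<longleftrightarrow> (x, v) = F (x, False)"
      using vel[of True] vel[of False] unfolding half_class_def F_def
      by (auto simp: eq vec_eq_iff velocities_def)
    then show ?thesis unfolding parity_class_def by (metis (full_types) Un_iff)
  qed
  show ?thesis
  proof (cases "(x, v) \<in> parity_class c")
    case True
    then obtain b where b: "(x, v) = F (x, b)" using class_iff by blast
    have "pmf class_pmf (F (x, b)) = pmf (pair_pmf (gibbs_pmf U) (bernoulli_pmf (1 / 2))) (x, b)"
      unfolding class_pmf_def F_def[symmetric] by (rule pmf_map_inj'[OF inj])
    then show ?thesis using True b summable_U by (cases b) (simp_all add: pmf_pair)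
  next
    case False
    have "(x, v) \<notin> F ` set_pmf (pair_pmf (gibbs_pmf U) (bernoulli_pmf (1 / 2)))"
    proof
      assume "(x, v) \<in> F ` set_pmf (pair_pmf (gibbs_pmf U) (bernoulli_pmf (1 / 2)))"
      then obtain x' b where "(x, v) = F (x', b)" by auto
      moreover from this have "x' = x" by (simp add: F_def)
      ultimately show False using False class_iff by blast
    qed
    then have "pmf class_pmf (x, v) = 0"
      unfolding class_pmf_def F_def[symmetric] by (simp add: pmf_eq_0_set_pmf)
    then show ?thesis using False by simp
  qed
qed

text \<open>Membership in the class is preserved by steps in both directions, so the conditioning
  factor moves from \<open>s\<close> to \<open>t\<close> and the invariance of
  \<open>joint_pmf\<close> applies.\<close>

lemma invariant_class_pmf: "bind_pmf class_pmf (zz_pmf U) = class_pmf"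
proof (rule pmf_eqI)
  fix t
  \<comment> \<open>The inverse of the mass of the class under \<open>joint_pmf\<close>: over each
    position two of the velocities belong to it.\<close>
  define \<kappa> where "\<kappa> = real (card (velocities :: 'd lattice set)) / 2"
  have card: "card (velocities :: 'd lattice set) \<noteq> 0"
    using finite_velocities one_in_velocities[where ?'a='d] unfolding card_eq_0_iff by blast
  have \<kappa>: "pmf class_pmf s = \<kappa> * pmf (joint_pmf U) s * of_bool (s \<in> parity_class c)" for s
  proof -
    obtain x v where s: "s = (x, v)" by (cases s)
    show ?thesis
      using parity_class_velocities[of s c] card unfolding s pmf_class_pmf pmf_joint_pmf[OF summable_U]
      by (auto simp: \<kappa>_def)
  qed
  have \<kappa>0: "0 \<le> \<kappa>" by (simp add: \<kappa>_def)
  have "ennreal (pmf (bind_pmf class_pmf (zz_pmf U)) t) =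
      (\<integral>\<^sup>+s. ennreal (pmf class_pmf s) * ennreal (pmf (zz_pmf U s) t) \<partial>count_space UNIV)"
    by (simp add: ennreal_pmf_bind nn_integral_measure_pmf)
  also have "\<dots> = (\<integral>\<^sup>+s. ennreal (\<kappa> * of_bool (t \<in> parity_class c)) *
      (ennreal (pmf (joint_pmf U) s) * ennreal (pmf (zz_pmf U s) t)) \<partial>count_space UNIV)"
  proof (rule nn_integral_cong)
    fix s
    show "ennreal (pmf class_pmf s) * ennreal (pmf (zz_pmf U s) t) =
        ennreal (\<kappa> * of_bool (t \<in> parity_class c)) * (ennreal (pmf (joint_pmf U) s) * ennreal (pmf (zz_pmf U s) t))"
    proof (cases "pmf (joint_pmf U) s = 0 \<or> pmf (zz_pmf U s) t = 0")
      case True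
      then show ?thesis using \<kappa>[of s] by auto
    next
      case False
      have "snd s \<in> velocities" using False set_joint_pmf[OF summable_U, of "fst s" "snd s"] by (simp add: set_pmf_iff)
      moreover have "t \<in> set_pmf (zz_pmf U s)" using False by (simp add: set_pmf_iff)
      ultimately have "t \<in> parity_class c \<longleftrightarrow> s \<in> parity_class c" by (rule parity_class_step)
      then show ?thesis using \<kappa>[of s] \<kappa>0 by (auto simp: ennreal_mult' mult.assoc)
    qed
  qed
  also have "\<dots> = ennreal (\<kappa> * of_bool (t \<in> parity_class c)) * ennreal (pmf (bind_pmf (joint_pmf U) (zz_pmf U)) t)"
    by (simp add: nn_integral_cmult ennreal_pmf_bind nn_integral_measure_pmf)
  also have "\<dots> = ennreal (pmf class_pmf t)"
    using \<kappa>[of t] \<kappa>0 by (simp add: invariant_zz_pmf[OF summable_U] ennreal_mult'[symmetric] mult_ac)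
  finally show "pmf (bind_pmf class_pmf (zz_pmf U)) t = pmf class_pmf t" by simp
qed

sublocale atomic_chain "zz_pmf U" "parity_class c" "(0, c)" class_pmf
proof unfold_locales
  show "\<And>s. s \<in> parity_class c \<Longrightarrow> (s, 0, c) \<in> zz_arrows\<^sup>+" by (rule atom_reachable)
  show "set_pmf class_pmf \<subseteq> parity_class c"
    by (auto simp: set_pmf_iff pmf_class_pmf)
  show "bind_pmf class_pmf (zz_pmf U) = class_pmf" by (rule invariant_class_pmf)
  have "(0, c) \<in> parity_class c" using c by (simp add: parity_class_def half_class_def sgn_parity_def)
  then show "(0, c) \<in> set_pmf class_pmf"
    using gibbs_pos[OF summable_U, of 0] by (simp add: set_pmf_iff pmf_class_pmf)
qed

lemma expectation_class_pmf:
  assumes "integrable (measure_pmf class_pmf) (\<lambda>s. f (fst s))"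
  shows "measure_pmf.expectation class_pmf (\<lambda>s. f (fst s)) = gibbs_mean U f"
proof -
  have "integrable (measure_pmf (map_pmf fst class_pmf)) f"
    using assms by (simp add: integrable_map_pmf_eq)
  then show ?thesis
    using expectation_gibbs_pmf[OF summable_U, of f] by (simp add: map_fst_class_pmf[symmetric])
qed

end

section \<open>Paths encoded by their dyadic values\<close>

text \<open>
  A path is encoded by its values \<open>u (j, k)\<close> at the dyadic times \<open>k / 2 ^ j\<close>.  The sets
  \<open>dyadic_holder A\<close> are compact in the product topology, and on each of them the interpolating path
  depends continuously on the encoding.
\<close>

type_synonym dyadic = "nat \<times> nat \<Rightarrow> real"

definition consistent :: "dyadic \<Rightarrow> bool" where
  "consistent u \<longleftrightarrow> (\<forall>j. u (j, 0) = 0) \<and> (\<forall>j k. u (Suc j, 2 * k) = u (j, k))"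

text \<open>The decay corresponds to a Hoelder exponent of about 0.15. Level \<open>j\<close> is
  controlled only on the times up to \<open>j\<close>, so that each bounded time interval is covered
  at all but finitely many levels and no uniformity at infinity is asked for.\<close>

definition dyadic_holder :: "real \<Rightarrow> dyadic set" where
  "dyadic_holder A = {u. consistent u \<and> (\<forall>j k. k < j * 2 ^ j \<longrightarrow> \<bar>u (j, Suc k) - u (j, k)\<bar> \<le> A * (9 / 10) ^ j)}"

definition dyadic_index :: "nat \<Rightarrow> real \<Rightarrow> nat" where
  "dyadic_index j t = nat \<lfloor>2 ^ j * t\<rfloor>"

definition path_of :: "dyadic \<Rightarrow> real \<Rightarrow> real" where
  "path_of u = (\<lambda>t\<in>{0..}. lim (\<lambda>j. u (j, dyadic_index j t)))"

lemma consistent_shift: "consistent u \<Longrightarrow> u (j + i, k * 2 ^ i) = u (j, k)"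
proof (induction i)
  case (Suc i)
  have "u (Suc (j + i), 2 * (k * 2 ^ i)) = u (j + i, k * 2 ^ i)"
    using Suc.prems unfolding consistent_def by blast
  then show ?case using Suc by (simp add: mult_ac)
qed simp

lemma consistent_0: "consistent u \<Longrightarrow> u (j, 0) = 0"
  by (simp add: consistent_def)

lemma dyadic_index_bounds:
  assumes "0 \<le> t"
  shows "real (dyadic_index j t) \<le> 2 ^ j * t" "2 ^ j * t < real (dyadic_index j t) + 1"
proof -
  have "real (nat \<lfloor>2 ^ j * t\<rfloor>) = real_of_int \<lfloor>2 ^ j * t\<rfloor>" using assms by simp
  then show "real (dyadic_index j t) \<le> 2 ^ j * t" "2 ^ j * t < real (dyadic_index j t) + 1"
    unfolding dyadic_index_def using of_int_floor_le[of "2 ^ j * t"] real_of_int_floor_add_one_gt[of "2 ^ j * t"]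
    by linarith+
qed

lemma dyadic_index_Suc:
  assumes "0 \<le> t"
  shows "dyadic_index (Suc j) t = 2 * dyadic_index j t \<or> dyadic_index (Suc j) t = 2 * dyadic_index j t + 1"
proof -
  have "real (2 * dyadic_index j t) < real (dyadic_index (Suc j) t) + 1"
    "real (dyadic_index (Suc j) t) < real (2 * dyadic_index j t + 2)"
    using dyadic_index_bounds[OF assms, of j] dyadic_index_bounds[OF assms, of "Suc j"] by simp_all
  then show ?thesis by linarith
qed

lemma dyadic_index_less:
  assumes "0 \<le> t" "t \<le> real J"
  shows "dyadic_index J t \<le> J * 2 ^ J"
proof -
  have "real (dyadic_index J t) \<le> 2 ^ J * t" by (rule dyadic_index_bounds[OF assms(1)])
  also have "\<dots> \<le> 2 ^ J * real J" using assms by simp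
  finally have "real (dyadic_index J t) \<le> real (J * 2 ^ J)" by (simp add: mult.commute)
  then show ?thesis by (simp only: of_nat_le_iff)
qed

lemma dyadic_holder_nonneg: "u \<in> dyadic_holder A \<Longrightarrow> 0 \<le> A"
proof -
  assume "u \<in> dyadic_holder A"
  then have "\<forall>j k. k < j * 2 ^ j \<longrightarrow> \<bar>u (j, Suc k) - u (j, k)\<bar> \<le> A * (9 / 10) ^ j"
    by (simp add: dyadic_holder_def)
  then have "\<bar>u (1, Suc 0) - u (1, 0)\<bar> \<le> A * (9 / 10) ^ 1" by (metis less_numeral_extra(1) mult_1 power_one_right zero_less_numeral)
  then have "0 \<le> A * (9 / 10) ^ 1" by (rule order_trans[OF abs_ge_zero])
  then show ?thesis by simp
qed

context
  fixes u :: dyadic and A :: real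
  assumes u: "u \<in> dyadic_holder A"
begin

lemma dyadic_holder_step:
  assumes t: "0 \<le> t" "t \<le> real j"
  shows "\<bar>u (Suc j, dyadic_index (Suc j) t) - u (j, dyadic_index j t)\<bar> \<le> A * (9 / 10) ^ Suc j"
proof -
  let ?m = "dyadic_index j t"
  have cons: "u (Suc j, 2 * ?m) = u (j, ?m)" using u by (simp add: dyadic_holder_def consistent_def)
  have "?m \<le> j * 2 ^ j" by (rule dyadic_index_less[OF t])
  then have "2 * ?m < Suc j * 2 ^ Suc j" by (simp add: add_strict_increasing)
  then have "\<bar>u (Suc j, Suc (2 * ?m)) - u (Suc j, 2 * ?m)\<bar> \<le> A * (9 / 10) ^ Suc j"
    using u unfolding dyadic_holder_def by blast
  then show ?thesis
    using dyadic_index_Suc[OF t(1), of j] cons dyadic_holder_nonneg[OF u] by auto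
qed

text \<open>Consecutive levels differ by at most one dyadic increment at the finer level; the factor
  9 is the sum of the positive powers of 9/10.\<close>

lemma path_of_approx:
  assumes t: "0 \<le> t" "t \<le> real J"
  shows "(\<lambda>j. u (j, dyadic_index j t)) \<longlonglongrightarrow> path_of u t"
    and "\<bar>path_of u t - u (J, dyadic_index J t)\<bar> \<le> 9 * A * (9 / 10) ^ J"
proof -
  define f where "f j = u (j, dyadic_index j t)" for j
  define a where "a i = u (J + i, dyadic_index (J + i) t)" for i
  have af: "a = (\<lambda>i. f (i + J))" by (simp add: fun_eq_iff a_def f_def add.commute)
  have step: "\<bar>a (Suc i) - a i\<bar> \<le> A * (9 / 10) ^ Suc J * (9 / 10) ^ i" for i
    unfolding a_def using dyadic_holder_step[of t "J + i"] t by (simp add: power_add mult_ac)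
  have sg: "summable (\<lambda>i. A * (9 / 10) ^ Suc J * (9 / 10 :: real) ^ i)"
    by (intro summable_mult summable_geometric) auto
  have sa: "summable (\<lambda>i. \<bar>a (Suc i) - a i\<bar>)"
    by (rule summable_comparison_test[OF _ sg]) (use step in auto)
  then have s: "summable (\<lambda>i. a (Suc i) - a i)" by (rule summable_rabs_cancel)
  have "(\<lambda>n. \<Sum>i<n. a (Suc i) - a i) \<longlonglongrightarrow> (\<Sum>i. a (Suc i) - a i)"
    by (rule summable_LIMSEQ[OF s])
  then have "(\<lambda>n. (\<Sum>i<n. a (Suc i) - a i) + a 0) \<longlonglongrightarrow> (\<Sum>i. a (Suc i) - a i) + a 0"
    by (intro tendsto_intros)
  then have "a \<longlonglongrightarrow> (\<Sum>i. a (Suc i) - a i) + a 0"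
    by (simp add: sum_lessThan_telescope)
  then have lim: "(\<lambda>j. u (j, dyadic_index j t)) \<longlonglongrightarrow> (\<Sum>i. a (Suc i) - a i) + a 0"
    unfolding f_def[symmetric] af by (rule LIMSEQ_offset)
  then have eq: "path_of u t = (\<Sum>i. a (Suc i) - a i) + a 0"
    using t by (simp add: path_of_def limI)
  show "(\<lambda>j. u (j, dyadic_index j t)) \<longlonglongrightarrow> path_of u t" using lim eq by simp
  have "\<bar>path_of u t - a 0\<bar> \<le> (\<Sum>i. \<bar>a (Suc i) - a i\<bar>)"
    unfolding eq using summable_rabs[OF sa] by simp
  also have "\<dots> \<le> (\<Sum>i. A * (9 / 10) ^ Suc J * (9 / 10) ^ i)" by (rule suminf_le[OF step sa sg])
  also have "\<dots> = 9 * A * (9 / 10) ^ J"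
    using suminf_mult[of "\<lambda>i. (9 / 10 :: real) ^ i" "A * (9 / 10) ^ Suc J"] suminf_geometric[of "9 / 10 :: real"]
    by (simp add: summable_geometric)
  finally show "\<bar>path_of u t - u (J, dyadic_index J t)\<bar> \<le> 9 * A * (9 / 10) ^ J" by (simp add: a_def)
qed

text \<open>Two approximation errors of 9 each and one dyadic increment, since the indices of
  \<open>s\<close> and \<open>t\<close> at level \<open>J\<close> differ by at most 1.\<close>

lemma path_of_modulus:
  assumes s: "0 \<le> s" "s \<le> t" and t: "t \<le> real J" "t - s \<le> 1 / 2 ^ J"
  shows "\<bar>path_of u t - path_of u s\<bar> \<le> 19 * A * (9 / 10) ^ J"
proof -
  have t0: "0 \<le> t" and sJ: "s \<le> real J" using s t by auto
  let ?m = "dyadic_index J s" and ?n = "dyadic_index J t"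
  have "2 ^ J * t \<le> 2 ^ J * s + 1" using t(2) by (simp add: field_simps)
  moreover have "2 ^ J * s \<le> 2 ^ J * t" using s(2) by simp
  ultimately have "real ?n < real ?m + 2" "real ?m < real ?n + 1"
    using dyadic_index_bounds[OF s(1), of J] dyadic_index_bounds[OF t0, of J] by linarith+
  then have mn: "?n = ?m \<or> ?n = Suc ?m" by linarith
  have "\<bar>u (J, ?n) - u (J, ?m)\<bar> \<le> A * (9 / 10) ^ J"
  proof (cases "?n = ?m")
    case False
    then have "?m < J * 2 ^ J" using mn dyadic_index_less[OF t0 t(1)] by auto
    then have "\<bar>u (J, Suc ?m) - u (J, ?m)\<bar> \<le> A * (9 / 10) ^ J" using u unfolding dyadic_holder_def by blast
    then show ?thesis using mn False by auto
  qed (use dyadic_holder_nonneg[OF u] in simp)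
  then show ?thesis
    using path_of_approx(2)[OF t0 t(1)] path_of_approx(2)[OF s(1) sJ] by linarith
qed

lemma continuous_on_path_of: "continuous_on {0..} (path_of u)"
  unfolding continuous_on_iff
proof (intro ballI allI impI)
  fix t \<epsilon> :: real assume t: "t \<in> {0..}" and \<epsilon>: "0 < \<epsilon>"
  have "(\<lambda>J. 19 * A * (9 / 10) ^ J) \<longlonglongrightarrow> 19 * A * 0"
    by (intro tendsto_intros LIMSEQ_realpow_zero) auto
  then have "\<forall>\<^sub>F J in sequentially. 19 * A * (9 / 10) ^ J < \<epsilon>" using \<epsilon> by (auto simp: order_tendsto_iff)
  moreover have "\<forall>\<^sub>F J in sequentially. t + 1 \<le> real J"
    using filterlim_real_sequentially by (auto simp: filterlim_at_top)
  ultimately have "\<forall>\<^sub>F J in sequentially. 19 * A * (9 / 10) ^ J < \<epsilon> \<and> t + 1 \<le> real J" by (rule eventually_conj)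
  then obtain J where J: "19 * A * (9 / 10) ^ J < \<epsilon>" "t + 1 \<le> real J"
    by (auto simp: eventually_sequentially)
  show "\<exists>d>0. \<forall>s\<in>{0..}. dist s t < d \<longrightarrow> dist (path_of u s) (path_of u t) < \<epsilon>"
  proof (intro exI[of _ "1 / 2 ^ J"] conjI ballI impI)
    fix s :: real assume s: "s \<in> {0..}" "dist s t < 1 / 2 ^ J"
    have "(1 :: real) / 2 ^ J \<le> 1" by simp
    then have "s \<le> real J" using s(2) J(2) unfolding dist_real_def by linarith
    then have "\<bar>path_of u s - path_of u t\<bar> \<le> 19 * A * (9 / 10) ^ J"
      using path_of_modulus[of s t J] path_of_modulus[of t s J] s t J
      by (cases "s \<le> t") (auto simp: dist_real_def abs_minus_commute abs_if split: if_splits)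
    then show "dist (path_of u s) (path_of u t) < \<epsilon>" using J by (simp add: dist_real_def)
  qed simp
qed

lemma path_of_dyadic: "path_of u (real k / 2 ^ j) = u (j, k)"
proof -
  have cons: "consistent u" using u by (simp add: dyadic_holder_def)
  have "dyadic_index (j + i) (real k / 2 ^ j) = k * 2 ^ i" for i
  proof -
    have "2 ^ (j + i) * (real k / 2 ^ j) = real (k * 2 ^ i)" by (simp add: power_add)
    then show ?thesis unfolding dyadic_index_def by (simp del: of_nat_mult of_nat_power)
  qed
  then have "(\<lambda>i. u (i + j, dyadic_index (i + j) (real k / 2 ^ j))) = (\<lambda>i. u (j, k))"
    using consistent_shift[OF cons, of j _ k] by (simp add: add.commute)
  then have "(\<lambda>i. u (i, dyadic_index i (real k / 2 ^ j))) \<longlonglongrightarrow> u (j, k)"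
    by (intro LIMSEQ_offset[of "\<lambda>i. u (i, dyadic_index i (real k / 2 ^ j))" j]) simp_all
  then show ?thesis by (simp add: path_of_def limI)
qed

lemma path_of_cadlag: "path_of u \<in> cadlag"
  unfolding cadlag_def
proof (intro CollectI conjI allI impI)
  show "path_of u \<in> extensional {0..}" by (simp add: path_of_def)
  have lim: "(path_of u \<longlongrightarrow> path_of u t) (at t within {0..})" if "0 \<le> t" for t
    using continuous_on_path_of that by (simp add: continuous_on_def)
  show "(path_of u \<longlongrightarrow> path_of u t) (at_right t)" if "0 \<le> t" for t
    using lim[OF that] by (rule tendsto_within_subset) (use that in auto)
  show "\<exists>l. (path_of u \<longlongrightarrow> l) (at_left t)" if "0 < t" for t
  proof -
    have "(path_of u \<longlongrightarrow> path_of u t) (at t within {0..<t})"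
      using that by (intro tendsto_within_subset[OF lim]) auto
    moreover have "at t within {0..<t} = at_left t"
      using that by (rule_tac at_within_nhd[of t "{0<..}"]) auto
    ultimately show ?thesis by auto
  qed
qed

end

section \<open>Continuity and compactness of the encoding\<close>

lemma tendsto_dyadic_index:
  assumes t: "0 \<le> t"
  shows "(\<lambda>j. real (dyadic_index j t) / 2 ^ j) \<longlonglongrightarrow> t"
proof -
  have "(\<lambda>j. real (dyadic_index j t) / 2 ^ j - t) \<longlonglongrightarrow> 0"
  proof (rule Lim_null_comparison)
    show "(\<lambda>j. (1 / 2 :: real) ^ j) \<longlonglongrightarrow> 0" by (rule LIMSEQ_realpow_zero) auto
    have "\<bar>real (dyadic_index j t) / 2 ^ j - t\<bar> \<le> (1 / 2) ^ j" for j
    proof -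
      have "real (dyadic_index j t) / 2 ^ j - t = (real (dyadic_index j t) - 2 ^ j * t) / 2 ^ j"
        by (simp add: field_simps)
      moreover have "\<bar>real (dyadic_index j t) - 2 ^ j * t\<bar> \<le> 1"
        using dyadic_index_bounds[OF t, of j] by linarith
      ultimately show ?thesis by (simp add: abs_divide divide_right_mono power_divide)
    qed
    then show "\<forall>\<^sub>F j in sequentially. norm (real (dyadic_index j t) / 2 ^ j - t) \<le> (1 / 2) ^ j" by simp
  qed
  then show ?thesis by (simp add: LIM_zero_iff)
qed

lemma path_of_continuous_eq:
  assumes cont: "continuous_on {0..} x" and t: "0 \<le> t"
  shows "path_of (\<lambda>(j, k). x (real k / 2 ^ j)) t = x t"
proof -
  have "(\<lambda>j. x (real (dyadic_index j t) / 2 ^ j)) \<longlonglongrightarrow> x t"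
  by (rule continuous_on_tendsto_compose[OF cont tendsto_dyadic_index[OF t]]) (use t in auto)
  then show ?thesis using t by (simp add: path_of_def limI)
qed

lemma tendsto_coordinate:
  assumes "U \<longlonglongrightarrow> (u :: 'i \<Rightarrow> 'b::topological_space)"
  shows "(\<lambda>n. U n i) \<longlonglongrightarrow> u i"
proof (rule continuous_on_tendsto_compose[OF _ assms])
  show "continuous_on UNIV (\<lambda>x :: 'i \<Rightarrow> 'b. x i)" by simp
qed auto

text \<open>A single level \<open>J\<close> determines all these paths on \<open>{0..T}\<close> up
  to a third of the tolerance, and only finitely many coordinates of this level are
  involved.\<close>

lemma path_of_uniform_limit:
  assumes U: "\<And>n. U n \<in> dyadic_holder A" and u: "u \<in> dyadic_holder A" and lim: "U \<longlonglongrightarrow> u"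
  shows "uniform_limit {0..T} (\<lambda>n. path_of (U n)) (path_of u) sequentially"
  unfolding uniform_limit_iff
proof (intro allI impI)
  fix \<epsilon> :: real assume \<epsilon>: "0 < \<epsilon>"
  have "(\<lambda>J. 9 * A * (9 / 10) ^ J) \<longlonglongrightarrow> 9 * A * 0"
    by (intro tendsto_intros LIMSEQ_realpow_zero) auto
  then have "\<forall>\<^sub>F J in sequentially. 9 * A * (9 / 10) ^ J < \<epsilon> / 3" using \<epsilon> by (intro order_tendstoD(2)) auto
  moreover have "\<forall>\<^sub>F J in sequentially. T \<le> real J"
    using filterlim_real_sequentially by (auto simp: filterlim_at_top)
  ultimately have "\<forall>\<^sub>F J in sequentially. 9 * A * (9 / 10) ^ J < \<epsilon> / 3 \<and> T \<le> real J" by (rule eventually_conj)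
  then obtain J where J: "9 * A * (9 / 10) ^ J < \<epsilon> / 3" "T \<le> real J"
    by (auto simp: eventually_sequentially)
  have "\<forall>\<^sub>F n in sequentially. \<forall>k\<le>J * 2 ^ J. \<bar>U n (J, k) - u (J, k)\<bar> < \<epsilon> / 3"
  proof -
    have "\<forall>\<^sub>F n in sequentially. \<forall>k\<in>{..J * 2 ^ J}. \<bar>U n (J, k) - u (J, k)\<bar> < \<epsilon> / 3"
      using \<epsilon> tendstoD[OF tendsto_coordinate[OF lim], of "\<epsilon> / 3"]
      by (intro eventually_ball_finite) (auto simp: dist_real_def)
    then show ?thesis by (rule eventually_mono) auto
  qed
  then show "\<forall>\<^sub>F n in sequentially. \<forall>t\<in>{0..T}. dist (path_of (U n) t) (path_of u t) < \<epsilon>"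
  proof eventually_elim
    case (elim n)
    show ?case
    proof
      fix t assume t: "t \<in> {0..T}"
      then have t': "0 \<le> t" "t \<le> real J" using J by auto
      have "\<bar>U n (J, dyadic_index J t) - u (J, dyadic_index J t)\<bar> < \<epsilon> / 3"
        using elim dyadic_index_less[OF t'] by blast
      then show "dist (path_of (U n) t) (path_of u t) < \<epsilon>"
        using path_of_approx(2)[OF U t', of n] path_of_approx(2)[OF u t'] J(1) unfolding dist_real_def by linarith
    qed
  qed
qed

lemma closed_dyadic_holder: "closed (dyadic_holder A)"
  unfolding dyadic_holder_def consistent_def
  by (intro closed_Collect_conj closed_Collect_all closed_Collect_imp open_Collect_const closed_Collect_eq closed_Collect_le
      continuous_intros continuous_on_product_coordinates)

text \<open>A closed subset of a product of intervals. To bound \<open>u (j, k)\<close> it is read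
  at level \<open>j + k\<close>, where its index \<open>k * 2 ^ k\<close> lies in the controlled
  window, and reached from 0 by increments of size at most \<open>A\<close>.\<close>

lemma compact_dyadic_holder: "compact (dyadic_holder A)"
proof -
  define b where "b = (\<lambda>(j :: nat, k :: nat). A * (real k * 2 ^ k))"
  have "\<bar>u (j, k)\<bar> \<le> b (j, k)" if u: "u \<in> dyadic_holder A" for u j k
  proof -
    have cons: "consistent u" using u by (simp add: dyadic_holder_def)
    have "\<bar>u (j + k, m)\<bar> \<le> A * real m" if "m \<le> (j + k) * 2 ^ (j + k)" for m
      using that
    proof (induction m)
      case 0
      then show ?case using consistent_0[OF cons] by simp
    next
      case (Suc m)
      then have "\<bar>u (j + k, Suc m) - u (j + k, m)\<bar> \<le> A * (9 / 10) ^ (j + k)"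
        using u unfolding dyadic_holder_def by simp
      also have "\<dots> \<le> A * 1" using dyadic_holder_nonneg[OF u] by (intro mult_left_mono power_le_one) auto
      finally show ?case using Suc by (simp add: algebra_simps)
    qed
    moreover have "k * 2 ^ k \<le> (j + k) * 2 ^ (j + k)" by (intro mult_mono power_increasing) auto
    ultimately have "\<bar>u (j + k, k * 2 ^ k)\<bar> \<le> A * real (k * 2 ^ k)" by blast
    then show ?thesis using consistent_shift[OF cons, of j k k] by (simp add: b_def)
  qed
  then have "dyadic_holder A \<subseteq> PiE UNIV (\<lambda>i. {- b i..b i})"
    by (auto simp: abs_le_iff minus_le_iff)
  moreover have "compact (PiE UNIV (\<lambda>i. {- b i..b i}))"
    using compactin_PiE[of "\<lambda>_. euclideanreal" "UNIV :: (nat \<times> nat) set" "\<lambda>i. {- b i..b i}"]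
    by (simp add: euclidean_product_topology)
  ultimately show ?thesis
    using closed_dyadic_holder compact_Int_closed[of "PiE UNIV (\<lambda>i. {- b i..b i})" "dyadic_holder A"]
    by (simp add: Int_absorb1)
qed

section \<open>From the encoding to the Skorohod topology\<close>

lemma uniform_limit_imp_skorohod_tendsto:
  assumes "\<And>T. uniform_limit {0..T} xs x sequentially"
  shows "skorohod_tendsto xs x"
  unfolding skorohod_tendsto_def
  by (intro exI[of _ "\<lambda>n t. t"])
     (use assms in \<open>auto simp: time_change_def strict_mono_on_def uniform_limit_iff\<close>)

lemma skorohod_continuous_tendsto:
  assumes g: "continuous_map skorohod_topology euclideanreal g"
    and xs: "range xs \<subseteq> cadlag" and x: "x \<in> cadlag" and lim: "skorohod_tendsto xs x"
  shows "(\<lambda>n. g (xs n)) \<longlonglongrightarrow> g x"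
proof (rule topological_tendstoI)
  fix B :: "real set" assume B: "open B" "g x \<in> B"
  have "openin skorohod_topology {y \<in> cadlag. g y \<in> B}"
    using g B unfolding continuous_map_def by (simp add: topspace_skorohod_topology)
  then have "skorohod_open {y \<in> cadlag. g y \<in> B}" by (simp add: openin_skorohod_topology)
  then have "\<forall>\<^sub>F n in sequentially. xs n \<in> {y \<in> cadlag. g y \<in> B}"
    using xs x lim B unfolding skorohod_open_def by blast
  then show "\<forall>\<^sub>F n in sequentially. g (xs n) \<in> B" by (auto elim!: eventually_mono)
qed

lemma continuous_on_dyadic_holder:
  assumes g: "continuous_map skorohod_topology euclideanreal g"
  shows "continuous_on (dyadic_holder A) (\<lambda>u. g (path_of u))"
  unfolding continuous_on_sequentially comp_def
proof (intro allI ballI impI)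
  fix U u assume u: "u \<in> dyadic_holder A" and "(\<forall>n. U n \<in> dyadic_holder A) \<and> U \<longlonglongrightarrow> u"
  then show "(\<lambda>n. g (path_of (U n))) \<longlonglongrightarrow> g (path_of u)"
    by (intro skorohod_continuous_tendsto[OF g] uniform_limit_imp_skorohod_tendsto path_of_uniform_limit[of U A])
       (auto intro: path_of_cadlag)
qed

text \<open>Uniform continuity near a compact set, obtained from sequences: counterexamples with
  \<open>T = n\<close> and \<open>\<delta> = 1 / (n + 1)\<close> would have a subsequence along
  which both paths converge locally uniformly to the same limit.\<close>

lemma skorohod_continuous_near_holder:
  assumes g: "continuous_map skorohod_topology euclideanreal g" and \<epsilon>: "0 < \<epsilon>"
  obtains T \<delta> where "0 \<le> T" "0 < \<delta>"
    "\<And>u y. u \<in> dyadic_holder A \<Longrightarrow> y \<in> cadlag \<Longrightarrow> (\<And>t. 0 \<le> t \<Longrightarrow> t \<le> T \<Longrightarrow> \<bar>y t - path_of u t\<bar> < \<delta>) \<Longrightarrow>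
      \<bar>g y - g (path_of u)\<bar> < \<epsilon>"
proof -
  have "\<exists>n::nat. \<forall>u y. u \<in> dyadic_holder A \<and> y \<in> cadlag \<and> (\<forall>t. 0 \<le> t \<and> t \<le> real n \<longrightarrow> \<bar>y t - path_of u t\<bar> < 1 / real (Suc n)) \<longrightarrow>
      \<bar>g y - g (path_of u)\<bar> < \<epsilon>"
  proof (rule ccontr)
    assume "\<not> ?thesis"
    then have "\<forall>n. \<exists>u y. u \<in> dyadic_holder A \<and> y \<in> cadlag \<and>
        (\<forall>t. 0 \<le> t \<and> t \<le> real n \<longrightarrow> \<bar>y t - path_of u t\<bar> < 1 / real (Suc n)) \<and> \<not> \<bar>g y - g (path_of u)\<bar> < \<epsilon>"
      by blast
    then obtain U Y where UY: "\<And>n. U n \<in> dyadic_holder A" "\<And>n. Y n \<in> cadlag"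
      "\<And>n t. 0 \<le> t \<Longrightarrow> t \<le> real n \<Longrightarrow> \<bar>Y n t - path_of (U n) t\<bar> < 1 / real (Suc n)"
      "\<And>n. \<epsilon> \<le> \<bar>g (Y n) - g (path_of (U n))\<bar>"
      by (metis not_less)
    obtain u r where u: "u \<in> dyadic_holder A" and r: "strict_mono r" "(U \<circ> r) \<longlonglongrightarrow> u"
      using compact_dyadic_holder[of A] UY(1) unfolding compact_eq_seq_compact_metric seq_compact_def by metis
    have ul: "uniform_limit {0..T} (\<lambda>n. path_of (U (r n))) (path_of u) sequentially" for T
      using path_of_uniform_limit[of "U \<circ> r" A u T] UY(1) u r(2) by (simp add: comp_def)
    have uy: "uniform_limit {0..T} (\<lambda>n. Y (r n)) (path_of u) sequentially" for T
      unfolding uniform_limit_iff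
    proof (intro allI impI)
      fix e :: real assume e: "0 < e"
      have "\<forall>\<^sub>F n in sequentially. \<forall>t\<in>{0..T}. dist (path_of (U (r n)) t) (path_of u t) < e / 2"
        using uniform_limitD[OF ul, of "e / 2"] e by simp
      moreover have "\<forall>\<^sub>F n in sequentially. T \<le> real n"
        using filterlim_real_sequentially by (auto simp: filterlim_at_top)
      moreover have "\<forall>\<^sub>F n in sequentially. 1 / real (Suc n) < e / 2"
        unfolding inverse_eq_divide[symmetric] using e by (intro order_tendstoD(2)[OF LIMSEQ_inverse_real_of_nat]) simp
      ultimately show "\<forall>\<^sub>F n in sequentially. \<forall>t\<in>{0..T}. dist (Y (r n) t) (path_of u t) < e"
      proof eventually_elim
        case (elim n)
        have rn: "n \<le> r n" by (rule seq_suble[OF r(1)])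
        show ?case
        proof
          fix t assume t: "t \<in> {0..T}"
          have "\<bar>Y (r n) t - path_of (U (r n)) t\<bar> < 1 / real (Suc (r n))"
            using t elim(2) rn by (intro UY(3)) auto
          also have "\<dots> \<le> 1 / real (Suc n)" using rn by (intro divide_left_mono) auto
          finally have "\<bar>Y (r n) t - path_of (U (r n)) t\<bar> < 1 / real (Suc n)" .
          moreover have "\<bar>path_of (U (r n)) t - path_of u t\<bar> < e / 2"
            using elim(1) t by (simp add: dist_real_def)
          ultimately show "dist (Y (r n) t) (path_of u t) < e"
            using elim(3) unfolding dist_real_def by linarith
        qed
      qed
    qed
    have "(\<lambda>n. g (Y (r n)) - g (path_of (U (r n)))) \<longlonglongrightarrow> g (path_of u) - g (path_of u)"
      using u UY(1,2) ul uy
      by (intro tendsto_diff skorohod_continuous_tendsto[OF g] uniform_limit_imp_skorohod_tendsto)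
         (auto intro: path_of_cadlag)
    then have "\<forall>\<^sub>F n in sequentially. \<bar>g (Y (r n)) - g (path_of (U (r n)))\<bar> < \<epsilon>"
      using \<epsilon> by (simp add: tendsto_iff dist_real_def)
    then show False using UY(4) by (auto simp: eventually_sequentially not_less[symmetric])
  qed
  then obtain n :: nat where "\<forall>u y. u \<in> dyadic_holder A \<and> y \<in> cadlag \<and>
      (\<forall>t. 0 \<le> t \<and> t \<le> real n \<longrightarrow> \<bar>y t - path_of u t\<bar> < 1 / real (Suc n)) \<longrightarrow> \<bar>g y - g (path_of u)\<bar> < \<epsilon>"
    by blast
  then show ?thesis by (intro that[of "real n" "1 / real (Suc n)"]) auto
qed

text \<open>\<open>path_of\<close> is continuous only on each \<open>dyadic_holder A\<close>. The
  preimage of an open set is a countable union over \<open>A\<close> of preimages of differences of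
  two closed sets.\<close>

lemma measurable_path_of:
  assumes u: "u \<in> N \<rightarrow>\<^sub>M borel" and holder: "\<And>\<omega>. \<omega> \<in> space N \<Longrightarrow> \<exists>A::nat. u \<omega> \<in> dyadic_holder (real A)"
  shows "(\<lambda>\<omega>. path_of (u \<omega>)) \<in> N \<rightarrow>\<^sub>M borel_of skorohod_topology"
  unfolding borel_of_def
proof (rule measurable_measure_of)
  show "{S. openin skorohod_topology S} \<subseteq> Pow (topspace skorohod_topology)"
    by (auto dest: openin_subset)
  show "(\<lambda>\<omega>. path_of (u \<omega>)) \<in> space N \<rightarrow> topspace skorohod_topology"
    using holder by (auto simp: topspace_skorohod_topology intro: path_of_cadlag)
  fix S assume "S \<in> {S. openin skorohod_topology S}"
  then have S: "skorohod_open S" by (simp add: openin_skorohod_topology)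
  define C where "C A = {v \<in> dyadic_holder (real A). path_of v \<notin> S}" for A :: nat
  have closed: "closed (C A)" for A
    unfolding closed_sequential_limits
  proof (intro allI impI)
    fix V v assume V: "(\<forall>n. V n \<in> C A) \<and> V \<longlonglongrightarrow> v"
    then have V1: "\<And>n. V n \<in> dyadic_holder (real A)" by (simp add: C_def)
    then have v: "v \<in> dyadic_holder (real A)"
      using V closed_dyadic_holder[of "real A"] unfolding closed_sequential_limits by blast
    have "path_of v \<notin> S"
    proof
      assume "path_of v \<in> S"
      moreover have "skorohod_tendsto (\<lambda>n. path_of (V n)) (path_of v)"
        using V v V1 by (intro uniform_limit_imp_skorohod_tendsto path_of_uniform_limit[of V "real A"]) auto
      moreover have "range (\<lambda>n. path_of (V n)) \<subseteq> cadlag" using path_of_cadlag[OF V1] by auto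
      ultimately have "\<forall>\<^sub>F n in sequentially. path_of (V n) \<in> S"
        using S unfolding skorohod_open_def by blast
      then show False using V by (auto simp: C_def eventually_sequentially)
    qed
    then show "v \<in> C A" using v by (simp add: C_def)
  qed
  have "(\<lambda>\<omega>. path_of (u \<omega>)) -` S \<inter> space N = (\<Union>A::nat. u -` (dyadic_holder (real A) - C A) \<inter> space N)"
    using holder by (auto simp: C_def)
  also have "\<dots> \<in> sets N"
    using closed closed_dyadic_holder
    by (intro sets.countable_UN image_subsetI measurable_sets[OF u] sets.Diff borel_closed) auto
  finally show "(\<lambda>\<omega>. path_of (u \<omega>)) -` S \<inter> space N \<in> sets N" .
qed

text \<open>The geometric factors combine to \<open>sqrt (1 / 2) / (9 / 10) ^ 3 < 1\<close>.\<close>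

lemma chaining_bound:
  obtains c where "0 \<le> c"
    "\<And>(M :: 'a measure) u K A. prob_space M \<Longrightarrow> 0 < A \<Longrightarrow> u \<in> M \<rightarrow>\<^sub>M borel \<Longrightarrow>
      (\<And>\<omega>. \<omega> \<in> space M \<Longrightarrow> consistent (u \<omega>)) \<Longrightarrow>
      (\<And>j k. integrable M (\<lambda>\<omega>. \<bar>u \<omega> (j, Suc k) - u \<omega> (j, k)\<bar> ^ 3)) \<Longrightarrow>
      (\<And>j k. (\<integral>\<omega>. \<bar>u \<omega> (j, Suc k) - u \<omega> (j, k)\<bar> ^ 3 \<partial>M) \<le> K * three_halves (1 / 2 ^ j)) \<Longrightarrow>
      measure M {\<omega> \<in> space M. u \<omega> \<notin> dyadic_holder A} \<le> c * K / A ^ 3"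
proof -
  define q where "q = sqrt (1 / 2) / (9 / 10) ^ 3"
  have "sqrt (1 / 2) < (9 / 10) ^ 3" by (rule real_less_lsqrt) (simp_all add: power2_eq_square power3_eq_cube)
  then have q: "0 \<le> q" "q < 1" by (simp_all add: q_def)
  have s: "summable (\<lambda>j. real (Suc j) * q ^ j)"
    using geometric_deriv_sums[of q] q by (auto simp: sums_iff)
  define c where "c = (\<Sum>j. real (Suc j) * q ^ j)"
  show ?thesis
  proof (rule that[of c])
    show "0 \<le> c" unfolding c_def using q by (intro suminf_nonneg s) auto
    fix M :: "'a measure" and u :: "'a \<Rightarrow> dyadic" and K A :: real
    assume M: "prob_space M" and A: "0 < A" and u: "u \<in> M \<rightarrow>\<^sub>M borel"
      and cons: "\<And>\<omega>. \<omega> \<in> space M \<Longrightarrow> consistent (u \<omega>)"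
      and int: "\<And>j k. integrable M (\<lambda>\<omega>. \<bar>u \<omega> (j, Suc k) - u \<omega> (j, k)\<bar> ^ 3)"
      and K: "\<And>j k. (\<integral>\<omega>. \<bar>u \<omega> (j, Suc k) - u \<omega> (j, k)\<bar> ^ 3 \<partial>M) \<le> K * three_halves (1 / 2 ^ j)"
    interpret prob_space M by fact
    have coord [measurable]: "(\<lambda>\<omega>. u \<omega> i) \<in> borel_measurable M" for i
      using u by (rule measurable_compose) (rule measurable_product_coordinates)
    have K0: "0 \<le> K"
      by (rule order_trans[OF integral_nonneg_AE K[of 0 0, simplified three_halves_def, simplified]]) simp
    define B where "B j k = {\<omega> \<in> space M. A * (9 / 10) ^ j \<le> \<bar>u \<omega> (j, Suc k) - u \<omega> (j, k)\<bar>}" for j k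
    have B_sets: "B j k \<in> events" for j k unfolding B_def by measurable
    have Bp: "prob (B j k) \<le> K * three_halves (1 / 2 ^ j) / (A * (9 / 10) ^ j) ^ 3" for j k
    proof -
      have "prob (B j k) \<le> prob {\<omega> \<in> space M. (A * (9 / 10) ^ j) ^ 3 \<le> \<bar>u \<omega> (j, Suc k) - u \<omega> (j, k)\<bar> ^ 3}"
        unfolding B_def using A by (intro finite_measure_mono) (auto intro!: power_mono)
      also have "\<dots> \<le> expectation (\<lambda>\<omega>. \<bar>u \<omega> (j, Suc k) - u \<omega> (j, k)\<bar> ^ 3) / (A * (9 / 10) ^ j) ^ 3"
        using A int by (intro integral_Markov_inequality_measure[where A="{}"]) auto
      also have "\<dots> \<le> K * three_halves (1 / 2 ^ j) / (A * (9 / 10) ^ j) ^ 3"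
        using K A by (intro divide_right_mono) auto
      finally show ?thesis .
    qed
    define C where "C j = (\<Union>k<j * 2 ^ j. B j k)" for j
    have C_sets: "C j \<in> events" for j unfolding C_def using B_sets by (intro sets.finite_UN) auto
    have Cp: "prob (C j) \<le> K / A ^ 3 * (real (Suc j) * q ^ j)" for j
    proof -
      have "prob (C j) \<le> (\<Sum>k<j * 2 ^ j. prob (B j k))"
        unfolding C_def using B_sets by (intro finite_measure_subadditive_finite) auto
      also have "\<dots> \<le> (\<Sum>k<j * 2 ^ j. K * three_halves (1 / 2 ^ j) / (A * (9 / 10) ^ j) ^ 3)" by (intro sum_mono Bp)
      also have "\<dots> = real j * (2 ^ j * three_halves (1 / 2 ^ j)) * K / (A ^ 3 * ((9 / 10) ^ j) ^ 3)"
        by (simp add: power_mult_distrib mult_ac)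
      \<comment> \<open>There are j 2^j increments at level \<open>j\<close>, with third moments of
        order 2^(-3j/2); after the union bound j 2^(-j/2) remains.\<close>
      also have "2 ^ j * three_halves (1 / 2 ^ j) = sqrt (1 / 2) ^ j"
        by (simp add: three_halves_def real_sqrt_power[symmetric] power_divide)
      also have "real j * sqrt (1 / 2) ^ j * K / (A ^ 3 * ((9 / 10) ^ j) ^ 3) = K / A ^ 3 * (real j * q ^ j)"
      proof -
        have "((9 / 10 :: real) ^ j) ^ 3 = ((9 / 10) ^ 3) ^ j" by (simp only: power_mult[symmetric] mult.commute)
        moreover have "real j * s ^ j * K / (A ^ 3 * p ^ j) = K / A ^ 3 * (real j * (s / p) ^ j)" for s p
          by (simp add: power_divide)
        ultimately show ?thesis unfolding q_def by (simp only:)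
      qed
      also have "\<dots> \<le> K / A ^ 3 * (real (Suc j) * q ^ j)"
        using K0 A q by (intro mult_left_mono mult_right_mono) auto
      finally show ?thesis .
    qed
    have sC: "summable (\<lambda>j. prob (C j))"
      by (rule summable_comparison_test[OF _ summable_mult[OF s, of "K / A ^ 3"]]) (use Cp in auto)
    have "prob {\<omega> \<in> space M. u \<omega> \<notin> dyadic_holder A} \<le> prob (\<Union>j. C j)"
    proof (rule finite_measure_mono)
      show "{\<omega> \<in> space M. u \<omega> \<notin> dyadic_holder A} \<subseteq> (\<Union>j. C j)"
        using cons unfolding dyadic_holder_def C_def B_def by (fastforce simp: not_le)
      show "(\<Union>j. C j) \<in> events" using C_sets by auto
    qed
    also have "\<dots> \<le> (\<Sum>j. prob (C j))"
      using C_sets by (intro finite_measure_subadditive_countably sC) auto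
    also have "\<dots> \<le> (\<Sum>j. K / A ^ 3 * (real (Suc j) * q ^ j))"
      by (intro suminf_le Cp sC summable_mult s)
    also have "\<dots> = c * K / A ^ 3" unfolding c_def by (subst suminf_mult[OF s]) simp
    finally show "prob {\<omega> \<in> space M. u \<omega> \<notin> dyadic_holder A} \<le> c * K / A ^ 3" .
  qed
qed

section \<open>Convergence in law for the Skorohod topology\<close>

definition lin_form :: "(real \<times> nat \<times> nat) list \<Rightarrow> dyadic \<Rightarrow> real" where
  "lin_form ps u = (\<Sum>(c, i)\<leftarrow>ps. c * u i)"

lemma lin_form_simps [simp]:
  "lin_form [] u = 0" "lin_form ((c, i) # ps) u = c * u i + lin_form ps u"
  by (simp_all add: lin_form_def)

lemma lin_form_append [simp]: "lin_form (ps @ qs) u = lin_form ps u + lin_form qs u"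
  by (simp add: lin_form_def)

lemma lin_form_uminus: "lin_form (map (\<lambda>(c, i). (- c, i)) ps) u = - lin_form ps u"
  by (induction ps) auto

lemma continuous_on_lin_form: "continuous_on S (lin_form ps)"
proof (induction ps)
  case (Cons p ps)
  obtain c i where p: "p = (c, i)" by (cases p)
  have "continuous_on S (\<lambda>u :: dyadic. u i)"
    by (rule continuous_on_subset[OF continuous_on_product_coordinates]) simp
  then show ?case using Cons by (auto simp: p intro!: continuous_intros)
qed simp

inductive_set trig_polys :: "(dyadic \<Rightarrow> real) set" where
  trig: "(\<lambda>u. a * cos (lin_form ps u) + b * sin (lin_form ps u)) \<in> trig_polys"
| add: "f \<in> trig_polys \<Longrightarrow> g \<in> trig_polys \<Longrightarrow> (\<lambda>u. f u + g u) \<in> trig_polys"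

lemma trig_polys_const: "(\<lambda>u. c) \<in> trig_polys"
  using trig_polys.trig[of c "[]" 0] by simp

text \<open>The product-to-sum formulas: frequencies are added and subtracted, which for lists is
  concatenation, with the signs of the second list reversed for the difference.\<close>

lemma trig_polys_mult_trig:
  assumes "g \<in> trig_polys"
  shows "(\<lambda>u. (a * cos (lin_form ps u) + b * sin (lin_form ps u)) * g u) \<in> trig_polys"
  using assms
proof induction
  case (trig a' qs b')
  let ?p = "ps @ qs" and ?m = "ps @ map (\<lambda>(c, i). (- c, i)) qs"
  have "(\<lambda>u. (a * cos (lin_form ps u) + b * sin (lin_form ps u)) * (a' * cos (lin_form qs u) + b' * sin (lin_form qs u))) =
      (\<lambda>u. ((a * a' + b * b') / 2 * cos (lin_form ?m u) + (b * a' - a * b') / 2 * sin (lin_form ?m u)) +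
        ((a * a' - b * b') / 2 * cos (lin_form ?p u) + (a * b' + b * a') / 2 * sin (lin_form ?p u)))"
    by (simp add: fun_eq_iff lin_form_uminus cos_add sin_add cos_diff sin_diff field_simps)
  then show ?case by (simp only: trig_polys.intros)
next
  case (add f g)
  then show ?case by (simp add: distrib_left trig_polys.add)
qed

lemma trig_polys_mult:
  assumes "f \<in> trig_polys" "g \<in> trig_polys"
  shows "(\<lambda>u. f u * g u) \<in> trig_polys"
  using assms(1)
proof induction
  case (trig a ps b)
  then show ?case by (rule trig_polys_mult_trig[OF assms(2)])
next
  case (add f1 f2)
  then show ?case by (simp add: distrib_right trig_polys.add)
qed

lemma continuous_on_trig_polys: "f \<in> trig_polys \<Longrightarrow> continuous_on S f"
  by (induction rule: trig_polys.induct) (auto intro!: continuous_intros continuous_on_lin_form)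

lemma trig_polys_bounded: "f \<in> trig_polys \<Longrightarrow> \<exists>B. \<forall>u. \<bar>f u\<bar> \<le> B"
proof (induction rule: trig_polys.induct)
  case (trig a ps b)
  have "\<bar>a * cos x + b * sin x\<bar> \<le> \<bar>a\<bar> + \<bar>b\<bar>" for x
    using mult_left_mono[OF abs_cos_le_one[of x], of "\<bar>a\<bar>"] mult_left_mono[OF abs_sin_le_one[of x], of "\<bar>b\<bar>"]
      abs_triangle_ineq[of "a * cos x" "b * sin x"] by (simp add: abs_mult)
  then show ?case by blast
next
  case (add f g)
  then obtain B C where "\<forall>u. \<bar>f u\<bar> \<le> B" "\<forall>u. \<bar>g u\<bar> \<le> C" by blast
  then show ?case by (intro exI[of _ "B + C"]) (auto intro: order_trans[OF abs_triangle_ineq add_mono])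
qed

lemma polynomial_trig_polys:
  fixes P :: "real \<Rightarrow> real"
  assumes "real_polynomial_function P" and f: "f \<in> trig_polys"
  shows "(\<lambda>u. P (f u)) \<in> trig_polys"
  using assms(1)
proof (induction rule: real_polynomial_function.induct)
  case (linear P)
  have "P x = P 1 * x" for x
    using linear.scaleR[OF bounded_linear.linear[OF linear], of x 1] by (simp add: mult.commute)
  then have "(\<lambda>u. P (f u)) = (\<lambda>u. P 1 * f u)" by metis
  then show ?case using trig_polys_mult[OF trig_polys_const f] by (simp only:)
qed (auto intro: trig_polys_const trig_polys.add trig_polys_mult)

text \<open>
  Clamping the approximation by a polynomial keeps it bounded by \<open>C + \<epsilon>\<close> outside the compact set.
\<close>

lemma trig_poly_approx:
  assumes F: "continuous_on (dyadic_holder A) F" and C: "\<And>u. u \<in> dyadic_holder A \<Longrightarrow> \<bar>F u\<bar> \<le> C"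
    and C0: "0 \<le> C" and \<epsilon>: "0 < \<epsilon>"
  obtains f where "f \<in> trig_polys" "\<And>u. \<bar>f u\<bar> \<le> C + \<epsilon>" "\<And>u. u \<in> dyadic_holder A \<Longrightarrow> \<bar>F u - f u\<bar> \<le> 2 * \<epsilon>"
proof -
  interpret function_ring_on trig_polys "dyadic_holder A"
  proof
    fix u v :: dyadic assume "u \<noteq> v"
    then obtain i where i: "u i \<noteq> v i" by (auto simp: fun_eq_iff)
    \<comment> \<open>Scales both values into [-1, 1], where the sine is injective.\<close>
    define c where "c = 1 / (1 + \<bar>u i\<bar> + \<bar>v i\<bar>)"
    have c0: "0 < c" by (simp add: c_def add_pos_nonneg)
    have small: "- (pi / 2) \<le> c * x \<and> c * x \<le> pi / 2" if "x = u i \<or> x = v i" for x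
    proof -
      have "\<bar>c * x\<bar> \<le> 1" using that by (auto simp: c_def abs_mult field_simps)
      then show ?thesis using pi_ge_two by (simp add: abs_le_iff)
    qed
    have "sin (c * u i) \<noteq> sin (c * v i)"
      using sin_inj_pi[of "c * u i" "c * v i"] small[of "u i"] small[of "v i"] i c0 by auto
    moreover have "(\<lambda>u. 0 * cos (lin_form [(c, i)] u) + 1 * sin (lin_form [(c, i)] u)) \<in> trig_polys"
      by (rule trig_polys.trig)
    ultimately show "\<exists>f\<in>trig_polys. f u \<noteq> f v" by (intro bexI) auto
  qed (auto intro: compact_dyadic_holder continuous_on_trig_polys trig_polys.add trig_polys_mult trig_polys_const)
  obtain g where g: "g \<in> trig_polys" "\<And>u. u \<in> dyadic_holder A \<Longrightarrow> \<bar>F u - g u\<bar> < \<epsilon>"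
    using Stone_Weierstrass_basic[OF F \<epsilon>] by blast
  obtain B where B: "\<And>u. \<bar>g u\<bar> \<le> B" using trig_polys_bounded[OF g(1)] by blast
  define \<phi> where "\<phi> x = max (- C) (min C x)" for x
  have "continuous_on {-B..B} \<phi>" unfolding \<phi>_def by (intro continuous_intros)
  then obtain P where P: "real_polynomial_function P" "\<And>x. x \<in> {-B..B} \<Longrightarrow> \<bar>\<phi> x - P x\<bar> < \<epsilon>"
    using Stone_Weierstrass_real_polynomial_function[of "{-B..B}" \<phi> \<epsilon>] \<epsilon> by auto
  have PB: "\<bar>\<phi> (g u) - P (g u)\<bar> < \<epsilon>" for u
    using B[of u] by (intro P(2)) (auto simp: abs_le_iff)
  show ?thesis
  proof (rule that[of "\<lambda>u. P (g u)"])
    show "(\<lambda>u. P (g u)) \<in> trig_polys" by (rule polynomial_trig_polys[OF P(1) g(1)])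
    have "\<bar>\<phi> x\<bar> \<le> C" for x using C0 by (auto simp: \<phi>_def)
    then show "\<bar>P (g u)\<bar> \<le> C + \<epsilon>" for u using PB[of u] by (smt (verit))
    fix u assume u: "u \<in> dyadic_holder A"
    \<comment> \<open>\<open>F u\<close> lies in the interval onto which \<open>\<phi>\<close>
      clamps, so clamping does not increase the distance to it.\<close>
    have "\<bar>F u - \<phi> (g u)\<bar> \<le> \<bar>F u - g u\<bar>" using C[OF u] by (auto simp: \<phi>_def)
    then show "\<bar>F u - P (g u)\<bar> \<le> 2 * \<epsilon>" using g(2)[OF u] PB[of u] by linarith
  qed
qed

text \<open>Consistency allows all coordinates to be read at one level, for which the sum of the
  occurring levels is large enough. There each value is the sum of the increments before it.\<close>

lemma lin_form_increments:
  "\<exists>J N v. \<forall>u. consistent u \<longrightarrow> lin_form ps u = (\<Sum>k<N. v k * (u (J, Suc k) - u (J, k)))"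
proof -
  define J where "J = (\<Sum>(c, j, k)\<leftarrow>ps. j)"
  have J: "j \<le> J" if "(c, j, k) \<in> set ps" for c j k
    unfolding J_def by (rule member_le_sum_list) (use that in force)+
  have "\<exists>N v. \<forall>u. consistent u \<longrightarrow> lin_form qs u = (\<Sum>k<N. v k * (u (J, Suc k) - u (J, k)))"
    if "set qs \<subseteq> set ps" for qs
    using that
  proof (induction qs)
    case Nil
    show ?case by (intro exI[of _ 0]) simp
  next
    case (Cons q qs)
    obtain c j k where q: "q = (c, j, k)" by (cases q)
    obtain N v where Nv: "\<And>u. consistent u \<Longrightarrow> lin_form qs u = (\<Sum>k<N. v k * (u (J, Suc k) - u (J, k)))"
      using Cons by auto
    have jJ: "j \<le> J" using J[of c j k] Cons.prems q by auto
    define m where "m = k * 2 ^ (J - j)"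
    define N' where "N' = max N m"
    define v' where "v' i = (if i < N then v i else 0) + (if i < m then c else 0)" for i
    have "lin_form (q # qs) u = (\<Sum>i<N'. v' i * (u (J, Suc i) - u (J, i)))" if u: "consistent u" for u
    proof -
      have "u (j, k) = u (J, m)" using consistent_shift[OF u, of j "J - j" k] jJ by (simp add: m_def)
      also have "\<dots> = (\<Sum>i<m. u (J, Suc i) - u (J, i))"
        using consistent_0[OF u] by (simp add: sum_lessThan_telescope[of "\<lambda>i. u (J, i)"])
      finally have 1: "c * u (j, k) = (\<Sum>i<m. c * (u (J, Suc i) - u (J, i)))" by (simp add: sum_distrib_left)
      have "(\<Sum>i<m. c * (u (J, Suc i) - u (J, i))) = (\<Sum>i<N'. (if i < m then c else 0) * (u (J, Suc i) - u (J, i)))"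
        by (rule sum.mono_neutral_cong_left) (auto simp: N'_def)
      moreover have "(\<Sum>i<N. v i * (u (J, Suc i) - u (J, i))) = (\<Sum>i<N'. (if i < N then v i else 0) * (u (J, Suc i) - u (J, i)))"
        by (rule sum.mono_neutral_cong_left) (auto simp: N'_def)
      ultimately show ?thesis
        using 1 Nv[OF u] by (simp add: q v'_def distrib_right sum.distrib)
    qed
    then show ?case by blast
  qed
  then show ?thesis by blast
qed

lemma measurable_coordinate: "U \<in> M \<rightarrow>\<^sub>M borel \<Longrightarrow> (\<lambda>\<omega>. (U \<omega> :: dyadic) i) \<in> borel_measurable M"
  by (rule measurable_compose[OF _ measurable_product_coordinates])

lemma measurable_trig_poly:
  assumes "f \<in> trig_polys" "U \<in> M \<rightarrow>\<^sub>M borel"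
  shows "(\<lambda>\<omega>. f (U \<omega>)) \<in> borel_measurable M"
  using borel_measurable_continuous_onI[OF continuous_on_trig_polys[OF assms(1)]] assms(2)
  by (rule measurable_compose_rev)

lemma trig_expectation_eq:
  fixes L :: "'c measure" and W :: "'c \<Rightarrow> dyadic"
  assumes L: "prob_space L" and W: "W \<in> L \<rightarrow>\<^sub>M borel" "\<And>\<omega>. \<omega> \<in> space L \<Longrightarrow> consistent (W \<omega>)"
    and eq: "\<And>u. consistent u \<Longrightarrow> lin_form ps u = (\<Sum>k<m. v k * (u (J, Suc k) - u (J, k)))"
  shows "(\<integral>\<omega>. a * cos (lin_form ps (W \<omega>)) + b * sin (lin_form ps (W \<omega>)) \<partial>L) =
    Re ((complex_of_real a - \<i> * complex_of_real b) * (\<integral>\<omega>. iexp (\<Sum>k<m. v k * (W \<omega> (J, Suc k) - W \<omega> (J, k))) \<partial>L))"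
proof -
  interpret L: prob_space L by fact
  define z where "z = complex_of_real a - \<i> * complex_of_real b"
  have trig_eq: "a * cos x + b * sin x = Re (z * iexp x)" for x
    by (simp add: z_def cis_conv_exp[symmetric] algebra_simps)
  have lin_meas [measurable]: "lin_form ps \<in> borel_measurable borel"
    by (rule borel_measurable_continuous_onI[OF continuous_on_lin_form])
  note [measurable] = W(1)
  have int: "integrable L (\<lambda>\<omega>. iexp (lin_form ps (W \<omega>)))"
    by (rule L.integrable_const_bound[where B=1]) auto
  have "(\<integral>\<omega>. a * cos (lin_form ps (W \<omega>)) + b * sin (lin_form ps (W \<omega>)) \<partial>L) = (\<integral>\<omega>. Re (z * iexp (lin_form ps (W \<omega>))) \<partial>L)"
    unfolding trig_eq ..
  also have "\<dots> = Re (\<integral>\<omega>. z * iexp (lin_form ps (W \<omega>)) \<partial>L)"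
    using int by (intro integral_Re integrable_mult_right) auto
  also have "(\<integral>\<omega>. z * iexp (lin_form ps (W \<omega>)) \<partial>L) = z * (\<integral>\<omega>. iexp (lin_form ps (W \<omega>)) \<partial>L)" by simp
  also have "(\<integral>\<omega>. iexp (lin_form ps (W \<omega>)) \<partial>L) = (\<integral>\<omega>. iexp (\<Sum>k<m. v k * (W \<omega> (J, Suc k) - W \<omega> (J, k))) \<partial>L)"
    by (intro Bochner_Integration.integral_cong) (simp_all add: eq W(2) del: of_real_sum)
  finally show ?thesis unfolding z_def .
qed

lemma trig_polys_expectation_limit:
  fixes M :: "'a measure" and N :: "'b measure" and U :: "nat \<Rightarrow> 'a \<Rightarrow> dyadic" and u :: "'b \<Rightarrow> dyadic"
  assumes M: "prob_space M" and N: "prob_space N"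
    and U: "\<And>n. U n \<in> M \<rightarrow>\<^sub>M borel" "\<And>n \<omega>. \<omega> \<in> space M \<Longrightarrow> consistent (U n \<omega>)"
    and u: "u \<in> N \<rightarrow>\<^sub>M borel" "\<And>\<omega>. \<omega> \<in> space N \<Longrightarrow> consistent (u \<omega>)"
    and char: "\<And>J m v. (\<lambda>n. \<integral>\<omega>. iexp (\<Sum>k<m. v k * (U n \<omega> (J, Suc k) - U n \<omega> (J, k))) \<partial>M) \<longlonglongrightarrow>
        (\<integral>\<omega>. iexp (\<Sum>k<m. v k * (u \<omega> (J, Suc k) - u \<omega> (J, k))) \<partial>N)"
    and f: "f \<in> trig_polys"
  shows "(\<lambda>n. \<integral>\<omega>. f (U n \<omega>) \<partial>M) \<longlonglongrightarrow> (\<integral>\<omega>. f (u \<omega>) \<partial>N)"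
  using f
proof induction
  case (trig a ps b)
  obtain J m v where Jmv: "\<And>u. consistent u \<Longrightarrow> lin_form ps u = (\<Sum>k<m. v k * (u (J, Suc k) - u (J, k)))"
    using lin_form_increments[of ps] by blast
  let ?z = "complex_of_real a - \<i> * complex_of_real b"
  have "(\<integral>\<omega>. a * cos (lin_form ps (U n \<omega>)) + b * sin (lin_form ps (U n \<omega>)) \<partial>M) =
      Re (?z * (\<integral>\<omega>. iexp (\<Sum>k<m. v k * (U n \<omega> (J, Suc k) - U n \<omega> (J, k))) \<partial>M))" for n
    by (rule trig_expectation_eq[OF M U Jmv])
  moreover have "(\<integral>\<omega>. a * cos (lin_form ps (u \<omega>)) + b * sin (lin_form ps (u \<omega>)) \<partial>N) =
      Re (?z * (\<integral>\<omega>. iexp (\<Sum>k<m. v k * (u \<omega> (J, Suc k) - u \<omega> (J, k))) \<partial>N))"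
    by (rule trig_expectation_eq[OF N u Jmv])
  ultimately show ?case
    by (simp only:) (intro tendsto_intros char)
next
  case (add f g)
  interpret M: prob_space M by fact
  interpret N: prob_space N by fact
  have intM: "integrable M (\<lambda>\<omega>. h (U n \<omega>))" and intN: "integrable N (\<lambda>\<omega>. h (u \<omega>))" if h: "h \<in> trig_polys" for h n
  proof -
    obtain B where "\<And>u. \<bar>h u\<bar> \<le> B" using trig_polys_bounded[OF h] by blast
    then show "integrable M (\<lambda>\<omega>. h (U n \<omega>))" "integrable N (\<lambda>\<omega>. h (u \<omega>))"
      using measurable_trig_poly[OF h U(1)] measurable_trig_poly[OF h u(1)]
      by (auto intro!: M.integrable_const_bound[where B=B] N.integrable_const_bound[where B=B])
  qed
  show ?case
    using tendsto_add[OF add.IH] intM[OF add.hyps(1)] intM[OF add.hyps(2)] intN[OF add.hyps(1)] intN[OF add.hyps(2)] by simp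
qed

lemma (in prob_space) expectation_diff_le:
  fixes f g :: "'a \<Rightarrow> real"
  assumes int: "integrable M f" "integrable M g" and G: "{\<omega> \<in> space M. \<not> G \<omega>} \<in> events"
    and good: "\<And>\<omega>. \<omega> \<in> space M \<Longrightarrow> G \<omega> \<Longrightarrow> \<bar>f \<omega> - g \<omega>\<bar> \<le> a"
    and bad: "\<And>\<omega>. \<omega> \<in> space M \<Longrightarrow> \<bar>f \<omega> - g \<omega>\<bar> \<le> b" and a: "0 \<le> a"
  shows "\<bar>expectation f - expectation g\<bar> \<le> a + b * prob {\<omega> \<in> space M. \<not> G \<omega>}"
proof -
  let ?B = "{\<omega> \<in> space M. \<not> G \<omega>}"
  have "\<bar>expectation f - expectation g\<bar> = norm (expectation (\<lambda>\<omega>. f \<omega> - g \<omega>))"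
    using int by simp
  also have "\<dots> \<le> expectation (\<lambda>\<omega>. a + b * indicator ?B \<omega>)"
  proof (rule norm_integral_le)
    show "integrable M (\<lambda>\<omega>. a + b * indicator ?B \<omega>)" using G by (auto simp: emeasure_eq_measure)
    show "AE \<omega> in M. norm (f \<omega> - g \<omega>) \<le> a + b * indicator ?B \<omega>"
      using good bad a by (intro AE_I2) (auto simp: indicator_def add_increasing)
  qed
  also have "\<dots> = a + b * prob ?B"
    using G by (subst Bochner_Integration.integral_add) (auto simp: prob_space emeasure_eq_measure)
  finally show ?thesis .
qed

text \<open>On a compact set of large probability the test function is replaced by a trigonometric
  polynomial, whose mean is determined by characteristic functions. The replacement is bounded
  everywhere, so the exceptional event costs little; \<open>close\<close> allows the actual paths to
  be discontinuous.\<close>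

theorem weak_convergence:
  fixes M :: "'a measure" and N :: "'b measure" and U :: "nat \<Rightarrow> 'a \<Rightarrow> dyadic" and u :: "'b \<Rightarrow> dyadic"
    and Y :: "nat \<Rightarrow> 'a \<Rightarrow> real \<Rightarrow> real"
  assumes M: "prob_space M" and N: "prob_space N"
    and U: "\<And>n. U n \<in> M \<rightarrow>\<^sub>M borel" "\<And>n \<omega>. \<omega> \<in> space M \<Longrightarrow> consistent (U n \<omega>)"
    and u: "u \<in> N \<rightarrow>\<^sub>M borel" "\<And>\<omega>. \<omega> \<in> space N \<Longrightarrow> \<exists>A::nat. u \<omega> \<in> dyadic_holder (real A)"
    and char: "\<And>J m v. (\<lambda>n. \<integral>\<omega>. iexp (\<Sum>k<m. v k * (U n \<omega> (J, Suc k) - U n \<omega> (J, k))) \<partial>M) \<longlonglongrightarrow>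
        (\<integral>\<omega>. iexp (\<Sum>k<m. v k * (u \<omega> (J, Suc k) - u \<omega> (J, k))) \<partial>N)"
    and tight: "\<And>\<epsilon>. 0 < \<epsilon> \<Longrightarrow> \<exists>A. (\<forall>n. measure M {\<omega> \<in> space M. U n \<omega> \<notin> dyadic_holder A} \<le> \<epsilon>) \<and>
        measure N {\<omega> \<in> space N. u \<omega> \<notin> dyadic_holder A} \<le> \<epsilon>"
    and Y: "\<And>n. Y n \<in> M \<rightarrow>\<^sub>M borel_of skorohod_topology"
    and close: "\<And>T \<delta>. 0 \<le> T \<Longrightarrow> 0 < \<delta> \<Longrightarrow> \<exists>E. (\<forall>n. E n \<in> sets M) \<and> (\<lambda>n. measure M (E n)) \<longlonglongrightarrow> 0 \<and>
        (\<forall>n \<omega> t A. \<omega> \<in> space M - E n \<longrightarrow> 0 \<le> t \<longrightarrow> t \<le> T \<longrightarrow> U n \<omega> \<in> dyadic_holder A \<longrightarrow> \<bar>Y n \<omega> t - path_of (U n \<omega>) t\<bar> < \<delta>)"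
  shows "converges_in_law skorohod_topology M Y N (\<lambda>\<omega>. path_of (u \<omega>))"
  unfolding converges_in_law_def
proof (intro conjI allI impI)
  show "Y n \<in> M \<rightarrow>\<^sub>M borel_of skorohod_topology" for n by (rule Y)
  show path_meas: "(\<lambda>\<omega>. path_of (u \<omega>)) \<in> N \<rightarrow>\<^sub>M borel_of skorohod_topology"
    by (rule measurable_path_of[OF u])
  fix g assume g: "continuous_map skorohod_topology euclideanreal g \<and> bounded (g ` topspace skorohod_topology)"
  interpret M: prob_space M by fact
  interpret N: prob_space N by fact
  have u_cons: "consistent (u \<omega>)" if "\<omega> \<in> space N" for \<omega> using u(2)[OF that] by (auto simp: dyadic_holder_def)
  obtain C where C: "\<And>y. y \<in> cadlag \<Longrightarrow> \<bar>g y\<bar> \<le> C" and C0: "0 < C"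
    using g unfolding bounded_pos topspace_skorohod_topology by auto
  have space_borel: "space (borel_of skorohod_topology) = cadlag"
    by (simp add: borel_of_def topspace_skorohod_topology space_measure_of_conv)
  have g_meas: "g \<in> borel_measurable (borel_of skorohod_topology)"
  proof (rule borel_measurableI)
    fix S :: "real set" assume "open S"
    then have "openin skorohod_topology {y \<in> topspace skorohod_topology. g y \<in> S}"
      using g unfolding continuous_map_def by simp
    then have "{y \<in> topspace skorohod_topology. g y \<in> S} \<in> sets (borel_of skorohod_topology)"
      unfolding borel_of_def by (subst sets_measure_of) (auto dest: openin_subset)
    then show "g -` S \<inter> space (borel_of skorohod_topology) \<in> sets (borel_of skorohod_topology)"
      by (simp add: space_borel topspace_skorohod_topology vimage_def Int_def conj_commute)
  qed
  have Y_cad: "Y n \<omega> \<in> cadlag" if "\<omega> \<in> space M" for n \<omega>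
    using measurable_space[OF Y that] by (simp add: space_borel)
  have u_cad: "path_of (u \<omega>) \<in> cadlag" if "\<omega> \<in> space N" for \<omega>
    using measurable_space[OF path_meas that] by (simp add: space_borel)
  have intY: "integrable M (\<lambda>\<omega>. g (Y n \<omega>))" for n
    by (rule M.integrable_const_bound[where B=C]) (use C Y_cad measurable_compose[OF Y g_meas] in auto)
  have intu: "integrable N (\<lambda>\<omega>. g (path_of (u \<omega>)))"
    by (rule N.integrable_const_bound[where B=C]) (use C u_cad measurable_compose[OF path_meas g_meas] in auto)
  show "(\<lambda>n. \<integral>\<omega>. g (Y n \<omega>) \<partial>M) \<longlonglongrightarrow> (\<integral>\<omega>. g (path_of (u \<omega>)) \<partial>N)"
  proof (rule tendstoI)
    fix e :: real assume e: "0 < e"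
    \<comment> \<open>The three errors below are 5, 1 and 3 times \<open>\<epsilon>\<close>. The
      bound \<open>\<epsilon> \<le> 1\<close> keeps all differences below
      \<open>2 * C + 1\<close>.\<close>
    define \<epsilon> where "\<epsilon> = min 1 (e / 10)"
    have \<epsilon>: "0 < \<epsilon>" "\<epsilon> \<le> 1" "10 * \<epsilon> \<le> e" using e by (auto simp: \<epsilon>_def)
    define \<eta> where "\<eta> = \<epsilon> / (2 * C + 1)"
    have \<eta>: "0 < \<eta>" "(2 * C + 1) * \<eta> = \<epsilon>" using \<epsilon> C0 by (auto simp: \<eta>_def)
    obtain A where A: "\<And>n. measure M {\<omega> \<in> space M. U n \<omega> \<notin> dyadic_holder A} \<le> \<eta>"
      "measure N {\<omega> \<in> space N. u \<omega> \<notin> dyadic_holder A} \<le> \<eta>"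
      using tight[OF \<eta>(1)] by blast
    have F: "continuous_on (dyadic_holder A) (\<lambda>u. g (path_of u))"
      using g by (intro continuous_on_dyadic_holder) auto
    have gC: "\<bar>g (path_of v)\<bar> \<le> C" if "v \<in> dyadic_holder A" for v
      using C path_of_cadlag[OF that] by blast
    obtain f where f: "f \<in> trig_polys" "\<And>v. \<bar>f v\<bar> \<le> C + \<epsilon>" "\<And>v. v \<in> dyadic_holder A \<Longrightarrow> \<bar>g (path_of v) - f v\<bar> \<le> 2 * \<epsilon>"
      using trig_poly_approx[OF F gC _ \<epsilon>(1)] C0 by (metis less_imp_le)
    obtain T \<delta> where T: "0 \<le> T" "0 < \<delta>" "\<And>v y. v \<in> dyadic_holder A \<Longrightarrow> y \<in> cadlag \<Longrightarrow>
        (\<And>t. 0 \<le> t \<Longrightarrow> t \<le> T \<Longrightarrow> \<bar>y t - path_of v t\<bar> < \<delta>) \<Longrightarrow> \<bar>g y - g (path_of v)\<bar> < \<epsilon>"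
      using skorohod_continuous_near_holder[of g \<epsilon> A] g \<epsilon>(1) by metis
    obtain E where E: "\<And>n. E n \<in> sets M" "(\<lambda>n. measure M (E n)) \<longlonglongrightarrow> 0"
      "\<And>n \<omega> t A. \<omega> \<in> space M - E n \<Longrightarrow> 0 \<le> t \<Longrightarrow> t \<le> T \<Longrightarrow> U n \<omega> \<in> dyadic_holder A \<Longrightarrow> \<bar>Y n \<omega> t - path_of (U n \<omega>) t\<bar> < \<delta>"
      using close[OF T(1,2)] by blast
    have intf: "integrable M (\<lambda>\<omega>. f (U n \<omega>))" "integrable N (\<lambda>\<omega>. f (u \<omega>))" for n
      using f(2) measurable_trig_poly[OF f(1) U(1)] measurable_trig_poly[OF f(1) u(1)]
      by (auto intro!: M.integrable_const_bound[where B="C + \<epsilon>"] N.integrable_const_bound[where B="C + \<epsilon>"])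
    have bad_sets: "{\<omega> \<in> space M. U n \<omega> \<notin> dyadic_holder A} \<in> sets M" "{\<omega> \<in> space N. u \<omega> \<notin> dyadic_holder A} \<in> sets N" for n
      using measurable_sets[OF U(1)[of n], of "- dyadic_holder A"] measurable_sets[OF u(1), of "- dyadic_holder A"]
        closed_dyadic_holder[of A] by (auto simp: vimage_def Int_def conj_commute)
    have "\<forall>\<^sub>F n in sequentially. measure M (E n) < \<eta>"
      using E(2) \<eta>(1) by (intro order_tendstoD(2)) auto
    moreover have "\<forall>\<^sub>F n in sequentially. dist (\<integral>\<omega>. f (U n \<omega>) \<partial>M) (\<integral>\<omega>. f (u \<omega>) \<partial>N) < \<epsilon>"
      using trig_polys_expectation_limit[OF M N U u(1) u_cons char f(1)] \<epsilon>(1) by (intro tendstoD)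
    ultimately show "\<forall>\<^sub>F n in sequentially. dist (\<integral>\<omega>. g (Y n \<omega>) \<partial>M) (\<integral>\<omega>. g (path_of (u \<omega>)) \<partial>N) < e"
    proof eventually_elim
      case (elim n)
      let ?G = "\<lambda>\<omega>. U n \<omega> \<in> dyadic_holder A \<and> \<omega> \<notin> E n"
      have badG: "{\<omega> \<in> space M. \<not> ?G \<omega>} = {\<omega> \<in> space M. U n \<omega> \<notin> dyadic_holder A} \<union> E n"
        using sets.sets_into_space[OF E(1)[of n]] by auto
      have "\<bar>(\<integral>\<omega>. g (Y n \<omega>) \<partial>M) - (\<integral>\<omega>. f (U n \<omega>) \<partial>M)\<bar> \<le> 3 * \<epsilon> + (2 * C + 1) * measure M {\<omega> \<in> space M. \<not> ?G \<omega>}"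
      proof (rule M.expectation_diff_le[OF intY intf(1)])
        show "{\<omega> \<in> space M. \<not> ?G \<omega>} \<in> sets M" unfolding badG using bad_sets E(1) by auto
        fix \<omega> assume \<omega>: "\<omega> \<in> space M"
        show "\<bar>g (Y n \<omega>) - f (U n \<omega>)\<bar> \<le> 2 * C + 1"
          using C[OF Y_cad[OF \<omega>, of n]] f(2)[of "U n \<omega>"] \<epsilon>(2) by linarith
        assume G: "?G \<omega>"
        have "\<bar>g (Y n \<omega>) - g (path_of (U n \<omega>))\<bar> < \<epsilon>"
          using G \<omega> E(3) Y_cad by (intro T(3)) auto
        then show "\<bar>g (Y n \<omega>) - f (U n \<omega>)\<bar> \<le> 3 * \<epsilon>" using f(3)[of "U n \<omega>"] G by linarith
      qed (use \<epsilon> in auto)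
      also have "\<dots> \<le> 3 * \<epsilon> + (2 * C + 1) * (\<eta> + \<eta>)"
      proof (intro add_left_mono mult_left_mono)
        have "measure M {\<omega> \<in> space M. \<not> ?G \<omega>} \<le> measure M {\<omega> \<in> space M. U n \<omega> \<notin> dyadic_holder A} + measure M (E n)"
          unfolding badG using bad_sets E(1) by (intro measure_Un_le) auto
        then show "measure M {\<omega> \<in> space M. \<not> ?G \<omega>} \<le> \<eta> + \<eta>" using A(1)[of n] elim(1) by linarith
      qed (use C0 in simp)
      also have "\<dots> = 5 * \<epsilon>" using \<eta>(2) by (simp add: distrib_left)
      finally have 1: "\<bar>(\<integral>\<omega>. g (Y n \<omega>) \<partial>M) - (\<integral>\<omega>. f (U n \<omega>) \<partial>M)\<bar> \<le> 5 * \<epsilon>" .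
      have "\<bar>(\<integral>\<omega>. g (path_of (u \<omega>)) \<partial>N) - (\<integral>\<omega>. f (u \<omega>) \<partial>N)\<bar> \<le> 2 * \<epsilon> + (2 * C + 1) * measure N {\<omega> \<in> space N. \<not> u \<omega> \<in> dyadic_holder A}"
      proof (rule N.expectation_diff_le[OF intu intf(2)])
        fix \<omega> assume \<omega>: "\<omega> \<in> space N"
        show "\<bar>g (path_of (u \<omega>)) - f (u \<omega>)\<bar> \<le> 2 * C + 1"
          using C[OF u_cad[OF \<omega>]] f(2)[of "u \<omega>"] \<epsilon>(2) by linarith
        show "\<bar>g (path_of (u \<omega>)) - f (u \<omega>)\<bar> \<le> 2 * \<epsilon>" if "u \<omega> \<in> dyadic_holder A" by (rule f(3)[OF that])
      qed (use \<epsilon> bad_sets in auto)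
      also have "\<dots> \<le> 2 * \<epsilon> + (2 * C + 1) * \<eta>" using A(2) C0 by (intro add_left_mono mult_left_mono) auto
      also have "\<dots> = 3 * \<epsilon>" using \<eta>(2) by simp
      finally have 2: "\<bar>(\<integral>\<omega>. g (path_of (u \<omega>)) \<partial>N) - (\<integral>\<omega>. f (u \<omega>) \<partial>N)\<bar> \<le> 3 * \<epsilon>" .
      show ?case using 1 2 elim(2) \<epsilon> unfolding dist_real_def by linarith
    qed
  qed
qed

section \<open>Construction of Brownian motion\<close>

context prob_space
begin

lemma integrable_iexp_real: "X \<in> borel_measurable M \<Longrightarrow> integrable M (\<lambda>\<omega>. iexp (X \<omega>))"
  by (rule integrable_const_bound[where B=1]) auto

text \<open>
  A bounded weight that is uncorrelated with all characters of \<open>X\<close> is uncorrelated with \<open>X\<close>: under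
  the probability with density proportional to a positive weight, \<open>X\<close> has the same characteristic
  function.
\<close>

lemma positive_weight_uncorrelated:
  assumes X [measurable]: "X \<in> borel_measurable M" and H [measurable]: "H \<in> borel_measurable M"
    and bounds: "\<And>\<omega>. 0 < H \<omega>" "\<And>\<omega>. H \<omega> \<le> b"
    and char: "\<And>s. expectation (\<lambda>\<omega>. complex_of_real (H \<omega>) * iexp (s * X \<omega>)) =
      of_real (expectation H) * expectation (\<lambda>\<omega>. iexp (s * X \<omega>))"
    and A: "A \<in> sets borel"
  shows "expectation (\<lambda>\<omega>. H \<omega> * indicator A (X \<omega>)) = expectation H * expectation (\<lambda>\<omega>. indicator A (X \<omega>))"
proof -
  have intH: "integrable M H"
    by (rule integrable_const_bound[where B=b]) (use bounds in \<open>auto simp: abs_of_pos\<close>)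
  have pos: "0 < expectation H"
  proof -
    have "0 \<le> expectation H" using bounds by (intro integral_nonneg_AE) (auto intro: less_imp_le)
    moreover have "expectation H \<noteq> 0"
    proof
      assume "expectation H = 0"
      then have "AE \<omega> in M. H \<omega> = 0"
        using integral_nonneg_eq_0_iff_AE[OF intH] bounds by (simp add: less_imp_le)
      then have "AE \<omega> in M. False" by eventually_elim (metis bounds(1) less_irrefl)
      then show False by simp
    qed
    ultimately show ?thesis by simp
  qed
  define D where "D \<omega> = H \<omega> / expectation H" for \<omega>
  have D_meas [measurable]: "D \<in> borel_measurable M" unfolding D_def by measurable
  have D_nonneg: "0 \<le> D \<omega>" for \<omega> using bounds(1)[of \<omega>] pos by (simp add: D_def)
  let ?N = "density M (\<lambda>\<omega>. ennreal (D \<omega>))"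
  have intD: "integrable M D" "expectation D = 1" unfolding D_def using intH pos by simp_all
  have "emeasure ?N (space ?N) = 1"
    using intD nn_integral_eq_integral[OF intD(1)] D_nonneg by (simp add: emeasure_density)
  then interpret N: prob_space ?N by (rule prob_spaceI)
  have XN: "X \<in> borel_measurable ?N" by simp
  have "distr ?N borel X = distr M borel X"
  proof (rule Levy_uniqueness)
    show "real_distribution (distr ?N borel X)" by (rule N.real_distribution_distr[OF XN])
    show "real_distribution (distr M borel X)" by (rule real_distribution_distr[OF X])
    show "char (distr ?N borel X) = char (distr M borel X)"
    proof
      fix s
      have "char (distr ?N borel X) s = (\<integral>\<omega>. iexp (s * X \<omega>) \<partial>?N)"
        unfolding char_def by (subst integral_distr) auto
      also have "\<dots> = expectation (\<lambda>\<omega>. D \<omega> *\<^sub>R iexp (s * X \<omega>))"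
        using D_nonneg by (subst integral_density) auto
      also have "\<dots> = expectation (\<lambda>\<omega>. of_real (1 / expectation H) * (complex_of_real (H \<omega>) * iexp (s * X \<omega>)))"
        by (simp add: D_def scaleR_conv_of_real)
      also have "\<dots> = expectation (\<lambda>\<omega>. iexp (s * X \<omega>))"
        unfolding Bochner_Integration.integral_mult_right_zero char using pos by simp
      also have "\<dots> = char (distr M borel X) s"
        unfolding char_def by (subst integral_distr) auto
      finally show "char (distr ?N borel X) s = char (distr M borel X) s" .
    qed
  qed
  then have "(\<integral>x. indicator A x \<partial>distr ?N borel X) = (\<integral>x. (indicator A x :: real) \<partial>distr M borel X)" by simp
  then have "(\<integral>\<omega>. indicator A (X \<omega>) \<partial>?N) = expectation (\<lambda>\<omega>. indicator A (X \<omega>) :: real)"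
    using A by (subst (asm) (1 2) integral_distr) auto
  moreover have "(\<integral>\<omega>. (indicator A (X \<omega>) :: real) \<partial>?N) = expectation (\<lambda>\<omega>. H \<omega> * indicator A (X \<omega>) / expectation H)"
    using A D_nonneg by (subst integral_density) (auto simp: D_def)
  ultimately show ?thesis using pos by (simp add: field_simps)
qed

text \<open>Adding 2 makes the weight positive, and constants are uncorrelated with
  everything.\<close>

lemma real_weight_uncorrelated:
  assumes X [measurable]: "X \<in> borel_measurable M" and H [measurable]: "H \<in> borel_measurable M"
    and bound: "\<And>\<omega>. \<bar>H \<omega>\<bar> \<le> 1"
    and char: "\<And>s. expectation (\<lambda>\<omega>. complex_of_real (H \<omega>) * iexp (s * X \<omega>)) =
      of_real (expectation H) * expectation (\<lambda>\<omega>. iexp (s * X \<omega>))"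
    and A [measurable]: "A \<in> sets borel"
  shows "expectation (\<lambda>\<omega>. H \<omega> * indicator A (X \<omega>)) = expectation H * expectation (\<lambda>\<omega>. indicator A (X \<omega>))"
proof -
  have intH: "integrable M H" by (rule integrable_const_bound[where B=1]) (use bound in auto)
  have int1: "integrable M (\<lambda>\<omega>. complex_of_real (H \<omega>) * iexp (s * X \<omega>))" for s
    by (rule integrable_const_bound[where B=1]) (use bound in \<open>auto simp: norm_mult\<close>)
  have int2: "integrable M (\<lambda>\<omega>. iexp (s * X \<omega>))" for s by (rule integrable_iexp_real) auto
  have int3: "integrable M (\<lambda>\<omega>. indicator A (X \<omega>) :: real)"
    by (rule integrable_const_bound[where B=1]) auto
  have int4: "integrable M (\<lambda>\<omega>. H \<omega> * indicator A (X \<omega>))"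
    by (rule integrable_const_bound[where B=1]) (use bound in \<open>auto simp: indicator_def\<close>)
  have "expectation (\<lambda>\<omega>. (2 + H \<omega>) * indicator A (X \<omega>)) =
      expectation (\<lambda>\<omega>. 2 + H \<omega>) * expectation (\<lambda>\<omega>. indicator A (X \<omega>))"
  proof (rule positive_weight_uncorrelated[OF X])
    show "0 < 2 + H \<omega>" "2 + H \<omega> \<le> 3" for \<omega> using bound[of \<omega>] by auto
    fix s
    have "expectation (\<lambda>\<omega>. complex_of_real (2 + H \<omega>) * iexp (s * X \<omega>)) =
        expectation (\<lambda>\<omega>. 2 * iexp (s * X \<omega>) + complex_of_real (H \<omega>) * iexp (s * X \<omega>))"
      by (simp add: distrib_right)
    also have "\<dots> = 2 * expectation (\<lambda>\<omega>. iexp (s * X \<omega>)) + of_real (expectation H) * expectation (\<lambda>\<omega>. iexp (s * X \<omega>))"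
      using int1[of s] int2[of s] char[of s] by (simp del: of_real_mult)
    also have "\<dots> = of_real (expectation (\<lambda>\<omega>. 2 + H \<omega>)) * expectation (\<lambda>\<omega>. iexp (s * X \<omega>))"
      using intH by (simp add: prob_space distrib_right)
    finally show "expectation (\<lambda>\<omega>. complex_of_real (2 + H \<omega>) * iexp (s * X \<omega>)) =
        of_real (expectation (\<lambda>\<omega>. 2 + H \<omega>)) * expectation (\<lambda>\<omega>. iexp (s * X \<omega>))" .
  qed auto
  moreover have "expectation (\<lambda>\<omega>. (2 + H \<omega>) * indicator A (X \<omega>)) =
      2 * expectation (\<lambda>\<omega>. indicator A (X \<omega>)) + expectation (\<lambda>\<omega>. H \<omega> * indicator A (X \<omega>))"
    using int3 int4 by (simp add: distrib_right)
  moreover have "expectation (\<lambda>\<omega>. 2 + H \<omega>) = 2 + expectation H" using intH by (simp add: prob_space)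
  ultimately show ?thesis by (simp add: distrib_right)
qed

text \<open>The real and imaginary parts of \<open>G\<close> are combinations of \<open>G\<close>
  and its conjugate; the hypothesis for the conjugate is the one for \<open>G\<close> at frequency
  \<open>- s\<close>.\<close>

lemma weight_uncorrelated:
  fixes G :: "'a \<Rightarrow> complex"
  assumes X [measurable]: "X \<in> borel_measurable M" and G [measurable]: "G \<in> borel_measurable M"
    and bound: "\<And>\<omega>. cmod (G \<omega>) \<le> 1"
    and char: "\<And>s. expectation (\<lambda>\<omega>. G \<omega> * iexp (s * X \<omega>)) = expectation G * expectation (\<lambda>\<omega>. iexp (s * X \<omega>))"
    and A [measurable]: "A \<in> sets borel"
  shows "expectation (\<lambda>\<omega>. G \<omega> * of_real (indicator A (X \<omega>))) = expectation G * of_real (prob {\<omega> \<in> space M. X \<omega> \<in> A})"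
proof -
  have intG: "integrable M G" by (rule integrable_const_bound[where B=1]) (use bound in auto)
  have intGe: "integrable M (\<lambda>\<omega>. G \<omega> * iexp (s * X \<omega>))" for s
    by (rule integrable_const_bound[where B=1]) (use bound in \<open>auto simp: norm_mult\<close>)
  have [measurable]: "(\<lambda>\<omega>. cnj (G \<omega>)) \<in> borel_measurable M"
    by (rule measurable_compose[OF G borel_measurable_continuous_onI]) (intro continuous_intros)
  have intcGe: "integrable M (\<lambda>\<omega>. cnj (G \<omega>) * iexp (s * X \<omega>))" for s
    by (rule integrable_const_bound[where B=1]) (use bound in \<open>auto simp: norm_mult\<close>)
  have cchar: "expectation (\<lambda>\<omega>. cnj (G \<omega>) * iexp (s * X \<omega>)) = cnj (expectation G) * expectation (\<lambda>\<omega>. iexp (s * X \<omega>))" for s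
  proof -
    have cnj_iexp: "cnj (iexp (- s * X \<omega>)) = iexp (s * X \<omega>)" for \<omega> by (simp add: exp_cnj)
    have "expectation (\<lambda>\<omega>. cnj (G \<omega>) * iexp (s * X \<omega>)) = expectation (\<lambda>\<omega>. cnj (G \<omega> * iexp (- s * X \<omega>)))"
      unfolding complex_cnj_mult cnj_iexp ..
    also have "\<dots> = cnj (expectation G * expectation (\<lambda>\<omega>. iexp (- s * X \<omega>)))"
      unfolding Bochner_Integration.integral_cnj char ..
    also have "\<dots> = cnj (expectation G) * expectation (\<lambda>\<omega>. iexp (s * X \<omega>))"
      unfolding complex_cnj_mult Bochner_Integration.integral_cnj[symmetric] cnj_iexp ..
    finally show ?thesis .
  qed
  have re: "expectation (\<lambda>\<omega>. Re (G \<omega>) * indicator A (X \<omega>)) = expectation (\<lambda>\<omega>. Re (G \<omega>)) * expectation (\<lambda>\<omega>. indicator A (X \<omega>))"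
  proof (rule real_weight_uncorrelated[OF X])
    show "\<bar>Re (G \<omega>)\<bar> \<le> 1" for \<omega> using abs_Re_le_cmod[of "G \<omega>"] bound[of \<omega>] by linarith
    fix s
    have "complex_of_real (Re z) = (z + cnj z) / 2" for z by (simp add: complex_eq_iff)
    then have "expectation (\<lambda>\<omega>. complex_of_real (Re (G \<omega>)) * iexp (s * X \<omega>)) =
        expectation (\<lambda>\<omega>. (G \<omega> * iexp (s * X \<omega>) + cnj (G \<omega>) * iexp (s * X \<omega>)) / 2)"
      by (simp add: distrib_right add_divide_distrib)
    also have "\<dots> = (expectation G + cnj (expectation G)) / 2 * expectation (\<lambda>\<omega>. iexp (s * X \<omega>))"
      using intGe[of s] intcGe[of s] char[of s] cchar[of s] by (simp add: distrib_right add_divide_distrib)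
    also have "(expectation G + cnj (expectation G)) / 2 = of_real (expectation (\<lambda>\<omega>. Re (G \<omega>)))"
      using integral_Re[OF intG] by (simp add: complex_eq_iff)
    finally show "expectation (\<lambda>\<omega>. complex_of_real (Re (G \<omega>)) * iexp (s * X \<omega>)) =
        of_real (expectation (\<lambda>\<omega>. Re (G \<omega>))) * expectation (\<lambda>\<omega>. iexp (s * X \<omega>))" .
  qed auto
  have im: "expectation (\<lambda>\<omega>. Im (G \<omega>) * indicator A (X \<omega>)) = expectation (\<lambda>\<omega>. Im (G \<omega>)) * expectation (\<lambda>\<omega>. indicator A (X \<omega>))"
  proof (rule real_weight_uncorrelated[OF X])
    show "\<bar>Im (G \<omega>)\<bar> \<le> 1" for \<omega> using abs_Im_le_cmod[of "G \<omega>"] bound[of \<omega>] by linarith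
    fix s
    have "complex_of_real (Im z) = (- \<i> / 2) * (z - cnj z)" for z by (simp add: complex_eq_iff)
    then have "expectation (\<lambda>\<omega>. complex_of_real (Im (G \<omega>)) * iexp (s * X \<omega>)) =
        expectation (\<lambda>\<omega>. (- \<i> / 2) * (G \<omega> * iexp (s * X \<omega>) - cnj (G \<omega>) * iexp (s * X \<omega>)))"
      by (simp add: left_diff_distrib right_diff_distrib mult.assoc del: of_real_mult)
    also have "\<dots> = (- \<i> / 2) * (expectation G - cnj (expectation G)) * expectation (\<lambda>\<omega>. iexp (s * X \<omega>))"
      using intGe[of s] intcGe[of s] char[of s] cchar[of s] by (simp add: left_diff_distrib right_diff_distrib mult.assoc)
    also have "(- \<i> / 2) * (expectation G - cnj (expectation G)) = of_real (expectation (\<lambda>\<omega>. Im (G \<omega>)))"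
      using integral_Im[OF intG] by (simp add: complex_eq_iff)
    finally show "expectation (\<lambda>\<omega>. complex_of_real (Im (G \<omega>)) * iexp (s * X \<omega>)) =
        of_real (expectation (\<lambda>\<omega>. Im (G \<omega>))) * expectation (\<lambda>\<omega>. iexp (s * X \<omega>))" .
  qed auto
  have P: "expectation (\<lambda>\<omega>. indicator A (X \<omega>)) = prob {\<omega> \<in> space M. X \<omega> \<in> A}"
  proof -
    have "expectation (\<lambda>\<omega>. indicator A (X \<omega>)) = expectation (indicator {\<omega> \<in> space M. X \<omega> \<in> A})"
      by (intro Bochner_Integration.integral_cong) (auto simp: indicator_def)
    also have "\<dots> = prob {\<omega> \<in> space M. X \<omega> \<in> A}"
      by (simp add: Int_absorb1 subset_eq)
    finally show ?thesis .
  qed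
  have int: "integrable M (\<lambda>\<omega>. G \<omega> * of_real (indicator A (X \<omega>)))"
    by (rule integrable_const_bound[where B=1]) (use bound in \<open>auto simp: norm_mult indicator_def\<close>)
  show ?thesis
    using integral_Re[OF int] integral_Im[OF int] integral_Re[OF intG] integral_Im[OF intG] re im
    by (simp add: complex_eq_iff P)
qed

text \<open>Characters are replaced by indicators one variable at a time. With \<open>m\<close> of
  them replaced, the induction hypothesis at all frequencies says that the remaining product is
  uncorrelated with every character of \<open>X m\<close>, hence with its indicators.\<close>

theorem indep_vars_of_char:
  fixes X :: "nat \<Rightarrow> 'a \<Rightarrow> real"
  assumes X [measurable]: "\<And>k. X k \<in> borel_measurable M"
    and char: "\<And>v. expectation (\<lambda>\<omega>. iexp (\<Sum>k<n. v k * X k \<omega>)) = (\<Prod>k<n. expectation (\<lambda>\<omega>. iexp (v k * X k \<omega>)))"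
  shows "indep_vars (\<lambda>_. borel) X {..<n}"
proof (cases "n = 0")
  case True
  then show ?thesis by (simp add: indep_vars_def indep_sets_def)
next
  case False
  define G where "G A v m \<omega> = (\<Prod>k<m. of_real (indicator (A k) (X k \<omega>))) * (\<Prod>k\<in>{m..<n}. iexp (v k * X k \<omega>))"
    for A :: "nat \<Rightarrow> real set" and v :: "nat \<Rightarrow> real" and m \<omega>
  define Q where "Q A v m = (\<Prod>k<m. of_real (prob {\<omega> \<in> space M. X k \<omega> \<in> A k})) * (\<Prod>k\<in>{m..<n}. expectation (\<lambda>\<omega>. iexp (v k * X k \<omega>)))"
    for A :: "nat \<Rightarrow> real set" and v :: "nat \<Rightarrow> real" and m
  have main: "expectation (G A v m) = Q A v m" if "\<And>k. A k \<in> sets borel" "m \<le> n" for A v m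
    using that
  proof (induction m arbitrary: v)
    case 0
    have "(\<Prod>k\<in>{0..<n}. iexp (v k * X k \<omega>)) = iexp (\<Sum>k<n. v k * X k \<omega>)" for \<omega>
      by (simp add: exp_sum sum_distrib_left atLeast0LessThan)
    then show ?case using char[of v] by (simp add: G_def Q_def atLeast0LessThan)
  next
    case (Suc m)
    note A [measurable] = Suc.prems(1)
    \<comment> \<open>Only the frequency of \<open>X m\<close> varies; the value 0 removes its
      factor from the products.\<close>
    define v0 where "v0 s = v(m := s)" for s
    define H where "H \<omega> = (\<Prod>k<m. of_real (indicator (A k) (X k \<omega>))) * (\<Prod>k\<in>{Suc m..<n}. iexp (v k * X k \<omega>))" for \<omega>
    have H_meas [measurable]: "H \<in> borel_measurable M" unfolding H_def by measurable
    have H_bound: "cmod (H \<omega>) \<le> 1" for \<omega>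
      unfolding H_def norm_mult prod_norm[symmetric]
      by (intro mult_le_one prod_le_1 prod_nonneg) (auto simp: indicator_def)
    have set: "{m..<n} = insert m {Suc m..<n}" using Suc.prems(2) by auto
    have GH: "G A (v0 s) m \<omega> = H \<omega> * iexp (s * X m \<omega>)" for s \<omega>
      unfolding G_def H_def v0_def set by (simp add: mult_ac)
    have Qs: "Q A (v0 s) m = Q A (v0 0) m * expectation (\<lambda>\<omega>. iexp (s * X m \<omega>))" for s
      unfolding Q_def v0_def set by (simp add: prob_space mult_ac)
    have IH: "expectation (\<lambda>\<omega>. H \<omega> * iexp (s * X m \<omega>)) = Q A (v0 0) m * expectation (\<lambda>\<omega>. iexp (s * X m \<omega>))" for s
    proof -
      have "expectation (\<lambda>\<omega>. H \<omega> * iexp (s * X m \<omega>)) = expectation (G A (v0 s) m)"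
        by (rule arg_cong[where f=expectation], rule ext, rule GH[symmetric])
      also have "\<dots> = Q A (v0 s) m" using Suc.prems by (intro Suc.IH) auto
      also have "\<dots> = Q A (v0 0) m * expectation (\<lambda>\<omega>. iexp (s * X m \<omega>))" by (rule Qs)
      finally show ?thesis .
    qed
    have EH: "expectation H = Q A (v0 0) m" using IH[of 0] by (simp add: prob_space)
    have "expectation (\<lambda>\<omega>. H \<omega> * of_real (indicator (A m) (X m \<omega>))) = expectation H * of_real (prob {\<omega> \<in> space M. X m \<omega> \<in> A m})"
      by (rule weight_uncorrelated) (use H_bound IH EH in auto)
    moreover have "G A v (Suc m) \<omega> = H \<omega> * of_real (indicator (A m) (X m \<omega>))" for \<omega>
      by (simp add: G_def H_def mult_ac)
    moreover have "Q A v (Suc m) = Q A (v0 0) m * of_real (prob {\<omega> \<in> space M. X m \<omega> \<in> A m})"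
    proof -
      have "(\<Prod>k\<in>{Suc m..<n}. expectation (\<lambda>\<omega>. iexp (v k * X k \<omega>))) = (\<Prod>k\<in>{m..<n}. expectation (\<lambda>\<omega>. iexp (v0 0 k * X k \<omega>)))"
        unfolding set v0_def by (simp add: prob_space)
      then show ?thesis unfolding Q_def by (simp add: mult_ac)
    qed
    ultimately show ?case using EH by simp
  qed
  have ind: "prob (\<Inter>k<n. X k -` A k \<inter> space M) = (\<Prod>k<n. prob (X k -` A k \<inter> space M))"
    if A: "\<And>k. A k \<in> sets borel" for A
  proof -
    have "complex_of_real (prob (\<Inter>k<n. X k -` A k \<inter> space M)) = expectation (G A (\<lambda>_. 0) n)"
    proof -
      have "expectation (G A (\<lambda>_. 0) n) = expectation (\<lambda>\<omega>. complex_of_real (indicator (\<Inter>k<n. X k -` A k \<inter> space M) \<omega>))"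
        by (intro Bochner_Integration.integral_cong) (auto simp: G_def indicator_def)
      also have "\<dots> = of_real (expectation (indicator (\<Inter>k<n. X k -` A k \<inter> space M)))"
        by (rule integral_complex_of_real)
      finally have "expectation (G A (\<lambda>_. 0) n) = of_real (expectation (indicator (\<Inter>k<n. X k -` A k \<inter> space M)))" .
      moreover have "{..<n} \<noteq> {}" using False by auto
      ultimately show ?thesis by (simp add: Int_absorb1 subset_eq)
    qed
    also have "\<dots> = of_real (\<Prod>k<n. prob (X k -` A k \<inter> space M))"
      using main[of A n "\<lambda>_. 0"] A by (simp add: Q_def vimage_def Int_def conj_commute)
    finally show ?thesis by (simp only: of_real_eq_iff)
  qed
  show ?thesis
    unfolding indep_vars_def2
  proof (intro conjI ballI)
    show "indep_sets (\<lambda>i. {X i -` A \<inter> space M |A. A \<in> sets borel}) {..<n}"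
    proof (subst indep_sets_finite)
      show "\<forall>B\<in>Pi {..<n} (\<lambda>i. {X i -` A \<inter> space M |A. A \<in> sets borel}). prob (\<Inter>j\<in>{..<n}. B j) = (\<Prod>j\<in>{..<n}. prob (B j))"
      proof
        fix B assume B: "B \<in> Pi {..<n} (\<lambda>i. {X i -` A \<inter> space M |A. A \<in> sets borel})"
        have "\<exists>A. A \<in> sets borel \<and> (j < n \<longrightarrow> B j = X j -` A \<inter> space M)" for j
        proof (cases "j < n")
          case True
          then have "B j \<in> {X j -` A \<inter> space M |A. A \<in> sets borel}" using B by (intro Pi_mem[OF B]) auto
          then show ?thesis by blast
        qed auto
        then obtain A where A: "\<And>j. A j \<in> sets borel" "\<And>j. j < n \<Longrightarrow> B j = X j -` A j \<inter> space M" by metis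
        show "prob (\<Inter>j\<in>{..<n}. B j) = (\<Prod>j\<in>{..<n}. prob (B j))"
          using ind[of A] A by simp
      qed
      show "\<And>i. i \<in> {..<n} \<Longrightarrow> space M \<in> {X i -` A \<inter> space M |A. A \<in> sets borel}"
        by (auto intro!: exI[of _ UNIV])
    qed (use False in \<open>auto intro: measurable_sets\<close>)
  qed auto
qed

end

text \<open>
  Only the coordinates at natural numbers are used; all real ones are there because the theorem
  asks for a measure on \<open>real \<Rightarrow> real\<close>.
\<close>

definition noise :: "(real \<Rightarrow> real) measure" where
  "noise = PiM UNIV (\<lambda>_. std_normal_distribution)"

definition gauss :: "nat \<times> nat \<Rightarrow> (real \<Rightarrow> real) \<Rightarrow> real" where
  "gauss p \<omega> = \<omega> (real (prod_encode p))"

text \<open>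
  Levy's construction: the normalised increments of level \<open>j + 1\<close> are the normalised sum and
  difference of those of level \<open>j\<close> and fresh normal variables.
\<close>

primrec levy :: "nat \<Rightarrow> nat \<Rightarrow> (real \<Rightarrow> real) \<Rightarrow> real" where
  "levy 0 k \<omega> = gauss (0, k) \<omega>"
| "levy (Suc j) k \<omega> = (levy j (k div 2) \<omega> + (if even k then 1 else - 1) * gauss (Suc j, k div 2) \<omega>) / sqrt 2"

interpretation noise: prob_space noise
  unfolding noise_def by (intro prob_space_PiM prob_space_normal_density) simp

lemma gauss_measurable [measurable]: "gauss p \<in> borel_measurable noise"
proof -
  have "(\<lambda>\<omega>. \<omega> i) \<in> noise \<rightarrow>\<^sub>M std_normal_distribution" for i
    unfolding noise_def by (rule measurable_component_singleton) simp
  then show ?thesis unfolding gauss_def[abs_def] by simp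
qed

lemma levy_measurable [measurable]: "levy j k \<in> borel_measurable noise"
proof (induction j arbitrary: k)
  case 0
  then show ?case by simp
next
  case (Suc j)
  note [measurable] = Suc
  show ?case by simp
qed

lemma char_gauss_sum:
  assumes P: "finite P"
  shows "noise.expectation (\<lambda>\<omega>. iexp (\<Sum>p\<in>P. c p * gauss p \<omega>)) = of_real (exp (- (\<Sum>p\<in>P. (c p)\<^sup>2) / 2))"
proof -
  let ?e = "\<lambda>p. real (prod_encode p)"
  have inj: "inj ?e" by (auto simp: inj_on_def)
  have comp: "(\<lambda>\<omega>. \<omega> i) \<in> borel_measurable noise" for i
    unfolding noise_def using measurable_component_singleton[of i UNIV "\<lambda>_. std_normal_distribution"] by simp
  have sets_noise: "sets noise = sets (PiM UNIV (\<lambda>_. borel))"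
    unfolding noise_def by (intro sets_PiM_cong) auto
  have distr_comp: "distr noise borel (\<lambda>\<omega>. \<omega> i) = std_normal_distribution" for i
  proof -
    have "distr noise borel (\<lambda>\<omega>. \<omega> i) = distr noise std_normal_distribution (\<lambda>\<omega>. \<omega> i)"
      by (rule distr_cong) simp_all
    then show ?thesis
      unfolding noise_def using distr_PiM_component[of UNIV "\<lambda>_. std_normal_distribution" i] prob_space_normal_density by simp
  qed
  have "noise.indep_vars (\<lambda>_. borel) (\<lambda>i \<omega>. \<omega> i) (UNIV :: real set)"
  proof (subst noise.indep_vars_iff_distr_eq_PiM)
    show "distr noise (PiM UNIV (\<lambda>_. borel)) (\<lambda>x. \<lambda>i\<in>UNIV. x i) = PiM UNIV (\<lambda>i. distr noise borel (\<lambda>\<omega>. \<omega> i))"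
      unfolding distr_comp using distr_id2[OF sets_noise[symmetric]] by (simp add: noise_def restrict_UNIV)
  qed (use comp in auto)
  then have "noise.indep_vars (\<lambda>_. borel) (\<lambda>i \<omega>. \<omega> i) (?e ` P)"
    by (rule noise.indep_vars_subset) simp
  then have "noise.indep_vars (\<lambda>_. borel) (\<lambda>i \<omega>. c (inv ?e i) * \<omega> i) (?e ` P)"
    by (rule noise.indep_vars_compose2[where Y="\<lambda>i x. c (inv ?e i) * x"]) auto
  then have "char (distr noise borel (\<lambda>\<omega>. \<Sum>i\<in>?e ` P. c (inv ?e i) * \<omega> i)) 1 =
      (\<Prod>i\<in>?e ` P. char (distr noise borel (\<lambda>\<omega>. c (inv ?e i) * \<omega> i)) 1)"
    by (rule noise.char_distr_sum)
  moreover have "char (distr noise borel X) 1 = noise.expectation (\<lambda>\<omega>. iexp (X \<omega>))" if "X \<in> borel_measurable noise" for X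
    unfolding char_def using that by (subst integral_distr) auto
  moreover have "noise.expectation (\<lambda>\<omega>. iexp (a * \<omega> i)) = of_real (exp (- a\<^sup>2 / 2))" for a i
  proof -
    have "noise.expectation (\<lambda>\<omega>. iexp (a * \<omega> i)) = char (distr noise borel (\<lambda>\<omega>. \<omega> i)) a"
      unfolding char_def using comp by (subst integral_distr) auto
    then show ?thesis unfolding distr_comp char_std_normal_distribution by simp
  qed
  ultimately have "noise.expectation (\<lambda>\<omega>. iexp (\<Sum>i\<in>?e ` P. c (inv ?e i) * \<omega> i)) =
      (\<Prod>i\<in>?e ` P. of_real (exp (- (c (inv ?e i))\<^sup>2 / 2)))"
    using comp by simp
  then show ?thesis
    using P inj_on_subset[OF inj, of P]
    by (simp add: sum.reindex prod.reindex inv_f_f[OF inj] gauss_def exp_sum[symmetric] sum_negf sum_divide_distrib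
        del: of_real_exp flip: of_real_prod)
qed

lemma sum_even_odd:
  fixes f :: "nat \<Rightarrow> 'b::comm_monoid_add"
  shows "(\<Sum>k<2 * N. f k) = (\<Sum>k<N. f (2 * k) + f (Suc (2 * k)))"
  by (induction N) (simp_all add: add_ac)

text \<open>Passing from level \<open>j + 1\<close> to level \<open>j\<close> is a rotation in each
  pair of siblings, which preserves sums of squares but releases normal variables of level
  \<open>j + 1\<close>. The family \<open>P\<close> of variables above level \<open>j\<close> is
  there to collect them.\<close>

lemma char_levy_sum:
  assumes "finite P" "\<And>l k. (l, k) \<in> P \<Longrightarrow> j < l"
  shows "noise.expectation (\<lambda>\<omega>. iexp ((\<Sum>k<N. u k * levy j k \<omega>) + (\<Sum>p\<in>P. c p * gauss p \<omega>))) =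
    of_real (exp (- ((\<Sum>k<N. (u k)\<^sup>2) + (\<Sum>p\<in>P. (c p)\<^sup>2)) / 2))"
  using assms
proof (induction j arbitrary: P N u c)
  case 0
  let ?R = "(\<lambda>k. (0 :: nat, k)) ` {..<N}"
  define c' where "c' = (\<lambda>p. if fst p = 0 then u (snd p) else c p)"
  have disj: "?R \<inter> P = {}" using 0(2) by force
  have c': "c' p = c p" if "p \<in> P" for p using 0(2)[of "fst p" "snd p"] that by (simp add: c'_def)
  have "(\<Sum>k<N. u k * levy 0 k \<omega>) + (\<Sum>p\<in>P. c p * gauss p \<omega>) = (\<Sum>p\<in>?R \<union> P. c' p * gauss p \<omega>)" for \<omega>
    using 0(1) disj c' by (subst sum.union_disjoint) (auto simp: sum.reindex inj_on_def c'_def intro!: sum.cong)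
  moreover have "(\<Sum>k<N. (u k)\<^sup>2) + (\<Sum>p\<in>P. (c p)\<^sup>2) = (\<Sum>p\<in>?R \<union> P. (c' p)\<^sup>2)"
    using 0(1) disj c' by (subst sum.union_disjoint) (auto simp: sum.reindex inj_on_def c'_def intro!: sum.cong)
  ultimately show ?case using char_gauss_sum[of "?R \<union> P" c'] 0(1) by simp
next
  case (Suc j)
  \<comment> \<open>Padding with zeros to \<open>2 * N\<close> coefficients completes every pair of
    siblings.\<close>
  define v where "v k = (if k < N then u k else 0)" for k
  define a where "a k = (v (2 * k) + v (Suc (2 * k))) / sqrt 2" for k
  define b where "b k = (v (2 * k) - v (Suc (2 * k))) / sqrt 2" for k
  let ?R = "(\<lambda>k. (Suc j, k)) ` {..<N}"
  define c' where "c' = (\<lambda>p. if fst p = Suc j then b (snd p) else c p)"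
  have disj: "?R \<inter> P = {}" using Suc.prems(2) by force
  have c': "c' p = c p" if "p \<in> P" for p using Suc.prems(2)[of "fst p" "snd p"] that by (auto simp: c'_def)
  have ext: "(\<Sum>k<N. f k (u k)) = (\<Sum>k<2 * N. f k (v k))" if "\<And>k. f k 0 = 0" for f :: "nat \<Rightarrow> real \<Rightarrow> real"
    by (rule sum.mono_neutral_cong_left) (auto simp: v_def that)
  have form: "(\<Sum>k<N. u k * levy (Suc j) k \<omega>) + (\<Sum>p\<in>P. c p * gauss p \<omega>) =
      (\<Sum>k<N. a k * levy j k \<omega>) + (\<Sum>p\<in>?R \<union> P. c' p * gauss p \<omega>)" for \<omega>
  proof -
    have "(\<Sum>k<N. u k * levy (Suc j) k \<omega>) = (\<Sum>k<2 * N. v k * levy (Suc j) k \<omega>)" by (rule ext) simp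
    also have "\<dots> = (\<Sum>k<N. a k * levy j k \<omega> + b k * gauss (Suc j, k) \<omega>)"
      unfolding sum_even_odd by (intro sum.cong refl) (simp add: a_def b_def add_divide_distrib diff_divide_distrib algebra_simps)
    also have "\<dots> = (\<Sum>k<N. a k * levy j k \<omega>) + (\<Sum>k<N. b k * gauss (Suc j, k) \<omega>)" by (rule sum.distrib)
    finally show ?thesis
      using Suc.prems(1) disj c' by (subst sum.union_disjoint) (auto simp: sum.reindex inj_on_def c'_def intro!: sum.cong)
  qed
  have squares: "(\<Sum>k<N. (u k)\<^sup>2) + (\<Sum>p\<in>P. (c p)\<^sup>2) = (\<Sum>k<N. (a k)\<^sup>2) + (\<Sum>p\<in>?R \<union> P. (c' p)\<^sup>2)"
  proof -
    have "(\<Sum>k<N. (u k)\<^sup>2) = (\<Sum>k<2 * N. (v k)\<^sup>2)" by (rule ext) simp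
    also have "\<dots> = (\<Sum>k<N. (a k)\<^sup>2 + (b k)\<^sup>2)"
      unfolding sum_even_odd by (intro sum.cong refl) (simp add: a_def b_def power_divide power2_sum power2_diff add_divide_distrib diff_divide_distrib)
    also have "\<dots> = (\<Sum>k<N. (a k)\<^sup>2) + (\<Sum>k<N. (b k)\<^sup>2)" by (rule sum.distrib)
    finally show ?thesis
      using Suc.prems(1) disj c' by (subst sum.union_disjoint) (auto simp: sum.reindex inj_on_def c'_def intro!: sum.cong)
  qed
  have "j < l" if "(l, k) \<in> ?R \<union> P" for l k using Suc.prems(2)[of l k] that by auto
  then show ?case
    unfolding form squares using Suc.prems(1) by (intro Suc.IH) auto
qed

lemma char_levy: "noise.expectation (\<lambda>\<omega>. iexp (\<Sum>k<N. u k * levy j k \<omega>)) = of_real (exp (- (\<Sum>k<N. (u k)\<^sup>2) / 2))"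
  using char_levy_sum[where P="{}" and j=j and N=N and u=u] by simp

lemma distr_levy: "distr noise borel (levy j k) = std_normal_distribution"
proof (rule Levy_uniqueness)
  show "real_distribution (distr noise borel (levy j k))" by (rule noise.real_distribution_distr) simp
  show "real_distribution std_normal_distribution" by (rule real_dist_normal_dist)
  show "char (distr noise borel (levy j k)) = char std_normal_distribution"
  proof
    fix t
    have "char (distr noise borel (levy j k)) t = noise.expectation (\<lambda>\<omega>. iexp (t * levy j k \<omega>))"
      unfolding char_def by (subst integral_distr) auto
    also have "\<dots> = noise.expectation (\<lambda>\<omega>. iexp (\<Sum>i<Suc k. (if i = k then t else 0) * levy j i \<omega>))"
      by simp
    also have "\<dots> = of_real (exp (- t\<^sup>2 / 2))"
      unfolding char_levy by (simp add: if_distrib[of "\<lambda>x. x\<^sup>2"] cong: if_cong)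
    finally show "char (distr noise borel (levy j k)) t = char std_normal_distribution t"
      by (simp add: char_std_normal_distribution)
  qed
qed

definition levy_cube :: real where
  "levy_cube = (\<integral>x. \<bar>x\<bar> ^ 3 \<partial>std_normal_distribution)"

lemma levy_cube_moment:
  "integrable noise (\<lambda>\<omega>. \<bar>levy j k \<omega>\<bar> ^ 3)" "noise.expectation (\<lambda>\<omega>. \<bar>levy j k \<omega>\<bar> ^ 3) = levy_cube"
proof -
  have "integrable lborel (\<lambda>x. std_normal_density x * \<bar>x\<bar> ^ (2 * 1 + 1))"
    using std_normal_moment_abs_odd[of 1] by (rule integrable.intros)
  then have "integrable std_normal_distribution (\<lambda>x. \<bar>x\<bar> ^ 3)"
    by (subst integrable_density) (simp_all add: normal_density_nonneg)
  then show "integrable noise (\<lambda>\<omega>. \<bar>levy j k \<omega>\<bar> ^ 3)"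
    unfolding distr_levy[of j k, symmetric] by (subst (asm) integrable_distr_eq) auto
  show "noise.expectation (\<lambda>\<omega>. \<bar>levy j k \<omega>\<bar> ^ 3) = levy_cube"
    unfolding levy_cube_def distr_levy[of j k, symmetric] by (subst integral_distr) auto
qed

definition levy_dyadic :: "(real \<Rightarrow> real) \<Rightarrow> dyadic" where
  "levy_dyadic \<omega> = (\<lambda>(j, k). \<Sum>i<k. levy j i \<omega> / sqrt (2 ^ j))"

lemma levy_dyadic_increment: "levy_dyadic \<omega> (j, Suc k) - levy_dyadic \<omega> (j, k) = levy j k \<omega> / sqrt (2 ^ j)"
  by (simp add: levy_dyadic_def)

text \<open>In the sum of two siblings the fresh normal variable cancels.\<close>

lemma consistent_levy: "consistent (levy_dyadic \<omega>)"
proof -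
  have "levy_dyadic \<omega> (Suc j, 2 * k) = levy_dyadic \<omega> (j, k)" for j k
  proof -
    have "levy (Suc j) (2 * i) \<omega> / sqrt (2 ^ Suc j) + levy (Suc j) (Suc (2 * i)) \<omega> / sqrt (2 ^ Suc j) = levy j i \<omega> / sqrt (2 ^ j)" for i
      by (simp add: real_sqrt_mult field_simps)
    then show ?thesis unfolding levy_dyadic_def prod.case sum_even_odd by simp
  qed
  then show ?thesis by (simp add: consistent_def) (simp add: levy_dyadic_def)
qed

lemma levy_dyadic_measurable: "levy_dyadic \<in> noise \<rightarrow>\<^sub>M borel"
  unfolding levy_dyadic_def by (rule measurable_coordinatewise_then_product) (auto split: prod.splits)

lemma dyadic_holder_mono: "u \<in> dyadic_holder A \<Longrightarrow> A \<le> B \<Longrightarrow> u \<in> dyadic_holder B"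
  unfolding dyadic_holder_def
proof safe
  fix j k :: nat assume "A \<le> B" "\<forall>j k. k < j * 2 ^ j \<longrightarrow> \<bar>u (j, Suc k) - u (j, k)\<bar> \<le> A * (9 / 10) ^ j" "k < j * 2 ^ j"
  then have "\<bar>u (j, Suc k) - u (j, k)\<bar> \<le> A * (9 / 10) ^ j" "A * (9 / 10) ^ j \<le> B * (9 / 10) ^ j"
    by (auto intro!: mult_right_mono)
  then show "\<bar>u (j, Suc k) - u (j, k)\<bar> \<le> B * (9 / 10) ^ j" by (rule order_trans)
qed

lemma levy_holder_bound:
  obtains C where "\<And>\<sigma> A. 0 < A \<Longrightarrow>
    noise.prob {\<omega> \<in> space noise. (\<lambda>i. \<sigma> * levy_dyadic \<omega> i) \<notin> dyadic_holder A} \<le> C * (\<bar>\<sigma>\<bar> ^ 3 * levy_cube) / A ^ 3"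
proof -
  obtain C where C: "0 \<le> C"
    "\<And>(M :: (real \<Rightarrow> real) measure) u K A. prob_space M \<Longrightarrow> 0 < A \<Longrightarrow> u \<in> M \<rightarrow>\<^sub>M borel \<Longrightarrow>
      (\<And>\<omega>. \<omega> \<in> space M \<Longrightarrow> consistent (u \<omega>)) \<Longrightarrow>
      (\<And>j k. integrable M (\<lambda>\<omega>. \<bar>u \<omega> (j, Suc k) - u \<omega> (j, k)\<bar> ^ 3)) \<Longrightarrow>
      (\<And>j k. (\<integral>\<omega>. \<bar>u \<omega> (j, Suc k) - u \<omega> (j, k)\<bar> ^ 3 \<partial>M) \<le> K * three_halves (1 / 2 ^ j)) \<Longrightarrow>
      measure M {\<omega> \<in> space M. u \<omega> \<notin> dyadic_holder A} \<le> C * K / A ^ 3"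
    by (rule chaining_bound) blast
  show ?thesis
  proof (rule that)
    fix \<sigma> A :: real assume A: "0 < A"
    have inc: "\<bar>\<sigma> * levy_dyadic \<omega> (j, Suc k) - \<sigma> * levy_dyadic \<omega> (j, k)\<bar> ^ 3 =
        \<bar>\<sigma>\<bar> ^ 3 * three_halves (1 / 2 ^ j) * \<bar>levy j k \<omega>\<bar> ^ 3" for j k \<omega>
    proof -
      have "\<bar>\<sigma> * levy_dyadic \<omega> (j, Suc k) - \<sigma> * levy_dyadic \<omega> (j, k)\<bar> = \<bar>\<sigma>\<bar> * (\<bar>levy j k \<omega>\<bar> / sqrt (2 ^ j))"
        unfolding right_diff_distrib[symmetric] levy_dyadic_increment by (simp add: abs_mult abs_divide)
      moreover have "1 / sqrt (2 ^ j) ^ 3 = three_halves (1 / 2 ^ j)"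
        by (simp add: three_halves_def real_sqrt_divide power3_eq_cube)
      ultimately show ?thesis
        by (simp only: power_mult_distrib power_divide) (metis mult.assoc mult.commute times_divide_eq_right mult.right_neutral)
    qed
    show "noise.prob {\<omega> \<in> space noise. (\<lambda>i. \<sigma> * levy_dyadic \<omega> i) \<notin> dyadic_holder A} \<le> C * (\<bar>\<sigma>\<bar> ^ 3 * levy_cube) / A ^ 3"
    proof (rule C(2)[OF noise.prob_space_axioms A])
      show "(\<lambda>\<omega> i. \<sigma> * levy_dyadic \<omega> i) \<in> borel_measurable noise"
        using measurable_coordinate[OF levy_dyadic_measurable]
        by (intro measurable_coordinatewise_then_product borel_measurable_times) auto
      show "consistent (\<lambda>i. \<sigma> * levy_dyadic \<omega> i)" for \<omega>
        using consistent_levy[of \<omega>] by (simp add: consistent_def)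
      show "integrable noise (\<lambda>\<omega>. \<bar>\<sigma> * levy_dyadic \<omega> (j, Suc k) - \<sigma> * levy_dyadic \<omega> (j, k)\<bar> ^ 3)" for j k
        unfolding inc using levy_cube_moment(1) by simp
      show "noise.expectation (\<lambda>\<omega>. \<bar>\<sigma> * levy_dyadic \<omega> (j, Suc k) - \<sigma> * levy_dyadic \<omega> (j, k)\<bar> ^ 3) \<le>
          \<bar>\<sigma>\<bar> ^ 3 * levy_cube * three_halves (1 / 2 ^ j)" for j k
        unfolding inc using levy_cube_moment(2) by (simp add: mult_ac)
    qed
  qed
qed

section \<open>Brownian motion from the dyadic encoding\<close>

definition regular_noise :: "(real \<Rightarrow> real) set" where
  "regular_noise = {\<omega> \<in> space noise. \<exists>A::nat. levy_dyadic \<omega> \<in> dyadic_holder (real A)}"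

lemma regular_noise_events: "{\<omega> \<in> space noise. levy_dyadic \<omega> \<in> dyadic_holder A} \<in> sets noise"
  using measurable_sets[OF levy_dyadic_measurable borel_closed[OF closed_dyadic_holder[of A]]]
  by (simp add: vimage_def Int_def conj_commute)

lemma regular_noise_sets [measurable]: "regular_noise \<in> sets noise"
proof -
  have "regular_noise = (\<Union>A::nat. {\<omega> \<in> space noise. levy_dyadic \<omega> \<in> dyadic_holder (real A)})"
    by (auto simp: regular_noise_def)
  also have "\<dots> \<in> sets noise"
    by (intro sets.countable_UN image_subsetI regular_noise_events)
  finally show ?thesis .
qed

lemma AE_regular_noise: "AE \<omega> in noise. \<omega> \<in> regular_noise"
proof -
  obtain C where C: "\<And>\<sigma> A. 0 < A \<Longrightarrow>
    noise.prob {\<omega> \<in> space noise. (\<lambda>i. \<sigma> * levy_dyadic \<omega> i) \<notin> dyadic_holder A} \<le> C * (\<bar>\<sigma>\<bar> ^ 3 * levy_cube) / A ^ 3"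
    using levy_holder_bound by blast
  have le: "noise.prob (space noise - regular_noise) \<le> C * levy_cube * inverse (real (Suc n))" for n
  proof -
    have bad_sets: "{\<omega> \<in> space noise. levy_dyadic \<omega> \<notin> dyadic_holder A} \<in> sets noise" for A
      using sets.compl_sets[OF regular_noise_events[of A]] by (simp add: set_diff_eq Collect_conj_eq cong: conj_cong)
    have "noise.prob (space noise - regular_noise) \<le> noise.prob {\<omega> \<in> space noise. levy_dyadic \<omega> \<notin> dyadic_holder (real (Suc n))}"
      using bad_sets by (intro noise.finite_measure_mono) (auto simp: regular_noise_def simp del: of_nat_Suc)
    also have "\<dots> \<le> C * levy_cube / real (Suc n) ^ 3" using C[of "real (Suc n)" 1] by simp
    also have "\<dots> \<le> C * levy_cube / real (Suc n)"
    proof (rule divide_left_mono)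
      show "real (Suc n) \<le> real (Suc n) ^ 3" using power_increasing[of 1 3 "real (Suc n)"] by simp
      show "0 \<le> C * levy_cube" using order_trans[OF measure_nonneg C[of 1 1]] by simp
    qed simp
    finally show ?thesis by (simp add: inverse_eq_divide)
  qed
  have "(\<lambda>n. C * levy_cube * inverse (real (Suc n))) \<longlonglongrightarrow> C * levy_cube * 0"
    by (intro tendsto_mult tendsto_const LIMSEQ_inverse_real_of_nat)
  then have "noise.prob (space noise - regular_noise) \<le> 0"
    using le by (intro LIMSEQ_le_const) auto
  then have "noise.prob (space noise - regular_noise) = 0" using measure_nonneg[of noise] by (simp add: order_antisym)
  then have "AE \<omega> in noise. \<omega> \<notin> space noise - regular_noise"
    using regular_noise_sets noise.prob_eq_0[of "space noise - regular_noise"] by simp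
  then show ?thesis using AE_space by eventually_elim auto
qed

text \<open>The zero path on the null set outside \<open>regular_noise\<close> makes every path
  continuous, as \<open>brownian_motion\<close> asks for all outcomes.\<close>

definition bm_dyadic :: "(real \<Rightarrow> real) \<Rightarrow> dyadic" where
  "bm_dyadic \<omega> = (if \<omega> \<in> regular_noise then levy_dyadic \<omega> else (\<lambda>_. 0))"

definition bm :: "real \<Rightarrow> (real \<Rightarrow> real) \<Rightarrow> real" where
  "bm t \<omega> = path_of (bm_dyadic \<omega>) t"

lemma AE_bm_dyadic: "AE \<omega> in noise. bm_dyadic \<omega> = levy_dyadic \<omega>"
  using AE_regular_noise by eventually_elim (simp add: bm_dyadic_def)

lemma bm_dyadic_holder: "\<exists>A::nat. bm_dyadic \<omega> \<in> dyadic_holder (real A)"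
  by (auto simp: bm_dyadic_def regular_noise_def dyadic_holder_def consistent_def)

lemma bm_dyadic_measurable: "bm_dyadic \<in> noise \<rightarrow>\<^sub>M borel"
proof -
  note [measurable] = levy_dyadic_measurable
  show ?thesis unfolding bm_dyadic_def[abs_def] by measurable
qed

lemma char_bm_dyadic:
  "noise.expectation (\<lambda>\<omega>. iexp (\<Sum>k<N. v k * (bm_dyadic \<omega> (J, Suc k) - bm_dyadic \<omega> (J, k)))) =
    of_real (exp (- (\<Sum>k<N. (v k)\<^sup>2) / 2 ^ J / 2))"
proof -
  have "noise.expectation (\<lambda>\<omega>. iexp (\<Sum>k<N. v k * (bm_dyadic \<omega> (J, Suc k) - bm_dyadic \<omega> (J, k)))) =
      noise.expectation (\<lambda>\<omega>. iexp (\<Sum>k<N. v k / sqrt (2 ^ J) * levy J k \<omega>))"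
  proof (rule integral_cong_AE)
    note [measurable] = measurable_coordinate[OF bm_dyadic_measurable]
    show "(\<lambda>\<omega>. iexp (\<Sum>k<N. v k * (bm_dyadic \<omega> (J, Suc k) - bm_dyadic \<omega> (J, k)))) \<in> borel_measurable noise" by measurable
    show "AE \<omega> in noise. iexp (\<Sum>k<N. v k * (bm_dyadic \<omega> (J, Suc k) - bm_dyadic \<omega> (J, k))) =
        iexp (\<Sum>k<N. v k / sqrt (2 ^ J) * levy J k \<omega>)"
      using AE_bm_dyadic
    proof eventually_elim
      case (elim \<omega>)
      show ?case unfolding elim levy_dyadic_increment by simp
    qed
  qed measurable
  then show ?thesis unfolding char_levy by (simp add: power_divide sum_divide_distrib)
qed

lemma bm_limit: "0 \<le> t \<Longrightarrow> (\<lambda>j. bm_dyadic \<omega> (j, dyadic_index j t)) \<longlonglongrightarrow> bm t \<omega>"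
proof -
  assume t: "0 \<le> t"
  obtain A :: nat where A: "bm_dyadic \<omega> \<in> dyadic_holder (real A)" using bm_dyadic_holder by blast
  obtain J :: nat where "t \<le> real J" using real_arch_simple by blast
  then show ?thesis unfolding bm_def using path_of_approx(1)[OF A t] by blast
qed

lemma bm_measurable [measurable]: "0 \<le> t \<Longrightarrow> bm t \<in> borel_measurable noise"
  by (rule borel_measurable_LIMSEQ_metric[OF measurable_coordinate[OF bm_dyadic_measurable] bm_limit])

text \<open>Coarse increments are sums of consecutive fine ones: each \<open>v k\<close> is repeated
  over its block, and indices below \<open>m 0\<close> receive weight 0.\<close>

lemma block_increments:
  assumes m: "incseq (m :: nat \<Rightarrow> nat)"
  shows "\<exists>w. (\<forall>u :: dyadic. (\<Sum>k<n. v k * (u (J, m (Suc k)) - u (J, m k))) = (\<Sum>i<m n. w i * (u (J, Suc i) - u (J, i)))) \<and>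
    (\<Sum>i<m n. (w i)\<^sup>2) = (\<Sum>k<n. (v k)\<^sup>2 * (real (m (Suc k)) - real (m k)))"
proof (induction n)
  case 0
  show ?case by (intro exI[of _ "\<lambda>_. 0"]) simp
next
  case (Suc n)
  then obtain w where w: "\<And>u :: dyadic. (\<Sum>k<n. v k * (u (J, m (Suc k)) - u (J, m k))) = (\<Sum>i<m n. w i * (u (J, Suc i) - u (J, i)))"
    "(\<Sum>i<m n. (w i)\<^sup>2) = (\<Sum>k<n. (v k)\<^sup>2 * (real (m (Suc k)) - real (m k)))"
    by blast
  define w' where "w' i = (if i < m n then w i else v n)" for i
  have mn: "m n \<le> m (Suc n)" using m by (simp add: incseqD)
  have split: "(\<Sum>i<m (Suc n). f i) = (\<Sum>i<m n. f i) + (\<Sum>i\<in>{m n..<m (Suc n)}. f i)" for f :: "nat \<Rightarrow> real"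
    using mn by (simp only: lessThan_atLeast0 sum.atLeastLessThan_concat[of 0 "m n" "m (Suc n)"])
  show ?case
  proof (intro exI[of _ w'] conjI allI)
    fix u :: dyadic
    have "(\<Sum>i\<in>{m n..<m (Suc n)}. w' i * (u (J, Suc i) - u (J, i))) = v n * (\<Sum>i\<in>{m n..<m (Suc n)}. u (J, Suc i) - u (J, i))"
      unfolding sum_distrib_left by (intro sum.cong) (auto simp: w'_def)
    also have "(\<Sum>i\<in>{m n..<m (Suc n)}. u (J, Suc i) - u (J, i)) = u (J, m (Suc n)) - u (J, m n)"
      using mn by (rule sum_Suc_diff'[of _ _ "\<lambda>i. u (J, i)"])
    finally show "(\<Sum>k<Suc n. v k * (u (J, m (Suc k)) - u (J, m k))) = (\<Sum>i<m (Suc n). w' i * (u (J, Suc i) - u (J, i)))"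
      unfolding split using w(1)[of u] by (simp add: w'_def)
  next
    have "(\<Sum>i\<in>{m n..<m (Suc n)}. (w' i)\<^sup>2) = (\<Sum>i\<in>{m n..<m (Suc n)}. (v n)\<^sup>2)"
      by (intro sum.cong) (auto simp: w'_def)
    then show "(\<Sum>i<m (Suc n). (w' i)\<^sup>2) = (\<Sum>k<Suc n. (v k)\<^sup>2 * (real (m (Suc k)) - real (m k)))"
      unfolding split using w(2) mn by (simp add: w'_def of_nat_diff mult.commute)
  qed
qed

text \<open>The times are rounded down to the dyadic grid, where the increments are sums of
  independent normal ones; path continuity and dominated convergence remove the rounding.\<close>

lemma char_bm:
  assumes r: "0 \<le> r 0" "incseq r"
  shows "noise.expectation (\<lambda>\<omega>. iexp (\<Sum>k<n. v k * (bm (r (Suc k)) \<omega> - bm (r k) \<omega>))) =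
    of_real (exp (- (\<Sum>k<n. (v k)\<^sup>2 * (r (Suc k) - r k)) / 2))"
proof -
  have r0: "0 \<le> r k" for k using r incseqD[OF r(2), of 0 k] by simp
  define m where "m J k = dyadic_index J (r k)" for J k
  have m_mono: "incseq (m J)" for J
    unfolding m_def dyadic_index_def incseq_def using incseqD[OF r(2)] by (auto intro!: nat_mono floor_mono)
  let ?X = "\<lambda>J \<omega>. \<Sum>k<n. v k * (bm_dyadic \<omega> (J, m J (Suc k)) - bm_dyadic \<omega> (J, m J k))"
  have eq: "noise.expectation (\<lambda>\<omega>. iexp (?X J \<omega>)) =
      of_real (exp (- (\<Sum>k<n. (v k)\<^sup>2 * (real (m J (Suc k)) / 2 ^ J - real (m J k) / 2 ^ J)) / 2))" for J
  proof -
    obtain w where w: "\<And>u :: dyadic. (\<Sum>k<n. v k * (u (J, m J (Suc k)) - u (J, m J k))) = (\<Sum>i<m J n. w i * (u (J, Suc i) - u (J, i)))"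
      "(\<Sum>i<m J n. (w i)\<^sup>2) = (\<Sum>k<n. (v k)\<^sup>2 * (real (m J (Suc k)) - real (m J k)))"
      using block_increments[where n=n and v=v and J=J and m="m J", OF m_mono] by blast
    have "(\<Sum>k<n. (v k)\<^sup>2 * (real (m J (Suc k)) / 2 ^ J - real (m J k) / 2 ^ J)) = (\<Sum>i<m J n. (w i)\<^sup>2) / 2 ^ J"
      unfolding w(2) sum_divide_distrib by (simp add: diff_divide_distrib right_diff_distrib)
    then show ?thesis unfolding w(1) char_bm_dyadic by simp
  qed
  have "(\<lambda>J. noise.expectation (\<lambda>\<omega>. iexp (?X J \<omega>))) \<longlonglongrightarrow>
      noise.expectation (\<lambda>\<omega>. iexp (\<Sum>k<n. v k * (bm (r (Suc k)) \<omega> - bm (r k) \<omega>)))"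
  proof (rule integral_dominated_convergence[where w="\<lambda>_. 1"])
    note [measurable] = measurable_coordinate[OF bm_dyadic_measurable]
    show "(\<lambda>\<omega>. iexp (?X J \<omega>)) \<in> borel_measurable noise" for J by measurable
    show "(\<lambda>\<omega>. iexp (\<Sum>k<n. v k * (bm (r (Suc k)) \<omega> - bm (r k) \<omega>))) \<in> borel_measurable noise"
      using r0 by measurable
    show "AE \<omega> in noise. (\<lambda>J. iexp (?X J \<omega>)) \<longlonglongrightarrow> iexp (\<Sum>k<n. v k * (bm (r (Suc k)) \<omega> - bm (r k) \<omega>))"
      unfolding m_def by (intro AE_I2 tendsto_intros bm_limit r0)
  qed auto
  moreover have "(\<lambda>J. of_real (exp (- (\<Sum>k<n. (v k)\<^sup>2 * (real (m J (Suc k)) / 2 ^ J - real (m J k) / 2 ^ J)) / 2))) \<longlonglongrightarrow>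
      complex_of_real (exp (- (\<Sum>k<n. (v k)\<^sup>2 * (r (Suc k) - r k)) / 2))"
  proof -
    have "(\<lambda>J. real (m J k) / 2 ^ J) \<longlonglongrightarrow> r k" for k
      unfolding m_def by (rule tendsto_dyadic_index[OF r0])
    then show ?thesis by (intro tendsto_intros) auto
  qed
  ultimately show ?thesis unfolding eq by (rule LIMSEQ_unique)
qed

theorem brownian_motion_bm: "brownian_motion noise bm"
  unfolding brownian_motion_def
proof (intro conjI allI impI ballI)
  show "prob_space noise" by (rule noise.prob_space_axioms)
  show "bm t \<in> borel_measurable noise" if "0 \<le> t" for t using that by (rule bm_measurable)
  fix \<omega>
  obtain A :: nat where A: "bm_dyadic \<omega> \<in> dyadic_holder (real A)" using bm_dyadic_holder by blast
  show "bm 0 \<omega> = 0"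
    using path_of_dyadic[OF A, of 0 0] consistent_0[of "bm_dyadic \<omega>" 0] A by (simp add: bm_def dyadic_holder_def)
  show "continuous_on {0..} (\<lambda>t. bm t \<omega>)"
    unfolding bm_def using continuous_on_path_of[OF A] by simp
next
  fix s t :: real assume st: "0 \<le> s \<and> s < t"
  define d where "d = sqrt (t - s)"
  have d: "0 < d" using st by (simp add: d_def)
  have meas: "(\<lambda>\<omega>. bm t \<omega> - bm s \<omega>) \<in> borel_measurable noise" using st by (intro borel_measurable_diff bm_measurable) auto
  have meas': "(\<lambda>\<omega>. (bm t \<omega> - bm s \<omega> - 0) / d) \<in> borel_measurable noise" using meas by simp
  \<comment> \<open>The subtraction of 0 matches the mean in the standardisation of normal
    variables.\<close>
  have "distr noise borel (\<lambda>\<omega>. (bm t \<omega> - bm s \<omega> - 0) / d) = std_normal_distribution"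
  proof (rule Levy_uniqueness)
    show "real_distribution (distr noise borel (\<lambda>\<omega>. (bm t \<omega> - bm s \<omega> - 0) / d))"
      by (rule noise.real_distribution_distr[OF meas'])
    show "real_distribution std_normal_distribution" by (rule real_dist_normal_dist)
    show "char (distr noise borel (\<lambda>\<omega>. (bm t \<omega> - bm s \<omega> - 0) / d)) = char std_normal_distribution"
    proof
      fix x
      have "char (distr noise borel (\<lambda>\<omega>. (bm t \<omega> - bm s \<omega> - 0) / d)) x = noise.expectation (\<lambda>\<omega>. iexp (x * ((bm t \<omega> - bm s \<omega> - 0) / d)))"
        unfolding char_def using meas' by (subst integral_distr) auto
      also have "\<dots> = noise.expectation (\<lambda>\<omega>. iexp (\<Sum>k<Suc 0. (x / d) * (bm (if Suc k = 0 then s else t) \<omega> - bm (if k = 0 then s else t) \<omega>)))"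
        by simp
      also have "\<dots> = of_real (exp (- (\<Sum>k<Suc 0. (x / d)\<^sup>2 * ((if Suc k = 0 then s else t) - (if k = 0 then s else t))) / 2))"
        using st by (intro char_bm[of "\<lambda>k. if k = 0 then s else t" "\<lambda>_. x / d" "Suc 0"]) (auto simp: incseq_def)
      also have "\<dots> = char std_normal_distribution x"
        using st by (simp add: char_std_normal_distribution power_divide d_def)
      finally show "char (distr noise borel (\<lambda>\<omega>. (bm t \<omega> - bm s \<omega> - 0) / d)) x = char std_normal_distribution x" .
    qed
  qed
  then have "distributed noise lborel (\<lambda>\<omega>. (bm t \<omega> - bm s \<omega> - 0) / d) std_normal_density"
    using meas' by (auto simp: distributed_def cong: distr_cong)
  then show "distributed noise lborel (\<lambda>\<omega>. bm t \<omega> - bm s \<omega>) (normal_density 0 (sqrt (t - s)))"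
    unfolding d_def[symmetric] by (subst noise.normal_standard_normal_convert[OF d])
next
  fix r :: "nat \<Rightarrow> real" and n assume r: "0 \<le> r 0 \<and> incseq r"
  have r0: "0 \<le> r k" for k using r incseqD[of r 0 k] by simp
  show "noise.indep_vars (\<lambda>_. borel) (\<lambda>k \<omega>. bm (r (Suc k)) \<omega> - bm (r k) \<omega>) {..<n}"
  proof (rule noise.indep_vars_of_char)
    show "(\<lambda>\<omega>. bm (r (Suc k)) \<omega> - bm (r k) \<omega>) \<in> borel_measurable noise" for k
      using r0 by (intro borel_measurable_diff bm_measurable) auto
    fix v
    have one: "noise.expectation (\<lambda>\<omega>. iexp (v k * (bm (r (Suc k)) \<omega> - bm (r k) \<omega>))) =
        of_real (exp (- ((v k)\<^sup>2 * (r (Suc k) - r k)) / 2))" for k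
      using char_bm[of "\<lambda>i. r (k + i)" "\<lambda>_. v k" "Suc 0"] r r0 by (simp add: incseq_def)
    have "noise.expectation (\<lambda>\<omega>. iexp (\<Sum>k<n. v k * (bm (r (Suc k)) \<omega> - bm (r k) \<omega>))) =
        of_real (exp (- (\<Sum>k<n. (v k)\<^sup>2 * (r (Suc k) - r k)) / 2))"
      using r by (intro char_bm) auto
    also have "\<dots> = (\<Prod>k<n. of_real (exp (- ((v k)\<^sup>2 * (r (Suc k) - r k)) / 2)))"
      unfolding of_real_prod[symmetric] by (simp add: exp_sum[symmetric] sum_negf sum_divide_distrib)
    finally show "noise.expectation (\<lambda>\<omega>. iexp (\<Sum>k<n. v k * (bm (r (Suc k)) \<omega> - bm (r k) \<omega>))) =
        (\<Prod>k<n. noise.expectation (\<lambda>\<omega>. iexp (v k * (bm (r (Suc k)) \<omega> - bm (r k) \<omega>))))"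
      unfolding one .
  qed
qed

section \<open>The invariance principle\<close>

definition step_path :: "real \<Rightarrow> (nat \<Rightarrow> real) \<Rightarrow> real \<Rightarrow> real" where
  "step_path c a = (\<lambda>t\<in>{0..}. a (nat \<lfloor>c * t\<rfloor>))"

lemma step_path_cadlag:
  assumes c: "0 \<le> c"
  shows "step_path c a \<in> cadlag"
proof (cases "c = 0")
  case True
  then have eq: "step_path c a = (\<lambda>t\<in>{0..}. a 0)" by (simp add: step_path_def)
  have "((\<lambda>t\<in>{0..}. a 0) \<longlongrightarrow> a 0) (at_right t)" if "0 \<le> t" for t :: real
    using that by (intro tendsto_eventually eventually_mono[OF eventually_at_right_less]) auto
  moreover have "((\<lambda>t\<in>{0..}. a 0) \<longlongrightarrow> a 0) (at_left t)" if "0 < t" for t :: real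
    using that by (intro tendsto_eventually eventually_mono[OF eventually_at_left_real]) auto
  ultimately show ?thesis unfolding eq cadlag_def by auto
next
  case False
  then have c: "0 < c" using assms by simp
  have right: "(step_path c a \<longlongrightarrow> step_path c a t) (at_right t)" if t: "0 \<le> t" for t
  proof (rule tendsto_eventually)
    have "t < (of_int \<lfloor>c * t\<rfloor> + 1) / c"
      using c floor_correct[of "c * t"] by (simp add: pos_less_divide_eq mult.commute)
    then show "\<forall>\<^sub>F s in at_right t. step_path c a s = step_path c a t"
    proof (rule eventually_mono[OF eventually_at_right_real])
      fix s assume s: "s \<in> {t<..<(of_int \<lfloor>c * t\<rfloor> + 1) / c}"
      have "c * s < of_int \<lfloor>c * t\<rfloor> + 1" using s c by (simp add: pos_less_divide_eq mult.commute)
      moreover have "of_int \<lfloor>c * t\<rfloor> \<le> c * s"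
        by (rule order_trans[OF of_int_floor_le]) (use s c in simp)
      ultimately have "\<lfloor>c * s\<rfloor> = \<lfloor>c * t\<rfloor>" by (simp add: floor_unique)
      then show "step_path c a s = step_path c a t" using s t by (simp add: step_path_def)
    qed
  qed
  \<comment> \<open>Just before \<open>t\<close> the floor of \<open>c * s\<close> is the ceiling of
    \<open>c * t\<close> minus 1, whether or not \<open>c * t\<close> is an integer.\<close>
  have left: "(step_path c a \<longlongrightarrow> a (nat (\<lceil>c * t\<rceil> - 1))) (at_left t)" if t: "0 < t" for t
  proof (rule tendsto_eventually)
    have "max 0 ((of_int \<lceil>c * t\<rceil> - 1) / c) < t"
      using c t ceiling_correct[of "c * t"] by (simp add: pos_divide_less_eq mult.commute)
    then show "\<forall>\<^sub>F s in at_left t. step_path c a s = a (nat (\<lceil>c * t\<rceil> - 1))"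
    proof (rule eventually_mono[OF eventually_at_left_real])
      fix s assume s: "s \<in> {max 0 ((of_int \<lceil>c * t\<rceil> - 1) / c)<..<t}"
      have "of_int \<lceil>c * t\<rceil> - 1 < c * s" using s c by (simp add: pos_divide_less_eq mult.commute)
      moreover have "c * s < of_int \<lceil>c * t\<rceil>"
        by (rule less_le_trans[OF _ le_of_int_ceiling]) (use s c in simp)
      ultimately have "\<lfloor>c * s\<rfloor> = \<lceil>c * t\<rceil> - 1" by (intro floor_unique) simp_all
      then show "step_path c a s = a (nat (\<lceil>c * t\<rceil> - 1))" using s by (simp add: step_path_def)
    qed
  qed
  show ?thesis
    unfolding cadlag_def using left right by (auto simp: step_path_def[of c a])
qed

lemma step_path_tendsto:
  assumes c: "0 \<le> c" and a: "(as :: nat \<Rightarrow> nat \<Rightarrow> real) \<longlonglongrightarrow> a"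
  shows "skorohod_tendsto (\<lambda>n. step_path c (as n)) (step_path c a)"
proof (rule uniform_limit_imp_skorohod_tendsto)
  fix T :: real
  show "uniform_limit {0..T} (\<lambda>n. step_path c (as n)) (step_path c a) sequentially"
    unfolding uniform_limit_iff
  proof (intro allI impI)
    fix e :: real assume e: "0 < e"
    have "\<forall>\<^sub>F n in sequentially. dist (as n k) (a k) < e" for k
      using tendsto_coordinate[OF a, of k] e by (rule tendstoD)
    then have "\<forall>\<^sub>F n in sequentially. \<forall>k\<in>{..nat \<lfloor>c * T\<rfloor>}. dist (as n k) (a k) < e"
      by (intro eventually_ball_finite) auto
    then show "\<forall>\<^sub>F n in sequentially. \<forall>t\<in>{0..T}. dist (step_path c (as n) t) (step_path c a t) < e"
    proof eventually_elim
      case (elim n)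
      have "nat \<lfloor>c * t\<rfloor> \<le> nat \<lfloor>c * T\<rfloor>" if "t \<le> T" for t
        using that c by (intro nat_mono floor_mono mult_left_mono) auto
      then show ?case using elim by (auto simp: step_path_def)
    qed
  qed
qed

text \<open>The partial sums form a random element of a product space, on which
  \<open>step_path c\<close> is continuous because finitely many values determine the path up to a
  given time. So preimages of open sets are open.\<close>

lemma measurable_step_path:
  assumes c: "0 \<le> c"
  shows "step_path c \<in> borel \<rightarrow>\<^sub>M borel_of skorohod_topology"
  unfolding borel_of_def
proof (rule measurable_measure_of)
  show "{S. openin skorohod_topology S} \<subseteq> Pow (topspace skorohod_topology)"
    by (auto dest: openin_subset)
  show "step_path c \<in> space borel \<rightarrow> topspace skorohod_topology"
    using step_path_cadlag[OF c] by (simp add: topspace_skorohod_topology)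
  fix S assume "S \<in> {S. openin skorohod_topology S}"
  then have S: "skorohod_open S" by (simp add: openin_skorohod_topology)
  have "closed (step_path c -` (- S))"
    unfolding closed_sequential_limits
  proof (intro allI impI)
    fix as a assume H: "(\<forall>n. as n \<in> step_path c -` (- S)) \<and> as \<longlonglongrightarrow> a"
    show "a \<in> step_path c -` (- S)"
    proof (rule ccontr)
      assume "a \<notin> step_path c -` (- S)"
      then have "step_path c a \<in> S" by simp
      moreover have "range (\<lambda>n. step_path c (as n)) \<subseteq> cadlag" using step_path_cadlag[OF c] by auto
      ultimately have "\<forall>\<^sub>F n in sequentially. step_path c (as n) \<in> S"
        using S H step_path_tendsto[OF c, of as a] unfolding skorohod_open_def by blast
      then have "\<forall>\<^sub>F n in sequentially. False" by (rule eventually_mono) (use H in auto)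
      then show False by simp
    qed
  qed
  then have "open (step_path c -` S)" by (simp add: closed_open vimage_Compl)
  then show "step_path c -` S \<inter> space borel \<in> sets borel" by simp
qed

lemma dyadic_holder_scale:
  assumes u: "u \<in> dyadic_holder A"
  shows "(\<lambda>i. \<sigma> * u i) \<in> dyadic_holder (\<bar>\<sigma>\<bar> * A)"
proof -
  have "\<bar>\<sigma> * u (j, Suc k) - \<sigma> * u (j, k)\<bar> \<le> \<bar>\<sigma>\<bar> * A * (9 / 10) ^ j" if "k < j * 2 ^ j" for j k
  proof -
    have "\<bar>\<sigma>\<bar> * \<bar>u (j, Suc k) - u (j, k)\<bar> \<le> \<bar>\<sigma>\<bar> * (A * (9 / 10) ^ j)"
      using u that by (intro mult_left_mono) (auto simp: dyadic_holder_def)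
    then show ?thesis by (simp only: right_diff_distrib[symmetric] abs_mult mult.assoc)
  qed
  then show ?thesis using u by (auto simp: dyadic_holder_def consistent_def)
qed

lemma path_of_scale:
  assumes u: "u \<in> dyadic_holder A"
  shows "path_of (\<lambda>i. \<sigma> * u i) = (\<lambda>t\<in>{0..}. \<sigma> * path_of u t)"
proof
  fix t
  show "path_of (\<lambda>i. \<sigma> * u i) t = (\<lambda>t\<in>{0..}. \<sigma> * path_of u t) t"
  proof (cases "0 \<le> t")
    case True
    obtain J :: nat where J: "t \<le> real J" using real_arch_simple by blast
    have "path_of (\<lambda>i. \<sigma> * u i) t = \<sigma> * path_of u t"
      by (rule LIMSEQ_unique[OF path_of_approx(1)[OF dyadic_holder_scale[OF u] True J]
            tendsto_mult_left[OF path_of_approx(1)[OF u True J]]])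
    then show ?thesis using True by simp
  next
    case False
    then show ?thesis by (simp add: path_of_def)
  qed
qed

section \<open>The functional limit theorem for partial sums\<close>

context partial_sums
begin

definition dyadic_path :: "nat \<Rightarrow> 'a \<Rightarrow> dyadic" where
  "dyadic_path n \<omega> = (\<lambda>(j, k). W n (real k / 2 ^ j) \<omega>)"

lemma path_of_dyadic_path: "0 \<le> t \<Longrightarrow> path_of (dyadic_path n \<omega>) t = W n t \<omega>"
  unfolding dyadic_path_def
proof (rule path_of_continuous_eq)
  have "continuous_on {0..} (\<lambda>t. lerp (\<lambda>k. F k \<omega>) (real n * t))"
    by (rule continuous_on_compose2[OF continuous_on_lerp]) (auto intro!: continuous_intros)
  then show "continuous_on {0..} (\<lambda>t. W n t \<omega>)"
    unfolding W_def by (cases "n = 0") (auto intro!: continuous_intros)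
qed

lemma dyadic_path_measurable: "dyadic_path n \<in> M \<rightarrow>\<^sub>M borel"
  unfolding dyadic_path_def by (rule measurable_coordinatewise_then_product) (auto split: prod.splits)

lemma consistent_dyadic_path: "consistent (dyadic_path n \<omega>)"
  by (simp add: consistent_def dyadic_path_def W_def)

text \<open>The sum up to \<open>m\<close> includes the whole term \<open>F m\<close>, the polygonal
  line only a fraction of it.\<close>

lemma step_path_near_interpolation:
  assumes t: "0 \<le> t" and m: "m = nat \<lfloor>real n * t\<rfloor>"
  shows "\<bar>(\<Sum>k=0..m. F k \<omega>) / sqrt (real n) - W n t \<omega>\<bar> \<le> \<bar>F m \<omega>\<bar> / sqrt (real n)"
proof -
  have nt: "0 \<le> real n * t" using t by simp
  have frac: "0 \<le> 1 - (real n * t - real m)" "1 - (real n * t - real m) \<le> 1"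
    using nt unfolding m by (simp_all add: of_nat_nat) linarith+
  have "(\<Sum>k=0..m. F k \<omega>) = (\<Sum>k<m. F k \<omega>) + F m \<omega>"
    by (simp add: atLeast0AtMost lessThan_Suc_atMost[symmetric])
  then have "(\<Sum>k=0..m. F k \<omega>) / sqrt (real n) - W n t \<omega> = (1 - (real n * t - real m)) * F m \<omega> / sqrt (real n)"
    unfolding W_def lerp_def m[symmetric] by (simp add: diff_divide_distrib[symmetric]) (simp add: algebra_simps)
  also have "\<bar>\<dots>\<bar> = (1 - (real n * t - real m)) * \<bar>F m \<omega>\<bar> / sqrt (real n)"
    using frac(1) by (simp add: abs_mult)
  also have "\<dots> \<le> \<bar>F m \<omega>\<bar> / sqrt (real n)"
    using mult_right_mono[OF frac(2), of "\<bar>F m \<omega>\<bar>"] by (intro divide_right_mono) auto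
  finally show ?thesis .
qed

theorem invariance_principle:
  assumes \<sigma>2: "0 \<le> \<sigma>2"
  shows "converges_in_law skorohod_topology
    M (\<lambda>n \<omega>. \<lambda>t\<in>{0..}. (\<Sum>k=0..nat \<lfloor>real n * t\<rfloor>. F k \<omega>) / sqrt (real n))
    noise (\<lambda>\<omega>. \<lambda>t\<in>{0..}. sqrt \<sigma>2 * bm t \<omega>)"
proof -
  define u where "u \<omega> = (\<lambda>i. sqrt \<sigma>2 * bm_dyadic \<omega> i)" for \<omega>
  have u_meas: "u \<in> noise \<rightarrow>\<^sub>M borel"
    unfolding u_def using measurable_coordinate[OF bm_dyadic_measurable]
    by (intro measurable_coordinatewise_then_product borel_measurable_times) auto
  have limit: "path_of (u \<omega>) = (\<lambda>t\<in>{0..}. sqrt \<sigma>2 * bm t \<omega>)" for \<omega>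
  proof -
    obtain A :: nat where "bm_dyadic \<omega> \<in> dyadic_holder (real A)" using bm_dyadic_holder by blast
    then show ?thesis unfolding u_def bm_def by (rule path_of_scale)
  qed
  have "converges_in_law skorohod_topology
    M (\<lambda>n \<omega>. \<lambda>t\<in>{0..}. (\<Sum>k=0..nat \<lfloor>real n * t\<rfloor>. F k \<omega>) / sqrt (real n)) noise (\<lambda>\<omega>. path_of (u \<omega>))"
  proof (rule weak_convergence[where U=dyadic_path])
    show "prob_space M" by (rule prob_space_axioms)
    show "prob_space noise" by (rule noise.prob_space_axioms)
    show "dyadic_path n \<in> M \<rightarrow>\<^sub>M borel" for n by (rule dyadic_path_measurable)
    show "consistent (dyadic_path n \<omega>)" for n \<omega> by (rule consistent_dyadic_path)
    show "u \<in> noise \<rightarrow>\<^sub>M borel" by (rule u_meas)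
    show "\<exists>A::nat. u \<omega> \<in> dyadic_holder (real A)" for \<omega>
    proof -
      obtain A :: nat where A: "bm_dyadic \<omega> \<in> dyadic_holder (real A)" using bm_dyadic_holder by blast
      obtain B :: nat where "\<bar>sqrt \<sigma>2\<bar> * real A \<le> real B" using real_arch_simple by blast
      then show ?thesis unfolding u_def using dyadic_holder_mono[OF dyadic_holder_scale[OF A]] by blast
    qed
    show "(\<lambda>n. expectation (\<lambda>\<omega>. iexp (\<Sum>k<m. v k * (dyadic_path n \<omega> (J, Suc k) - dyadic_path n \<omega> (J, k))))) \<longlonglongrightarrow>
        noise.expectation (\<lambda>\<omega>. iexp (\<Sum>k<m. v k * (u \<omega> (J, Suc k) - u \<omega> (J, k))))" for J m v
    proof -
      have "noise.expectation (\<lambda>\<omega>. iexp (\<Sum>k<m. v k * (u \<omega> (J, Suc k) - u \<omega> (J, k)))) =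
          noise.expectation (\<lambda>\<omega>. iexp (\<Sum>k<m. (sqrt \<sigma>2 * v k) * (bm_dyadic \<omega> (J, Suc k) - bm_dyadic \<omega> (J, k))))"
        unfolding u_def by (simp add: algebra_simps)
      also have "\<dots> = of_real (exp (- (\<sigma>2 / 2 * (\<Sum>k<m. (v k)\<^sup>2 * (real (Suc k) / 2 ^ J - real k / 2 ^ J)))))"
        unfolding char_bm_dyadic using \<sigma>2
        by (simp add: power_mult_distrib sum_distrib_left sum_divide_distrib diff_divide_distrib[symmetric] mult_ac)
      finally show ?thesis
        unfolding dyadic_path_def prod.case
        using W_char_limit[where t="\<lambda>k. real k / 2 ^ J" and N=m and v=v] by (simp add: incseq_def divide_right_mono)
    qed
    show "\<exists>A. (\<forall>n. prob {\<omega> \<in> space M. dyadic_path n \<omega> \<notin> dyadic_holder A} \<le> \<epsilon>) \<and>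
        noise.prob {\<omega> \<in> space noise. u \<omega> \<notin> dyadic_holder A} \<le> \<epsilon>" if \<epsilon>: "0 < \<epsilon>" for \<epsilon>
    proof -
      obtain C1 where C1:
        "\<And>(M :: 'a measure) u K A. prob_space M \<Longrightarrow> 0 < A \<Longrightarrow> u \<in> M \<rightarrow>\<^sub>M borel \<Longrightarrow>
          (\<And>\<omega>. \<omega> \<in> space M \<Longrightarrow> consistent (u \<omega>)) \<Longrightarrow>
          (\<And>j k. integrable M (\<lambda>\<omega>. \<bar>u \<omega> (j, Suc k) - u \<omega> (j, k)\<bar> ^ 3)) \<Longrightarrow>
          (\<And>j k. (\<integral>\<omega>. \<bar>u \<omega> (j, Suc k) - u \<omega> (j, k)\<bar> ^ 3 \<partial>M) \<le> K * three_halves (1 / 2 ^ j)) \<Longrightarrow>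
          measure M {\<omega> \<in> space M. u \<omega> \<notin> dyadic_holder A} \<le> C1 * K / A ^ 3"
        by (rule chaining_bound) blast
      obtain C2 where C2: "\<And>\<sigma> A. 0 < A \<Longrightarrow>
          noise.prob {\<omega> \<in> space noise. (\<lambda>i. \<sigma> * levy_dyadic \<omega> i) \<notin> dyadic_holder A} \<le> C2 * (\<bar>\<sigma>\<bar> ^ 3 * levy_cube) / A ^ 3"
        using levy_holder_bound by blast
      define K1 where "K1 = C1 * (48 * L)"
      define K2 where "K2 = C2 * (\<bar>sqrt \<sigma>2\<bar> ^ 3 * levy_cube)"
      \<comment> \<open>One \<open>A\<close> for both laws; since \<open>A \<ge> 1\<close>, its cube
        may be replaced by \<open>A\<close> in the estimate.\<close>
      define A where "A = 1 + (\<bar>K1\<bar> + \<bar>K2\<bar>) / \<epsilon>"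
      have A: "1 \<le> A" using \<epsilon> by (simp add: A_def)
      have small: "K / A ^ 3 \<le> \<epsilon>" if "K \<le> \<bar>K1\<bar> + \<bar>K2\<bar>" for K
      proof -
        have "\<epsilon> * A = \<epsilon> + (\<bar>K1\<bar> + \<bar>K2\<bar>)" using \<epsilon> by (simp add: A_def field_simps)
        then have "K \<le> \<epsilon> * A" using that \<epsilon> by linarith
        also have "\<dots> \<le> \<epsilon> * A ^ 3" using \<epsilon> A power_increasing[of 1 3 A] by simp
        finally show ?thesis using A by (simp add: divide_le_eq)
      qed
      have "prob {\<omega> \<in> space M. dyadic_path n \<omega> \<notin> dyadic_holder A} \<le> K1 / A ^ 3" for n
        unfolding K1_def
      proof (rule C1[OF prob_space_axioms _ dyadic_path_measurable consistent_dyadic_path])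
        have le: "real k / 2 ^ j \<le> real (Suc k) / 2 ^ j" and diff: "real (Suc k) / 2 ^ j - real k / 2 ^ j = 1 / 2 ^ j" for j k
          by (simp_all add: divide_right_mono diff_divide_distrib[symmetric])
        show "integrable M (\<lambda>\<omega>. \<bar>dyadic_path n \<omega> (j, Suc k) - dyadic_path n \<omega> (j, k)\<bar> ^ 3)"
          "expectation (\<lambda>\<omega>. \<bar>dyadic_path n \<omega> (j, Suc k) - dyadic_path n \<omega> (j, k)\<bar> ^ 3) \<le> 48 * L * three_halves (1 / 2 ^ j)" for j k
          using W_cube[OF _ le[of k j], of n] unfolding dyadic_path_def prod.case diff by simp_all
      qed (use A in simp)
      moreover have "noise.prob {\<omega> \<in> space noise. u \<omega> \<notin> dyadic_holder A} \<le> K2 / A ^ 3"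
      proof -
        let ?v = "\<lambda>\<omega> i. sqrt \<sigma>2 * levy_dyadic \<omega> i"
        have v: "?v \<in> noise \<rightarrow>\<^sub>M borel"
          using measurable_coordinate[OF levy_dyadic_measurable]
          by (intro measurable_coordinatewise_then_product borel_measurable_times) auto
        have "{\<omega> \<in> space noise. ?v \<omega> \<notin> dyadic_holder A} = ?v -` (- dyadic_holder A) \<inter> space noise" by auto
        also have "\<dots> \<in> sets noise"
          by (rule measurable_sets[OF v]) (intro borel_comp borel_closed closed_dyadic_holder)
        finally have "noise.prob {\<omega> \<in> space noise. u \<omega> \<notin> dyadic_holder A} \<le>
            noise.prob {\<omega> \<in> space noise. ?v \<omega> \<notin> dyadic_holder A}"
          by (intro noise.finite_measure_mono_AE eventually_mono[OF AE_bm_dyadic]) (auto simp: u_def)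
        also have "\<dots> \<le> K2 / A ^ 3" unfolding K2_def using A by (intro C2) simp
        finally show ?thesis .
      qed
      moreover have "K1 / A ^ 3 \<le> \<epsilon>" "K2 / A ^ 3 \<le> \<epsilon>" by (intro small; linarith)+
      ultimately show ?thesis by (meson order_trans)
    qed
    show "(\<lambda>\<omega>. \<lambda>t\<in>{0..}. (\<Sum>k=0..nat \<lfloor>real n * t\<rfloor>. F k \<omega>) / sqrt (real n)) \<in> M \<rightarrow>\<^sub>M borel_of skorohod_topology" for n
    proof -
      have "(\<lambda>\<omega> m. (\<Sum>k=0..m. F k \<omega>) / sqrt (real n)) \<in> M \<rightarrow>\<^sub>M borel"
        by (intro measurable_coordinatewise_then_product) measurable
      then show ?thesis
        using measurable_compose[OF _ measurable_step_path[of "real n"]] by (simp add: step_path_def[abs_def])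
    qed
    show "\<exists>E. (\<forall>n. E n \<in> sets M) \<and> (\<lambda>n. prob (E n)) \<longlonglongrightarrow> 0 \<and>
        (\<forall>n \<omega> t A. \<omega> \<in> space M - E n \<longrightarrow> 0 \<le> t \<longrightarrow> t \<le> T \<longrightarrow> dyadic_path n \<omega> \<in> dyadic_holder A \<longrightarrow>
          \<bar>(\<lambda>t\<in>{0..}. (\<Sum>k=0..nat \<lfloor>real n * t\<rfloor>. F k \<omega>) / sqrt (real n)) t - path_of (dyadic_path n \<omega>) t\<bar> < \<delta>)"
      if T: "0 \<le> T" and \<delta>: "0 < \<delta>" for T \<delta>
    proof (intro exI conjI allI impI)
      let ?E = "\<lambda>n. {\<omega> \<in> space M. \<exists>k\<le>nat \<lfloor>real n * T\<rfloor>. \<delta> * sqrt (real n) \<le> \<bar>F k \<omega>\<bar>}"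
      show "?E n \<in> sets M" for n by measurable
      show "(\<lambda>n. prob (?E n)) \<longlonglongrightarrow> 0" by (rule remainder_limit[OF T \<delta>])
      fix n \<omega> t assume \<omega>: "\<omega> \<in> space M - ?E n" and t: "0 \<le> t" "t \<le> T"
      define m where "m = nat \<lfloor>real n * t\<rfloor>"
      have "m \<le> nat \<lfloor>real n * T\<rfloor>" unfolding m_def using t by (intro nat_mono floor_mono mult_left_mono) auto
      then have F: "\<bar>F m \<omega>\<bar> < \<delta> * sqrt (real n)" using \<omega> by (force simp: not_le)
      \<comment> \<open>The strict bound on \<open>F m\<close> excludes \<open>n = 0\<close>, where
        its right side would be zero.\<close>
      then have n: "0 < sqrt (real n)" using \<delta> abs_ge_zero[of "F m \<omega>"] by (cases "n = 0") auto
      have "\<bar>(\<Sum>k=0..m. F k \<omega>) / sqrt (real n) - W n t \<omega>\<bar> \<le> \<bar>F m \<omega>\<bar> / sqrt (real n)"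
        by (rule step_path_near_interpolation[OF t(1) m_def])
      also have "\<dots> < \<delta>" using F n by (simp add: pos_divide_less_eq)
      finally show "\<bar>(\<lambda>t\<in>{0..}. (\<Sum>k=0..nat \<lfloor>real n * t\<rfloor>. F k \<omega>) / sqrt (real n)) t - path_of (dyadic_path n \<omega>) t\<bar> < \<delta>"
        using t by (simp add: path_of_dyadic_path m_def)
    qed
  qed
  then show ?thesis unfolding limit .
qed

end

section \<open>Limit theorems for the Zig-Zag walk\<close>

lemma power_sum_bounds:
  fixes a :: "'i::finite \<Rightarrow> real"
  assumes a: "\<And>i. 0 \<le> a i"
  shows "(\<Sum>i\<in>UNIV. a i ^ Suc p) \<le> (\<Sum>i\<in>UNIV. a i) ^ Suc p"
    and "(\<Sum>i\<in>UNIV. a i) ^ p \<le> real CARD('i) ^ p * (\<Sum>i\<in>UNIV. a i ^ p)"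
proof -
  have le: "a i \<le> (\<Sum>i\<in>UNIV. a i)" for i by (rule member_le_sum) (auto simp: a)
  have "(\<Sum>i\<in>UNIV. a i * a i ^ p) \<le> (\<Sum>i\<in>UNIV. a i * (\<Sum>i\<in>UNIV. a i) ^ p)"
    using le a by (intro sum_mono mult_left_mono power_mono) auto
  then show "(\<Sum>i\<in>UNIV. a i ^ Suc p) \<le> (\<Sum>i\<in>UNIV. a i) ^ Suc p" by (simp add: sum_distrib_right)
  have "Max (range a) \<in> range a" by (rule Max_in) auto
  then obtain i where i: "Max (range a) = a i" by blast
  have "a j \<le> a i" for j unfolding i[symmetric] by (rule Max_ge) auto
  then have "(\<Sum>j\<in>UNIV. a j) \<le> real CARD('i) * a i" using sum_bounded_above[of UNIV a "a i"] by simp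
  then have "(\<Sum>j\<in>UNIV. a j) ^ p \<le> (real CARD('i) * a i) ^ p" using a by (intro power_mono sum_nonneg) auto
  also have "\<dots> = real CARD('i) ^ p * a i ^ p" by (rule power_mult_distrib)
  also have "\<dots> \<le> real CARD('i) ^ p * (\<Sum>i\<in>UNIV. a i ^ p)"
    using a by (intro mult_left_mono member_le_sum) auto
  finally show "(\<Sum>i\<in>UNIV. a i) ^ p \<le> real CARD('i) ^ p * (\<Sum>i\<in>UNIV. a i ^ p)" .
qed

section \<open>Exponential weights and Poisson's equation for the walk\<close>

context zigzag
begin

text \<open>Up to constants a power of \<open>exp_sum\<close> is \<open>exp_sum\<close> with a
  multiple of the exponent. Growth conditions thus become conditions on exponents, which must stay
  below \<open>h\<close>.\<close>

lemma exp_sum_power_bounds: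
  "exp_sum (real (Suc p) * \<theta>) s \<le> exp_sum \<theta> s ^ Suc p"
  "exp_sum \<theta> s ^ p \<le> real CARD('d) ^ p * exp_sum (real p * \<theta>) s"
  using power_sum_bounds[of "\<lambda>i. exp (\<theta> * \<bar>real_of_int (fst s $ i)\<bar>)" p]
  by (simp_all only: exp_sum_def exp_of_nat_mult[symmetric] mult.assoc exp_ge_zero)

lemma lyap_eq_exp_sum: "lyap h y = exp_sum (h / 2) (y, w)"
  by (simp add: lyap_def exp_sum_def)

lemma sqrt_lyap_le: "sqrt (lyap h y) \<le> exp_sum (h / 4) (y, w)"
proof (rule real_le_lsqrt)
  show "0 \<le> exp_sum (h / 4) (y, w)" using exp_sum_ge_1[of "h / 4" "(y, w)"] h by simp
  show "lyap h y \<le> (exp_sum (h / 4) (y, w))\<^sup>2"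
    using exp_sum_power_bounds(1)[of 1 "h / 4" "(y, w)"] by (simp add: lyap_eq_exp_sum[of y w] power2_eq_square)
qed

lemma zz_lyap_conditions:
  assumes \<theta>: "0 < \<theta>" "\<theta> < h"
  obtains \<gamma> b where "\<And>s. s \<in> parity_class c \<Longrightarrow> 1 \<le> zz_lyap \<theta> s"
    "\<And>C. finite {s \<in> parity_class c. zz_lyap \<theta> s \<le> C}"
    "\<And>s. s \<in> parity_class c \<Longrightarrow> kernel_op (zz_pmf U) (zz_lyap \<theta>) s \<le> \<gamma> * zz_lyap \<theta> s + b"
    "0 \<le> \<gamma>" "\<gamma> < 1" "0 \<le> b"
proof (rule that)
  show "1 \<le> zz_lyap \<theta> s" for s
    using exp_sum_ge_1[OF \<theta>(1), of s] zz_lyap_bounds(1)[OF \<theta>, of s] by simp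
  show "finite {s \<in> parity_class c. zz_lyap \<theta> s \<le> C}" for C by (rule finite_zz_lyap_sublevel[OF \<theta>])
  show "kernel_op (zz_pmf U) (zz_lyap \<theta>) s \<le>
      max ((1 + exp (\<theta> - h)) / 2) (exp (- \<theta>)) * zz_lyap \<theta> s + CARD('d) * exp (\<theta> * (\<bar>R\<bar> + 2)) / damping h \<theta>"
    if "s \<in> parity_class c" for s
    using zz_lyap_drift[OF \<theta> parity_class_velocities[OF that]] .
  show "0 \<le> max ((1 + exp (\<theta> - h)) / 2) (exp (- \<theta>))" by (simp add: le_max_iff_disj)
  show "max ((1 + exp (\<theta> - h)) / 2) (exp (- \<theta>)) < 1" using \<theta> by simp
  show "0 \<le> CARD('d) * exp (\<theta> * (\<bar>R\<bar> + 2)) / damping h \<theta>"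
    using damping_bounds(1)[OF \<theta>(2)] by simp
qed

lemma integrable_class_pmf:
  assumes \<theta>: "0 < \<theta>" "\<theta> < h" and F: "\<And>s. s \<in> parity_class c \<Longrightarrow> \<bar>F s\<bar> \<le> C * exp_sum \<theta> s"
  shows "integrable (measure_pmf class_pmf) F"
proof -
  obtain \<gamma> b where W: "\<And>s. s \<in> parity_class c \<Longrightarrow> 1 \<le> zz_lyap \<theta> s"
    "\<And>C. finite {s \<in> parity_class c. zz_lyap \<theta> s \<le> C}"
    "\<And>s. s \<in> parity_class c \<Longrightarrow> kernel_op (zz_pmf U) (zz_lyap \<theta>) s \<le> \<gamma> * zz_lyap \<theta> s + b"
    "0 \<le> \<gamma>" "\<gamma> < 1" "0 \<le> b"
    by (rule zz_lyap_conditions[OF \<theta>]) (rule that)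
  have "\<bar>F s\<bar> \<le> \<bar>C\<bar> * zz_lyap \<theta> s" if "s \<in> parity_class c" for s
  proof -
    have "C * exp_sum \<theta> s \<le> \<bar>C\<bar> * zz_lyap \<theta> s"
      using zz_lyap_bounds(1)[OF \<theta>, of s] exp_sum_ge_1[OF \<theta>(1), of s] by (intro mult_mono) auto
    then show ?thesis using F[OF that] by simp
  qed
  with W show ?thesis by (rule integrable_mu)
qed

lemma kernel_op_exp_sum_le:
  assumes \<theta>: "0 < \<theta>" "\<theta> < h"
  obtains B where "0 \<le> B" "\<And>s. s \<in> parity_class c \<Longrightarrow> kernel_op (zz_pmf U) (exp_sum \<theta>) s \<le> B * exp_sum \<theta> s"
proof -
  obtain \<gamma> b where W: "\<And>s. s \<in> parity_class c \<Longrightarrow> 1 \<le> zz_lyap \<theta> s"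
    "\<And>C. finite {s \<in> parity_class c. zz_lyap \<theta> s \<le> C}"
    "\<And>s. s \<in> parity_class c \<Longrightarrow> kernel_op (zz_pmf U) (zz_lyap \<theta>) s \<le> \<gamma> * zz_lyap \<theta> s + b"
    "0 \<le> \<gamma>" "\<gamma> < 1" "0 \<le> b"
    by (rule zz_lyap_conditions[OF \<theta>]) (rule that)
  show ?thesis
  proof (rule that)
    show "0 \<le> (1 + b) / damping h \<theta>" using W(6) damping_bounds(1)[OF \<theta>(2)] by simp
    fix s assume s: "s \<in> parity_class c"
    have "kernel_op (zz_pmf U) (exp_sum \<theta>) s \<le> kernel_op (zz_pmf U) (zz_lyap \<theta>) s"
      by (rule kernel_op_mono[OF s zz_lyap_bounds(1)[OF \<theta>]])
    also have "\<dots> \<le> \<gamma> * zz_lyap \<theta> s + b" by (rule W(3)[OF s])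
    also have "\<dots> \<le> 1 * zz_lyap \<theta> s + b * zz_lyap \<theta> s"
      using W(1)[OF s] W(4-6) mult_left_mono[OF W(1)[OF s] W(6)] by (intro add_mono mult_right_mono) auto
    also have "\<dots> = (1 + b) * zz_lyap \<theta> s" by (simp add: distrib_right)
    also have "\<dots> \<le> (1 + b) * (exp_sum \<theta> s / damping h \<theta>)"
      using zz_lyap_bounds(2)[OF \<theta>, of s] W(6) by (intro mult_left_mono) auto
    finally show "kernel_op (zz_pmf U) (exp_sum \<theta>) s \<le> (1 + b) / damping h \<theta> * exp_sum \<theta> s" by simp
  qed
qed

lemma zz_poisson_equation:
  assumes \<theta>: "0 < \<theta>" "\<theta> < h" and F: "\<And>s. s \<in> parity_class c \<Longrightarrow> \<bar>F s\<bar> \<le> C * exp_sum \<theta> s"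
  obtains g D where "0 \<le> D" "\<And>s. s \<in> parity_class c \<Longrightarrow> \<bar>g s\<bar> \<le> D * exp_sum \<theta> s"
    "\<And>s. s \<in> parity_class c \<Longrightarrow> \<bar>kernel_op (zz_pmf U) g s\<bar> \<le> D * exp_sum \<theta> s"
    "\<And>s. s \<in> parity_class c \<Longrightarrow> g s - kernel_op (zz_pmf U) g s = F s - measure_pmf.expectation class_pmf F"
proof -
  obtain \<gamma> b where W: "\<And>s. s \<in> parity_class c \<Longrightarrow> 1 \<le> zz_lyap \<theta> s"
    "\<And>C. finite {s \<in> parity_class c. zz_lyap \<theta> s \<le> C}"
    "\<And>s. s \<in> parity_class c \<Longrightarrow> kernel_op (zz_pmf U) (zz_lyap \<theta>) s \<le> \<gamma> * zz_lyap \<theta> s + b"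
    "0 \<le> \<gamma>" "\<gamma> < 1" "0 \<le> b"
    by (rule zz_lyap_conditions[OF \<theta>]) (rule that)
  have F': "\<bar>F s\<bar> \<le> \<bar>C\<bar> * zz_lyap \<theta> s" if "s \<in> parity_class c" for s
  proof -
    have "C * exp_sum \<theta> s \<le> \<bar>C\<bar> * zz_lyap \<theta> s"
      using zz_lyap_bounds(1)[OF \<theta>, of s] exp_sum_ge_1[OF \<theta>(1), of s] by (intro mult_mono) auto
    then show ?thesis using F[OF that] by simp
  qed
  obtain g D where g: "0 \<le> D" "\<And>s. s \<in> parity_class c \<Longrightarrow> \<bar>g s\<bar> \<le> D * zz_lyap \<theta> s"
    "\<And>s. s \<in> parity_class c \<Longrightarrow> g s - kernel_op (zz_pmf U) g s = F s - measure_pmf.expectation class_pmf F"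
    by (rule poisson_equation[where W="zz_lyap \<theta>" and \<gamma>=\<gamma> and b=b and F=F, OF W F']) (assumption | rule that)+
  obtain B where B: "0 \<le> B" "\<And>s. s \<in> parity_class c \<Longrightarrow> kernel_op (zz_pmf U) (exp_sum \<theta>) s \<le> B * exp_sum \<theta> s"
    by (rule kernel_op_exp_sum_le[OF \<theta>]) (rule that)
  define D1 where "D1 = D / damping h \<theta>"
  have D1: "0 \<le> D1" using g(1) damping_bounds(1)[OF \<theta>(2)] by (simp add: D1_def)
  have g1: "\<bar>g s\<bar> \<le> D1 * exp_sum \<theta> s" if "s \<in> parity_class c" for s
    using g(2)[OF that] mult_left_mono[OF zz_lyap_bounds(2)[OF \<theta>, of s] g(1)] by (simp add: D1_def)
  have e: "0 \<le> exp_sum \<theta> s" for s using exp_sum_ge_1[OF \<theta>(1), of s] by simp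
  show ?thesis
  proof (rule that[of "D1 * (1 + B)" g])
    show "0 \<le> D1 * (1 + B)" using D1 B by simp
    fix s assume s: "s \<in> parity_class c"
    have "D1 * exp_sum \<theta> s \<le> D1 * (1 + B) * exp_sum \<theta> s"
      using D1 B e by (intro mult_right_mono) (simp_all add: distrib_left)
    then show "\<bar>g s\<bar> \<le> D1 * (1 + B) * exp_sum \<theta> s" using g1[OF s] by simp
    have "\<bar>kernel_op (zz_pmf U) g s\<bar> \<le> kernel_op (zz_pmf U) (\<lambda>t. D1 * exp_sum \<theta> t) s"
      using kernel_op_abs_le[OF s, of g] kernel_op_mono[OF s g1] by (rule order_trans)
    also have "\<dots> \<le> D1 * (B * exp_sum \<theta> s)"
      unfolding kernel_op_linear(3)[OF s] using B(2)[OF s] D1 by (rule mult_left_mono)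
    also have "\<dots> \<le> D1 * (1 + B) * exp_sum \<theta> s"
      using D1 e[of s] by (simp add: distrib_left distrib_right)
    finally show "\<bar>kernel_op (zz_pmf U) g s\<bar> \<le> D1 * (1 + B) * exp_sum \<theta> s" .
  qed (use g(3) in auto)
qed

end

locale zigzag_process =
  zigzag U R h c + chain_process "zz_pmf U" "parity_class c" M Z z0
  for U :: "'d::{finite,linorder} lattice \<Rightarrow> real" and R h :: real and c :: "'d lattice"
    and M :: "'a measure" and Z :: "nat \<Rightarrow> 'a \<Rightarrow> 'd lattice \<times> 'd lattice" and z0 :: "'d lattice \<times> 'd lattice"
begin

text \<open>The cube has the exponent \<open>3 * h / 4\<close>, for which the drift condition is
  still available.\<close>

lemma cube_moment:
  obtains B where "\<And>n. expectation (\<lambda>\<omega>. exp_sum (h / 4) (Z n \<omega>) ^ 3) \<le> B"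
proof -
  let ?\<theta> = "3 * (h / 4)"
  have \<theta>: "0 < ?\<theta>" "?\<theta> < h" using h by auto
  obtain \<gamma> b where W: "\<And>s. s \<in> parity_class c \<Longrightarrow> 1 \<le> zz_lyap ?\<theta> s"
    "\<And>C. finite {s \<in> parity_class c. zz_lyap ?\<theta> s \<le> C}"
    "\<And>s. s \<in> parity_class c \<Longrightarrow> kernel_op (zz_pmf U) (zz_lyap ?\<theta>) s \<le> \<gamma> * zz_lyap ?\<theta> s + b"
    "0 \<le> \<gamma>" "\<gamma> < 1" "0 \<le> b"
    by (rule zz_lyap_conditions[OF \<theta>]) (rule that)
  have W0: "0 \<le> zz_lyap ?\<theta> s" if "s \<in> parity_class c" for s using W(1)[OF that] by simp
  show ?thesis
  proof (rule that)
    fix n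
    have "exp_sum (h / 4) s ^ 3 \<le> real CARD('d) ^ 3 * zz_lyap ?\<theta> s" for s
      using exp_sum_power_bounds(2)[of "h / 4" s 3] zz_lyap_bounds(1)[OF \<theta>, of s]
      by (auto intro: order_trans mult_left_mono)
    then have "expectation (\<lambda>\<omega>. exp_sum (h / 4) (Z n \<omega>) ^ 3) \<le> expectation (\<lambda>\<omega>. real CARD('d) ^ 3 * zz_lyap ?\<theta> (Z n \<omega>))"
      by (intro integral_mono integrable_adapted[OF adapted_fun_Z[OF order_refl]])
    also have "\<dots> = real CARD('d) ^ 3 * expectation (\<lambda>\<omega>. zz_lyap ?\<theta> (Z n \<omega>))" by simp
    also have "\<dots> \<le> real CARD('d) ^ 3 * (zz_lyap ?\<theta> z0 + b / (1 - \<gamma>))"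
      by (intro mult_left_mono moment_bound[OF W(3) W0 W(4-6)]) auto
    finally show "expectation (\<lambda>\<omega>. exp_sum (h / 4) (Z n \<omega>) ^ 3) \<le> real CARD('d) ^ 3 * (zz_lyap ?\<theta> z0 + b / (1 - \<gamma>))" .
  qed
qed

lemma exp_sum_half_le: "exp_sum (h / 2) s \<le> exp_sum (h / 4) s ^ 2"
  using exp_sum_power_bounds(1)[of 1 "h / 4" s] by (simp add: power2_eq_square)

text \<open>The solution of Poisson's equation is bounded by \<open>exp_sum (h / 2)\<close>, hence
  by the square of \<open>exp_sum (h / 4)\<close>; its moments of order 3/2 are third moments of the
  latter.\<close>

lemma average_nonneg:
  assumes F: "\<And>s. s \<in> parity_class c \<Longrightarrow> 0 \<le> F s" "\<And>s. s \<in> parity_class c \<Longrightarrow> F s \<le> C * exp_sum (h / 2) s"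
  shows "AE \<omega> in M. (\<lambda>n. (\<Sum>k<n. F (Z k \<omega>)) / real n) \<longlonglongrightarrow> measure_pmf.expectation class_pmf F"
proof -
  have \<theta>: "0 < h / 2" "h / 2 < h" using h by auto
  have F': "\<bar>F s\<bar> \<le> C * exp_sum (h / 2) s" if "s \<in> parity_class c" for s using F[OF that] by simp
  obtain g D where g: "0 \<le> D" "\<And>s. s \<in> parity_class c \<Longrightarrow> \<bar>g s\<bar> \<le> D * exp_sum (h / 2) s"
    "\<And>s. s \<in> parity_class c \<Longrightarrow> \<bar>kernel_op (zz_pmf U) g s\<bar> \<le> D * exp_sum (h / 2) s"
    "\<And>s. s \<in> parity_class c \<Longrightarrow> g s - kernel_op (zz_pmf U) g s = F s - measure_pmf.expectation class_pmf F"
    by (rule zz_poisson_equation[OF \<theta>, where F=F and C=C]) (assumption | rule F' that)+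
  obtain B where B: "\<And>n. expectation (\<lambda>\<omega>. exp_sum (h / 4) (Z n \<omega>) ^ 3) \<le> B"
    by (rule cube_moment) (rule that)
  have le: "D * exp_sum (h / 2) s \<le> D * exp_sum (h / 4) s ^ 2" for s
    using exp_sum_half_le g(1) by (rule mult_left_mono)
  show ?thesis
  proof (rule law_of_large_numbers_nonneg[where g=g and C=D and w="exp_sum (h / 4)"])
    show "0 \<le> exp_sum (h / 4) s" for s using exp_sum_ge_1[of "h / 4" s] h by simp
    show "\<bar>g s\<bar> \<le> D * exp_sum (h / 4) s ^ 2" "\<bar>kernel_op (zz_pmf U) g s\<bar> \<le> D * exp_sum (h / 4) s ^ 2"
      if "s \<in> parity_class c" for s
      using g(2,3)[OF that] le[of s] by linarith+
  qed (use g(4) F(1) B in auto)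
qed

theorem ergodic_average:
  assumes f: "\<And>y. \<bar>f y\<bar> \<le> C * lyap h y"
  shows "AE \<omega> in M. (\<lambda>n. (\<Sum>k=0..n. f (fst (Z k \<omega>))) / real n) \<longlonglongrightarrow> gibbs_mean U f"
proof -
  let ?E = "measure_pmf.expectation class_pmf"
  have \<theta>: "0 < h / 2" "h / 2 < h" using h by auto
  define P where "P s = max (f (fst s)) 0" for s :: "'d lattice \<times> 'd lattice"
  define Q where "Q s = max (- f (fst s)) 0" for s :: "'d lattice \<times> 'd lattice"
  have f': "\<bar>f (fst s)\<bar> \<le> C * exp_sum (h / 2) s" for s
    using f[of "fst s"] lyap_eq_exp_sum[of "fst s" "snd s"] by simp
  have PQ: "0 \<le> P s" "P s \<le> C * exp_sum (h / 2) s" "0 \<le> Q s" "Q s \<le> C * exp_sum (h / 2) s" for s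
    using f'[of s] by (auto simp: P_def Q_def)
  have int: "integrable (measure_pmf class_pmf) P" "integrable (measure_pmf class_pmf) Q"
    "integrable (measure_pmf class_pmf) (\<lambda>s. f (fst s))"
    using PQ f' by (auto intro!: integrable_class_pmf[OF \<theta>, where C=C])
  have diff: "P s - Q s = f (fst s)" for s by (simp add: P_def Q_def)
  have "?E P - ?E Q = ?E (\<lambda>s. f (fst s))"
    using Bochner_Integration.integral_diff[OF int(1,2)] by (simp add: diff)
  then have mean: "?E P - ?E Q = gibbs_mean U f" using expectation_class_pmf[OF int(3)] by simp
  have "AE \<omega> in M. (\<lambda>n. (\<Sum>k<n. P (Z k \<omega>)) / real n) \<longlonglongrightarrow> ?E P"
    "AE \<omega> in M. (\<lambda>n. (\<Sum>k<n. Q (Z k \<omega>)) / real n) \<longlonglongrightarrow> ?E Q"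
    using PQ by (auto intro!: average_nonneg)
  then show ?thesis
  proof eventually_elim
    case (elim \<omega>)
    let ?S = "\<lambda>n. (\<Sum>k<n. f (fst (Z k \<omega>))) / real n"
    have "(\<lambda>n. (\<Sum>k<n. P (Z k \<omega>)) / real n - (\<Sum>k<n. Q (Z k \<omega>)) / real n) \<longlonglongrightarrow> gibbs_mean U f"
      using tendsto_diff[OF elim] unfolding mean .
    then have "?S \<longlonglongrightarrow> gibbs_mean U f"
      by (simp add: diff_divide_distrib[symmetric] sum_subtractf[symmetric] diff)
    \<comment> \<open>The sum up to \<open>n\<close> has \<open>n + 1\<close> terms but is divided
      by \<open>n\<close>.\<close>
    then have "(\<lambda>n. ?S (Suc n) * (real (Suc n) / real n)) \<longlonglongrightarrow> gibbs_mean U f * 1"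
      by (intro tendsto_mult LIMSEQ_Suc LIMSEQ_Suc_n_over_n)
    moreover have "(\<lambda>n. ?S (Suc n) * (real (Suc n) / real n)) = (\<lambda>n. (\<Sum>k=0..n. f (fst (Z k \<omega>))) / real n)"
      by (simp add: fun_eq_iff atLeast0AtMost lessThan_Suc_atMost[symmetric] del: of_nat_Suc sum.lessThan_Suc)
    ultimately show ?case by (simp only: mult_1_right)
  qed
qed

theorem functional_central_limit:
  assumes C: "0 \<le> C" and f: "\<And>y. \<bar>f y\<bar> \<le> C * sqrt (lyap h y)"
  obtains \<sigma> where "0 \<le> \<sigma>" "converges_in_law skorohod_topology
    M (\<lambda>n \<omega>. \<lambda>t\<in>{0..}. (\<Sum>k=0..nat \<lfloor>real n * t\<rfloor>. f (fst (Z k \<omega>)) - gibbs_mean U f) / sqrt (real n))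
    noise (\<lambda>\<omega>. \<lambda>t\<in>{0..}. \<sigma> * bm t \<omega>)"
proof -
  let ?E = "measure_pmf.expectation class_pmf" and ?K = "kernel_op (zz_pmf U)"
  let ?w = "exp_sum (h / 4)" and ?V = "exp_sum (h / 2)"
  have \<theta>1: "0 < h / 4" "h / 4 < h" and \<theta>2: "0 < h / 2" "h / 2 < h" using h by auto
  have w1: "1 \<le> ?w s" for s by (rule exp_sum_ge_1[OF \<theta>1(1)])
  define F where "F s = f (fst s) - gibbs_mean U f" for s :: "'d lattice \<times> 'd lattice"
  have f1: "\<bar>f (fst s)\<bar> \<le> C * ?w s" for s
    using f[of "fst s"] mult_left_mono[OF sqrt_lyap_le[of "fst s" "snd s"] C] by simp
  have F1: "\<bar>F s\<bar> \<le> (C + \<bar>gibbs_mean U f\<bar>) * ?w s" for s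
  proof -
    have "\<bar>F s\<bar> \<le> C * ?w s + \<bar>gibbs_mean U f\<bar>" using f1[of s] unfolding F_def by linarith
    also have "\<dots> \<le> (C + \<bar>gibbs_mean U f\<bar>) * ?w s"
      using mult_left_mono[OF w1[of s], of "\<bar>gibbs_mean U f\<bar>"] by (simp add: distrib_right)
    finally show ?thesis .
  qed
  have int: "integrable (measure_pmf class_pmf) (\<lambda>s. f (fst s))"
    using f1 by (intro integrable_class_pmf[OF \<theta>1, where C=C])
  have F0: "?E F = 0"
    unfolding F_def using int expectation_class_pmf[OF int] by simp
  obtain g D where g: "0 \<le> D" "\<And>s. s \<in> parity_class c \<Longrightarrow> \<bar>g s\<bar> \<le> D * ?w s"
    "\<And>s. s \<in> parity_class c \<Longrightarrow> \<bar>?K g s\<bar> \<le> D * ?w s"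
    "\<And>s. s \<in> parity_class c \<Longrightarrow> g s - ?K g s = F s - ?E F"
    by (rule zz_poisson_equation[OF \<theta>1 F1]) (rule that)
  \<comment> \<open>The conditional variance of the martingale increment; \<open>\<sigma>2\<close>
    is its stationary mean.\<close>
  define \<psi> where "\<psi> s = ?K (\<lambda>t. (g t - ?K g s)\<^sup>2) s" for s
  obtain B2 where B2: "0 \<le> B2" "\<And>s. s \<in> parity_class c \<Longrightarrow> ?K ?V s \<le> B2 * ?V s"
    by (rule kernel_op_exp_sum_le[OF \<theta>2]) (rule that)
  have \<psi>0: "0 \<le> \<psi> s" for s unfolding \<psi>_def kernel_op_def by (rule Bochner_Integration.integral_nonneg) simp
  define E where "E = 2 * D\<^sup>2 * (real CARD('d))\<^sup>2"
  have E: "0 \<le> E" by (simp add: E_def)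
  have \<psi>1: "\<bar>\<psi> s\<bar> \<le> (E * (B2 + 1)) * ?V s" if s: "s \<in> parity_class c" for s
  proof -
    have w2: "?w t ^ 2 \<le> (real CARD('d))\<^sup>2 * ?V t" for t
      using exp_sum_power_bounds(2)[of "h / 4" t 2] by simp
    have "(g t - ?K g s)\<^sup>2 \<le> E * ?V t + E * ?V s" if t: "t \<in> parity_class c" for t
    proof -
      have "(g t - ?K g s)\<^sup>2 \<le> 2 * (g t)\<^sup>2 + 2 * (?K g s)\<^sup>2"
        using zero_le_power2[of "g t + ?K g s"] by (simp add: power2_sum power2_diff)
      also have "(g t)\<^sup>2 \<le> (D * ?w t)\<^sup>2" using g(2)[OF t] by (rule power2_le_iff_abs_le[THEN iffD2, rotated]) (use g(1) w1[of t] in simp)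
      also have "(?K g s)\<^sup>2 \<le> (D * ?w s)\<^sup>2" using g(3)[OF s] by (rule power2_le_iff_abs_le[THEN iffD2, rotated]) (use g(1) w1[of s] in simp)
      finally have "(g t - ?K g s)\<^sup>2 \<le> 2 * D\<^sup>2 * (?w t)\<^sup>2 + 2 * D\<^sup>2 * (?w s)\<^sup>2" by (simp add: power_mult_distrib)
      also have "\<dots> \<le> 2 * D\<^sup>2 * ((real CARD('d))\<^sup>2 * ?V t) + 2 * D\<^sup>2 * ((real CARD('d))\<^sup>2 * ?V s)"
        by (intro add_mono mult_left_mono w2) auto
      finally show ?thesis by (simp add: E_def mult.assoc)
    qed
    then have "\<psi> s \<le> ?K (\<lambda>t. E * ?V t + E * ?V s) s" unfolding \<psi>_def by (rule kernel_op_mono[OF s])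
    also have "\<dots> = E * ?K ?V s + E * ?V s" by (simp add: kernel_op_linear[OF s])
    also have "\<dots> \<le> E * (B2 * ?V s) + E * ?V s" using B2(2)[OF s] E by (intro add_right_mono mult_left_mono)
    also have "\<dots> = (E * (B2 + 1)) * ?V s" by (simp add: algebra_simps)
    finally show ?thesis using \<psi>0[of s] by simp
  qed
  obtain q Dq where q: "0 \<le> Dq" "\<And>s. s \<in> parity_class c \<Longrightarrow> \<bar>q s\<bar> \<le> Dq * ?V s"
    "\<And>s. s \<in> parity_class c \<Longrightarrow> q s - ?K q s = \<psi> s - ?E \<psi>"
    by (rule zz_poisson_equation[OF \<theta>2, where F=\<psi> and C="E * (B2 + 1)"]) (assumption | rule \<psi>1 that)+
  define \<sigma>2 where "\<sigma>2 = ?E \<psi>"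
  have \<sigma>2: "0 \<le> \<sigma>2" unfolding \<sigma>2_def using \<psi>0 by (intro Bochner_Integration.integral_nonneg) auto
  obtain B where B: "\<And>n. expectation (\<lambda>\<omega>. ?w (Z n \<omega>) ^ 3) \<le> B" by (rule cube_moment) (rule that)
  obtain L where L: "0 \<le> L"
    "\<And>k m. expectation (\<lambda>\<omega>. \<bar>\<Sum>j<m. F (Z (k + j) \<omega>)\<bar> ^ 3) \<le> L * real m * sqrt (real m)"
    "\<And>k m \<theta> G. adapted k G \<Longrightarrow> (\<And>\<omega>. cmod (G \<omega>) \<le> 1) \<Longrightarrow> \<bar>\<theta>\<bar> \<le> 1 \<Longrightarrow>
      cmod (expectation (\<lambda>\<omega>. G \<omega> * iexp (\<theta> * (\<Sum>j<m. F (Z (k + j) \<omega>)))) -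
        of_real (exp (- (\<sigma>2 * \<theta>\<^sup>2 / 2)) ^ m) * expectation G) \<le> L * (\<bar>\<theta>\<bar> + real m * \<bar>\<theta>\<bar> ^ 3)"
  proof (rule clt_estimates[where g=g and F=F and C="D + Dq" and w="?w" and q=q and B=B])
    fix s assume s: "s \<in> parity_class c"
    show "g s - ?K g s = F s" using g(4)[OF s] F0 by simp
    have "D * ?w s \<le> (D + Dq) * ?w s" using q(1) w1[of s] by (intro mult_right_mono) auto
    then show "\<bar>g s\<bar> \<le> (D + Dq) * ?w s" "\<bar>?K g s\<bar> \<le> (D + Dq) * ?w s"
      using g(2,3)[OF s] by linarith+
    show "q s - ?K q s = ?K (\<lambda>t. (g t - ?K g s)\<^sup>2) s - \<sigma>2" using q(3)[OF s] by (simp add: \<psi>_def \<sigma>2_def)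
    have "Dq * ?V s \<le> (D + Dq) * ?w s ^ 2"
      using exp_sum_half_le[of s] g(1) q(1) exp_sum_ge_1[OF \<theta>2(1), of s] by (intro mult_mono) auto
    then show "\<bar>q s\<bar> \<le> (D + Dq) * ?w s ^ 2" using q(2)[OF s] by linarith
  qed (use w1 B \<sigma>2 in auto)
  interpret sums: partial_sums M "\<lambda>k \<omega>. F (Z k \<omega>)" L \<sigma>2
  proof unfold_locales
    show "(\<lambda>\<omega>. F (Z k \<omega>)) \<in> borel_measurable M" for k by measurable
    show "integrable M (\<lambda>\<omega>. \<bar>\<Sum>j<m. F (Z (k + j) \<omega>)\<bar> ^ 3)" for m k
      by (rule integrable_adapted[OF adapted_compose[OF adapted_sum[OF adapted_fun_Z], of "{..<m}" "\<lambda>j. k + j" "k + m"]]) simp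
    show "expectation (\<lambda>\<omega>. \<bar>\<Sum>j<m. F (Z (k + j) \<omega>)\<bar> ^ 3) \<le> L * real m * sqrt (real m)" for m k by (rule L(2))
    show "(\<lambda>n. expectation (\<lambda>\<omega>. iexp (\<Sum>k<N. v k *
          ((\<Sum>i\<in>{nat \<lfloor>real n * t k\<rfloor>..<nat \<lfloor>real n * t (Suc k)\<rfloor>}. F (Z i \<omega>)) / sqrt (real n)))))
      \<longlonglongrightarrow> of_real (exp (- (\<sigma>2 / 2 * (\<Sum>k<N. (v k)\<^sup>2 * (t (Suc k) - t k)))))"
      if "0 \<le> t 0" "incseq t" for t v N
      using \<sigma>2 L(1,3) that by (rule char_blocks_limit)
  qed
  show ?thesis
  proof (rule that)
    show "0 \<le> sqrt \<sigma>2" using \<sigma>2 by simp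
    show "converges_in_law skorohod_topology
        M (\<lambda>n \<omega>. \<lambda>t\<in>{0..}. (\<Sum>k=0..nat \<lfloor>real n * t\<rfloor>. f (fst (Z k \<omega>)) - gibbs_mean U f) / sqrt (real n))
        noise (\<lambda>\<omega>. \<lambda>t\<in>{0..}. sqrt \<sigma>2 * bm t \<omega>)"
      using sums.invariance_principle[OF \<sigma>2] unfolding F_def .
  qed
qed

end

lemma bounded_quotientD:
  fixes f w :: "'b \<Rightarrow> real"
  assumes "bounded (range (\<lambda>y. f y / w y))" "\<And>y. 0 < w y"
  obtains C where "0 \<le> C" "\<And>y. \<bar>f y\<bar> \<le> C * w y"
proof -
  obtain C where C: "\<And>y. \<bar>f y / w y\<bar> \<le> C" using assms(1) unfolding bounded_iff by auto
  show ?thesis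
  proof (rule that)
    show "0 \<le> C" using order_trans[OF abs_ge_zero C] .
    show "\<bar>f y\<bar> \<le> C * w y" for y using C[of y] assms(2)[of y] by (simp add: abs_divide pos_divide_le_eq)
  qed
qed

theorem theorem12:
  fixes U f :: "'d::{finite,linorder} lattice \<Rightarrow> real"
    and R h :: real
    and M :: "'a measure"
    and X V :: "nat \<Rightarrow> 'a \<Rightarrow> 'd lattice"
    and x v :: "'d lattice"
  assumes "(\<lambda>y. exp (- U y)) summable_on UNIV"
    and "\<exists>z. strict_local_min U z"
    and "R > 0" and "h > 0"
    and "\<And>i y w. w \<in> velocities \<Longrightarrow>
           max (U (y + axis i (w $ i)) - U y) 0 \<ge> h * of_bool (real_of_int (w $ i * y $ i) > R)"
    and "bounded (range (\<lambda>y. f y / lyap h y))"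
    and "zigzag_walk M U x v X V"
  shows "(AE \<omega> in M. (\<lambda>n. (\<Sum>k=0..n. f (X k \<omega>)) / real n) \<longlonglongrightarrow> gibbs_mean U f) \<and>
    (bounded (range (\<lambda>y. f y / sqrt (lyap h y))) \<longrightarrow>
      (\<exists>\<sigma>\<ge>0. \<exists>(N :: (real \<Rightarrow> real) measure) B. brownian_motion N B \<and>
        converges_in_law skorohod_topology
          M (\<lambda>n \<omega>. \<lambda>t\<in>{0..}. (\<Sum>k=0..nat \<lfloor>real n * t\<rfloor>. f (X k \<omega>) - gibbs_mean U f) / sqrt (real n))
          N (\<lambda>\<omega>. \<lambda>t\<in>{0..}. \<sigma> * B t \<omega>)))"
proof -
  define Z where "Z n \<omega> = (X n \<omega>, V n \<omega>)" for n \<omega>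
  \<comment> \<open>The class of the initial state, which then lies in the half class with sign
    1.\<close>
  define c where "c = (\<chi> i. v $ i * sgn_parity (x $ i))"
  have v: "v \<in> velocities" and chain: "markov_chain M (zz_kernel U) (x, v) Z"
    using assms(7) by (simp_all add: zigzag_walk_def Z_def[abs_def])
  have c: "c \<in> velocities" using v by (auto simp: c_def velocities_def sgn_parity_def)
  interpret zigzag U R h c using assms(1,4,5) c by unfold_locales
  interpret prob_space M using chain by (simp add: markov_chain_def)
  interpret zigzag_process U R h c M Z "(x, v)"
  proof unfold_locales
    show "Z n \<in> M \<rightarrow>\<^sub>M count_space UNIV" for n using chain by (simp add: markov_chain_def)
    show "AE \<omega> in M. Z 0 \<omega> = (x, v)" using chain by (simp add: markov_chain_def)
    show "(x, v) \<in> parity_class c" using v by (simp add: parity_class_def half_class_def c_def)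
    show "measure M {\<omega> \<in> space M. (\<forall>k\<le>n. Z k \<omega> = s k) \<and> Z (Suc n) \<omega> = t} =
        measure M {\<omega> \<in> space M. \<forall>k\<le>n. Z k \<omega> = s k} * pmf (zz_pmf U (s n)) t"
      if "s n \<in> parity_class c" for s n t
      using chain unfolding pmf_zz_pmf[OF parity_class_velocities[OF that]] markov_chain_def by blast
  qed
  have lyap: "0 < lyap h y" for y :: "'d lattice"
    using exp_sum_ge_1[of "h / 2" "(y, v)"] h by (simp add: lyap_eq_exp_sum[of y v])
  have X: "X k \<omega> = fst (Z k \<omega>)" for k \<omega> by (simp add: Z_def)
  obtain C where "\<And>y. \<bar>f y\<bar> \<le> C * lyap h y" by (rule bounded_quotientD[OF assms(6) lyap]) (rule that)
  then have "AE \<omega> in M. (\<lambda>n. (\<Sum>k=0..n. f (X k \<omega>)) / real n) \<longlonglongrightarrow> gibbs_mean U f"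
    unfolding X by (rule ergodic_average)
  moreover have "\<exists>\<sigma>\<ge>0. \<exists>(N :: (real \<Rightarrow> real) measure) B. brownian_motion N B \<and>
        converges_in_law skorohod_topology
          M (\<lambda>n \<omega>. \<lambda>t\<in>{0..}. (\<Sum>k=0..nat \<lfloor>real n * t\<rfloor>. f (X k \<omega>) - gibbs_mean U f) / sqrt (real n))
          N (\<lambda>\<omega>. \<lambda>t\<in>{0..}. \<sigma> * B t \<omega>)"
    if bounded: "bounded (range (\<lambda>y. f y / sqrt (lyap h y)))"
  proof -
    have "0 < sqrt (lyap h y)" for y :: "'d lattice" using lyap[of y] by simp
    then obtain C where C: "0 \<le> C" "\<And>y. \<bar>f y\<bar> \<le> C * sqrt (lyap h y)"
      by (rule bounded_quotientD[OF bounded]) (rule that)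
    show ?thesis
      unfolding X
      by (rule functional_central_limit[OF C]) (use brownian_motion_bm in blast)+
  qed
  ultimately show ?thesis by blast
qed

end
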